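(* The bialgebras $k[GL(m|n)]$ and $k[SL(m|n)]$ are Hopf algebras with antipode $S$ given, entrywise on the generators, by $$S\begin{pmatrix}X_{11}&\Xi_{12}\\ \Xi_{21}&X_{22}\end{pmatrix}=\begin{pmatrix}S_1(B)&-S_{11}(X_{11})\,\Xi_{12}\,S_2(C)\\ -S_{22}(X_{22})\,\Xi_{21}\,S_1(B)&S_2(C)\end{pmatrix},$$ where $B=X_{11}-\Xi_{12}S_{22}(X_{22})\Xi_{21}$ and $C=X_{22}-\Xi_{21}S_{11}(X_{11})\Xi_{12}$, and by $$S(d_1^{-1})=d_2,\qquad S(d_2^{-1})=d_1 .$$
   Context: $k$ is an algebraically closed field. A superalgebra is a $\mathbb{Z}_2$-graded algebra; it is commutative if $xy=(-1)^{p(x)p(y)}yx$ for homogeneous $x,y$, $p$ denoting parity. Bialgebra and Hopf algebra are meant in the super sense. Let $a_{ij}$, $1\le i,j\le m+n$, be variables. For $1\le i,j\le m$ or $m+1\le i,j\le m+n$, $a_{ij}=x_{ij}$ is even; otherwise $a_{ij}=\xi_{ij}$ is odd. Put $X_{11}=(x_{ij})_{1\le i,j\le m}$, $X_{22}=(x_{ij})_{m+1\le i,j\le m+n}$, $\Xi_{12}=(\xi_{kl})_{1\le k\le m,\,m+1\le l\le m+n}$, $\Xi_{21}=(\xi_{kl})_{m+1\le k\le m+n,\,1\le l\le m}$, $d_1=\det(X_{11})$, $d_2=\det(X_{22})$. $k[GL(m|n)]=k[x_{ij},\xi_{kl},d_1^{-1},d_2^{-1}]$ is the free commutative superalgebra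 on the $a_{ij}$ with even inverses $d_1^{-1},d_2^{-1}$ of $d_1,d_2$ adjoined. $S_{11}(X_{11})$ and $S_{22}(X_{22})$ are the inverse matrices of $X_{11}$ and $X_{22}$ given by the adjugate formula: their $(i,j)$ entries are $(-1)^{i-j}A^{11}_{ji}d_1^{-1}$ and $(-1)^{i-j}A^{22}_{ji}d_2^{-1}$, where $A^{11}_{ji}$, $A^{22}_{ji}$ are the determinants of the minors obtained by suppressing row $j$ and column $i$ in $X_{11}$, $X_{22}$. The Berezinian is $\mathrm{Ber}=\det(S_{22}(X_{22}))\det(X_{11}-\Xi_{12}S_{22}(X_{22})\Xi_{21})$, and $k[SL(m|n)]=k[GL(m|n)]/(\mathrm{Ber}-1)$. The matrices $B$ ($m\times m$) and $C$ ($n\times n$) have even entries, and $\det(B)$, $\det(C)$ are invertible in both algebras. $S_1(B)$ and $S_2(C)$ are the matrices with entries $S_1(B)_{ij}=(-1)^{i-j}A^B_{ji}\det(B)^{-1}$ and $S_2(C)_{kl}=(-1)^{l-k}A^C_{lk}\det(C)^{-1}$, where $A^B_{ji}$ (resp. $A^C_{lk}$) is the determinant of the minor obtained by suppressing row $j$ and column $i$ of $B$ (resp. row $l$ and column $k$ of $C$). Both algebras are bialgebras with comultiplication and counit the superalgebra homomorphisms with $\Delta(a_{ij})=\sum_{k=1}^{m+n}a_{ik}\otimes a_{kj}$, $\epsilon(a_{ij})=\delta_{ij}$; on $d_1^{-1},d_2^{-1}$ their values are the inverses of the values on $d_1,d_2$.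
   Formalization: On k[GL(m|n)] the printed S(d1^{-1})=d2, S(d2^{-1})=d1 are false (m=1, n=0) and are corrected to Ber·d2 and Ber^{-1}·d1; on k[SL(m|n)] they stand as printed. Odd elements are required to square to zero, which matters only in characteristic 2. *)

theory Defs
  imports "HOL-Algebra.Algebraic_Closure" "HOL-Combinatorics.Permutations"
begin

section \<open>Superalgebras\<close>

text \<open>Parities are booleans: \<^term>\<open>False\<close> is even, \<^term>\<open>True\<close> is odd, and the sum of
  \<open>p\<close> and \<open>q\<close> is \<open>p \<noteq> q\<close>.\<close>

record ('k, 'a) superalg = "('k, 'a) module" +
  grade :: "bool \<Rightarrow> 'a set"

definition neg_if :: "('a, 'b) ring_scheme \<Rightarrow> bool \<Rightarrow> 'a \<Rightarrow> 'a" where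
  "neg_if R c x = (if c then \<ominus>\<^bsub>R\<^esub> x else x)"

locale superalgebra = module K A + field K + ring A
  for K :: "('k, 'r) ring_scheme" and A :: "('k, 'a, 'z) superalg_scheme" +
  assumes smult_mult_left:
      "\<lbrakk>c \<in> carrier K; x \<in> carrier A; y \<in> carrier A\<rbrakk>
        \<Longrightarrow> (c \<odot>\<^bsub>A\<^esub> x) \<otimes>\<^bsub>A\<^esub> y = c \<odot>\<^bsub>A\<^esub> (x \<otimes>\<^bsub>A\<^esub> y)"
    and smult_mult_right:
      "\<lbrakk>c \<in> carrier K; x \<in> carrier A; y \<in> carrier A\<rbrakk>
        \<Longrightarrow> x \<otimes>\<^bsub>A\<^esub> (c \<odot>\<^bsub>A\<^esub> y) = c \<odot>\<^bsub>A\<^esub> (x \<otimes>\<^bsub>A\<^esub> y)"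
    and grade_submodule: "submodule (grade A p) K A"
    and grade_sum: "carrier A = grade A False <+>\<^bsub>A\<^esub> grade A True"
    and grade_inter: "grade A False \<inter> grade A True = {\<zero>\<^bsub>A\<^esub>}"
    and grade_one: "\<one>\<^bsub>A\<^esub> \<in> grade A False"
    and grade_mult: "\<lbrakk>x \<in> grade A p; y \<in> grade A q\<rbrakk> \<Longrightarrow> x \<otimes>\<^bsub>A\<^esub> y \<in> grade A (p \<noteq> q)"

definition hcomp :: "('k, 'a, 'z) superalg_scheme \<Rightarrow> bool \<Rightarrow> 'a \<Rightarrow> 'a" where
  "hcomp A p x = (THE y. y \<in> grade A p \<and> x \<ominus>\<^bsub>A\<^esub> y \<in> grade A (\<not> p))"

definition even_linear ::
  "('k, 'r) ring_scheme \<Rightarrow> ('k, 'a, 'y) superalg_scheme \<Rightarrow> ('k, 'b, 'z) superalg_scheme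
    \<Rightarrow> ('a \<Rightarrow> 'b) set" where
  "even_linear K A B = {h \<in> carrier A \<rightarrow> carrier B.
     (\<forall>x\<in>carrier A. \<forall>y\<in>carrier A. h (x \<oplus>\<^bsub>A\<^esub> y) = h x \<oplus>\<^bsub>B\<^esub> h y) \<and>
     (\<forall>c\<in>carrier K. \<forall>x\<in>carrier A. h (c \<odot>\<^bsub>A\<^esub> x) = c \<odot>\<^bsub>B\<^esub> h x) \<and>
     (\<forall>p. \<forall>x\<in>grade A p. h x \<in> grade B p)}"

definition superalg_hom ::
  "('k, 'r) ring_scheme \<Rightarrow> ('k, 'a, 'y) superalg_scheme \<Rightarrow> ('k, 'b, 'z) superalg_scheme
    \<Rightarrow> ('a \<Rightarrow> 'b) set" where
  "superalg_hom K A B = ring_hom A B \<inter> even_linear K A B"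

definition base_superalg :: "('k, 'r) ring_scheme \<Rightarrow> ('k, 'k) superalg" where
  "base_superalg K = \<lparr>carrier = carrier K, monoid.mult = monoid.mult K, one = one K,
     ring.zero = ring.zero K, ring.add = ring.add K, smult = monoid.mult K,
     grade = (\<lambda>p. if p then {\<zero>\<^bsub>K\<^esub>} else carrier K)\<rparr>"

definition super_quot ::
  "('k, 'a, 'z) superalg_scheme \<Rightarrow> 'a set \<Rightarrow> ('k, 'a set) superalg" where
  "super_quot A I = \<lparr>carrier = carrier (A Quot I), monoid.mult = monoid.mult (A Quot I),
     one = one (A Quot I),
     ring.zero = ring.zero (A Quot I), ring.add = ring.add (A Quot I),
     smult = (\<lambda>c Y. \<Union>x\<in>Y. I +>\<^bsub>A\<^esub> (c \<odot>\<^bsub>A\<^esub> x)),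
     grade = (\<lambda>p. (\<lambda>x. I +>\<^bsub>A\<^esub> x) ` grade A p)\<rparr>"


section \<open>Free commutative superalgebras\<close>

text \<open>Free associative superalgebra on a set \<open>G\<close> of generators with parity \<open>\<pi>\<close>: finitely
  supported functions on words in \<open>G\<close>, multiplied by concatenation of words.\<close>

definition free_superalg ::
  "('k, 'r) ring_scheme \<Rightarrow> 'g set \<Rightarrow> ('g \<Rightarrow> bool) \<Rightarrow> ('k, 'g list \<Rightarrow> 'k) superalg" where
  "free_superalg K G \<pi> =
    (let C = {f. (\<forall>w. f w \<in> carrier K) \<and> finite {w. f w \<noteq> \<zero>\<^bsub>K\<^esub>} \<and>
                 (\<forall>w. f w \<noteq> \<zero>\<^bsub>K\<^esub> \<longrightarrow> w \<in> lists G)}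
     in \<lparr>carrier = C,
         monoid.mult = (\<lambda>f g w. \<Oplus>\<^bsub>K\<^esub>i\<in>{..length w}. f (take i w) \<otimes>\<^bsub>K\<^esub> g (drop i w)),
         one = (\<lambda>w. if w = [] then \<one>\<^bsub>K\<^esub> else \<zero>\<^bsub>K\<^esub>),
         ring.zero = (\<lambda>w. \<zero>\<^bsub>K\<^esub>),
         ring.add = (\<lambda>f g w. f w \<oplus>\<^bsub>K\<^esub> g w),
         smult = (\<lambda>c f w. c \<otimes>\<^bsub>K\<^esub> f w),
         grade = (\<lambda>p. {f \<in> C. \<forall>w. f w \<noteq> \<zero>\<^bsub>K\<^esub> \<longrightarrow> odd (length (filter \<pi> w)) = p})\<rparr>)"

definition free_gen :: "('k, 'r) ring_scheme \<Rightarrow> 'g \<Rightarrow> 'g list \<Rightarrow> 'k" where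
  "free_gen K g = (\<lambda>w. if w = [g] then \<one>\<^bsub>K\<^esub> else \<zero>\<^bsub>K\<^esub>)"

text \<open>The ideal that makes a superalgebra commutative. The squares of odd elements lie in the ideal
  of supercommutators as soon as 2 is invertible, so listing them matters in characteristic 2 only.
  There it is the usual convention, and without it \<open>det B\<close> is not invertible.\<close>

definition supercomm_ideal :: "('k, 'a, 'z) superalg_scheme \<Rightarrow> 'a set" where
  "supercomm_ideal A = Idl\<^bsub>A\<^esub>
     ({x \<otimes>\<^bsub>A\<^esub> y \<ominus>\<^bsub>A\<^esub> neg_if A (p \<and> q) (y \<otimes>\<^bsub>A\<^esub> x) | x y p q.
         x \<in> grade A p \<and> y \<in> grade A q} \<union>
      {x \<otimes>\<^bsub>A\<^esub> x | x. x \<in> grade A True})"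

definition free_comm_superalg ::
  "('k, 'r) ring_scheme \<Rightarrow> 'g set \<Rightarrow> ('g \<Rightarrow> bool) \<Rightarrow> ('k, ('g list \<Rightarrow> 'k) set) superalg" where
  "free_comm_superalg K G \<pi> =
     super_quot (free_superalg K G \<pi>) (supercomm_ideal (free_superalg K G \<pi>))"

definition free_comm_gen ::
  "('k, 'r) ring_scheme \<Rightarrow> 'g set \<Rightarrow> ('g \<Rightarrow> bool) \<Rightarrow> 'g \<Rightarrow> ('g list \<Rightarrow> 'k) set" where
  "free_comm_gen K G \<pi> g =
     supercomm_ideal (free_superalg K G \<pi>) +>\<^bsub>free_superalg K G \<pi>\<^esub> free_gen K g"


section \<open>Tensor products of superalgebras\<close>

text \<open>The free \<open>K\<close>-module on \<open>carrier A \<times> carrier B\<close>, with the bilinear (not associative)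
  multiplication that extends \<open>(a, b) (c, d) = (\<Sum>p q. (-1)^(p q) (a c\<^sub>q, b\<^sub>p d))\<close>, where \<open>c\<^sub>q\<close> and
  \<open>b\<^sub>p\<close> are homogeneous components. It becomes the multiplication
  \<open>(a \<otimes> b) (c \<otimes> d) = (-1)^(|b| |c|) a c \<otimes> b d\<close> modulo \<open>bilinear_rel\<close>.\<close>

definition free_pairs ::
  "('k, 'r) ring_scheme \<Rightarrow> ('k, 'a, 'y) superalg_scheme \<Rightarrow> ('k, 'b, 'z) superalg_scheme
    \<Rightarrow> ('k, 'a \<times> 'b \<Rightarrow> 'k) superalg" where
  "free_pairs K A B =
    (let C = {f. (\<forall>s. f s \<in> carrier K) \<and> finite {s. f s \<noteq> \<zero>\<^bsub>K\<^esub>} \<and>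
                 (\<forall>s. f s \<noteq> \<zero>\<^bsub>K\<^esub> \<longrightarrow> s \<in> carrier A \<times> carrier B)}
     in \<lparr>carrier = C,
         monoid.mult = (\<lambda>f g z.
           \<Oplus>\<^bsub>K\<^esub>s\<in>{s. f s \<noteq> \<zero>\<^bsub>K\<^esub>}. \<Oplus>\<^bsub>K\<^esub>t\<in>{t. g t \<noteq> \<zero>\<^bsub>K\<^esub>}. \<Oplus>\<^bsub>K\<^esub>p\<in>UNIV. \<Oplus>\<^bsub>K\<^esub>q\<in>UNIV.
             if z = (fst s \<otimes>\<^bsub>A\<^esub> hcomp A q (fst t), hcomp B p (snd s) \<otimes>\<^bsub>B\<^esub> snd t)
             then neg_if K (p \<and> q) (f s \<otimes>\<^bsub>K\<^esub> g t) else \<zero>\<^bsub>K\<^esub>),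
         one = (\<lambda>s. if s = (\<one>\<^bsub>A\<^esub>, \<one>\<^bsub>B\<^esub>) then \<one>\<^bsub>K\<^esub> else \<zero>\<^bsub>K\<^esub>),
         ring.zero = (\<lambda>s. \<zero>\<^bsub>K\<^esub>),
         ring.add = (\<lambda>f g s. f s \<oplus>\<^bsub>K\<^esub> g s),
         smult = (\<lambda>c f s. c \<otimes>\<^bsub>K\<^esub> f s),
         grade = (\<lambda>r. {f \<in> C. \<forall>s. f s \<noteq> \<zero>\<^bsub>K\<^esub> \<longrightarrow>
                     (\<exists>p q. fst s \<in> grade A p \<and> snd s \<in> grade B q \<and> r = (p \<noteq> q))})\<rparr>)"

definition pair_gen :: "('k, 'r) ring_scheme \<Rightarrow> 'a \<Rightarrow> 'b \<Rightarrow> 'a \<times> 'b \<Rightarrow> 'k" where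
  "pair_gen K a b = (\<lambda>s. if s = (a, b) then \<one>\<^bsub>K\<^esub> else \<zero>\<^bsub>K\<^esub>)"

definition bilinear_rel ::
  "('k, 'r) ring_scheme \<Rightarrow> ('k, 'a, 'y) superalg_scheme \<Rightarrow> ('k, 'b, 'z) superalg_scheme
    \<Rightarrow> ('a \<times> 'b \<Rightarrow> 'k) set" where
  "bilinear_rel K A B =
    (let F = free_pairs K A B;
         R = {pair_gen K (a \<oplus>\<^bsub>A\<^esub> a') b \<ominus>\<^bsub>F\<^esub> (pair_gen K a b \<oplus>\<^bsub>F\<^esub> pair_gen K a' b) | a a' b.
                a \<in> carrier A \<and> a' \<in> carrier A \<and> b \<in> carrier B} \<union>
             {pair_gen K a (b \<oplus>\<^bsub>B\<^esub> b') \<ominus>\<^bsub>F\<^esub> (pair_gen K a b \<oplus>\<^bsub>F\<^esub> pair_gen K a b') | a b b'.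
                a \<in> carrier A \<and> b \<in> carrier B \<and> b' \<in> carrier B} \<union>
             {pair_gen K (c \<odot>\<^bsub>A\<^esub> a) b \<ominus>\<^bsub>F\<^esub> c \<odot>\<^bsub>F\<^esub> pair_gen K a b | c a b.
                c \<in> carrier K \<and> a \<in> carrier A \<and> b \<in> carrier B} \<union>
             {pair_gen K a (c \<odot>\<^bsub>B\<^esub> b) \<ominus>\<^bsub>F\<^esub> c \<odot>\<^bsub>F\<^esub> pair_gen K a b | c a b.
                c \<in> carrier K \<and> a \<in> carrier A \<and> b \<in> carrier B}
     in \<Inter>{N. submodule N K F \<and> R \<subseteq> N})"

definition tensor ::
  "('k, 'r) ring_scheme \<Rightarrow> ('k, 'a, 'y) superalg_scheme \<Rightarrow> ('k, 'b, 'z) superalg_scheme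
    \<Rightarrow> ('k, ('a \<times> 'b \<Rightarrow> 'k) set) superalg" where
  "tensor K A B = super_quot (free_pairs K A B) (bilinear_rel K A B)"

definition tens ::
  "('k, 'r) ring_scheme \<Rightarrow> ('k, 'a, 'y) superalg_scheme \<Rightarrow> ('k, 'b, 'z) superalg_scheme
    \<Rightarrow> 'a \<Rightarrow> 'b \<Rightarrow> ('a \<times> 'b \<Rightarrow> 'k) set" where
  "tens K A B a b = bilinear_rel K A B +>\<^bsub>free_pairs K A B\<^esub> pair_gen K a b"

text \<open>The linear map with \<open>a \<otimes> b \<mapsto> \<beta> a b\<close>. For bilinear \<open>\<beta>\<close> its value does not depend on the
  representative \<open>f\<close>. All maps that are tensored below are even, so no signs occur.\<close>

definition tens_lift ::
  "('k, 'c, 'z) superalg_scheme \<Rightarrow> ('k, 'r) ring_scheme \<Rightarrow> ('a \<Rightarrow> 'b \<Rightarrow> 'c)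
    \<Rightarrow> ('a \<times> 'b \<Rightarrow> 'k) set \<Rightarrow> 'c" where
  "tens_lift M K \<beta> Y =
    (let f = (SOME f. f \<in> Y)
     in \<Oplus>\<^bsub>M\<^esub>s\<in>{s. f s \<noteq> \<zero>\<^bsub>K\<^esub>}. f s \<odot>\<^bsub>M\<^esub> \<beta> (fst s) (snd s))"


section \<open>Superbialgebras and Hopf superalgebras\<close>

definition superbialgebra ::
  "('k, 'r) ring_scheme \<Rightarrow> ('k, 'a, 'z) superalg_scheme
    \<Rightarrow> ('a \<Rightarrow> ('a \<times> 'a \<Rightarrow> 'k) set) \<Rightarrow> ('a \<Rightarrow> 'k) \<Rightarrow> bool" where
  "superbialgebra K A \<Delta> \<epsilon> \<longleftrightarrow>
    (let T = tensor K A A; T3 = tensor K A T in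
     superalgebra K A \<and>
     \<Delta> \<in> superalg_hom K A T \<and>
     \<epsilon> \<in> superalg_hom K A (base_superalg K) \<and>
     (\<forall>x\<in>carrier A.
        tens_lift T3 K (\<lambda>t c. tens_lift T3 K (\<lambda>a b. tens K A T a (tens K A A b c)) t)
          (tens_lift (tensor K T A) K (\<lambda>a b. tens K T A (\<Delta> a) b) (\<Delta> x))
        = tens_lift T3 K (\<lambda>a b. tens K A T a (\<Delta> b)) (\<Delta> x)) \<and>
     (\<forall>x\<in>carrier A.
        tens_lift A K (\<lambda>a b. \<epsilon> a \<odot>\<^bsub>A\<^esub> b) (\<Delta> x) = x \<and>
        tens_lift A K (\<lambda>a b. \<epsilon> b \<odot>\<^bsub>A\<^esub> a) (\<Delta> x) = x))"

definition antipode ::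
  "('k, 'r) ring_scheme \<Rightarrow> ('k, 'a, 'z) superalg_scheme
    \<Rightarrow> ('a \<Rightarrow> ('a \<times> 'a \<Rightarrow> 'k) set) \<Rightarrow> ('a \<Rightarrow> 'k) \<Rightarrow> ('a \<Rightarrow> 'a) \<Rightarrow> bool" where
  "antipode K A \<Delta> \<epsilon> S \<longleftrightarrow>
     S \<in> even_linear K A A \<and>
     (\<forall>x\<in>carrier A.
        tens_lift A K (\<lambda>a b. S a \<otimes>\<^bsub>A\<^esub> b) (\<Delta> x) = \<epsilon> x \<odot>\<^bsub>A\<^esub> \<one>\<^bsub>A\<^esub> \<and>
        tens_lift A K (\<lambda>a b. a \<otimes>\<^bsub>A\<^esub> S b) (\<Delta> x) = \<epsilon> x \<odot>\<^bsub>A\<^esub> \<one>\<^bsub>A\<^esub>)"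

definition hopf_superalgebra ::
  "('k, 'r) ring_scheme \<Rightarrow> ('k, 'a, 'z) superalg_scheme
    \<Rightarrow> ('a \<Rightarrow> ('a \<times> 'a \<Rightarrow> 'k) set) \<Rightarrow> ('a \<Rightarrow> 'k) \<Rightarrow> ('a \<Rightarrow> 'a) \<Rightarrow> bool" where
  "hopf_superalgebra K A \<Delta> \<epsilon> S \<longleftrightarrow> superbialgebra K A \<Delta> \<epsilon> \<and> antipode K A \<Delta> \<epsilon> S"


section \<open>Matrices over a ring\<close>

text \<open>Matrices are functions of two indices, starting at 0; the sizes are passed separately.\<close>

type_synonym 'a matrix = "nat \<Rightarrow> nat \<Rightarrow> 'a"

definition mmul :: "('a, 'b) ring_scheme \<Rightarrow> nat \<Rightarrow> 'a matrix \<Rightarrow> 'a matrix \<Rightarrow> 'a matrix" where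
  "mmul R l M N i j = (\<Oplus>\<^bsub>R\<^esub>k\<in>{..<l}. M i k \<otimes>\<^bsub>R\<^esub> N k j)"

text \<open>The factors are multiplied in the order of the rows. Only matrices with even, hence commuting,
  entries occur below, so the order is immaterial.\<close>

definition mdet :: "('a, 'b) ring_scheme \<Rightarrow> nat \<Rightarrow> 'a matrix \<Rightarrow> 'a" where
  "mdet R l M = (\<Oplus>\<^bsub>R\<^esub>\<sigma>\<in>{\<sigma>. \<sigma> permutes {..<l}}.
     neg_if R (\<not> evenperm \<sigma>) (foldr (\<lambda>i x. M i (\<sigma> i) \<otimes>\<^bsub>R\<^esub> x) [0..<l] \<one>\<^bsub>R\<^esub>))"

definition suppress :: "nat \<Rightarrow> nat \<Rightarrow> 'a matrix \<Rightarrow> 'a matrix" where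
  "suppress i j M = (\<lambda>r c. M (if r < i then r else Suc r) (if c < j then c else Suc c))"

text \<open>The inverse of an \<open>l \<times> l\<close> matrix by the adjugate formula, \<open>u\<close> being the inverse of its
  determinant.\<close>

definition adj_inv :: "('a, 'b) ring_scheme \<Rightarrow> nat \<Rightarrow> 'a matrix \<Rightarrow> 'a \<Rightarrow> 'a matrix" where
  "adj_inv R l M u i j = neg_if R (odd (i + j)) (mdet R (l - 1) (suppress j i M) \<otimes>\<^bsub>R\<^esub> u)"


section \<open>Formulas in the entries of a generic matrix\<close>

text \<open>In a ring \<open>A\<close> with elements \<open>a i j\<close> (\<open>i, j < m + n\<close>), \<open>t1\<close>, \<open>t2\<close>, where \<open>t1\<close> and \<open>t2\<close> are the
  inverses of \<open>d1\<close> and \<open>d2\<close>. They are collected in one record, because the same formulas are used in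
  \<open>k[GL(m|n)]\<close> and in its quotient \<open>k[SL(m|n)]\<close>.\<close>

record 'a gl_data =
  msize :: nat
  nsize :: nat
  entry :: "'a matrix"
  dinv1 :: 'a
  dinv2 :: 'a

definition X11 :: "'a gl_data \<Rightarrow> 'a matrix" where
  "X11 D i j = entry D i j"

definition Xi12 :: "'a gl_data \<Rightarrow> 'a matrix" where
  "Xi12 D i j = entry D i (msize D + j)"

definition Xi21 :: "'a gl_data \<Rightarrow> 'a matrix" where
  "Xi21 D i j = entry D (msize D + i) j"

definition X22 :: "'a gl_data \<Rightarrow> 'a matrix" where
  "X22 D i j = entry D (msize D + i) (msize D + j)"

definition d1 :: "('a, 'b) ring_scheme \<Rightarrow> 'a gl_data \<Rightarrow> 'a" where
  "d1 A D = mdet A (msize D) (X11 D)"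

definition d2 :: "('a, 'b) ring_scheme \<Rightarrow> 'a gl_data \<Rightarrow> 'a" where
  "d2 A D = mdet A (nsize D) (X22 D)"

definition S11 :: "('a, 'b) ring_scheme \<Rightarrow> 'a gl_data \<Rightarrow> 'a matrix" where
  "S11 A D = adj_inv A (msize D) (X11 D) (dinv1 D)"

definition S22 :: "('a, 'b) ring_scheme \<Rightarrow> 'a gl_data \<Rightarrow> 'a matrix" where
  "S22 A D = adj_inv A (nsize D) (X22 D) (dinv2 D)"

definition matB :: "('a, 'b) ring_scheme \<Rightarrow> 'a gl_data \<Rightarrow> 'a matrix" where
  "matB A D i j = X11 D i j \<ominus>\<^bsub>A\<^esub>
     mmul A (nsize D) (mmul A (nsize D) (Xi12 D) (S22 A D)) (Xi21 D) i j"

definition matC :: "('a, 'b) ring_scheme \<Rightarrow> 'a gl_data \<Rightarrow> 'a matrix" where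
  "matC A D i j = X22 D i j \<ominus>\<^bsub>A\<^esub>
     mmul A (msize D) (mmul A (msize D) (Xi21 D) (S11 A D)) (Xi12 D) i j"

definition S1B :: "('a, 'b) ring_scheme \<Rightarrow> 'a gl_data \<Rightarrow> 'a matrix" where
  "S1B A D = adj_inv A (msize D) (matB A D) (inv\<^bsub>A\<^esub> mdet A (msize D) (matB A D))"

definition S2C :: "('a, 'b) ring_scheme \<Rightarrow> 'a gl_data \<Rightarrow> 'a matrix" where
  "S2C A D = adj_inv A (nsize D) (matC A D) (inv\<^bsub>A\<^esub> mdet A (nsize D) (matC A D))"

definition Ber :: "('a, 'b) ring_scheme \<Rightarrow> 'a gl_data \<Rightarrow> 'a" where
  "Ber A D = mdet A (nsize D) (S22 A D) \<otimes>\<^bsub>A\<^esub> mdet A (msize D) (matB A D)"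

definition antipode_matrix :: "('a, 'b) ring_scheme \<Rightarrow> 'a gl_data \<Rightarrow> 'a matrix" where
  "antipode_matrix A D i j =
    (let m = msize D; n = nsize D in
     if i < m then
       if j < m then S1B A D i j
       else \<ominus>\<^bsub>A\<^esub> mmul A n (mmul A m (S11 A D) (Xi12 D)) (S2C A D) i (j - m)
     else
       if j < m then \<ominus>\<^bsub>A\<^esub> mmul A m (mmul A n (S22 A D) (Xi21 D)) (S1B A D) (i - m) j
       else S2C A D (i - m) (j - m))"

text \<open>The values of comultiplication and counit on the generators.\<close>

definition matrix_coalgebra ::
  "('k, 'r) ring_scheme \<Rightarrow> ('k, 'a, 'z) superalg_scheme \<Rightarrow> 'a gl_data
    \<Rightarrow> ('a \<Rightarrow> ('a \<times> 'a \<Rightarrow> 'k) set) \<Rightarrow> ('a \<Rightarrow> 'k) \<Rightarrow> bool" where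
  "matrix_coalgebra K A D \<Delta> \<epsilon> \<longleftrightarrow>
    (let N = msize D + nsize D; T = tensor K A A in
     (\<forall>i<N. \<forall>j<N. \<Delta> (entry D i j) = (\<Oplus>\<^bsub>T\<^esub>k\<in>{..<N}. tens K A A (entry D i k) (entry D k j)) \<and>
                   \<epsilon> (entry D i j) = (if i = j then \<one>\<^bsub>K\<^esub> else \<zero>\<^bsub>K\<^esub>)) \<and>
     \<Delta> (dinv1 D) = inv\<^bsub>T\<^esub> (\<Delta> (d1 A D)) \<and> \<Delta> (dinv2 D) = inv\<^bsub>T\<^esub> (\<Delta> (d2 A D)) \<and>
     \<epsilon> (dinv1 D) = inv\<^bsub>K\<^esub> (\<epsilon> (d1 A D)) \<and> \<epsilon> (dinv2 D) = inv\<^bsub>K\<^esub> (\<epsilon> (d2 A D)))"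


section \<open>The coordinate superalgebras of \<open>GL(m|n)\<close> and \<open>SL(m|n)\<close>\<close>

datatype gl_gen = Entry nat nat | DetInv1 | DetInv2

definition gl_gens :: "nat \<Rightarrow> nat \<Rightarrow> gl_gen set" where
  "gl_gens m n = {Entry i j | i j. i < m + n \<and> j < m + n} \<union> {DetInv1, DetInv2}"

fun gl_parity :: "nat \<Rightarrow> gl_gen \<Rightarrow> bool" where
  "gl_parity m (Entry i j) = ((i < m) \<noteq> (j < m))"
| "gl_parity m DetInv1 = False"
| "gl_parity m DetInv2 = False"

type_synonym 'k gl_free = "(gl_gen list \<Rightarrow> 'k) set"

definition gl_free :: "('k, 'r) ring_scheme \<Rightarrow> nat \<Rightarrow> nat \<Rightarrow> ('k, 'k gl_free) superalg" where
  "gl_free K m n = free_comm_superalg K (gl_gens m n) (gl_parity m)"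

definition gl_free_data :: "('k, 'r) ring_scheme \<Rightarrow> nat \<Rightarrow> nat \<Rightarrow> 'k gl_free gl_data" where
  "gl_free_data K m n =
    (let g = free_comm_gen K (gl_gens m n) (gl_parity m)
     in \<lparr>msize = m, nsize = n, entry = (\<lambda>i j. g (Entry i j)), dinv1 = g DetInv1, dinv2 = g DetInv2\<rparr>)"

text \<open>The ideal by which the even variables \<open>DetInv1\<close>, \<open>DetInv2\<close> become inverses of \<open>d1\<close>, \<open>d2\<close>.\<close>

definition gl_ideal :: "('k, 'r) ring_scheme \<Rightarrow> nat \<Rightarrow> nat \<Rightarrow> 'k gl_free set" where
  "gl_ideal K m n =
    (let F = gl_free K m n; D = gl_free_data K m n
     in Idl\<^bsub>F\<^esub> {d1 F D \<otimes>\<^bsub>F\<^esub> dinv1 D \<ominus>\<^bsub>F\<^esub> \<one>\<^bsub>F\<^esub>, d2 F D \<otimes>\<^bsub>F\<^esub> dinv2 D \<ominus>\<^bsub>F\<^esub> \<one>\<^bsub>F\<^esub>})"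

definition map_data :: "('a \<Rightarrow> 'b) \<Rightarrow> 'a gl_data \<Rightarrow> 'b gl_data" where
  "map_data f D = \<lparr>msize = msize D, nsize = nsize D, entry = (\<lambda>i j. f (entry D i j)),
     dinv1 = f (dinv1 D), dinv2 = f (dinv2 D)\<rparr>"

definition kGL :: "('k, 'r) ring_scheme \<Rightarrow> nat \<Rightarrow> nat \<Rightarrow> ('k, 'k gl_free set) superalg" where
  "kGL K m n = super_quot (gl_free K m n) (gl_ideal K m n)"

definition GL_data :: "('k, 'r) ring_scheme \<Rightarrow> nat \<Rightarrow> nat \<Rightarrow> 'k gl_free set gl_data" where
  "GL_data K m n = map_data (\<lambda>x. gl_ideal K m n +>\<^bsub>gl_free K m n\<^esub> x) (gl_free_data K m n)"

definition sl_ideal :: "('k, 'r) ring_scheme \<Rightarrow> nat \<Rightarrow> nat \<Rightarrow> 'k gl_free set set" where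
  "sl_ideal K m n =
     Idl\<^bsub>kGL K m n\<^esub> {Ber (kGL K m n) (GL_data K m n) \<ominus>\<^bsub>kGL K m n\<^esub> \<one>\<^bsub>kGL K m n\<^esub>}"

definition kSL :: "('k, 'r) ring_scheme \<Rightarrow> nat \<Rightarrow> nat \<Rightarrow> ('k, 'k gl_free set set) superalg" where
  "kSL K m n = super_quot (kGL K m n) (sl_ideal K m n)"

definition SL_data :: "('k, 'r) ring_scheme \<Rightarrow> nat \<Rightarrow> nat \<Rightarrow> 'k gl_free set set gl_data" where
  "SL_data K m n = map_data (\<lambda>x. sl_ideal K m n +>\<^bsub>kGL K m n\<^esub> x) (GL_data K m n)"

end

theory Submission
  imports Defs "Jordan_Normal_Form.Determinant"
begin

text \<open>
  A matrix over a commutative superalgebra with invertible diagonal blocks (of even entries) factors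
  as a block lower unitriangular, a block diagonal and a block upper unitriangular matrix; hence its
  inverse is the matrix in the statement, once \<open>det B\<close> and \<open>det C\<close> are known to be units. The identity
  behind everything is \<open>det (1 + q r) det (1 + r q) = 1\<close> for odd matrices \<open>q\<close> and \<open>r\<close>, obtained by
  building \<open>q\<close> up from its single entries. It makes the Berezinian multiplicative and gives
  \<open>det B = Ber d\<^sub>2\<close> and \<open>det C = Ber\<inverse> d\<^sub>1\<close>. The determinants of the diagonal blocks of a product are
  units because odd elements have square zero, so that products of odd elements lie in the Jacobson
  radical of the even part.

  Homomorphisms from \<open>k[GL(m|n)]\<close> to a commutative superalgebra correspond to such matrices,
  homomorphisms from \<open>k[SL(m|n)]\<close> to those with \<open>Ber = 1\<close>. The comultiplication, the counit and \<open>S\<close> are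
  the homomorphisms given by the product of two generic matrices, the identity matrix and the inverse
  of the generic matrix. Both sides of each Hopf algebra axiom are homomorphisms on a commutative
  superalgebra, and a homomorphism is determined by its values on the matrix entries, where the axioms
  are the matrix identities \<open>(X Y) Z = X (Y Z)\<close>, \<open>1 X = X = X 1\<close> and \<open>X\<inverse> X = 1 = X X\<inverse>\<close>.
\<close>

text \<open>Determinants make sense only for even entries, and the even part of a commutative
  superalgebra has nilpotents, so no field of fractions is at hand; characteristic 2 and small
  characteristics rule out exponentials and logarithms, which divide by integers. This is why units
  are found modulo a radical and why the identity for odd matrices is proved by altering one entry
  at a time. Blocks of four shapes would need four kinds of products. All of them are padded to
  square matrices of one size, so that identities of a single noncommutative ring (Woodbury, Schur
  complements) can be applied as they stand. The values of \<open>S\<close> on the inverse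
  determinants are forced: the diagonal blocks of the inverse matrix are the inverses of B and C, so
  \<open>S\<close> takes the inverse of d1 to det B = Ber d2 and that of d2 to det C, which is d1
  divided by Ber. In k[GL(m|n)] the factor Ber stays: for m = 1, n = 0 the value on the inverse of x
  is x, while d2 = 1. The values d2 and d1 hold where Ber = 1, that is in k[SL(m|n)]; the formal
  statement distinguishes the two cases accordingly.\<close>

hide_const (open) Polynomial.smult Coset.order Polynomial.order Ring_Hom.ring_hom

section \<open>Determinants over a commutative ring with carrier\<close>

context ring
begin

lemma foldr_mult_closed:
  "(\<And>i. i \<in> set xs \<Longrightarrow> f i \<in> carrier R) \<Longrightarrow> foldr (\<lambda>i x. f i \<otimes> x) xs \<one> \<in> carrier R"
  by (induction xs) auto

lemma mdet_term_closed:
  assumes "\<And>i j. i < l \<Longrightarrow> j < l \<Longrightarrow> M i j \<in> carrier R" "p permutes {..<l}"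
  shows "foldr (\<lambda>i x. M i (p i) \<otimes> x) [0..<l] \<one> \<in> carrier R"
  using permutes_in_image[OF assms(2)] assms(1) by (intro foldr_mult_closed) auto

lemma mdet_closed:
  assumes "\<And>i j. i < l \<Longrightarrow> j < l \<Longrightarrow> M i j \<in> carrier R"
  shows "mdet R l M \<in> carrier R"
  unfolding mdet_def using mdet_term_closed[of l M] assms
  by (intro finsum_closed) (auto simp: neg_if_def)

lemma mdet_cong:
  assumes "\<And>i j. i < l \<Longrightarrow> j < l \<Longrightarrow> M i j \<in> carrier R"
    and "\<And>i j. i < l \<Longrightarrow> j < l \<Longrightarrow> M i j = M' i j"
  shows "mdet R l M = mdet R l M'"
proof -
  have "foldr (\<lambda>i x. M i (p i) \<otimes> x) [0..<l] \<one> = foldr (\<lambda>i x. M' i (p i) \<otimes> x) [0..<l] \<one>"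
    if "p permutes {..<l}" for p
    using permutes_in_image[OF that] assms(2) by (intro foldr_cong) auto
  with mdet_term_closed[of l M] assms(1) show ?thesis
    unfolding mdet_def by (intro finsum_cong') (auto simp: neg_if_def)
qed

lemma mmul_closed:
  assumes "\<And>k. k < l \<Longrightarrow> M i k \<in> carrier R" "\<And>k. k < l \<Longrightarrow> N k j \<in> carrier R"
  shows "mmul R l M N i j \<in> carrier R"
  unfolding mmul_def using assms by auto

end

text \<open>The product of all commutative rings on the type \<open>'a\<close>, and \<open>\<int>\<close> to keep \<open>0 \<noteq> 1\<close>. It is a
  type of class \<^class>\<open>comm_ring_1\<close> that projects onto each of these rings, so that determinant
  identities pass from the type class to rings with a carrier.\<close>

typedef 'a cring_family =
  "{(k :: int, f :: 'a ring \<Rightarrow> 'a). \<forall>R. if cring R then f R \<in> carrier R else f R = undefined}"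
proof
  show "(0, \<lambda>R. if cring R then \<zero>\<^bsub>R\<^esub> else undefined) \<in>
    {(k :: int, f :: 'a ring \<Rightarrow> 'a). \<forall>R. if cring R then f R \<in> carrier R else f R = undefined}"
    by (auto simp: cring.cring_simprules)
qed

setup_lifting type_definition_cring_family

instantiation cring_family :: (type) comm_ring_1
begin

lift_definition zero_cring_family :: "'a cring_family"
  is "(0, \<lambda>R. if cring R then \<zero>\<^bsub>R\<^esub> else undefined)"
  by (auto simp: cring.cring_simprules)

lift_definition one_cring_family :: "'a cring_family"
  is "(1, \<lambda>R. if cring R then \<one>\<^bsub>R\<^esub> else undefined)"
  by (auto simp: cring.cring_simprules)

lift_definition plus_cring_family :: "'a cring_family \<Rightarrow> 'a cring_family \<Rightarrow> 'a cring_family"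
  is "\<lambda>x y. (fst x + fst y, \<lambda>R. if cring R then snd x R \<oplus>\<^bsub>R\<^esub> snd y R else undefined)"
  by (auto simp: cring.cring_simprules split: if_splits)

lift_definition times_cring_family :: "'a cring_family \<Rightarrow> 'a cring_family \<Rightarrow> 'a cring_family"
  is "\<lambda>x y. (fst x * fst y, \<lambda>R. if cring R then snd x R \<otimes>\<^bsub>R\<^esub> snd y R else undefined)"
  by (auto simp: cring.cring_simprules split: if_splits)

lift_definition uminus_cring_family :: "'a cring_family \<Rightarrow> 'a cring_family"
  is "\<lambda>x. (- fst x, \<lambda>R. if cring R then \<ominus>\<^bsub>R\<^esub> snd x R else undefined)"
  by (auto simp: cring.cring_simprules split: if_splits)

definition minus_cring_family :: "'a cring_family \<Rightarrow> 'a cring_family \<Rightarrow> 'a cring_family" where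
  "minus_cring_family x y = x + - y"

instance
proof
  fix x y z :: "'a cring_family"
  show "x + y + z = x + (y + z)"
    by transfer (auto simp: fun_eq_iff cring.cring_simprules split: if_splits)
  show "x + y = y + x"
    by transfer (auto simp: fun_eq_iff cring.cring_simprules split: if_splits)
  show "0 + x = x"
    by transfer (auto simp: fun_eq_iff cring.cring_simprules split: if_splits; metis)
  show "- x + x = 0"
    by transfer (auto simp: fun_eq_iff cring.cring_simprules split: if_splits)
  show "x - y = x + - y"
    by (simp add: minus_cring_family_def)
  show "x * y * z = x * (y * z)"
    by transfer (auto simp: fun_eq_iff cring.cring_simprules split: if_splits)
  show "x * y = y * x"
    by transfer (auto simp: fun_eq_iff cring.cring_simprules split: if_splits)
  show "1 * x = x"
    by transfer (auto simp: fun_eq_iff cring.cring_simprules split: if_splits;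
      metis cring_def ring_def monoid.r_one)
  show "(x + y) * z = x * z + y * z"
    by transfer (auto simp: fun_eq_iff cring.cring_simprules algebra_simps split: if_splits)
  show "(0 :: 'a cring_family) \<noteq> 1"
    by transfer auto
qed

end

lift_definition component :: "'a ring \<Rightarrow> 'a cring_family \<Rightarrow> 'a"
  is "\<lambda>R x. snd x R" .

text \<open>A section of \<open>component R\<close> over \<open>carrier R\<close>. All other
  coordinates, including the integer, are set to zero; the map does not preserve one and serves only
  to lift the entries of a matrix.\<close>

lift_definition extend_family :: "'a ring \<Rightarrow> 'a \<Rightarrow> 'a cring_family"
  is "\<lambda>R a. (0, \<lambda>R'. if cring R' then if R' = R \<and> a \<in> carrier R then a else \<zero>\<^bsub>R'\<^esub> else undefined)"
  by (auto simp: cring.cring_simprules)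

lemma component_extend: "cring R \<Longrightarrow> a \<in> carrier R \<Longrightarrow> component R (extend_family R a) = a"
  by transfer auto

context
  fixes R :: "'a ring"
  assumes R: "cring R"
begin

interpretation cring R by (rule R)

lemma component_closed [simp]: "component R x \<in> carrier R"
  using R by transfer auto

lemma component_hom [simp]:
  "component R 0 = \<zero>\<^bsub>R\<^esub>" "component R 1 = \<one>\<^bsub>R\<^esub>" "component R (- x) = \<ominus>\<^bsub>R\<^esub> component R x"
  "component R (x + y) = component R x \<oplus>\<^bsub>R\<^esub> component R y"
  "component R (x * y) = component R x \<otimes>\<^bsub>R\<^esub> component R y"
  using R by (transfer; auto)+

lemma component_sum: "component R (sum f S) = (\<Oplus>\<^bsub>R\<^esub>s\<in>S. component R (f s))"
  by (induction S rule: infinite_finite_induct) (auto simp: finsum_infinite)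

lemma component_foldr:
  "component R (foldr (\<lambda>i x. f i * x) xs 1) = foldr (\<lambda>i x. component R (f i) \<otimes>\<^bsub>R\<^esub> x) xs \<one>\<^bsub>R\<^esub>"
  by (induction xs) auto

lemma component_prod:
  "component R (\<Prod>i = 0..<l. f i) = foldr (\<lambda>i x. component R (f i) \<otimes>\<^bsub>R\<^esub> x) [0..<l] \<one>\<^bsub>R\<^esub>"
proof -
  have "(\<Prod>i = 0..<l. f i) = foldr (\<lambda>i x. f i * x) [0..<l] 1"
    using prod.distinct_set_conv_list[of "[0..<l]" f] by (simp add: prod_list.eq_foldr foldr_map comp_def)
  then show ?thesis
    by (simp add: component_foldr)
qed

text \<open>\<open>component R\<close> respects sums, products and signs, hence the Leibniz formula.
  The ordered product in \<open>mdet\<close> is a product over the index set because the family is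
  commutative.\<close>

lemma component_det: "component R (det (mat l l (\<lambda>(i, j). M i j))) = mdet R l (\<lambda>i j. component R (M i j))"
proof -
  have "(\<Prod>i = 0..<l. mat l l (\<lambda>(i, j). M i j) $$ (i, p i)) = (\<Prod>i = 0..<l. M i (p i))"
    if "p permutes {0..<l}" for p
    using permutes_in_image[OF that] by (intro prod.cong) auto
  then have "det (mat l l (\<lambda>(i, j). M i j)) =
      (\<Sum>p | p permutes {..<l}. signof p * (\<Prod>i = 0..<l. M i (p i)))"
    by (subst det_def'[where n = l]) (auto simp: lessThan_atLeast0)
  moreover have "component R (signof p * (\<Prod>i = 0..<l. M i (p i))) =
      neg_if R (\<not> evenperm p) (foldr (\<lambda>i x. component R (M i (p i)) \<otimes>\<^bsub>R\<^esub> x) [0..<l] \<one>\<^bsub>R\<^esub>)" for p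
    by (simp add: sign_def neg_if_def component_prod foldr_mult_closed l_minus)
  ultimately show ?thesis
    by (simp add: mdet_def component_sum)
qed

definition lift_mat :: "nat \<Rightarrow> 'a matrix \<Rightarrow> 'a cring_family mat" where
  "lift_mat l M = mat l l (\<lambda>(i, j). extend_family R (M i j))"

lemma carrier_lift_mat: "lift_mat l M \<in> carrier_mat l l"
  by (simp add: lift_mat_def)

lemma component_lift_det:
  assumes "\<And>i j. i < l \<Longrightarrow> j < l \<Longrightarrow> M i j \<in> carrier R"
  shows "component R (det (lift_mat l M)) = mdet R l M"
  unfolding lift_mat_def component_det
  by (rule mdet_cong) (simp_all add: component_extend R assms)

lemma component_times_mat:
  assumes "A \<in> carrier_mat l l" "B \<in> carrier_mat l l" "i < l" "j < l"
  shows "component R ((A * B) $$ (i, j)) =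
    (\<Oplus>\<^bsub>R\<^esub>k\<in>{..<l}. component R (A $$ (i, k)) \<otimes>\<^bsub>R\<^esub> component R (B $$ (k, j)))"
  using assms by (simp add: scalar_prod_def component_sum lessThan_atLeast0)

lemma component_lift_mult:
  assumes M: "\<And>i j. i < l \<Longrightarrow> j < l \<Longrightarrow> M i j \<in> carrier R"
    and N: "\<And>i j. i < l \<Longrightarrow> j < l \<Longrightarrow> N i j \<in> carrier R" and "i < l" "j < l"
  shows "component R ((lift_mat l M * lift_mat l N) $$ (i, j)) = mmul R l M N i j"
  using assms unfolding lift_mat_def mmul_def
  by (auto simp: scalar_prod_def component_sum component_extend R lessThan_atLeast0 intro!: finsum_cong')

text \<open>Multiplicativity of the type class determinant for the lifted matrices, read in the
  coordinate \<open>R\<close>; there the entries of the product of the lifts are those of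
  \<open>mmul\<close>.\<close>

lemma mdet_mmul:
  assumes M: "\<And>i j. i < l \<Longrightarrow> j < l \<Longrightarrow> M i j \<in> carrier R"
    and N: "\<And>i j. i < l \<Longrightarrow> j < l \<Longrightarrow> N i j \<in> carrier R"
  shows "mdet R l (mmul R l M N) = mdet R l M \<otimes>\<^bsub>R\<^esub> mdet R l N"
proof -
  let ?P = "lift_mat l M * lift_mat l N"
  have P: "?P = mat l l (\<lambda>(i, j). ?P $$ (i, j))"
    by (rule eq_matI) (auto simp: lift_mat_def)
  have "mdet R l M \<otimes>\<^bsub>R\<^esub> mdet R l N = component R (det ?P)"
    using assms by (subst det_mult[of _ l]) (simp_all add: component_lift_det carrier_lift_mat)
  also have "\<dots> = mdet R l (\<lambda>i j. component R (?P $$ (i, j)))"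
    by (subst P, subst component_det) simp
  also have "\<dots> = mdet R l (mmul R l M N)"
    by (rule mdet_cong) (simp_all add: component_lift_mult assms mmul_closed flip: component_lift_mult)
  finally show ?thesis by simp
qed

lemma mdet_id: "mdet R l (\<lambda>i j. if i = j then \<one>\<^bsub>R\<^esub> else \<zero>\<^bsub>R\<^esub>) = \<one>\<^bsub>R\<^esub>"
proof -
  have "mdet R l (\<lambda>i j. if i = j then \<one>\<^bsub>R\<^esub> else \<zero>\<^bsub>R\<^esub>)
      = mdet R l (\<lambda>i j. component R (if i = j then 1 else 0))"
    by (rule mdet_cong) auto
  also have "\<dots> = component R (det (1\<^sub>m l))"
    unfolding one_mat_def component_det[symmetric] by (simp add: case_prod_beta)
  finally show ?thesis by simp
qed

text \<open>Both sides suppress row j and column i, and the sign of the cofactor, a power of -1 with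
  exponent j + i, is the one that \<open>neg_if\<close> inserts. Only the spelling of the minor has
  to be matched.\<close>

lemma adj_inv_component:
  assumes M: "\<And>i j. i < l \<Longrightarrow> j < l \<Longrightarrow> M i j \<in> carrier R" and u: "u \<in> carrier R" and "i < l" "j < l"
  shows "adj_inv R l M u i j = component R (adj_mat (lift_mat l M) $$ (i, j)) \<otimes>\<^bsub>R\<^esub> u"
proof -
  have "component R (det (mat_delete (lift_mat l M) j i)) =
      mdet R (l - 1) (\<lambda>i' j'. component R (extend_family R
        (M (if i' < j then i' else Suc i') (if j' < i then j' else Suc j'))))"
    unfolding component_det[symmetric]
    by (rule arg_cong[where f = "\<lambda>x. component R (det x)"], rule eq_matI)
      (use assms in \<open>auto simp: mat_delete_def lift_mat_def\<close>)
  also have "\<dots> = mdet R (l - 1) (suppress j i M)"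
    unfolding suppress_def using assms by (intro mdet_cong) (auto simp: component_extend R)
  finally have *: "component R (det (mat_delete (lift_mat l M) j i)) = mdet R (l - 1) (suppress j i M)" .
  have "mdet R (l - 1) (suppress j i M) \<in> carrier R"
    by (subst *[symmetric]) (rule component_closed)
  moreover have "(-1 :: 'a cring_family) ^ (j + i) = (if odd (i + j) then -1 else 1)"
    by (auto simp: minus_one_power_iff)
  ultimately show ?thesis
    using assms u by (auto simp: adj_inv_def adj_mat_def cofactor_def neg_if_def lift_mat_def[symmetric] * l_minus)
      (auto simp: lift_mat_def adj_inv_def adj_mat_def cofactor_def neg_if_def *[unfolded lift_mat_def] l_minus)
qed

lemma adj_inv_closed:
  assumes M: "\<And>i j. i < l \<Longrightarrow> j < l \<Longrightarrow> M i j \<in> carrier R" and u: "u \<in> carrier R" and "i < l" "j < l"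
  shows "adj_inv R l M u i j \<in> carrier R"
  by (subst adj_inv_component[OF assms]) (simp_all add: u)

text \<open>The product of a matrix with its adjugate, in either order, is its determinant times the
  identity; the factor u turns the determinant into 1.\<close>

lemma mmul_adj_inv:
  assumes M: "\<And>i j. i < l \<Longrightarrow> j < l \<Longrightarrow> M i j \<in> carrier R" and u: "u \<in> carrier R"
    and inv: "mdet R l M \<otimes>\<^bsub>R\<^esub> u = \<one>\<^bsub>R\<^esub>" and ij: "i < l" "j < l"
  shows "mmul R l M (adj_inv R l M u) i j = (if i = j then \<one>\<^bsub>R\<^esub> else \<zero>\<^bsub>R\<^esub>)"
    and "mmul R l (adj_inv R l M u) M i j = (if i = j then \<one>\<^bsub>R\<^esub> else \<zero>\<^bsub>R\<^esub>)"
proof -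
  let ?M = "lift_mat l M"
  let ?A = "adj_mat ?M"
  have cM: "?M \<in> carrier_mat l l" by (simp add: lift_mat_def)
  note adj = adj_mat[OF cM]
  have M': "component R (?M $$ (i, j)) = M i j" if "i < l" "j < l" for i j
    using that by (simp add: lift_mat_def component_extend R M)
  have d: "component R ((det ?M \<cdot>\<^sub>m 1\<^sub>m l) $$ (i, j)) \<otimes>\<^bsub>R\<^esub> u = (if i = j then \<one>\<^bsub>R\<^esub> else \<zero>\<^bsub>R\<^esub>)"
    using ij inv u mdet_closed[of l M] by (simp add: component_lift_det M)
  have "mmul R l M (adj_inv R l M u) i j
      = (\<Oplus>\<^bsub>R\<^esub>k\<in>{..<l}. (component R (?M $$ (i, k)) \<otimes>\<^bsub>R\<^esub> component R (?A $$ (k, j))) \<otimes>\<^bsub>R\<^esub> u)"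
    unfolding mmul_def using ij u by (intro finsum_cong') (auto simp: adj_inv_component M M' m_assoc)
  also have "\<dots> = component R ((?M * ?A) $$ (i, j)) \<otimes>\<^bsub>R\<^esub> u"
    using u by (simp add: finsum_ldistr component_times_mat[OF cM adj(1) ij] Pi_def)
  finally show "mmul R l M (adj_inv R l M u) i j = (if i = j then \<one>\<^bsub>R\<^esub> else \<zero>\<^bsub>R\<^esub>)"
    using d adj by simp
  have "mmul R l (adj_inv R l M u) M i j
      = (\<Oplus>\<^bsub>R\<^esub>k\<in>{..<l}. (component R (?A $$ (i, k)) \<otimes>\<^bsub>R\<^esub> component R (?M $$ (k, j))) \<otimes>\<^bsub>R\<^esub> u)"
    unfolding mmul_def using ij u by (intro finsum_cong') (auto simp: adj_inv_component M M' m_ac)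
  also have "\<dots> = component R ((?A * ?M) $$ (i, j)) \<otimes>\<^bsub>R\<^esub> u"
    using u by (simp add: finsum_ldistr component_times_mat[OF adj(1) cM ij] Pi_def)
  finally show "mmul R l (adj_inv R l M u) M i j = (if i = j then \<one>\<^bsub>R\<^esub> else \<zero>\<^bsub>R\<^esub>)"
    using d adj by simp
qed

end

section \<open>Determinants of matrices that differ from the identity in one row or column\<close>

lemma permutes_fixing_all_but_one:
  assumes "p permutes S" "\<And>k. k \<in> S \<Longrightarrow> k \<noteq> i \<Longrightarrow> p k = k"
  shows "p = id"
proof
  fix k
  have "p k = k" if "k \<noteq> i" for k
    using assms that by (cases "k \<in> S") (auto simp: permutes_not_in)
  moreover from this have "p i = i"
    using permutes_inj[OF assms(1)] by (metis injD)
  ultimately show "p k = id k" by (cases "k = i") auto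
qed

text \<open>A permutation other than the identity moves some index besides i, and there the row is
  one of the identity matrix and contributes 0. So the Leibniz sum has a single term.\<close>

lemma det_one_row:
  fixes M :: "nat \<Rightarrow> nat \<Rightarrow> 'a :: comm_ring_1"
  assumes "i < l" "\<And>k j. k < l \<Longrightarrow> j < l \<Longrightarrow> k \<noteq> i \<Longrightarrow> M k j = (if k = j then 1 else 0)"
  shows "det (mat l l (\<lambda>(i, j). M i j)) = M i i"
proof -
  let ?A = "mat l l (\<lambda>(i, j). M i j)"
  have "det ?A = (\<Sum>p | p permutes {0..<l}. signof p * (\<Prod>i = 0..<l. ?A $$ (i, p i)))"
    by (rule det_def'[where n = l]) simp
  also have "\<dots> = (\<Sum>p\<in>{id}. signof p * (\<Prod>i = 0..<l. ?A $$ (i, p i)))"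
  proof (rule sum.mono_neutral_right)
    show "\<forall>p\<in>{p. p permutes {0..<l}} - {id}. signof p * (\<Prod>i = 0..<l. ?A $$ (i, p i)) = 0"
    proof
      fix p assume p: "p \<in> {p. p permutes {0..<l}} - {id}"
      then obtain k where k: "k < l" "k \<noteq> i" "p k \<noteq> k"
        using permutes_fixing_all_but_one[of p "{0..<l}" i] by auto
      then have "?A $$ (k, p k) = 0"
        using assms p permutes_in_image[of p "{0..<l}" k] by auto
      then show "signof p * (\<Prod>i = 0..<l. ?A $$ (i, p i)) = 0"
        using k by (subst prod_zero) auto
    qed
  qed (auto simp: permutes_id finite_permutations)
  also have "\<dots> = M i i"
  proof -
    have "(\<Prod>k = 0..<l. ?A $$ (k, k)) = (\<Prod>k = 0..<l. if k = i then M i i else 1)"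
      by (rule prod.cong) (use assms in auto)
    then show ?thesis
      using assms(1) by (simp add: sign_id)
  qed
  finally show ?thesis .
qed

text \<open>Made for 1 + e r, where e has a single nonzero entry: this matrix differs from the
  identity in one row only.\<close>

lemma mdet_one_row:
  fixes R :: "'a ring"
  assumes R: "cring R" and "i < l" "\<And>j. j < l \<Longrightarrow> M i j \<in> carrier R"
    and "\<And>k j. k < l \<Longrightarrow> j < l \<Longrightarrow> k \<noteq> i \<Longrightarrow> M k j = (if k = j then \<one>\<^bsub>R\<^esub> else \<zero>\<^bsub>R\<^esub>)"
  shows "mdet R l M = M i i"
proof -
  interpret cring R by (rule R)
  \<comment> \<open>The rows of the identity are lifted to the 0 and 1 of the family itself, because
    \<open>extend_family\<close> does not send one to one.\<close>
  define M' where "M' k j = (if k = i then extend_family R (M i j) else if k = j then 1 else 0)" for k j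
  have closed: "M k j \<in> carrier R" if "k < l" "j < l" for k j
    using assms that by (cases "k = i") auto
  have "mdet R l M = mdet R l (\<lambda>k j. component R (M' k j))"
    using closed assms by (intro mdet_cong) (auto simp: M'_def component_extend)
  also have "\<dots> = component R (M' i i)"
    unfolding component_det[OF R, symmetric]
    by (subst det_one_row[of i]) (use assms in \<open>auto simp: M'_def\<close>)
  finally show ?thesis
    using assms by (simp add: M'_def component_extend)
qed

text \<open>The transpose of the case of one row, made for 1 + r e with a single entry in e.\<close>

lemma mdet_one_col:
  fixes R :: "'a ring"
  assumes R: "cring R" and "i < l" "\<And>j. j < l \<Longrightarrow> M j i \<in> carrier R"
    and "\<And>k j. k < l \<Longrightarrow> j < l \<Longrightarrow> k \<noteq> i \<Longrightarrow> M j k = (if k = j then \<one>\<^bsub>R\<^esub> else \<zero>\<^bsub>R\<^esub>)"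
  shows "mdet R l M = M i i"
proof -
  interpret cring R by (rule R)
  define M' where "M' k j = (if k = i then extend_family R (M j i) else if k = j then 1 else 0)" for k j
  have closed: "M k j \<in> carrier R" if "k < l" "j < l" for k j
    using assms that by (cases "j = i") auto
  have "mdet R l M = mdet R l (\<lambda>k j. component R (M' j k))"
    using closed assms by (intro mdet_cong) (auto simp: M'_def component_extend)
  also have "\<dots> = component R (det (transpose_mat (mat l l (\<lambda>(i, j). M' i j))))"
    unfolding component_det[OF R, symmetric]
    by (rule arg_cong[where f = "\<lambda>x. component R (det x)"], rule eq_matI) auto
  also have "\<dots> = component R (M' i i)"
    by (subst det_transpose[of _ l], simp, subst det_one_row[of i])
      (use assms in \<open>auto simp: M'_def\<close>)
  finally show ?thesis
    using assms by (simp add: M'_def component_extend)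
qed

section \<open>Matrices over a supercommutative ring\<close>

lemma (in abelian_monoid) finsum_swap:
  assumes "finite I" "finite J" "\<And>i j. i \<in> I \<Longrightarrow> j \<in> J \<Longrightarrow> f i j \<in> carrier G"
  shows "(\<Oplus>i\<in>I. \<Oplus>j\<in>J. f i j) = (\<Oplus>j\<in>J. \<Oplus>i\<in>I. f i j)"
  using assms(1,3)
proof (induction I)
  case empty
  then show ?case by simp
next
  case (insert x I)
  then have "(\<Oplus>i\<in>insert x I. \<Oplus>j\<in>J. f i j) = (\<Oplus>j\<in>J. f x j) \<oplus> (\<Oplus>j\<in>J. \<Oplus>i\<in>I. f i j)"
    by (subst finsum_insert) (auto intro!: finsum_closed)
  also have "\<dots> = (\<Oplus>j\<in>J. f x j \<oplus> (\<Oplus>i\<in>I. f i j))"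
    using insert by (intro finsum_addf[symmetric]) (auto intro!: finsum_closed)
  also have "\<dots> = (\<Oplus>j\<in>J. \<Oplus>i\<in>insert x I. f i j)"
    using insert by (intro finsum_cong') (auto intro!: finsum_closed)
  finally show ?case .
qed

lemma (in abelian_monoid) finsum_mono_neutral:
  assumes "finite J" "I \<subseteq> J" "\<And>i. i \<in> J - I \<Longrightarrow> f i = \<zero>" "\<And>i. i \<in> I \<Longrightarrow> f i = g i"
    "\<And>i. i \<in> I \<Longrightarrow> g i \<in> carrier G"
  shows "(\<Oplus>i\<in>J. f i) = (\<Oplus>i\<in>I. g i)"
proof -
  have "f i \<in> carrier G" if "i \<in> J" for i
    using assms(3-5) that by (cases "i \<in> I") auto
  then show ?thesis
    using assms by (intro add.finprod_mono_neutral_cong_right) auto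
qed

lemma (in abelian_monoid) finsum_single:
  assumes "finite J" "i \<in> J" "\<And>j. j \<in> J \<Longrightarrow> j \<noteq> i \<Longrightarrow> f j = \<zero>" "f i \<in> carrier G"
  shows "(\<Oplus>j\<in>J. f j) = f i"
  using finsum_mono_neutral[of J "{i}" f f] assms by simp

lemma (in abelian_monoid) finsum_lessThan_add:
  fixes a b :: nat
  assumes "\<And>k. k < a + b \<Longrightarrow> f k \<in> carrier G"
  shows "(\<Oplus>k\<in>{..<a + b}. f k) = (\<Oplus>k\<in>{..<a}. f k) \<oplus> (\<Oplus>k\<in>{..<b}. f (a + k))"
proof -
  have "{..<a + b} = {..<a} \<union> {a..<a + b}"
    by auto
  moreover have "(\<Oplus>k\<in>{a..<a + b}. f k) = (\<Oplus>k\<in>{..<b}. f (a + k))"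
    using finsum_reindex[of f "(+) a" "{0..<b}"] assms
    by (simp add: Pi_def inj_on_def lessThan_atLeast0 add.commute)
  moreover have "{..<a} \<inter> {a..<a + b} = {}"
    by auto
  ultimately show ?thesis
    using finsum_Un_disjoint[of "{..<a}" "{a..<a + b}" f] assms by (simp add: Pi_def)
qed

text \<open>The factors keep their order, so this holds for any ring homomorphism. It is applied to
  the projection modulo \<open>rad\<close> and to superalgebra homomorphisms, whose source is
  commutative only in a graded sense.\<close>

lemma mdet_hom:
  assumes "ring R" "ring S" "h \<in> ring_hom R S" "\<And>i j. i < l \<Longrightarrow> j < l \<Longrightarrow> M i j \<in> carrier R"
  shows "h (mdet R l M) = mdet S l (\<lambda>i j. h (M i j))"
proof -
  interpret ring_hom_ring R S h
    using assms by (simp add: ring_hom_ringI2)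
  have foldr: "h (foldr (\<lambda>i x. f i \<otimes>\<^bsub>R\<^esub> x) xs \<one>\<^bsub>R\<^esub>) = foldr (\<lambda>i x. h (f i) \<otimes>\<^bsub>S\<^esub> x) xs \<one>\<^bsub>S\<^esub>"
    if "\<And>i. i \<in> set xs \<Longrightarrow> f i \<in> carrier R" for f and xs :: "nat list"
    using that by (induction xs) (auto simp: R.foldr_mult_closed)
  have *: "h (foldr (\<lambda>i x. M i (p i) \<otimes>\<^bsub>R\<^esub> x) [0..<l] \<one>\<^bsub>R\<^esub>) = foldr (\<lambda>i x. h (M i (p i)) \<otimes>\<^bsub>S\<^esub> x) [0..<l] \<one>\<^bsub>S\<^esub>"
    if "p permutes {..<l}" for p
    using permutes_in_image[OF that] assms(4) by (intro foldr) auto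
  note closed = R.mdet_term_closed[of l M, OF assms(4)] S.mdet_term_closed[of l "\<lambda>i j. h (M i j)"]
  show ?thesis
    unfolding mdet_def
    by (subst hom_finsum, use closed assms(4) in \<open>force simp: neg_if_def\<close>, rule S.finsum_cong')
      (use closed assms(4) * in \<open>auto simp: neg_if_def\<close>)
qed

lemma mmul_hom:
  assumes "ring R" "ring S" "h \<in> ring_hom R S"
    "\<And>k. k < l \<Longrightarrow> M i k \<in> carrier R" "\<And>k. k < l \<Longrightarrow> N k j \<in> carrier R"
  shows "h (mmul R l M N i j) = mmul S l (\<lambda>i j. h (M i j)) (\<lambda>i j. h (N i j)) i j"
proof -
  interpret ring_hom_ring R S h
    using assms by (simp add: ring_hom_ringI2)
  show ?thesis
    unfolding mmul_def using assms(4,5)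
    by (subst hom_finsum) (auto intro!: S.finsum_cong')
qed

text \<open>Matrices vanish outside the N by N corner, so that equality of matrices is equality of
  functions and the ring axioms hold without index bounds.\<close>

definition matring :: "('a, 'b) ring_scheme \<Rightarrow> nat \<Rightarrow> 'a matrix ring" where
  "matring A N = \<lparr>carrier = {M. (\<forall>i j. M i j \<in> carrier A) \<and> (\<forall>i j. N \<le> i \<or> N \<le> j \<longrightarrow> M i j = \<zero>\<^bsub>A\<^esub>)},
     monoid.mult = mmul A N, one = (\<lambda>i j. if i = j \<and> i < N then \<one>\<^bsub>A\<^esub> else \<zero>\<^bsub>A\<^esub>),
     ring.zero = (\<lambda>i j. \<zero>\<^bsub>A\<^esub>), ring.add = (\<lambda>M M' i j. M i j \<oplus>\<^bsub>A\<^esub> M' i j)\<rparr>"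

lemma (in ring) matring_ring: "ring (matring R N)"
proof (rule ringI)
  let ?M = "matring R N"
  show "abelian_group ?M"
  proof (rule abelian_groupI)
    fix x assume x: "x \<in> carrier ?M"
    show "\<exists>y\<in>carrier ?M. y \<oplus>\<^bsub>?M\<^esub> x = \<zero>\<^bsub>?M\<^esub>"
      by (rule bexI[of _ "\<lambda>i j. \<ominus> x i j"]) (use x in \<open>auto simp: matring_def l_neg\<close>)
  qed (auto simp: matring_def a_ac fun_eq_iff)
  show "Group.monoid ?M"
  proof (rule monoidI)
    fix x y assume xy: "x \<in> carrier ?M" "y \<in> carrier ?M"
    then show "x \<otimes>\<^bsub>?M\<^esub> y \<in> carrier ?M"
      by (auto simp: matring_def mmul_def intro!: add.finprod_one_eqI)
    fix z assume z: "z \<in> carrier ?M"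
    have "(\<Oplus>k\<in>{..<N}. (\<Oplus>l\<in>{..<N}. x i l \<otimes> y l k) \<otimes> z k j)
        = (\<Oplus>k\<in>{..<N}. x i k \<otimes> (\<Oplus>l\<in>{..<N}. y k l \<otimes> z l j))" for i j
    proof -
      have "(\<Oplus>k\<in>{..<N}. (\<Oplus>l\<in>{..<N}. x i l \<otimes> y l k) \<otimes> z k j)
          = (\<Oplus>k\<in>{..<N}. \<Oplus>l\<in>{..<N}. x i l \<otimes> y l k \<otimes> z k j)"
        using xy z by (intro finsum_cong') (auto simp: matring_def finsum_ldistr)
      also have "\<dots> = (\<Oplus>l\<in>{..<N}. \<Oplus>k\<in>{..<N}. x i l \<otimes> y l k \<otimes> z k j)"
        using xy z by (intro finsum_swap) (auto simp: matring_def)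
      also have "\<dots> = (\<Oplus>k\<in>{..<N}. x i k \<otimes> (\<Oplus>l\<in>{..<N}. y k l \<otimes> z l j))"
        using xy z by (intro finsum_cong') (auto simp: matring_def finsum_rdistr m_assoc)
      finally show ?thesis .
    qed
    then show "x \<otimes>\<^bsub>?M\<^esub> y \<otimes>\<^bsub>?M\<^esub> z = x \<otimes>\<^bsub>?M\<^esub> (y \<otimes>\<^bsub>?M\<^esub> z)"
      by (simp add: matring_def mmul_def fun_eq_iff)
  next
    fix x assume x: "x \<in> carrier ?M"
    have "(\<Oplus>k\<in>{..<N}. (if i = k \<and> i < N then \<one> else \<zero>) \<otimes> x k j) = x i j" for i j
    proof (cases "i < N")
      case True
      then show ?thesis
        using x by (subst finsum_single[of _ i]) (auto simp: matring_def)
    next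
      case False
      then show ?thesis
        using x by (auto simp: matring_def intro!: add.finprod_one_eqI)
    qed
    then show "\<one>\<^bsub>?M\<^esub> \<otimes>\<^bsub>?M\<^esub> x = x"
      by (simp add: matring_def mmul_def fun_eq_iff)
    have "(\<Oplus>k\<in>{..<N}. x i k \<otimes> (if k = j \<and> k < N then \<one> else \<zero>)) = x i j" for i j
    proof (cases "j < N")
      case True
      then show ?thesis
        using x by (subst finsum_single[of _ j]) (auto simp: matring_def)
    next
      case False
      then show ?thesis
        using x by (auto simp: matring_def intro!: add.finprod_one_eqI)
    qed
    then show "x \<otimes>\<^bsub>?M\<^esub> \<one>\<^bsub>?M\<^esub> = x"
      by (simp add: matring_def mmul_def fun_eq_iff)
  qed (auto simp: matring_def)
  fix x y z assume xyz: "x \<in> carrier ?M" "y \<in> carrier ?M" "z \<in> carrier ?M"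
  show "(x \<oplus>\<^bsub>?M\<^esub> y) \<otimes>\<^bsub>?M\<^esub> z = x \<otimes>\<^bsub>?M\<^esub> z \<oplus>\<^bsub>?M\<^esub> y \<otimes>\<^bsub>?M\<^esub> z"
    using xyz by (auto simp: matring_def mmul_def l_distr fun_eq_iff finsum_addf Pi_def)
  show "z \<otimes>\<^bsub>?M\<^esub> (x \<oplus>\<^bsub>?M\<^esub> y) = z \<otimes>\<^bsub>?M\<^esub> x \<oplus>\<^bsub>?M\<^esub> z \<otimes>\<^bsub>?M\<^esub> y"
    using xyz by (auto simp: matring_def mmul_def r_distr fun_eq_iff finsum_addf Pi_def)
qed

lemma (in ring) matring_minus:
  assumes "x \<in> carrier (matring R N)"
  shows "\<ominus>\<^bsub>matring R N\<^esub> x = (\<lambda>i j. \<ominus> x i j)"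
proof -
  interpret M: ring "matring R N" by (rule matring_ring)
  show ?thesis
    by (rule M.minus_equality) (use assms in \<open>auto simp: matring_def l_neg\<close>)
qed

text \<open>What the matrix calculations use of a commutative superalgebra: homogeneous elements and
  the sign rule, without scalars. Odd elements have square zero by assumption, which covers
  characteristic 2.\<close>

locale super_ring = ring A for A (structure) +
  fixes G :: "bool \<Rightarrow> 'a set"
  assumes G_subset: "G p \<subseteq> carrier A"
    and G_zero [simp, intro]: "\<zero> \<in> G p"
    and G_add [intro]: "x \<in> G p \<Longrightarrow> y \<in> G p \<Longrightarrow> x \<oplus> y \<in> G p"
    and G_minus [intro]: "x \<in> G p \<Longrightarrow> \<ominus> x \<in> G p"
    and G_one [simp, intro]: "\<one> \<in> G False"
    and G_mult: "x \<in> G p \<Longrightarrow> y \<in> G q \<Longrightarrow> x \<otimes> y \<in> G (p \<noteq> q)"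
    and G_commute: "x \<in> G p \<Longrightarrow> y \<in> G q \<Longrightarrow> x \<otimes> y = neg_if A (p \<and> q) (y \<otimes> x)"
    and G_square: "x \<in> G True \<Longrightarrow> x \<otimes> x = \<zero>"
begin

lemma G_carrier: "x \<in> G p \<Longrightarrow> x \<in> carrier A"
  using G_subset by auto

lemmas [simp] = G_carrier[of _ False] G_carrier[of _ True]

lemma even_mult [simp]: "x \<in> G False \<Longrightarrow> y \<in> G False \<Longrightarrow> x \<otimes> y \<in> G False"
  using G_mult[of x False y False] by simp

lemma G_mult' [intro]: "x \<in> G p \<Longrightarrow> y \<in> G q \<Longrightarrow> r = (p \<noteq> q) \<Longrightarrow> x \<otimes> y \<in> G r"
  using G_mult by simp

lemma G_finsum: "(\<And>i. i \<in> I \<Longrightarrow> f i \<in> G p) \<Longrightarrow> (\<Oplus>i\<in>I. f i) \<in> G p"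
proof (induction I rule: infinite_finite_induct)
  case (insert x I)
  then have "f \<in> insert x I \<rightarrow> carrier A"
    by (auto intro: G_carrier)
  with insert show ?case
    by (subst finsum_insert) auto
qed (auto simp: finsum_infinite)

lemma even_commute: "x \<in> G False \<Longrightarrow> y \<in> G p \<Longrightarrow> x \<otimes> y = y \<otimes> x"
  using G_commute[of x False y p] by (simp add: neg_if_def)

text \<open>A bare \<open>ring\<close> record without further fields, because the coordinates of
  \<open>cring_family\<close> are indexed by such records. Through it the determinant identities
  reach the even entries.\<close>

definition evens :: "'a ring" where
  "evens = \<lparr>carrier = G False, monoid.mult = (\<otimes>), one = \<one>, ring.zero = \<zero>, ring.add = (\<oplus>)\<rparr>"

lemma evens_simps [simp]: "carrier evens = G False" "monoid.mult evens = (\<otimes>)" "\<one>\<^bsub>evens\<^esub> = \<one>"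
  "\<zero>\<^bsub>evens\<^esub> = \<zero>" "ring.add evens = (\<oplus>)"
  by (simp_all add: evens_def)

lemma evens_cring: "cring evens"
proof (rule cringI)
  show "abelian_group evens"
  proof (rule abelian_groupI)
    fix x assume "x \<in> carrier evens"
    then show "\<exists>y\<in>carrier evens. y \<oplus>\<^bsub>evens\<^esub> x = \<zero>\<^bsub>evens\<^esub>"
      by (intro bexI[of _ "\<ominus> x"]) (auto simp: l_neg)
  qed (auto simp: a_ac)
  show "Group.comm_monoid evens"
    by (rule comm_monoidI) (auto simp: m_assoc intro: even_commute)
qed (auto simp: l_distr)

lemma evens_minus [simp]: "x \<in> G False \<Longrightarrow> \<ominus>\<^bsub>evens\<^esub> x = \<ominus> x"
proof -
  interpret E: cring evens by (rule evens_cring)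
  show "x \<in> G False \<Longrightarrow> \<ominus>\<^bsub>evens\<^esub> x = \<ominus> x"
    by (rule E.minus_equality) (auto simp: l_neg)
qed

lemma evens_finsum: "(\<And>i. i \<in> I \<Longrightarrow> f i \<in> G False) \<Longrightarrow> (\<Oplus>\<^bsub>evens\<^esub>i\<in>I. f i) = (\<Oplus>i\<in>I. f i)"
proof -
  interpret E: cring evens by (rule evens_cring)
  assume "\<And>i. i \<in> I \<Longrightarrow> f i \<in> G False"
  then show ?thesis
  proof (induction I rule: infinite_finite_induct)
    case (insert x I)
    then show ?case
      by (simp add: Pi_def)
  qed (auto simp: E.finsum_infinite finsum_infinite)
qed

lemma evens_mdet:
  assumes "\<And>i j. i < l \<Longrightarrow> j < l \<Longrightarrow> M i j \<in> G False"
  shows "mdet evens l M = mdet A l M"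
proof -
  interpret E: cring evens by (rule evens_cring)
  note closed = E.mdet_term_closed[of l M, simplified, OF assms]
  have "neg_if evens c x = neg_if A c x \<and> neg_if A c x \<in> G False" if "x \<in> G False" for c x
    using that by (auto simp: neg_if_def)
  then have "neg_if evens c (foldr (\<lambda>i x. M i (p i) \<otimes> x) [0..<l] \<one>) = neg_if A c (foldr (\<lambda>i x. M i (p i) \<otimes> x) [0..<l] \<one>)
      \<and> neg_if A c (foldr (\<lambda>i x. M i (p i) \<otimes> x) [0..<l] \<one>) \<in> G False" if "p permutes {..<l}" for c p
    using closed that by blast
  then show ?thesis
    unfolding mdet_def evens_simps
    by (subst evens_finsum[symmetric], simp, intro E.finsum_cong') auto
qed

lemma evens_adj_inv:
  assumes "\<And>i j. i < l \<Longrightarrow> j < l \<Longrightarrow> M i j \<in> G False" "u \<in> G False" "i < l" "j < l"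
  shows "adj_inv evens l M u i j = adj_inv A l M u i j"
    and "adj_inv A l M u i j \<in> G False"
proof -
  interpret E: cring evens by (rule evens_cring)
  have *: "suppress j i M i' j' \<in> G False" if "i' < l - 1" "j' < l - 1" for i' j'
    using that assms by (auto simp: suppress_def)
  then have "mdet evens (l - 1) (suppress j i M) = mdet A (l - 1) (suppress j i M)"
    by (rule evens_mdet)
  moreover have "mdet evens (l - 1) (suppress j i M) \<in> G False"
    using E.mdet_closed[of "l - 1" "suppress j i M"] * by simp
  ultimately show "adj_inv evens l M u i j = adj_inv A l M u i j"
    using assms by (auto simp: adj_inv_def neg_if_def)
  then show "adj_inv A l M u i j \<in> G False"
    using adj_inv_closed[OF evens_cring, of l M u i j] assms by simp
qed

end

section \<open>Blocks as padded square matrices\<close>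

locale super_mat = super_ring A G for A (structure) and G +
  fixes N :: nat
begin

abbreviation MM :: "'a matrix ring" where "MM \<equiv> matring A N"

interpretation E: cring evens by (rule evens_cring)

interpretation M: ring MM by (rule matring_ring)

lemma MM_simps:
  "carrier MM = {M. (\<forall>i j. M i j \<in> carrier A) \<and> (\<forall>i j. N \<le> i \<or> N \<le> j \<longrightarrow> M i j = \<zero>)}"
  "\<one>\<^bsub>MM\<^esub> = (\<lambda>i j. if i = j \<and> i < N then \<one> else \<zero>)"
  "\<zero>\<^bsub>MM\<^esub> = (\<lambda>i j. \<zero>)" "x \<oplus>\<^bsub>MM\<^esub> y = (\<lambda>i j. x i j \<oplus> y i j)"
  "x \<otimes>\<^bsub>MM\<^esub> y = mmul A N x y"
  by (simp_all add: matring_def)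

text \<open>Blocks of all shapes live in the ring of \<open>N \<times> N\<close> matrices, in the upper left corner: \<open>Cor\<close> holds
  the \<open>a \<times> b\<close> blocks filled up by 0, \<open>Fit\<close> the even \<open>k \<times> k\<close> blocks filled up by 1 on the diagonal.\<close>

definition Cor :: "bool \<Rightarrow> nat \<Rightarrow> nat \<Rightarrow> 'a matrix set" where
  "Cor p a b = {M. (\<forall>i j. M i j \<in> G p) \<and> (\<forall>i j. \<not> (i < a \<and> j < b \<and> i < N \<and> j < N) \<longrightarrow> M i j = \<zero>)}"

definition Fit :: "nat \<Rightarrow> 'a matrix set" where
  "Fit k = {\<one>\<^bsub>MM\<^esub> \<oplus>\<^bsub>MM\<^esub> c | c. c \<in> Cor False k k}"

lemma Cor_carrier: "x \<in> Cor p a b \<Longrightarrow> x \<in> carrier MM"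
  by (auto simp: Cor_def MM_simps intro: G_carrier)

lemma Cor_entry: "x \<in> Cor p a b \<Longrightarrow> x i j \<in> G p"
  by (auto simp: Cor_def)

lemma Cor_zero: "x \<in> Cor p a b \<Longrightarrow> \<not> (i < a \<and> j < b) \<Longrightarrow> x i j = \<zero>"
  by (auto simp: Cor_def)

lemma Cor_add: "x \<in> Cor p a b \<Longrightarrow> y \<in> Cor p a b \<Longrightarrow> x \<oplus>\<^bsub>MM\<^esub> y \<in> Cor p a b"
  by (auto simp: Cor_def MM_simps)

lemma Cor_minus: "x \<in> Cor p a b \<Longrightarrow> \<ominus>\<^bsub>MM\<^esub> x \<in> Cor p a b"
  by (subst matring_minus) (auto simp: Cor_carrier, auto simp: Cor_def)

text \<open>The inner sizes b and b' may differ, since beyond the smaller one a factor of each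
  summand is a padding zero. Parities add.\<close>

lemma Cor_mult: "x \<in> Cor p a b \<Longrightarrow> y \<in> Cor q b' c \<Longrightarrow> r = (p \<noteq> q) \<Longrightarrow> x \<otimes>\<^bsub>MM\<^esub> y \<in> Cor r a c"
proof -
  assume x: "x \<in> Cor p a b" and y: "y \<in> Cor q b' c" and r: "r = (p \<noteq> q)"
  have [simp]: "x i k \<in> carrier A" "y i k \<in> carrier A" for i k
    using x y G_carrier[of _ p] G_carrier[of _ q] by (auto simp: Cor_def)
  have "x i k \<otimes> y k j \<in> G r" for i j k
    unfolding r using x y by (intro G_mult) (auto simp: Cor_def)
  moreover have "x i k \<otimes> y k j = \<zero>" if "\<not> (i < a \<and> j < c \<and> i < N \<and> j < N)" for i j k
    using x y that unfolding Cor_def mem_Collect_eq by (cases "i < a \<and> i < N") auto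
  ultimately show ?thesis
    unfolding Cor_def MM_simps mmul_def by (auto intro!: G_finsum add.finprod_one_eqI)
qed

lemma Fit_carrier: "x \<in> Fit k \<Longrightarrow> x \<in> carrier MM"
  by (auto simp: Fit_def Cor_carrier)

lemma Fit_one: "\<one>\<^bsub>MM\<^esub> \<in> Fit k"
  unfolding Fit_def by (rule CollectI, rule exI[of _ "\<zero>\<^bsub>MM\<^esub>"]) (auto simp: Cor_def MM_simps)

lemma Fit_add_Cor: "x \<in> Fit k \<Longrightarrow> c \<in> Cor False k k \<Longrightarrow> x \<oplus>\<^bsub>MM\<^esub> c \<in> Fit k"
proof -
  assume "x \<in> Fit k" and c: "c \<in> Cor False k k"
  then obtain d where d: "d \<in> Cor False k k" "x = \<one>\<^bsub>MM\<^esub> \<oplus>\<^bsub>MM\<^esub> d"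
    by (auto simp: Fit_def)
  then have "x \<oplus>\<^bsub>MM\<^esub> c = \<one>\<^bsub>MM\<^esub> \<oplus>\<^bsub>MM\<^esub> (d \<oplus>\<^bsub>MM\<^esub> c)"
    using c by (simp add: M.a_assoc Cor_carrier)
  then show ?thesis
    using Cor_add[OF d(1) c] by (auto simp: Fit_def)
qed

lemma Fit_mult: "x \<in> Fit k \<Longrightarrow> y \<in> Fit k \<Longrightarrow> x \<otimes>\<^bsub>MM\<^esub> y \<in> Fit k"
proof -
  assume "x \<in> Fit k" "y \<in> Fit k"
  then obtain c d where cd: "c \<in> Cor False k k" "d \<in> Cor False k k"
    "x = \<one>\<^bsub>MM\<^esub> \<oplus>\<^bsub>MM\<^esub> c" "y = \<one>\<^bsub>MM\<^esub> \<oplus>\<^bsub>MM\<^esub> d"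
    by (auto simp: Fit_def)
  then have "x \<otimes>\<^bsub>MM\<^esub> y = \<one>\<^bsub>MM\<^esub> \<oplus>\<^bsub>MM\<^esub> (c \<oplus>\<^bsub>MM\<^esub> d \<oplus>\<^bsub>MM\<^esub> c \<otimes>\<^bsub>MM\<^esub> d)"
    by (simp add: Cor_carrier M.l_distr M.r_distr M.a_ac)
  moreover have "c \<oplus>\<^bsub>MM\<^esub> d \<oplus>\<^bsub>MM\<^esub> c \<otimes>\<^bsub>MM\<^esub> d \<in> Cor False k k"
    using cd by (intro Cor_add Cor_mult) auto
  ultimately show ?thesis by (auto simp: Fit_def)
qed

lemma Fit_Cor: "x \<in> Fit a \<Longrightarrow> y \<in> Cor p a b \<Longrightarrow> x \<otimes>\<^bsub>MM\<^esub> y \<in> Cor p a b"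
proof -
  assume "x \<in> Fit a" and y: "y \<in> Cor p a b"
  then obtain c where c: "c \<in> Cor False a a" "x = \<one>\<^bsub>MM\<^esub> \<oplus>\<^bsub>MM\<^esub> c"
    by (auto simp: Fit_def)
  then have "x \<otimes>\<^bsub>MM\<^esub> y = y \<oplus>\<^bsub>MM\<^esub> c \<otimes>\<^bsub>MM\<^esub> y"
    using y by (simp add: M.l_distr Cor_carrier)
  then show ?thesis
    using Cor_add[OF y Cor_mult[OF c(1) y]] by simp
qed

lemma Cor_Fit: "x \<in> Cor p a b \<Longrightarrow> y \<in> Fit b \<Longrightarrow> x \<otimes>\<^bsub>MM\<^esub> y \<in> Cor p a b"
proof -
  assume x: "x \<in> Cor p a b" and "y \<in> Fit b"
  then obtain c where c: "c \<in> Cor False b b" "y = \<one>\<^bsub>MM\<^esub> \<oplus>\<^bsub>MM\<^esub> c"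
    by (auto simp: Fit_def)
  then have "x \<otimes>\<^bsub>MM\<^esub> y = x \<oplus>\<^bsub>MM\<^esub> x \<otimes>\<^bsub>MM\<^esub> c"
    using x by (simp add: M.r_distr Cor_carrier)
  then show ?thesis
    using Cor_add[OF x Cor_mult[OF x c(1)]] by simp
qed

lemma Fit_entry: "x \<in> Fit k \<Longrightarrow> x i j \<in> G False"
  by (auto simp: Fit_def MM_simps Cor_def)

lemma Fit_outside: "x \<in> Fit k \<Longrightarrow> \<not> (i < k \<and> j < k) \<Longrightarrow> x i j = \<one>\<^bsub>MM\<^esub> i j"
  by (auto simp: Fit_def MM_simps Cor_def)

lemma FitI:
  assumes "\<And>i j. x i j \<in> G False" "\<And>i j. \<not> (i < k \<and> j < k) \<Longrightarrow> x i j = \<one>\<^bsub>MM\<^esub> i j" "k \<le> N"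
  shows "x \<in> Fit k"
proof -
  have x: "x \<in> carrier MM"
    using assms by (auto simp: MM_simps intro: G_carrier)
  have "x \<oplus>\<^bsub>MM\<^esub> \<ominus>\<^bsub>MM\<^esub> \<one>\<^bsub>MM\<^esub> \<in> Cor False k k"
    unfolding matring_minus[OF M.one_closed] using assms
    by (auto simp: Cor_def MM_simps r_neg)
  moreover have "x = \<one>\<^bsub>MM\<^esub> \<oplus>\<^bsub>MM\<^esub> (x \<oplus>\<^bsub>MM\<^esub> \<ominus>\<^bsub>MM\<^esub> \<one>\<^bsub>MM\<^esub>)"
    using x by (metis M.add.m_lcomm M.r_neg M.r_zero M.one_closed M.a_inv_closed)
  ultimately show ?thesis by (auto simp: Fit_def)
qed

lemma Fit_eqI:
  assumes "x \<in> Fit k" "y \<in> Fit k" "\<And>i j. i < k \<Longrightarrow> j < k \<Longrightarrow> x i j = y i j"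
  shows "x = y"
  using assms(3) Fit_outside[OF assms(1)] Fit_outside[OF assms(2)] by (intro ext) metis

lemma Fit_sum_Cor:
  "x \<in> Fit k \<Longrightarrow> q \<in> Cor True k l \<Longrightarrow> r \<in> Cor True l' k \<Longrightarrow> x \<oplus>\<^bsub>MM\<^esub> q \<otimes>\<^bsub>MM\<^esub> r \<in> Fit k"
  by (intro Fit_add_Cor Cor_mult) auto

lemma mmul_restrict:
  assumes "k \<le> n" "\<And>l. k \<le> l \<Longrightarrow> l < n \<Longrightarrow> x i l \<otimes> y l j = \<zero>"
    "\<And>l. l < k \<Longrightarrow> x i l = x' i l" "\<And>l. l < k \<Longrightarrow> y l j = y' l j"
    "\<And>l. l < k \<Longrightarrow> x' i l \<in> carrier A" "\<And>l. l < k \<Longrightarrow> y' l j \<in> carrier A"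
  shows "mmul A n x y i j = mmul A k x' y' i j"
  unfolding mmul_def using assms by (intro finsum_mono_neutral) auto

abbreviation D :: "nat \<Rightarrow> 'a matrix \<Rightarrow> 'a" where "D k x \<equiv> mdet A k x"

lemma D_even: "x \<in> Fit k \<Longrightarrow> D k x \<in> G False"
  using E.mdet_closed[of k x] evens_mdet[of k x] by (simp add: Fit_entry)

lemma D_one: "k \<le> N \<Longrightarrow> D k \<one>\<^bsub>MM\<^esub> = \<one>"
proof -
  assume k: "k \<le> N"
  have "D k \<one>\<^bsub>MM\<^esub> = mdet A k (\<lambda>i j. if i = j then \<one> else \<zero>)"
    using k by (intro mdet_cong) (auto simp: MM_simps)
  also have "\<dots> = mdet evens k (\<lambda>i j. if i = j then \<one>\<^bsub>evens\<^esub> else \<zero>\<^bsub>evens\<^esub>)"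
    unfolding evens_simps by (subst evens_mdet) auto
  finally show ?thesis
    by (subst (asm) mdet_id[OF evens_cring]) simp
qed

text \<open>Row i < k of x is zero beyond column k, so the corner of the product is the product of
  the corners. These have even entries, and multiplicativity is taken from the commutative ring
  \<open>evens\<close>.\<close>

lemma D_mult:
  assumes x: "x \<in> Fit k" and y: "y \<in> Fit k" and k: "k \<le> N"
  shows "D k (x \<otimes>\<^bsub>MM\<^esub> y) = D k x \<otimes> D k y"
proof -
  have "D k (x \<otimes>\<^bsub>MM\<^esub> y) = D k (mmul A k x y)"
  proof (rule mdet_cong)
    fix i j assume ij: "i < k" "j < k"
    show "(x \<otimes>\<^bsub>MM\<^esub> y) i j \<in> carrier A"
      using Fit_entry[OF Fit_mult[OF x y]] by simp
    show "(x \<otimes>\<^bsub>MM\<^esub> y) i j = mmul A k x y i j"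
      unfolding MM_simps(5) using k ij x y
      by (intro mmul_restrict) (auto simp: Fit_outside Fit_entry MM_simps(2))
  qed
  also have "\<dots> = mdet evens k (mmul evens k x y)"
  proof -
    have "mmul A k x y i j \<in> G False \<and> mmul evens k x y i j = mmul A k x y i j" for i j
      unfolding mmul_def using x y by (auto intro!: G_finsum evens_finsum simp: Fit_entry)
    then show ?thesis by (subst evens_mdet) (auto intro!: mdet_cong)
  qed
  also have "\<dots> = D k x \<otimes> D k y"
    using mdet_mmul[OF evens_cring, of k x y] x y by (simp add: Fit_entry evens_mdet)
  finally show ?thesis .
qed

text \<open>The adjugate inverse of the k by k corner, padded by the identity so that it is an
  inverse in the whole ring \<open>MM\<close>.\<close>

definition padinv :: "nat \<Rightarrow> 'a matrix \<Rightarrow> 'a \<Rightarrow> 'a matrix" where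
  "padinv k x u = (\<lambda>i j. if i < k \<and> j < k then adj_inv A k x u i j else \<one>\<^bsub>MM\<^esub> i j)"

lemma padinv:
  assumes x: "x \<in> Fit k" and u: "u \<in> G False" "D k x \<otimes> u = \<one>" and k: "k \<le> N"
  shows "padinv k x u \<in> Fit k" "x \<otimes>\<^bsub>MM\<^esub> padinv k x u = \<one>\<^bsub>MM\<^esub>" "padinv k x u \<otimes>\<^bsub>MM\<^esub> x = \<one>\<^bsub>MM\<^esub>"
proof -
  note adj = evens_adj_inv[of k x u, OF Fit_entry[OF x] u(1)]
  have "mdet evens k x \<otimes>\<^bsub>evens\<^esub> u = \<one>\<^bsub>evens\<^esub>"
    using x u by (simp add: evens_mdet Fit_entry)
  note inv = mmul_adj_inv[OF evens_cring _ _ this, simplified, OF Fit_entry[OF x] u(1)]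
  show *: "padinv k x u \<in> Fit k"
    using adj k by (intro FitI) (auto simp: padinv_def MM_simps)
  show "x \<otimes>\<^bsub>MM\<^esub> padinv k x u = \<one>\<^bsub>MM\<^esub>"
  proof (rule Fit_eqI[OF Fit_mult[OF x *] Fit_one])
    fix i j assume ij: "i < k" "j < k"
    have "(x \<otimes>\<^bsub>MM\<^esub> padinv k x u) i j = mmul A k x (adj_inv A k x u) i j"
      unfolding MM_simps(5) using k ij x adj
      by (intro mmul_restrict) (auto simp: Fit_outside Fit_entry MM_simps(2) padinv_def)
    also have "\<dots> = mmul evens k x (adj_inv evens k x u) i j"
      unfolding mmul_def using x adj ij by (subst evens_finsum[symmetric]) (auto intro!: E.finsum_cong' simp: Fit_entry)
    finally show "(x \<otimes>\<^bsub>MM\<^esub> padinv k x u) i j = \<one>\<^bsub>MM\<^esub> i j"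
      using inv(1)[OF ij] ij k by (simp add: MM_simps)
  qed
  show "padinv k x u \<otimes>\<^bsub>MM\<^esub> x = \<one>\<^bsub>MM\<^esub>"
  proof (rule Fit_eqI[OF Fit_mult[OF * x] Fit_one])
    fix i j assume ij: "i < k" "j < k"
    have "(padinv k x u \<otimes>\<^bsub>MM\<^esub> x) i j = mmul A k (adj_inv A k x u) x i j"
      unfolding MM_simps(5) using k ij x adj
      by (intro mmul_restrict) (auto simp: Fit_outside Fit_entry MM_simps(2) padinv_def)
    also have "\<dots> = mmul evens k (adj_inv evens k x u) x i j"
      unfolding mmul_def using x adj ij by (subst evens_finsum[symmetric]) (auto intro!: E.finsum_cong' simp: Fit_entry)
    finally show "(padinv k x u \<otimes>\<^bsub>MM\<^esub> x) i j = \<one>\<^bsub>MM\<^esub> i j"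
      using inv(2)[OF ij] ij k by (simp add: MM_simps)
  qed
qed

section \<open>Units and the Jacobson radical of the even part\<close>

definition eunit :: "'a \<Rightarrow> bool" where
  "eunit u \<longleftrightarrow> u \<in> G False \<and> (\<exists>v\<in>G False. u \<otimes> v = \<one>)"

lemma eunitI: "u \<in> G False \<Longrightarrow> v \<in> G False \<Longrightarrow> u \<otimes> v = \<one> \<Longrightarrow> eunit u"
  by (auto simp: eunit_def)

lemma eunit_mult:
  assumes "eunit u" "eunit w"
  shows "eunit (u \<otimes> w)"
proof -
  obtain v z where vz: "v \<in> G False" "u \<otimes> v = \<one>" "z \<in> G False" "w \<otimes> z = \<one>" "u \<in> G False" "w \<in> G False"
    using assms by (auto simp: eunit_def)
  have "(u \<otimes> w) \<otimes> (v \<otimes> z) = (u \<otimes> v) \<otimes> (w \<otimes> z)"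
    using vz E.m_ac by simp
  then show ?thesis
    using vz by (intro eunitI[of _ "v \<otimes> z"]) auto
qed

lemma eunit_Fit:
  assumes "x \<in> Fit k" "k \<le> N" "eunit (D k x)"
  obtains y where "y \<in> Fit k" "x \<otimes>\<^bsub>MM\<^esub> y = \<one>\<^bsub>MM\<^esub>" "y \<otimes>\<^bsub>MM\<^esub> x = \<one>\<^bsub>MM\<^esub>" "D k x \<otimes> D k y = \<one>"
proof -
  obtain u where "u \<in> G False" "D k x \<otimes> u = \<one>"
    using assms by (auto simp: eunit_def)
  note p = padinv[OF assms(1) this assms(2)]
  show ?thesis
    using p D_mult[OF assms(1) p(1) assms(2)] by (intro that[of "padinv k x u"]) (auto simp: D_one assms(2))
qed

lemma Fit_eunit:
  assumes "x \<in> Fit k" "k \<le> N" "y \<in> Fit k" "x \<otimes>\<^bsub>MM\<^esub> y = \<one>\<^bsub>MM\<^esub>"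
  shows "D k x \<otimes> D k y = \<one>" "eunit (D k x)"
  using D_mult[OF assms(1,3,2)] assms by (auto simp: D_one D_even intro: eunitI[of _ "D k y"])

text \<open>The Jacobson radical of the even part. It contains the products of odd elements, as these have
  square zero.\<close>

definition rad :: "'a set" where
  "rad = {x \<in> G False. \<forall>r\<in>G False. eunit (\<one> \<oplus> r \<otimes> x)}"

lemma rad_ideal: "ideal rad evens"
proof (rule idealI)
  show "ring evens" ..
  have mult: "r \<otimes> x \<in> rad" if "x \<in> rad" "r \<in> G False" for x r
    using that by (auto simp: rad_def simp flip: m_assoc)
  have add: "x \<oplus> y \<in> rad" if x: "x \<in> rad" and y: "y \<in> rad" for x y
  proof -
    have "eunit (\<one> \<oplus> r \<otimes> (x \<oplus> y))" if r: "r \<in> G False" for r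
    proof -
      have "eunit (\<one> \<oplus> r \<otimes> x)" using x r by (auto simp: rad_def)
      \<comment> \<open>With v the inverse of 1 + r x, the element 1 + r (x + y) factors as (1 + r
        x) (1 + v r y), and both factors are units.\<close>
      then obtain v where v: "v \<in> G False" "(\<one> \<oplus> r \<otimes> x) \<otimes> v = \<one>"
        by (auto simp: eunit_def)
      have c: "r \<in> carrier A" "x \<in> carrier A" "y \<in> carrier A" "v \<in> carrier A"
        using r x y v by (auto simp: rad_def)
      have "(\<one> \<oplus> r \<otimes> x) \<otimes> (\<one> \<oplus> (v \<otimes> r) \<otimes> y) = (\<one> \<oplus> r \<otimes> x) \<oplus> ((\<one> \<oplus> r \<otimes> x) \<otimes> v) \<otimes> (r \<otimes> y)"
        using c by (simp add: r_distr m_assoc)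
      also have "\<dots> = \<one> \<oplus> r \<otimes> (x \<oplus> y)"
        unfolding v(2) using c by (simp add: r_distr a_assoc)
      finally have eq: "(\<one> \<oplus> r \<otimes> x) \<otimes> (\<one> \<oplus> (v \<otimes> r) \<otimes> y) = \<one> \<oplus> r \<otimes> (x \<oplus> y)" .
      have "eunit (\<one> \<oplus> (v \<otimes> r) \<otimes> y)" using y r v by (auto simp: rad_def)
      with \<open>eunit (\<one> \<oplus> r \<otimes> x)\<close> show ?thesis
        unfolding eq[symmetric] by (rule eunit_mult)
    qed
    then show ?thesis using x y by (auto simp: rad_def)
  qed
  show "subgroup rad (add_monoid evens)"
  proof (rule E.add.subgroupI)
    show "rad \<subseteq> carrier evens" by (auto simp: rad_def)
    have "\<zero> \<in> rad" by (auto simp: rad_def intro!: eunitI[of _ \<one>])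
    then show "rad \<noteq> {}" by auto
    show "\<ominus>\<^bsub>evens\<^esub> x \<in> rad" if "x \<in> rad" for x
      using mult[OF that, of "\<ominus> \<one>"] that by (auto simp: rad_def l_minus)
    show "x \<oplus>\<^bsub>evens\<^esub> y \<in> rad" if "x \<in> rad" "y \<in> rad" for x y
      using add[OF that] by simp
  qed
  show "a \<in> rad \<Longrightarrow> x \<in> carrier evens \<Longrightarrow> x \<otimes>\<^bsub>evens\<^esub> a \<in> rad" for a x
    by (simp add: mult)
  show "a \<in> rad \<Longrightarrow> x \<in> carrier evens \<Longrightarrow> a \<otimes>\<^bsub>evens\<^esub> x \<in> rad" for a x
    using mult[of a x] even_commute[of a x False] by (simp add: rad_def)
qed

lemma odd_anticommute: "x \<in> G True \<Longrightarrow> y \<in> G True \<Longrightarrow> x \<otimes> y = \<ominus> (y \<otimes> x)"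
  using G_commute[of x True y True] by (simp add: neg_if_def)

lemma odd_mult [simp]: "x \<in> G True \<Longrightarrow> y \<in> G True \<Longrightarrow> x \<otimes> y \<in> G False"
  using G_mult[of x True y True] by simp

lemma odd_product_square:
  assumes "x \<in> G True" "y \<in> G True"
  shows "(x \<otimes> y) \<otimes> (x \<otimes> y) = \<zero>"
proof -
  have "(x \<otimes> y) \<otimes> (x \<otimes> y) = x \<otimes> (y \<otimes> x) \<otimes> y"
    using assms by (simp add: m_assoc)
  also have "\<dots> = \<ominus> ((x \<otimes> x) \<otimes> (y \<otimes> y))"
    using assms by (simp add: odd_anticommute[of y x] l_minus r_minus m_assoc)
  finally show ?thesis using assms by (simp add: G_square)
qed

text \<open>For z = r x y with r even, z squares to zero because x y does, so 1 - z is an inverse of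
  1 + z.\<close>

lemma odd_product_rad:
  assumes "x \<in> G True" "y \<in> G True"
  shows "x \<otimes> y \<in> rad"
proof -
  have "eunit (\<one> \<oplus> r \<otimes> (x \<otimes> y))" if r: "r \<in> G False" for r
  proof (rule eunitI)
    define z where "z = r \<otimes> (x \<otimes> y)"
    have z: "z \<in> G False" using r assms by (simp add: z_def)
    have "w \<in> G False \<Longrightarrow> (r \<otimes> w) \<otimes> (r \<otimes> w) = (r \<otimes> r) \<otimes> (w \<otimes> w)" for w
      using r E.m_lcomm[simplified] by (simp add: m_assoc)
    then have "z \<otimes> z = (r \<otimes> r) \<otimes> ((x \<otimes> y) \<otimes> (x \<otimes> y))"
      unfolding z_def using assms by simp
    then have "z \<otimes> z = \<zero>" using r assms by (simp add: odd_product_square)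
    then have "(\<one> \<oplus> z) \<otimes> (\<one> \<ominus> z) = \<one>"
      using z by (simp add: l_distr r_distr minus_eq r_minus a_assoc r_neg)
        
    then show "(\<one> \<oplus> r \<otimes> (x \<otimes> y)) \<otimes> (\<one> \<ominus> z) = \<one>" by (simp add: z_def)
    show "\<one> \<ominus> z \<in> G False" using z by (auto simp: minus_eq)
  qed (use r assms in auto)
  then show ?thesis using assms by (auto simp: rad_def)
qed

lemma Cor_mult_rad:
  assumes "q \<in> Cor True a b" "r \<in> Cor True c d"
  shows "(q \<otimes>\<^bsub>MM\<^esub> r) i j \<in> rad"
proof -
  interpret ideal rad evens by (rule rad_ideal)
  have "(\<Oplus>\<^bsub>evens\<^esub>k\<in>K. q i k \<otimes> r k j) \<in> rad" if "finite K" for K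
    using that
  proof induction
    case (insert k K)
    then show ?case
      using assms additive_subgroup.a_closed[OF additive_subgroup_axioms] odd_product_rad
      by (subst E.finsum_insert) (auto simp: Cor_entry)
  qed (use additive_subgroup.zero_closed[OF additive_subgroup_axioms] in auto)
  then show ?thesis
    using assms by (simp add: MM_simps mmul_def evens_finsum Cor_entry)
qed

text \<open>The entries of q r lie in the radical, so the two determinants agree modulo
  \<open>rad\<close>. If d is a unit with inverse v and z lies in the radical, then d + z = d (1 + v
  z) is a unit.\<close>

lemma D_unit_perturb:
  assumes x: "x \<in> Fit k" and k: "k \<le> N" and u: "eunit (D k x)"
    and q: "q \<in> Cor True k l" "r \<in> Cor True l' k"
  shows "eunit (D k (x \<oplus>\<^bsub>MM\<^esub> q \<otimes>\<^bsub>MM\<^esub> r))"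
proof -
  interpret I: ideal rad evens by (rule rad_ideal)
  let ?y = "x \<oplus>\<^bsub>MM\<^esub> q \<otimes>\<^bsub>MM\<^esub> r"
  have y: "?y \<in> Fit k" using Fit_sum_Cor[OF x q] .
  have xy: "D k x \<in> G False" "D k ?y \<in> G False" using x y D_even by auto
  have "rad +>\<^bsub>evens\<^esub> (x i j) = rad +>\<^bsub>evens\<^esub> (?y i j)" for i j
  proof (rule I.a_repr_independence')
    show "?y i j \<in> rad +>\<^bsub>evens\<^esub> x i j"
      using Cor_mult_rad[OF q, of i j] x
      by (auto simp: MM_simps(4) a_r_coset_def r_coset_def Fit_entry rad_def E.a_comm[simplified] intro!: bexI[of _ "(q \<otimes>\<^bsub>MM\<^esub> r) i j"])
  qed (use x in \<open>auto simp: Fit_entry\<close>)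
  then have "rad +>\<^bsub>evens\<^esub> mdet evens k x = rad +>\<^bsub>evens\<^esub> mdet evens k ?y"
    using x y by (simp add: mdet_hom[OF E.ring_axioms I.quotient_is_ring I.rcos_ring_hom] Fit_entry)
  then have "rad +>\<^bsub>evens\<^esub> D k x = rad +>\<^bsub>evens\<^esub> D k ?y"
    using x y by (simp add: evens_mdet Fit_entry)
  then have "D k ?y \<in> rad +>\<^bsub>evens\<^esub> D k x"
    using xy by (simp add: I.a_repr_independenceD)
  then obtain z where z: "z \<in> rad" "D k ?y = z \<oplus> D k x"
    by (auto simp: a_r_coset_def r_coset_def)
  obtain v where v: "v \<in> G False" "D k x \<otimes> v = \<one>"
    using u by (auto simp: eunit_def)
  have zG: "z \<in> G False" using z by (simp add: rad_def)
  have "D k x \<otimes> (\<one> \<oplus> v \<otimes> z) = D k x \<oplus> (D k x \<otimes> v) \<otimes> z"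
    using xy v(1) zG by (simp add: r_distr m_assoc)
  also have "\<dots> = D k ?y"
    unfolding v z(2) using xy zG by (simp add: a_comm)
  finally have "D k ?y = D k x \<otimes> (\<one> \<oplus> v \<otimes> z)" ..
  then show ?thesis
    using u v z by (auto simp: rad_def intro: eunit_mult)
qed

section \<open>The determinant identity for odd matrices\<close>

definition el :: "nat \<Rightarrow> nat \<Rightarrow> 'a \<Rightarrow> 'a matrix" where
  "el a b x = (\<lambda>i j. if i = a \<and> j = b then x else \<zero>)"

lemma el_Cor: "x \<in> G p \<Longrightarrow> a < m \<Longrightarrow> b < n \<Longrightarrow> m \<le> N \<Longrightarrow> n \<le> N \<Longrightarrow> el a b x \<in> Cor p m n"
  by (auto simp: el_def Cor_def)

text \<open>The two matrices differ from the identity in row a and in column b. With y = r b a their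
  determinants are 1 + x y and 1 + y x = 1 - x y, and x y squares to zero.\<close>

lemma det_odd_el:
  assumes x: "x \<in> G True" and ab: "a < m" "b < n" "m \<le> N" "n \<le> N" and r: "r \<in> Cor True n m"
  shows "D m (\<one>\<^bsub>MM\<^esub> \<oplus>\<^bsub>MM\<^esub> el a b x \<otimes>\<^bsub>MM\<^esub> r) \<otimes> D n (\<one>\<^bsub>MM\<^esub> \<oplus>\<^bsub>MM\<^esub> r \<otimes>\<^bsub>MM\<^esub> el a b x) = \<one>"
proof -
  let ?e = "el a b x"
  let ?L = "\<one>\<^bsub>MM\<^esub> \<oplus>\<^bsub>MM\<^esub> ?e \<otimes>\<^bsub>MM\<^esub> r" and ?R = "\<one>\<^bsub>MM\<^esub> \<oplus>\<^bsub>MM\<^esub> r \<otimes>\<^bsub>MM\<^esub> ?e"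
  have e: "?e \<in> Cor True m n" by (rule el_Cor[OF x ab])
  have L: "?L \<in> Fit m" by (rule Fit_sum_Cor[OF Fit_one e r])
  have R: "?R \<in> Fit n" by (rule Fit_sum_Cor[OF Fit_one r e])
  have er: "(?e \<otimes>\<^bsub>MM\<^esub> r) i j = (if i = a then x \<otimes> r b j else \<zero>)" for i j
  proof -
    have "(\<Oplus>k\<in>{..<N}. ?e i k \<otimes> r k j) = ?e i b \<otimes> r b j"
      using ab x Cor_entry[OF r] by (intro finsum_single) (auto simp: el_def)
    then show ?thesis
      using x Cor_entry[OF r] by (auto simp: MM_simps mmul_def el_def)
  qed
  have re: "(r \<otimes>\<^bsub>MM\<^esub> ?e) i j = (if j = b then r i a \<otimes> x else \<zero>)" for i j
  proof -
    have "(\<Oplus>k\<in>{..<N}. r i k \<otimes> ?e k j) = r i a \<otimes> ?e a j"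
      using ab x Cor_entry[OF r] by (intro finsum_single) (auto simp: el_def)
    then show ?thesis
      using x Cor_entry[OF r] by (auto simp: MM_simps mmul_def el_def)
  qed
  have rG: "r b a \<in> G True" by (rule Cor_entry[OF r])
  have "mdet evens m ?L = ?L a a"
  proof (rule mdet_one_row[OF evens_cring])
    show "?L a j \<in> carrier evens" for j
      using Fit_entry[OF L] by simp
  qed (use ab in \<open>auto simp: MM_simps(2,4) er\<close>)
  then have dL: "D m ?L = \<one> \<oplus> x \<otimes> r b a"
    using ab by (simp add: evens_mdet Fit_entry[OF L]) (simp add: MM_simps(2,4) er)
  have "mdet evens n ?R = ?R b b"
  proof (rule mdet_one_col[OF evens_cring])
    show "?R j b \<in> carrier evens" for j
      using Fit_entry[OF R] by simp
  qed (use ab in \<open>auto simp: MM_simps(2,4) re\<close>)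
  then have dR: "D n ?R = \<one> \<oplus> r b a \<otimes> x"
    using ab by (simp add: evens_mdet Fit_entry[OF R]) (simp add: MM_simps(2,4) re)
  have "r b a \<otimes> x = \<ominus> (x \<otimes> r b a)"
    by (rule odd_anticommute[OF rG x])
  then show ?thesis
    unfolding dL dR using x rG
    by (simp add: l_distr r_distr r_minus a_assoc odd_product_square r_neg)
qed

text \<open>Put X = 1 + q r and Y = 1 + r q. For r' = r X' with X' the inverse of X, one has 1 + (q
  + e) r = (1 + e r') X and 1 + r (q + e) = Y (1 + r' e). So the new entry e is compared with r'
  alone, where the case of a single entry applies.\<close>

lemma det_odd_step:
  assumes q: "q \<in> Cor True m n" and r: "r \<in> Cor True n m" and mn: "m \<le> N" "n \<le> N"
    and x: "x \<in> G True" and ab: "a < m" "b < n"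
    and IH: "D m (\<one>\<^bsub>MM\<^esub> \<oplus>\<^bsub>MM\<^esub> q \<otimes>\<^bsub>MM\<^esub> r) \<otimes> D n (\<one>\<^bsub>MM\<^esub> \<oplus>\<^bsub>MM\<^esub> r \<otimes>\<^bsub>MM\<^esub> q) = \<one>"
  shows "D m (\<one>\<^bsub>MM\<^esub> \<oplus>\<^bsub>MM\<^esub> (q \<oplus>\<^bsub>MM\<^esub> el a b x) \<otimes>\<^bsub>MM\<^esub> r) \<otimes>
    D n (\<one>\<^bsub>MM\<^esub> \<oplus>\<^bsub>MM\<^esub> r \<otimes>\<^bsub>MM\<^esub> (q \<oplus>\<^bsub>MM\<^esub> el a b x)) = \<one>"
proof -
  let ?e = "el a b x"
  let ?X = "\<one>\<^bsub>MM\<^esub> \<oplus>\<^bsub>MM\<^esub> q \<otimes>\<^bsub>MM\<^esub> r" and ?Y = "\<one>\<^bsub>MM\<^esub> \<oplus>\<^bsub>MM\<^esub> r \<otimes>\<^bsub>MM\<^esub> q"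
  have e: "?e \<in> Cor True m n" by (rule el_Cor[OF x ab mn])
  have one: "eunit (D k \<one>\<^bsub>MM\<^esub>)" if "k \<le> N" for k
    using that by (auto simp: D_one intro: eunitI[of _ \<one>])
  have X: "?X \<in> Fit m" by (rule Fit_sum_Cor[OF Fit_one q r])
  have Y: "?Y \<in> Fit n" by (rule Fit_sum_Cor[OF Fit_one r q])
  \<comment> \<open>The identity has determinant 1, and X and Y arise from it by adding products of
    odd matrices; so they are invertible before anything is known about the product of their
    determinants.\<close>
  obtain X' where X': "X' \<in> Fit m" "?X \<otimes>\<^bsub>MM\<^esub> X' = \<one>\<^bsub>MM\<^esub>" "X' \<otimes>\<^bsub>MM\<^esub> ?X = \<one>\<^bsub>MM\<^esub>"
    using eunit_Fit[OF X mn(1) D_unit_perturb[OF Fit_one mn(1) one[OF mn(1)] q r]] by metis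
  obtain Y' where Y': "Y' \<in> Fit n" "?Y \<otimes>\<^bsub>MM\<^esub> Y' = \<one>\<^bsub>MM\<^esub>" "Y' \<otimes>\<^bsub>MM\<^esub> ?Y = \<one>\<^bsub>MM\<^esub>"
    using eunit_Fit[OF Y mn(2) D_unit_perturb[OF Fit_one mn(2) one[OF mn(2)] r q]] by metis
  note c = Cor_carrier[OF q] Cor_carrier[OF r] Cor_carrier[OF e] Fit_carrier[OF X'(1)] Fit_carrier[OF Y'(1)]
    Fit_carrier[OF X] Fit_carrier[OF Y]
  define r' where "r' = r \<otimes>\<^bsub>MM\<^esub> X'"
  have r': "r' \<in> Cor True n m" unfolding r'_def by (rule Cor_Fit[OF r X'(1)])
  have r'X: "r' \<otimes>\<^bsub>MM\<^esub> ?X = r"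
    unfolding r'_def using c X' by (simp add: M.m_assoc)
  \<comment> \<open>Y r = r X moves the inverse of X to the other side of r, so that r' is at the
    same time Y inverse times r.\<close>
  have Yr': "?Y \<otimes>\<^bsub>MM\<^esub> r' = r"
  proof -
    have "?Y \<otimes>\<^bsub>MM\<^esub> r = r \<otimes>\<^bsub>MM\<^esub> ?X"
      using c by (simp add: M.l_distr M.r_distr M.m_assoc)
    then have "?Y \<otimes>\<^bsub>MM\<^esub> r' = r \<otimes>\<^bsub>MM\<^esub> (?X \<otimes>\<^bsub>MM\<^esub> X')"
      unfolding r'_def using c by (metis M.m_assoc)
    then show ?thesis using c X'(2) by simp
  qed
  let ?L = "\<one>\<^bsub>MM\<^esub> \<oplus>\<^bsub>MM\<^esub> ?e \<otimes>\<^bsub>MM\<^esub> r'" and ?R = "\<one>\<^bsub>MM\<^esub> \<oplus>\<^bsub>MM\<^esub> r' \<otimes>\<^bsub>MM\<^esub> ?e"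
  have L: "?L \<in> Fit m" by (rule Fit_sum_Cor[OF Fit_one e r'])
  have R: "?R \<in> Fit n" by (rule Fit_sum_Cor[OF Fit_one r' e])
  note c' = c Cor_carrier[OF r']
  have "?L \<otimes>\<^bsub>MM\<^esub> ?X = ?X \<oplus>\<^bsub>MM\<^esub> ?e \<otimes>\<^bsub>MM\<^esub> (r' \<otimes>\<^bsub>MM\<^esub> ?X)"
    using c' by (simp only: M.l_distr M.m_assoc M.l_one M.one_closed M.m_closed)
  also have "\<dots> = \<one>\<^bsub>MM\<^esub> \<oplus>\<^bsub>MM\<^esub> (q \<oplus>\<^bsub>MM\<^esub> ?e) \<otimes>\<^bsub>MM\<^esub> r"
    unfolding r'X using c by (simp add: M.l_distr M.a_assoc)
  finally have 1: "\<one>\<^bsub>MM\<^esub> \<oplus>\<^bsub>MM\<^esub> (q \<oplus>\<^bsub>MM\<^esub> ?e) \<otimes>\<^bsub>MM\<^esub> r = ?L \<otimes>\<^bsub>MM\<^esub> ?X" ..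
  have "?Y \<otimes>\<^bsub>MM\<^esub> ?R = ?Y \<oplus>\<^bsub>MM\<^esub> (?Y \<otimes>\<^bsub>MM\<^esub> r') \<otimes>\<^bsub>MM\<^esub> ?e"
    using c' by (simp only: M.r_distr M.m_assoc M.r_one M.one_closed M.m_closed)
  also have "\<dots> = \<one>\<^bsub>MM\<^esub> \<oplus>\<^bsub>MM\<^esub> r \<otimes>\<^bsub>MM\<^esub> (q \<oplus>\<^bsub>MM\<^esub> ?e)"
    unfolding Yr' using c by (simp add: M.r_distr M.a_assoc)
  finally have 2: "\<one>\<^bsub>MM\<^esub> \<oplus>\<^bsub>MM\<^esub> r \<otimes>\<^bsub>MM\<^esub> (q \<oplus>\<^bsub>MM\<^esub> ?e) = ?Y \<otimes>\<^bsub>MM\<^esub> ?R" ..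
  have "(D m ?L \<otimes> D m ?X) \<otimes> (D n ?Y \<otimes> D n ?R) = (D m ?L \<otimes> D n ?R) \<otimes> (D m ?X \<otimes> D n ?Y)"
    using D_even[OF L] D_even[OF X] D_even[OF Y] D_even[OF R] E.m_ac by simp
  also have "\<dots> = \<one>"
    using det_odd_el[OF x ab mn r'] IH by simp
  finally show ?thesis
    unfolding 1 2 D_mult[OF L X mn(1)] D_mult[OF Y R mn(2)] .
qed

text \<open>The sign against the even case \<open>det (1 + q r) = det (1 + r q)\<close> comes from a single entry
  \<open>x\<close> of \<open>q\<close>, where it reads \<open>(1 + x y) (1 + y x) = 1\<close> for odd \<open>x, y\<close>.\<close>

lemma det_odd:
  assumes q: "q \<in> Cor True m n" and r: "r \<in> Cor True n m" and mn: "m \<le> N" "n \<le> N"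
  shows "D m (\<one>\<^bsub>MM\<^esub> \<oplus>\<^bsub>MM\<^esub> q \<otimes>\<^bsub>MM\<^esub> r) \<otimes> D n (\<one>\<^bsub>MM\<^esub> \<oplus>\<^bsub>MM\<^esub> r \<otimes>\<^bsub>MM\<^esub> q) = \<one>"
proof -
  define part where "part S = (\<lambda>i j. if (i, j) \<in> S then q i j else \<zero>)" for S
  have part: "part S \<in> Cor True m n" for S
    using q by (auto simp: part_def Cor_def)
  have "D m (\<one>\<^bsub>MM\<^esub> \<oplus>\<^bsub>MM\<^esub> part S \<otimes>\<^bsub>MM\<^esub> r) \<otimes> D n (\<one>\<^bsub>MM\<^esub> \<oplus>\<^bsub>MM\<^esub> r \<otimes>\<^bsub>MM\<^esub> part S) = \<one>"
    if "finite S" "S \<subseteq> {..<m} \<times> {..<n}" for S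
    using that
  proof (induction S)
    case empty
    have "part {} = \<zero>\<^bsub>MM\<^esub>" by (simp add: part_def MM_simps)
    then show ?case using r mn by (simp add: Cor_carrier D_one)
  next
    case (insert z S)
    obtain a b where z: "z = (a, b)" by (cases z)
    have "part (insert z S) = part S \<oplus>\<^bsub>MM\<^esub> el a b (q a b)"
      using insert.hyps q unfolding z part_def MM_simps el_def
      by (auto simp: fun_eq_iff Cor_entry)
    then show ?case
      using insert q z by (simp add: det_odd_step[OF part r mn] Cor_entry)
  qed
  moreover have "part ({..<m} \<times> {..<n}) = q"
    using q by (auto simp: part_def fun_eq_iff Cor_zero)
  ultimately show ?thesis
    by (metis finite_lessThan finite_cartesian_product subset_refl)
qed

end

text \<open>The Woodbury formula for the inverse of a Schur complement b = p - q s' r, with c = s -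
  r p' q the other one. The identity b p' q = q s' c shows that the right side is a right inverse of
  b; the left inverse b' must then equal it.\<close>

lemma (in ring) woodbury:
  assumes carr [simp]: "p \<in> carrier R" "p' \<in> carrier R" "s \<in> carrier R" "s' \<in> carrier R" "q \<in> carrier R" "r \<in> carrier R"
      "b' \<in> carrier R" "c' \<in> carrier R"
    and inv: "p \<otimes> p' = \<one>" "p' \<otimes> p = \<one>" "s \<otimes> s' = \<one>" "s' \<otimes> s = \<one>"
    and b: "b' \<otimes> (p \<ominus> q \<otimes> (s' \<otimes> r)) = \<one>" and c: "(s \<ominus> r \<otimes> (p' \<otimes> q)) \<otimes> c' = \<one>"
  shows "b' = p' \<oplus> (p' \<otimes> q) \<otimes> (c' \<otimes> (r \<otimes> p'))"
proof -
  let ?b = "p \<ominus> q \<otimes> (s' \<otimes> r)" and ?c = "s \<ominus> r \<otimes> (p' \<otimes> q)"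
  have "?b \<otimes> (p' \<otimes> q) = (p \<otimes> p') \<otimes> q \<ominus> q \<otimes> (s' \<otimes> (r \<otimes> (p' \<otimes> q)))"
    using carr by (algebra; simp add: a_ac)
  also have "\<dots> = q \<otimes> (s' \<otimes> s) \<ominus> q \<otimes> (s' \<otimes> (r \<otimes> (p' \<otimes> q)))"
    by (simp add: inv)
  also have "\<dots> = (q \<otimes> s') \<otimes> ?c"
    using carr by (algebra; simp add: a_ac)
  finally have 1: "?b \<otimes> (p' \<otimes> q) = (q \<otimes> s') \<otimes> ?c" .
  have "?b \<otimes> (p' \<oplus> (p' \<otimes> q) \<otimes> (c' \<otimes> (r \<otimes> p'))) = ?b \<otimes> p' \<oplus> (?b \<otimes> (p' \<otimes> q)) \<otimes> (c' \<otimes> (r \<otimes> p'))"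
    using carr by (algebra; simp add: a_ac)
  also have "\<dots> = ?b \<otimes> p' \<oplus> (q \<otimes> s') \<otimes> ((?c \<otimes> c') \<otimes> (r \<otimes> p'))"
    unfolding 1 using carr by (algebra; simp add: a_ac)
  also have "\<dots> = p \<otimes> p'"
    unfolding c using carr by (algebra; simp add: a_ac)
  finally have "?b \<otimes> (p' \<oplus> (p' \<otimes> q) \<otimes> (c' \<otimes> (r \<otimes> p'))) = \<one>"
    by (simp add: inv)
  then have "b' \<otimes> (?b \<otimes> (p' \<oplus> (p' \<otimes> q) \<otimes> (c' \<otimes> (r \<otimes> p')))) = b'"
    by simp
  moreover have "b' \<otimes> (?b \<otimes> (p' \<oplus> (p' \<otimes> q) \<otimes> (c' \<otimes> (r \<otimes> p')))) = (b' \<otimes> ?b) \<otimes> (p' \<oplus> (p' \<otimes> q) \<otimes> (c' \<otimes> (r \<otimes> p')))"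
    by (simp add: m_assoc)
  ultimately show ?thesis
    unfolding b by simp
qed

text \<open>The Schur complement of a product of block matrices (p q; r s) and (p2 q2; r2 s2). The
  lower right block of the product is s (1 + x y) s2, with inverse s2' w s'. The Schur complement is
  the product of those of the factors, with 1 - y w x in between, and this middle factor inverts 1 +
  y x.\<close>

lemma (in ring) schur_product:
  assumes carr [simp]: "p \<in> carrier R" "q \<in> carrier R" "r \<in> carrier R" "s \<in> carrier R" "s' \<in> carrier R"
      "p2 \<in> carrier R" "q2 \<in> carrier R" "r2 \<in> carrier R" "s2 \<in> carrier R" "s2' \<in> carrier R" "w \<in> carrier R"
    and inv: "s' \<otimes> s = \<one>" "s2 \<otimes> s2' = \<one>"
    and xy: "x = s' \<otimes> r" "y = q2 \<otimes> s2'"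
    and w: "w \<otimes> (\<one> \<oplus> x \<otimes> y) = \<one>" "(\<one> \<oplus> x \<otimes> y) \<otimes> w = \<one>"
  shows "(p \<otimes> p2 \<oplus> q \<otimes> r2) \<ominus> (p \<otimes> q2 \<oplus> q \<otimes> s2) \<otimes> ((s2' \<otimes> (w \<otimes> s')) \<otimes> (r \<otimes> p2 \<oplus> s \<otimes> r2))
    = (p \<ominus> q \<otimes> x) \<otimes> ((\<one> \<ominus> y \<otimes> (w \<otimes> x)) \<otimes> (p2 \<ominus> y \<otimes> r2))"
    and "(\<one> \<oplus> y \<otimes> x) \<otimes> (\<one> \<ominus> y \<otimes> (w \<otimes> x)) = \<one>"
proof -
  \<comment> \<open>The upper right block of the product, multiplied by s2' from the right.\<close>
  define a where "a = p \<otimes> y \<oplus> q"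
  have carr2 [simp]: "x \<in> carrier R" "y \<in> carrier R" "a \<in> carrier R"
    by (simp_all add: xy a_def)
  have xyw: "x \<otimes> (y \<otimes> w) = \<one> \<ominus> w"
  proof -
    have "x \<otimes> (y \<otimes> w) = (\<one> \<oplus> x \<otimes> y) \<otimes> w \<ominus> w"
      using carr carr2 by (algebra; simp add: a_ac)
    then show ?thesis unfolding w .
  qed
  have wxy: "w \<otimes> (x \<otimes> y) = \<one> \<ominus> w"
  proof -
    have "w \<otimes> (x \<otimes> y) = (w \<oplus> w \<otimes> (x \<otimes> y)) \<ominus> w" using carr carr2 by (algebra; simp add: a_ac)
    also have "w \<oplus> w \<otimes> (x \<otimes> y) = w \<otimes> (\<one> \<oplus> x \<otimes> y)" by (simp add: r_distr)
    finally have "w \<otimes> (x \<otimes> y) = w \<otimes> (\<one> \<oplus> x \<otimes> y) \<ominus> w" .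
    then show ?thesis unfolding w .
  qed
  have "(p \<otimes> q2 \<oplus> q \<otimes> s2) \<otimes> s2' = p \<otimes> (q2 \<otimes> s2') \<oplus> q \<otimes> (s2 \<otimes> s2')" using carr carr2 by (algebra; simp add: a_ac)
  then have 1: "(p \<otimes> q2 \<oplus> q \<otimes> s2) \<otimes> s2' = a" by (simp add: inv a_def xy)
  have "s' \<otimes> (r \<otimes> p2 \<oplus> s \<otimes> r2) = (s' \<otimes> r) \<otimes> p2 \<oplus> (s' \<otimes> s) \<otimes> r2" using carr carr2 by (algebra; simp add: a_ac)
  then have 2: "s' \<otimes> (r \<otimes> p2 \<oplus> s \<otimes> r2) = x \<otimes> p2 \<oplus> r2" by (simp add: inv xy)
  have "(p \<otimes> q2 \<oplus> q \<otimes> s2) \<otimes> ((s2' \<otimes> (w \<otimes> s')) \<otimes> (r \<otimes> p2 \<oplus> s \<otimes> r2))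
    = ((p \<otimes> q2 \<oplus> q \<otimes> s2) \<otimes> s2') \<otimes> (w \<otimes> (s' \<otimes> (r \<otimes> p2 \<oplus> s \<otimes> r2)))"
    by (simp add: m_assoc)
  then have lhs: "(p \<otimes> q2 \<oplus> q \<otimes> s2) \<otimes> ((s2' \<otimes> (w \<otimes> s')) \<otimes> (r \<otimes> p2 \<oplus> s \<otimes> r2)) = a \<otimes> (w \<otimes> (x \<otimes> p2 \<oplus> r2))"
    unfolding 1 2 .
  have "(p \<ominus> q \<otimes> x) \<otimes> (\<one> \<ominus> y \<otimes> (w \<otimes> x)) = p \<ominus> p \<otimes> (y \<otimes> (w \<otimes> x)) \<ominus> q \<otimes> x \<oplus> q \<otimes> ((x \<otimes> (y \<otimes> w)) \<otimes> x)"
    using carr carr2 by (algebra; simp add: a_ac)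
  also have "\<dots> = p \<ominus> a \<otimes> (w \<otimes> x)"
    unfolding xyw a_def using carr carr2 by (algebra; simp add: a_ac)
  finally have 3: "(p \<ominus> q \<otimes> x) \<otimes> (\<one> \<ominus> y \<otimes> (w \<otimes> x)) = p \<ominus> a \<otimes> (w \<otimes> x)" .
  have "(p \<ominus> q \<otimes> x) \<otimes> ((\<one> \<ominus> y \<otimes> (w \<otimes> x)) \<otimes> (p2 \<ominus> y \<otimes> r2)) = (p \<ominus> a \<otimes> (w \<otimes> x)) \<otimes> (p2 \<ominus> y \<otimes> r2)"
    unfolding 3[symmetric] by (simp add: m_assoc)
  also have "\<dots> = p \<otimes> p2 \<ominus> (p \<otimes> y) \<otimes> r2 \<ominus> a \<otimes> (w \<otimes> (x \<otimes> p2)) \<oplus> a \<otimes> ((w \<otimes> (x \<otimes> y)) \<otimes> r2)"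
    using carr carr2 by (algebra; simp add: a_ac)
  also have "\<dots> = p \<otimes> p2 \<oplus> q \<otimes> r2 \<ominus> a \<otimes> (w \<otimes> (x \<otimes> p2 \<oplus> r2))"
    unfolding wxy a_def using carr carr2 by (algebra; simp add: a_ac)
  finally show "(p \<otimes> p2 \<oplus> q \<otimes> r2) \<ominus> (p \<otimes> q2 \<oplus> q \<otimes> s2) \<otimes> ((s2' \<otimes> (w \<otimes> s')) \<otimes> (r \<otimes> p2 \<oplus> s \<otimes> r2))
    = (p \<ominus> q \<otimes> x) \<otimes> ((\<one> \<ominus> y \<otimes> (w \<otimes> x)) \<otimes> (p2 \<ominus> y \<otimes> r2))"
    unfolding lhs ..
  have "(\<one> \<oplus> y \<otimes> x) \<otimes> (\<one> \<ominus> y \<otimes> (w \<otimes> x)) = \<one> \<oplus> y \<otimes> x \<ominus> y \<otimes> (w \<otimes> x) \<ominus> y \<otimes> ((x \<otimes> (y \<otimes> w)) \<otimes> x)"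
    using carr carr2 by (algebra; simp add: a_ac)
  also have "\<dots> = \<one>" unfolding xyw using carr carr2 by (algebra; simp add: a_ac)
  finally show "(\<one> \<oplus> y \<otimes> x) \<otimes> (\<one> \<ominus> y \<otimes> (w \<otimes> x)) = \<one>" .
qed

section \<open>Block matrices with invertible diagonal blocks\<close>

context super_mat
begin

interpretation E: cring evens by (rule evens_cring)

interpretation M: ring MM by (rule matring_ring)

text \<open>The block matrix (p q; r s) together with the inverses p' and s' of its diagonal blocks,
  each block padded separately.\<close>

definition blocks where
  "blocks m n p p' q r s s' \<longleftrightarrow> m \<le> N \<and> n \<le> N \<and> p \<in> Fit m \<and> p' \<in> Fit m \<and> s \<in> Fit n \<and> s' \<in> Fit n \<and>
     q \<in> Cor True m n \<and> r \<in> Cor True n m \<and>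
     p \<otimes>\<^bsub>MM\<^esub> p' = \<one>\<^bsub>MM\<^esub> \<and> p' \<otimes>\<^bsub>MM\<^esub> p = \<one>\<^bsub>MM\<^esub> \<and> s \<otimes>\<^bsub>MM\<^esub> s' = \<one>\<^bsub>MM\<^esub> \<and> s' \<otimes>\<^bsub>MM\<^esub> s = \<one>\<^bsub>MM\<^esub>"

text \<open>Exchanging the two halves of the index set turns each fact about p - q s' r into one
  about s - r p' q, that is, facts about B into facts about C.\<close>

lemma blocks_swap: "blocks m n p p' q r s s' \<Longrightarrow> blocks n m s s' r q p p'"
  by (auto simp: blocks_def)

text \<open>Both -q and s' r are odd, so the Schur complement is p perturbed by a product of odd
  matrices. This is the reason why det B and det C are units.\<close>

lemma blocks_schur:
  assumes "blocks m n p p' q r s s'"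
  defines "b \<equiv> p \<ominus>\<^bsub>MM\<^esub> q \<otimes>\<^bsub>MM\<^esub> (s' \<otimes>\<^bsub>MM\<^esub> r)"
  shows "b \<in> Fit m" "eunit (D m b)"
proof -
  have q: "\<ominus>\<^bsub>MM\<^esub> q \<in> Cor True m n" and r: "s' \<otimes>\<^bsub>MM\<^esub> r \<in> Cor True n m" and p: "p \<in> Fit m" and m: "m \<le> N"
    using assms by (auto simp: blocks_def intro: Cor_minus Fit_Cor)
  have b: "b = p \<oplus>\<^bsub>MM\<^esub> (\<ominus>\<^bsub>MM\<^esub> q) \<otimes>\<^bsub>MM\<^esub> (s' \<otimes>\<^bsub>MM\<^esub> r)"
  proof -
    have "q \<in> carrier MM"
      using assms(1) by (auto simp: blocks_def Cor_carrier)
    then show ?thesis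
      using Cor_carrier[OF r] by (simp only: b_def M.minus_eq M.l_minus)
  qed
  show "b \<in> Fit m"
    unfolding b by (rule Fit_sum_Cor[OF p q r])
  show "eunit (D m b)"
    unfolding b using assms(1) Fit_eunit(2)[of p m p'] by (intro D_unit_perturb[OF p m _ q r]) (auto simp: blocks_def)
qed

text \<open>With x = -p' q and y = s' r the Schur complements are p (1 + x y) and s (1 + y x), and
  the determinants of the two second factors multiply to 1. In the notation of the statement: det B
  det C = d1 d2.\<close>

lemma blocks_det:
  assumes bl: "blocks m n p p' q r s s'"
  shows "D m (p \<ominus>\<^bsub>MM\<^esub> q \<otimes>\<^bsub>MM\<^esub> (s' \<otimes>\<^bsub>MM\<^esub> r)) \<otimes> D n (s \<ominus>\<^bsub>MM\<^esub> r \<otimes>\<^bsub>MM\<^esub> (p' \<otimes>\<^bsub>MM\<^esub> q)) = D m p \<otimes> D n s"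
proof -
  define x where "x = \<ominus>\<^bsub>MM\<^esub> (p' \<otimes>\<^bsub>MM\<^esub> q)"
  define y where "y = s' \<otimes>\<^bsub>MM\<^esub> r"
  have x: "x \<in> Cor True m n" and y: "y \<in> Cor True n m"
    using bl by (auto simp: blocks_def x_def y_def intro: Cor_minus Fit_Cor)
  have mn: "m \<le> N" "n \<le> N" and p: "p \<in> Fit m" and s: "s \<in> Fit n"
    using bl by (auto simp: blocks_def)
  have c: "p \<in> carrier MM" "p' \<in> carrier MM" "q \<in> carrier MM" "r \<in> carrier MM" "s \<in> carrier MM" "s' \<in> carrier MM"
    using bl by (auto simp: blocks_def Fit_carrier Cor_carrier)
  have inv: "p \<otimes>\<^bsub>MM\<^esub> (p' \<otimes>\<^bsub>MM\<^esub> z) = z" "s \<otimes>\<^bsub>MM\<^esub> (s' \<otimes>\<^bsub>MM\<^esub> z) = z" if "z \<in> carrier MM" for z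
    using bl that c by (simp_all add: blocks_def flip: M.m_assoc)
  let ?L = "\<one>\<^bsub>MM\<^esub> \<oplus>\<^bsub>MM\<^esub> x \<otimes>\<^bsub>MM\<^esub> y" and ?R = "\<one>\<^bsub>MM\<^esub> \<oplus>\<^bsub>MM\<^esub> y \<otimes>\<^bsub>MM\<^esub> x"
  have L: "?L \<in> Fit m" by (rule Fit_sum_Cor[OF Fit_one x y])
  have R: "?R \<in> Fit n" by (rule Fit_sum_Cor[OF Fit_one y x])
  have 1: "p \<ominus>\<^bsub>MM\<^esub> q \<otimes>\<^bsub>MM\<^esub> (s' \<otimes>\<^bsub>MM\<^esub> r) = p \<otimes>\<^bsub>MM\<^esub> ?L"
    unfolding x_def y_def using c inv by (simp add: M.r_distr M.l_minus M.r_minus M.minus_eq M.m_assoc)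
  have 2: "s \<ominus>\<^bsub>MM\<^esub> r \<otimes>\<^bsub>MM\<^esub> (p' \<otimes>\<^bsub>MM\<^esub> q) = s \<otimes>\<^bsub>MM\<^esub> ?R"
    unfolding x_def y_def using c inv by (simp add: M.r_distr M.l_minus M.r_minus M.minus_eq M.m_assoc)
  have "(D m p \<otimes> D m ?L) \<otimes> (D n s \<otimes> D n ?R) = (D m p \<otimes> D n s) \<otimes> (D m ?L \<otimes> D n ?R)"
    using D_even[OF L] D_even[OF R] D_even[OF p] D_even[OF s] E.m_ac by (simp add: m_assoc)
  then show ?thesis
    unfolding 1 2 D_mult[OF p L mn(1)] D_mult[OF s R mn(2)] det_odd[OF x y mn]
    using D_even[OF p] D_even[OF s] by simp
qed

text \<open>The last claim is the multiplicativity of the Berezinian, where the determinant of S'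
  stands for that of the inverse of the lower right block. The inverse is an argument with a
  hypothesis, since the product matrix comes with inverse determinants of its own.\<close>

lemma blocks_product:
  assumes bl: "blocks m n p p' q r s s'" and bl2: "blocks m n p2 p2' q2 r2 s2 s2'"
  defines "P \<equiv> p \<otimes>\<^bsub>MM\<^esub> p2 \<oplus>\<^bsub>MM\<^esub> q \<otimes>\<^bsub>MM\<^esub> r2" and "Q \<equiv> p \<otimes>\<^bsub>MM\<^esub> q2 \<oplus>\<^bsub>MM\<^esub> q \<otimes>\<^bsub>MM\<^esub> s2"
    and "R \<equiv> r \<otimes>\<^bsub>MM\<^esub> p2 \<oplus>\<^bsub>MM\<^esub> s \<otimes>\<^bsub>MM\<^esub> r2" and "S \<equiv> r \<otimes>\<^bsub>MM\<^esub> q2 \<oplus>\<^bsub>MM\<^esub> s \<otimes>\<^bsub>MM\<^esub> s2"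
  shows "P \<in> Fit m" "Q \<in> Cor True m n" "R \<in> Cor True n m" "S \<in> Fit n" "eunit (D m P)" "eunit (D n S)"
    and "S' \<in> Fit n \<Longrightarrow> S' \<otimes>\<^bsub>MM\<^esub> S = \<one>\<^bsub>MM\<^esub> \<Longrightarrow> D n S' \<otimes> D m (P \<ominus>\<^bsub>MM\<^esub> Q \<otimes>\<^bsub>MM\<^esub> (S' \<otimes>\<^bsub>MM\<^esub> R)) =
      (D n s' \<otimes> D m (p \<ominus>\<^bsub>MM\<^esub> q \<otimes>\<^bsub>MM\<^esub> (s' \<otimes>\<^bsub>MM\<^esub> r))) \<otimes> (D n s2' \<otimes> D m (p2 \<ominus>\<^bsub>MM\<^esub> q2 \<otimes>\<^bsub>MM\<^esub> (s2' \<otimes>\<^bsub>MM\<^esub> r2)))"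
proof -
  have F: "p \<in> Fit m" "p' \<in> Fit m" "s \<in> Fit n" "s' \<in> Fit n" "p2 \<in> Fit m" "p2' \<in> Fit m" "s2 \<in> Fit n" "s2' \<in> Fit n"
    and C: "q \<in> Cor True m n" "r \<in> Cor True n m" "q2 \<in> Cor True m n" "r2 \<in> Cor True n m"
    and mn: "m \<le> N" "n \<le> N"
    using bl bl2 by (auto simp: blocks_def)
  note c [simp] = F[THEN Fit_carrier] C[THEN Cor_carrier]
  have inv: "p \<otimes>\<^bsub>MM\<^esub> p' = \<one>\<^bsub>MM\<^esub>" "s \<otimes>\<^bsub>MM\<^esub> s' = \<one>\<^bsub>MM\<^esub>" "s' \<otimes>\<^bsub>MM\<^esub> s = \<one>\<^bsub>MM\<^esub>"
    "p2 \<otimes>\<^bsub>MM\<^esub> p2' = \<one>\<^bsub>MM\<^esub>" "s2 \<otimes>\<^bsub>MM\<^esub> s2' = \<one>\<^bsub>MM\<^esub>" "s2' \<otimes>\<^bsub>MM\<^esub> s2 = \<one>\<^bsub>MM\<^esub>"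
    using bl bl2 by (auto simp: blocks_def)
  show "P \<in> Fit m" unfolding P_def by (intro Fit_sum_Cor[OF _ C(1,4)] Fit_mult F)
  show "Q \<in> Cor True m n" unfolding Q_def by (intro Cor_add Fit_Cor[OF F(1) C(3)] Cor_Fit[OF C(1) F(7)])
  show R: "R \<in> Cor True n m" unfolding R_def by (intro Cor_add Fit_Cor[OF F(3) C(4)] Cor_Fit[OF C(2) F(5)])
  have S2: "S = s \<otimes>\<^bsub>MM\<^esub> s2 \<oplus>\<^bsub>MM\<^esub> r \<otimes>\<^bsub>MM\<^esub> q2" unfolding S_def by (simp add: M.a_comm)
  show S: "S \<in> Fit n" unfolding S2 by (intro Fit_sum_Cor[OF _ C(2,3)] Fit_mult F)
  show "eunit (D m P)"
    unfolding P_def using Fit_eunit[OF F(1) mn(1) F(2) inv(1)] Fit_eunit[OF F(5) mn(1) F(6) inv(4)]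
    by (intro D_unit_perturb[OF _ mn(1) _ C(1,4)] Fit_mult F) (auto simp: D_mult F mn intro: eunit_mult)
  show "eunit (D n S)"
    unfolding S2 using Fit_eunit[OF F(3) mn(2) F(4) inv(2)] Fit_eunit[OF F(7) mn(2) F(8) inv(5)]
    by (intro D_unit_perturb[OF _ mn(2) _ C(2,3)] Fit_mult F) (auto simp: D_mult F mn intro: eunit_mult)
  assume S': "S' \<in> Fit n" "S' \<otimes>\<^bsub>MM\<^esub> S = \<one>\<^bsub>MM\<^esub>"
  define x where "x = s' \<otimes>\<^bsub>MM\<^esub> r"
  define y where "y = q2 \<otimes>\<^bsub>MM\<^esub> s2'"
  have x: "x \<in> Cor True n m" and y: "y \<in> Cor True m n"
    unfolding x_def y_def by (auto intro: Fit_Cor Cor_Fit F C)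
  let ?W = "\<one>\<^bsub>MM\<^esub> \<oplus>\<^bsub>MM\<^esub> x \<otimes>\<^bsub>MM\<^esub> y" and ?V = "\<one>\<^bsub>MM\<^esub> \<oplus>\<^bsub>MM\<^esub> y \<otimes>\<^bsub>MM\<^esub> x"
  have W: "?W \<in> Fit n" by (rule Fit_sum_Cor[OF Fit_one x y])
  have V: "?V \<in> Fit m" by (rule Fit_sum_Cor[OF Fit_one y x])
  have VW: "D m ?V \<otimes> D n ?W = \<one>" by (rule det_odd[OF y x mn])
  have "D n ?W \<otimes> D m ?V = \<one>" using VW D_even[OF V] D_even[OF W] even_commute by metis
  then have "eunit (D n ?W)" using D_even[OF V] D_even[OF W] by (auto intro: eunitI)
  then obtain w where w: "w \<in> Fit n" "?W \<otimes>\<^bsub>MM\<^esub> w = \<one>\<^bsub>MM\<^esub>" "w \<otimes>\<^bsub>MM\<^esub> ?W = \<one>\<^bsub>MM\<^esub>" "D n ?W \<otimes> D n w = \<one>"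
    using eunit_Fit[OF W mn(2)] by metis
  note c' [simp] = Fit_carrier[OF w(1)] Cor_carrier[OF x] Cor_carrier[OF y] Fit_carrier[OF S] Fit_carrier[OF S'(1)] Fit_carrier[OF W]
  \<comment> \<open>The lower right block is s W s2, so that its inverse is s2' w s', the form
    required by \<open>schur_product\<close>.\<close>
  have "S = s \<otimes>\<^bsub>MM\<^esub> (?W \<otimes>\<^bsub>MM\<^esub> s2)"
  proof -
    have "s \<otimes>\<^bsub>MM\<^esub> (?W \<otimes>\<^bsub>MM\<^esub> s2) = s \<otimes>\<^bsub>MM\<^esub> s2 \<oplus>\<^bsub>MM\<^esub> (s \<otimes>\<^bsub>MM\<^esub> s') \<otimes>\<^bsub>MM\<^esub> (r \<otimes>\<^bsub>MM\<^esub> (q2 \<otimes>\<^bsub>MM\<^esub> (s2' \<otimes>\<^bsub>MM\<^esub> s2)))"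
      unfolding x_def y_def by (simp add: M.l_distr M.r_distr M.m_assoc)
    then show ?thesis unfolding S2 inv by simp
  qed
  then have "S \<otimes>\<^bsub>MM\<^esub> (s2' \<otimes>\<^bsub>MM\<^esub> (w \<otimes>\<^bsub>MM\<^esub> s')) = s \<otimes>\<^bsub>MM\<^esub> ((?W \<otimes>\<^bsub>MM\<^esub> ((s2 \<otimes>\<^bsub>MM\<^esub> s2') \<otimes>\<^bsub>MM\<^esub> w)) \<otimes>\<^bsub>MM\<^esub> s')"
    by (simp add: M.m_assoc)
  also have "\<dots> = \<one>\<^bsub>MM\<^esub>" unfolding inv using w inv by simp
  finally have "S \<otimes>\<^bsub>MM\<^esub> (s2' \<otimes>\<^bsub>MM\<^esub> (w \<otimes>\<^bsub>MM\<^esub> s')) = \<one>\<^bsub>MM\<^esub>" .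
  then have "S' \<otimes>\<^bsub>MM\<^esub> (S \<otimes>\<^bsub>MM\<^esub> (s2' \<otimes>\<^bsub>MM\<^esub> (w \<otimes>\<^bsub>MM\<^esub> s'))) = S'" by simp
  moreover have "S' \<otimes>\<^bsub>MM\<^esub> (S \<otimes>\<^bsub>MM\<^esub> (s2' \<otimes>\<^bsub>MM\<^esub> (w \<otimes>\<^bsub>MM\<^esub> s'))) = s2' \<otimes>\<^bsub>MM\<^esub> (w \<otimes>\<^bsub>MM\<^esub> s')"
    using S'(2) M.m_assoc[of S' S] by simp
  ultimately have S'_eq: "S' = s2' \<otimes>\<^bsub>MM\<^esub> (w \<otimes>\<^bsub>MM\<^esub> s')" by simp
  note sp = M.schur_product[OF c(1,9,10,3,4,5,11,12,7,8) c'(1) inv(3,5) x_def y_def w(3,2)]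
  define v where "v = \<one>\<^bsub>MM\<^esub> \<ominus>\<^bsub>MM\<^esub> y \<otimes>\<^bsub>MM\<^esub> (w \<otimes>\<^bsub>MM\<^esub> x)"
  have "v = \<one>\<^bsub>MM\<^esub> \<oplus>\<^bsub>MM\<^esub> (\<ominus>\<^bsub>MM\<^esub> y) \<otimes>\<^bsub>MM\<^esub> (w \<otimes>\<^bsub>MM\<^esub> x)"
    unfolding v_def by (simp add: M.minus_eq M.l_minus)
  then have v: "v \<in> Fit m"
    by (simp add: Fit_sum_Cor[OF Fit_one Cor_minus[OF y] Fit_Cor[OF w(1) x]])
  have Vv: "D m ?V \<otimes> D m v = \<one>"
    using sp(2) by (intro Fit_eunit V v mn) (simp add: v_def)
  \<comment> \<open>det V det W = 1 holds by the identity for odd matrices, hence also det v det w =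
    1 for the inverses. These are the two surplus factors in the Berezinian of the product.\<close>
  have wv: "D n w \<otimes> D m v = \<one>"
  proof -
    have "(D m ?V \<otimes> D n ?W) \<otimes> (D n w \<otimes> D m v) = (D n ?W \<otimes> D n w) \<otimes> (D m ?V \<otimes> D m v)"
      using D_even[OF V] D_even[OF W] D_even[OF v] D_even[OF w(1)] E.m_ac by (simp add: m_assoc)
    then show ?thesis
      unfolding VW w Vv using D_even[OF v] D_even[OF w(1)] by simp
  qed
  let ?b = "p \<ominus>\<^bsub>MM\<^esub> q \<otimes>\<^bsub>MM\<^esub> (s' \<otimes>\<^bsub>MM\<^esub> r)" and ?b2 = "p2 \<ominus>\<^bsub>MM\<^esub> q2 \<otimes>\<^bsub>MM\<^esub> (s2' \<otimes>\<^bsub>MM\<^esub> r2)"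
  have "y \<otimes>\<^bsub>MM\<^esub> r2 = q2 \<otimes>\<^bsub>MM\<^esub> (s2' \<otimes>\<^bsub>MM\<^esub> r2)"
    unfolding y_def by (simp add: M.m_assoc)
  then have B: "P \<ominus>\<^bsub>MM\<^esub> Q \<otimes>\<^bsub>MM\<^esub> (S' \<otimes>\<^bsub>MM\<^esub> R) = ?b \<otimes>\<^bsub>MM\<^esub> (v \<otimes>\<^bsub>MM\<^esub> ?b2)"
    unfolding P_def Q_def R_def S'_eq using sp(1) by (simp add: v_def x_def)
  have b: "?b \<in> Fit m" "?b2 \<in> Fit m"
    using blocks_schur[OF bl] blocks_schur[OF bl2] by auto
  have e: "D m ?b \<in> G False" "D m ?b2 \<in> G False" "D n s' \<in> G False" "D n s2' \<in> G False" "D n w \<in> G False" "D m v \<in> G False"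
    using b v w F by (auto intro: D_even)
  have "D n S' \<otimes> D m (?b \<otimes>\<^bsub>MM\<^esub> (v \<otimes>\<^bsub>MM\<^esub> ?b2)) = (D n s2' \<otimes> (D n w \<otimes> D n s')) \<otimes> (D m ?b \<otimes> (D m v \<otimes> D m ?b2))"
    unfolding S'_eq using b v w F mn by (simp add: D_mult Fit_mult)
  also have "\<dots> = (D n w \<otimes> D m v) \<otimes> ((D n s' \<otimes> D m ?b) \<otimes> (D n s2' \<otimes> D m ?b2))"
    using e E.m_ac by (simp add: m_assoc)
  also have "\<dots> = (D n s' \<otimes> D m ?b) \<otimes> (D n s2' \<otimes> D m ?b2)"
    unfolding wv using e by simp
  finally show "D n S' \<otimes> D m (P \<ominus>\<^bsub>MM\<^esub> Q \<otimes>\<^bsub>MM\<^esub> (S' \<otimes>\<^bsub>MM\<^esub> R)) = (D n s' \<otimes> D m ?b) \<otimes> (D n s2' \<otimes> D m ?b2)"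
    unfolding B .
qed

text \<open>The upper block rows of X Y = 1 and Y X = 1, for X the block matrix and Y the matrix of
  the antipode formula. The lower block rows follow by \<open>blocks_swap\<close>.\<close>

lemma blocks_inverse:
  assumes bl: "blocks m n p p' q r s s'" and b': "b' \<in> Fit m" and c': "c' \<in> Fit n"
    and b: "(p \<ominus>\<^bsub>MM\<^esub> q \<otimes>\<^bsub>MM\<^esub> (s' \<otimes>\<^bsub>MM\<^esub> r)) \<otimes>\<^bsub>MM\<^esub> b' = \<one>\<^bsub>MM\<^esub>" "b' \<otimes>\<^bsub>MM\<^esub> (p \<ominus>\<^bsub>MM\<^esub> q \<otimes>\<^bsub>MM\<^esub> (s' \<otimes>\<^bsub>MM\<^esub> r)) = \<one>\<^bsub>MM\<^esub>"
    and c: "(s \<ominus>\<^bsub>MM\<^esub> r \<otimes>\<^bsub>MM\<^esub> (p' \<otimes>\<^bsub>MM\<^esub> q)) \<otimes>\<^bsub>MM\<^esub> c' = \<one>\<^bsub>MM\<^esub>" "c' \<otimes>\<^bsub>MM\<^esub> (s \<ominus>\<^bsub>MM\<^esub> r \<otimes>\<^bsub>MM\<^esub> (p' \<otimes>\<^bsub>MM\<^esub> q)) = \<one>\<^bsub>MM\<^esub>"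
  shows "p \<otimes>\<^bsub>MM\<^esub> b' \<oplus>\<^bsub>MM\<^esub> q \<otimes>\<^bsub>MM\<^esub> (\<ominus>\<^bsub>MM\<^esub> ((s' \<otimes>\<^bsub>MM\<^esub> r) \<otimes>\<^bsub>MM\<^esub> b')) = \<one>\<^bsub>MM\<^esub>"
    and "p \<otimes>\<^bsub>MM\<^esub> (\<ominus>\<^bsub>MM\<^esub> ((p' \<otimes>\<^bsub>MM\<^esub> q) \<otimes>\<^bsub>MM\<^esub> c')) \<oplus>\<^bsub>MM\<^esub> q \<otimes>\<^bsub>MM\<^esub> c' = \<zero>\<^bsub>MM\<^esub>"
    and "b' \<otimes>\<^bsub>MM\<^esub> p \<oplus>\<^bsub>MM\<^esub> (\<ominus>\<^bsub>MM\<^esub> ((p' \<otimes>\<^bsub>MM\<^esub> q) \<otimes>\<^bsub>MM\<^esub> c')) \<otimes>\<^bsub>MM\<^esub> r = \<one>\<^bsub>MM\<^esub>"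
    and "b' \<otimes>\<^bsub>MM\<^esub> q \<oplus>\<^bsub>MM\<^esub> (\<ominus>\<^bsub>MM\<^esub> ((p' \<otimes>\<^bsub>MM\<^esub> q) \<otimes>\<^bsub>MM\<^esub> c')) \<otimes>\<^bsub>MM\<^esub> s = \<zero>\<^bsub>MM\<^esub>"
proof -
  have F: "p \<in> Fit m" "p' \<in> Fit m" "s \<in> Fit n" "s' \<in> Fit n" "q \<in> Cor True m n" "r \<in> Cor True n m"
    and inv: "p \<otimes>\<^bsub>MM\<^esub> p' = \<one>\<^bsub>MM\<^esub>" "p' \<otimes>\<^bsub>MM\<^esub> p = \<one>\<^bsub>MM\<^esub>" "s \<otimes>\<^bsub>MM\<^esub> s' = \<one>\<^bsub>MM\<^esub>" "s' \<otimes>\<^bsub>MM\<^esub> s = \<one>\<^bsub>MM\<^esub>"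
    using bl by (auto simp: blocks_def)
  note cc [simp] = F(1-4)[THEN Fit_carrier] F(5-6)[THEN Cor_carrier] Fit_carrier[OF b'] Fit_carrier[OF c']
  have "p \<otimes>\<^bsub>MM\<^esub> b' \<oplus>\<^bsub>MM\<^esub> q \<otimes>\<^bsub>MM\<^esub> (\<ominus>\<^bsub>MM\<^esub> ((s' \<otimes>\<^bsub>MM\<^esub> r) \<otimes>\<^bsub>MM\<^esub> b')) = (p \<ominus>\<^bsub>MM\<^esub> q \<otimes>\<^bsub>MM\<^esub> (s' \<otimes>\<^bsub>MM\<^esub> r)) \<otimes>\<^bsub>MM\<^esub> b'"
    by (simp add: M.l_distr M.minus_eq M.l_minus M.r_minus M.m_assoc)
  then show "p \<otimes>\<^bsub>MM\<^esub> b' \<oplus>\<^bsub>MM\<^esub> q \<otimes>\<^bsub>MM\<^esub> (\<ominus>\<^bsub>MM\<^esub> ((s' \<otimes>\<^bsub>MM\<^esub> r) \<otimes>\<^bsub>MM\<^esub> b')) = \<one>\<^bsub>MM\<^esub>"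
    using b by simp
  have "p \<otimes>\<^bsub>MM\<^esub> (\<ominus>\<^bsub>MM\<^esub> ((p' \<otimes>\<^bsub>MM\<^esub> q) \<otimes>\<^bsub>MM\<^esub> c')) = \<ominus>\<^bsub>MM\<^esub> ((p \<otimes>\<^bsub>MM\<^esub> p') \<otimes>\<^bsub>MM\<^esub> (q \<otimes>\<^bsub>MM\<^esub> c'))"
    by (simp add: M.r_minus M.m_assoc)
  then show "p \<otimes>\<^bsub>MM\<^esub> (\<ominus>\<^bsub>MM\<^esub> ((p' \<otimes>\<^bsub>MM\<^esub> q) \<otimes>\<^bsub>MM\<^esub> c')) \<oplus>\<^bsub>MM\<^esub> q \<otimes>\<^bsub>MM\<^esub> c' = \<zero>\<^bsub>MM\<^esub>"
    by (simp add: inv M.l_neg)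
  \<comment> \<open>In Y X both b' and c' occur in the same block. Woodbury expresses b' by c',
    after which everything reduces to the defining relations of c' and p'.\<close>
  have wb: "b' = p' \<oplus>\<^bsub>MM\<^esub> (p' \<otimes>\<^bsub>MM\<^esub> q) \<otimes>\<^bsub>MM\<^esub> (c' \<otimes>\<^bsub>MM\<^esub> (r \<otimes>\<^bsub>MM\<^esub> p'))"
    by (rule M.woodbury[of p p' s s']) (simp_all add: inv b c)
  have "b' \<otimes>\<^bsub>MM\<^esub> p = p' \<otimes>\<^bsub>MM\<^esub> p \<oplus>\<^bsub>MM\<^esub> (p' \<otimes>\<^bsub>MM\<^esub> q) \<otimes>\<^bsub>MM\<^esub> (c' \<otimes>\<^bsub>MM\<^esub> (r \<otimes>\<^bsub>MM\<^esub> (p' \<otimes>\<^bsub>MM\<^esub> p)))"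
    by (subst wb) (simp add: M.l_distr M.m_assoc)
  then have bp: "b' \<otimes>\<^bsub>MM\<^esub> p = \<one>\<^bsub>MM\<^esub> \<oplus>\<^bsub>MM\<^esub> (p' \<otimes>\<^bsub>MM\<^esub> q) \<otimes>\<^bsub>MM\<^esub> (c' \<otimes>\<^bsub>MM\<^esub> r)"
    unfolding inv by simp
  then show "b' \<otimes>\<^bsub>MM\<^esub> p \<oplus>\<^bsub>MM\<^esub> (\<ominus>\<^bsub>MM\<^esub> ((p' \<otimes>\<^bsub>MM\<^esub> q) \<otimes>\<^bsub>MM\<^esub> c')) \<otimes>\<^bsub>MM\<^esub> r = \<one>\<^bsub>MM\<^esub>"
    by (simp add: M.l_minus M.m_assoc M.a_assoc M.r_neg)
  have "b' \<otimes>\<^bsub>MM\<^esub> q = p' \<otimes>\<^bsub>MM\<^esub> q \<oplus>\<^bsub>MM\<^esub> (p' \<otimes>\<^bsub>MM\<^esub> q) \<otimes>\<^bsub>MM\<^esub> (c' \<otimes>\<^bsub>MM\<^esub> (r \<otimes>\<^bsub>MM\<^esub> (p' \<otimes>\<^bsub>MM\<^esub> q)))"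
    by (subst wb) (simp add: M.l_distr M.m_assoc)
  also have "\<dots> = (p' \<otimes>\<^bsub>MM\<^esub> q) \<otimes>\<^bsub>MM\<^esub> (c' \<otimes>\<^bsub>MM\<^esub> (s \<ominus>\<^bsub>MM\<^esub> r \<otimes>\<^bsub>MM\<^esub> (p' \<otimes>\<^bsub>MM\<^esub> q)) \<oplus>\<^bsub>MM\<^esub> c' \<otimes>\<^bsub>MM\<^esub> (r \<otimes>\<^bsub>MM\<^esub> (p' \<otimes>\<^bsub>MM\<^esub> q)))"
    unfolding c by (simp add: M.r_distr M.m_assoc)
  also have "c' \<otimes>\<^bsub>MM\<^esub> (s \<ominus>\<^bsub>MM\<^esub> r \<otimes>\<^bsub>MM\<^esub> (p' \<otimes>\<^bsub>MM\<^esub> q)) \<oplus>\<^bsub>MM\<^esub> c' \<otimes>\<^bsub>MM\<^esub> (r \<otimes>\<^bsub>MM\<^esub> (p' \<otimes>\<^bsub>MM\<^esub> q)) = c' \<otimes>\<^bsub>MM\<^esub> s"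
    by (simp add: M.r_distr M.minus_eq M.r_minus M.a_assoc M.l_neg)
  finally show "b' \<otimes>\<^bsub>MM\<^esub> q \<oplus>\<^bsub>MM\<^esub> (\<ominus>\<^bsub>MM\<^esub> ((p' \<otimes>\<^bsub>MM\<^esub> q) \<otimes>\<^bsub>MM\<^esub> c')) \<otimes>\<^bsub>MM\<^esub> s = \<zero>\<^bsub>MM\<^esub>"
    by (simp add: M.l_minus M.m_assoc M.r_neg)
qed

end

section \<open>Points of GL(m|n) in a supercommutative ring\<close>

definition gl_entries :: "(bool \<Rightarrow> 'a set) \<Rightarrow> 'a gl_data \<Rightarrow> bool" where
  "gl_entries G U \<longleftrightarrow> (\<forall>i<msize U + nsize U. \<forall>j<msize U + nsize U.
     entry U i j \<in> G ((i < msize U) \<noteq> (j < msize U)))"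

text \<open>A point of GL(m|n) with values in A: exactly the data that a homomorphism out of
  k[GL(m|n)] carries. The inverse determinants belong to the data because they are generators of
  that algebra.\<close>

definition gl_valid :: "('a, 'b) ring_scheme \<Rightarrow> (bool \<Rightarrow> 'a set) \<Rightarrow> 'a gl_data \<Rightarrow> bool" where
  "gl_valid A G U \<longleftrightarrow> gl_entries G U \<and> dinv1 U \<in> G False \<and> dinv2 U \<in> G False \<and>
     d1 A U \<otimes>\<^bsub>A\<^esub> dinv1 U = \<one>\<^bsub>A\<^esub> \<and> d2 A U \<otimes>\<^bsub>A\<^esub> dinv2 U = \<one>\<^bsub>A\<^esub>"

text \<open>A relation on sizes and entries, silent about the inverse determinants of the product:
  that its diagonal determinants are invertible has to be proved first.\<close>

definition is_product :: "('a, 'b) ring_scheme \<Rightarrow> 'a gl_data \<Rightarrow> 'a gl_data \<Rightarrow> 'a gl_data \<Rightarrow> bool" where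
  "is_product A U Y Z \<longleftrightarrow> msize Y = msize U \<and> nsize Y = nsize U \<and> msize Z = msize U \<and> nsize Z = nsize U \<and>
     (\<forall>i<msize U + nsize U. \<forall>j<msize U + nsize U.
       entry Z i j = mmul A (msize U + nsize U) (entry U) (entry Y) i j)"

text \<open>The diagonal blocks of \<open>antipode_matrix\<close> are the inverses of B and C. Their
  determinants are therefore inverted by det B and det C, which gives the last two fields.\<close>

definition antipode_data :: "('a, 'b) ring_scheme \<Rightarrow> 'a gl_data \<Rightarrow> 'a gl_data" where
  "antipode_data A U = \<lparr>msize = msize U, nsize = nsize U, entry = antipode_matrix A U,
     dinv1 = mdet A (msize U) (matB A U), dinv2 = mdet A (nsize U) (matC A U)\<rparr>"

lemma (in ring) adj_inv_cong:
  assumes "\<And>i j. i < l \<Longrightarrow> j < l \<Longrightarrow> M i j \<in> carrier R"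
    and "\<And>i j. i < l \<Longrightarrow> j < l \<Longrightarrow> M i j = M' i j" and "i < l" "j < l"
  shows "adj_inv R l M u i j = adj_inv R l M' u i j"
proof -
  have "mdet R (l - 1) (suppress j i M) = mdet R (l - 1) (suppress j i M')"
    using assms by (intro mdet_cong) (auto simp: suppress_def)
  then show ?thesis by (simp add: adj_inv_def)
qed

lemma (in ring) mmul_cong:
  assumes "\<And>k. k < l \<Longrightarrow> M i k = M' i k" "\<And>k. k < l \<Longrightarrow> N k j = N' k j"
    "\<And>k. k < l \<Longrightarrow> M' i k \<in> carrier R" "\<And>k. k < l \<Longrightarrow> N' k j \<in> carrier R"
  shows "mmul R l M N i j = mmul R l M' N' i j"
  unfolding mmul_def using assms by (intro finsum_cong') auto

context super_mat
begin

interpretation E: cring evens by (rule evens_cring)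

interpretation M: ring MM by (rule matring_ring)

text \<open>The four blocks of \<open>U\<close> in padded form, the diagonal ones filled up by the
  identity and the others by zero. A prime marks the inverse of a diagonal block; \<open>bB\<close>
  and \<open>bC\<close> are B and C as Schur complements in \<open>MM\<close>.\<close>

definition bp where "bp U = (\<lambda>i j. if i < msize U \<and> j < msize U then X11 U i j else \<one>\<^bsub>MM\<^esub> i j)"
definition bs where "bs U = (\<lambda>i j. if i < nsize U \<and> j < nsize U then X22 U i j else \<one>\<^bsub>MM\<^esub> i j)"
definition bq where "bq U = (\<lambda>i j. if i < msize U \<and> j < nsize U then Xi12 U i j else \<zero>)"
definition br where "br U = (\<lambda>i j. if i < nsize U \<and> j < msize U then Xi21 U i j else \<zero>)"
definition bp' where "bp' U = padinv (msize U) (bp U) (dinv1 U)"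
definition bs' where "bs' U = padinv (nsize U) (bs U) (dinv2 U)"
definition bB where "bB U = bp U \<ominus>\<^bsub>MM\<^esub> bq U \<otimes>\<^bsub>MM\<^esub> (bs' U \<otimes>\<^bsub>MM\<^esub> br U)"
definition bC where "bC U = bs U \<ominus>\<^bsub>MM\<^esub> br U \<otimes>\<^bsub>MM\<^esub> (bp' U \<otimes>\<^bsub>MM\<^esub> bq U)"

lemmas block_entries = X11_def X22_def Xi12_def Xi21_def

lemma block_closed:
  assumes "gl_entries G U" "N = msize U + nsize U"
  shows "bp U \<in> Fit (msize U)" "bs U \<in> Fit (nsize U)"
    "bq U \<in> Cor True (msize U) (nsize U)" "br U \<in> Cor True (nsize U) (msize U)"
proof -
  have e: "entry U i j \<in> G ((i < msize U) \<noteq> (j < msize U))" if "i < N" "j < N" for i j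
    using assms(1) that unfolding assms(2) by (auto simp: gl_entries_def)
  have mN: "msize U \<le> N" "nsize U \<le> N"
    using assms(2) by simp_all
  have "X11 U i j \<in> G False" if "i < msize U" "j < msize U" for i j
    using e[of i j] that assms(2) by (auto simp: block_entries)
  then show "bp U \<in> Fit (msize U)"
    using mN by (intro FitI) (auto simp: bp_def MM_simps)
  have "X22 U i j \<in> G False" if "i < nsize U" "j < nsize U" for i j
    using e[of "msize U + i" "msize U + j"] that assms(2) by (auto simp: block_entries)
  then show "bs U \<in> Fit (nsize U)"
    using mN by (intro FitI) (auto simp: bs_def MM_simps)
  have "Xi12 U i j \<in> G True" if "i < msize U" "j < nsize U" for i j
    using e[of i "msize U + j"] that assms(2) by (auto simp: block_entries)
  then show "bq U \<in> Cor True (msize U) (nsize U)"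
    using mN by (auto simp: bq_def Cor_def)
  have "Xi21 U i j \<in> G True" if "i < nsize U" "j < msize U" for i j
    using e[of "msize U + i" j] that assms(2) by (auto simp: block_entries)
  then show "br U \<in> Cor True (nsize U) (msize U)"
    using mN by (auto simp: br_def Cor_def)
qed

lemma entry_block:
  assumes "i < msize U + nsize U" "j < msize U + nsize U"
  shows "entry U i j = (if i < msize U then if j < msize U then bp U i j else bq U i (j - msize U)
    else if j < msize U then br U (i - msize U) j else bs U (i - msize U) (j - msize U))"
  using assms by (auto simp: bp_def bq_def br_def bs_def block_entries)

lemma entries_eqI:
  assumes "bp U = bp Y" "bq U = bq Y" "br U = br Y" "bs U = bs Y" "msize U = msize Y" "nsize U = nsize Y"
    and "i < msize U + nsize U" "j < msize U + nsize U"
  shows "entry U i j = entry Y i j"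
  using assms entry_block[of i U j] entry_block[of i Y j] by simp

lemma d_block:
  assumes "gl_entries G U" "N = msize U + nsize U"
  shows "d1 A U = D (msize U) (bp U)" "d2 A U = D (nsize U) (bs U)"
proof -
  note b = block_closed[OF assms]
  show "d1 A U = D (msize U) (bp U)"
    unfolding d1_def 
    by (intro mdet_cong[symmetric], simp add: Fit_entry[OF b(1)], simp add: bp_def)
  show "d2 A U = D (nsize U) (bs U)"
    unfolding d2_def 
    by (intro mdet_cong[symmetric], simp add: Fit_entry[OF b(2)], simp add: bs_def)
qed

lemma valid_blocks:
  assumes "gl_valid A G U" "N = msize U + nsize U"
  shows "blocks (msize U) (nsize U) (bp U) (bp' U) (bq U) (br U) (bs U) (bs' U)"
proof -
  have e: "gl_entries G U" and i: "dinv1 U \<in> G False" "dinv2 U \<in> G False" "d1 A U \<otimes> dinv1 U = \<one>" "d2 A U \<otimes> dinv2 U = \<one>"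
    using assms by (auto simp: gl_valid_def)
  note b = block_closed[OF e assms(2)]
  have mN: "msize U \<le> N" "nsize U \<le> N"
    using assms(2) by simp_all
  note d = i(3,4)[unfolded d_block[OF e assms(2)]]
  show ?thesis
    using b padinv[OF b(1) i(1) d(1) mN(1)] padinv[OF b(2) i(2) d(2) mN(2)] mN
    by (auto simp: blocks_def bp'_def bs'_def)
qed

lemma S_block:
  assumes "gl_valid A G U" "N = msize U + nsize U"
  shows "i < msize U \<Longrightarrow> j < msize U \<Longrightarrow> S11 A U i j = bp' U i j"
    and "i < nsize U \<Longrightarrow> j < nsize U \<Longrightarrow> S22 A U i j = bs' U i j"
proof -
  have e: "gl_entries G U"
    using assms by (auto simp: gl_valid_def)
  note b = block_closed[OF e assms(2)]
  show "i < msize U \<Longrightarrow> j < msize U \<Longrightarrow> S11 A U i j = bp' U i j"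
    unfolding S11_def bp'_def padinv_def 
    by simp (intro adj_inv_cong[symmetric], simp add: Fit_entry[OF b(1)], simp_all add: bp_def)
  show "i < nsize U \<Longrightarrow> j < nsize U \<Longrightarrow> S22 A U i j = bs' U i j"
    unfolding S22_def bs'_def padinv_def 
    by simp (intro adj_inv_cong[symmetric], simp add: Fit_entry[OF b(2)], simp_all add: bs_def)
qed

text \<open>This lemma and the next three are one conversion, in the four combinations of padding by
  0 and by the identity: a product with inner size k is an entry of a product in
  \<open>MM\<close>.\<close>

lemma mmul_Cor_Cor:
  assumes "x \<in> Cor p a k" "y \<in> Cor q k c" "k \<le> N"
    "\<And>l. l < k \<Longrightarrow> x' i l = x i l" "\<And>l. l < k \<Longrightarrow> y' l j = y l j"
  shows "mmul A k x' y' i j = (x \<otimes>\<^bsub>MM\<^esub> y) i j"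
  unfolding MM_simps(5) using assms Cor_entry[OF assms(1), THEN G_carrier] Cor_entry[OF assms(2), THEN G_carrier]
  by (intro mmul_restrict[symmetric]) (auto simp: Cor_zero G_carrier)

lemma mmul_Fit_Cor:
  assumes "x \<in> Fit k" "y \<in> Cor q k c" "k \<le> N"
    "\<And>l. l < k \<Longrightarrow> x' i l = x i l" "\<And>l. l < k \<Longrightarrow> y' l j = y l j"
  shows "mmul A k x' y' i j = (x \<otimes>\<^bsub>MM\<^esub> y) i j"
  unfolding MM_simps(5) using assms Fit_entry[OF assms(1), THEN G_carrier] Cor_entry[OF assms(2), THEN G_carrier]
  by (intro mmul_restrict[symmetric]) (auto simp: Cor_zero G_carrier)

lemma mmul_Cor_Fit:
  assumes "x \<in> Cor p a k" "y \<in> Fit k" "k \<le> N"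
    "\<And>l. l < k \<Longrightarrow> x' i l = x i l" "\<And>l. l < k \<Longrightarrow> y' l j = y l j"
  shows "mmul A k x' y' i j = (x \<otimes>\<^bsub>MM\<^esub> y) i j"
  unfolding MM_simps(5) using assms Cor_entry[OF assms(1), THEN G_carrier] Fit_entry[OF assms(2), THEN G_carrier]
  by (intro mmul_restrict[symmetric]) (auto simp: Cor_zero G_carrier)

text \<open>The bound i < k excludes the rows padded by the identity: on the diagonal there the
  product in \<open>MM\<close> is 1, but the sum over l < k is 0.\<close>

lemma mmul_Fit_Fit:
  assumes "x \<in> Fit k" "y \<in> Fit k" "k \<le> N" "i < k"
    "\<And>l. l < k \<Longrightarrow> x' i l = x i l" "\<And>l. l < k \<Longrightarrow> y' l j = y l j"
  shows "mmul A k x' y' i j = (x \<otimes>\<^bsub>MM\<^esub> y) i j"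
  unfolding MM_simps(5) using assms Fit_entry[OF assms(1)] Fit_entry[OF assms(2)]
  by (intro mmul_restrict[symmetric]) (auto simp: Fit_outside MM_simps(2))

text \<open>The dictionary between \<open>matB\<close>, \<open>matC\<close>, written with the sizes
  m and n, and the Schur complements in \<open>MM\<close>. The invertibility of det B and det C and
  their product are then those of \<open>blocks_schur\<close> and \<open>blocks_det\<close>.\<close>

lemma BC_block:
  assumes "gl_valid A G U" "N = msize U + nsize U"
  shows "bB U \<in> Fit (msize U)" "bC U \<in> Fit (nsize U)"
    "i < msize U \<Longrightarrow> j < msize U \<Longrightarrow> matB A U i j = bB U i j"
    "k < nsize U \<Longrightarrow> l < nsize U \<Longrightarrow> matC A U k l = bC U k l"
    "eunit (D (msize U) (bB U))" "eunit (D (nsize U) (bC U))"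
    "D (msize U) (bB U) \<otimes> D (nsize U) (bC U) = d1 A U \<otimes> d2 A U"
proof -
  have e: "gl_entries G U" using assms by (auto simp: gl_valid_def)
  note b = block_closed[OF e assms(2)]
  note bl = valid_blocks[OF assms]
  have F: "bp' U \<in> Fit (msize U)" "bs' U \<in> Fit (nsize U)"
    using bl by (auto simp: blocks_def)
  note cc [simp] = b(1,2)[THEN Fit_carrier] b(3,4)[THEN Cor_carrier] F[THEN Fit_carrier]
  show "bB U \<in> Fit (msize U)" "eunit (D (msize U) (bB U))"
    using blocks_schur[OF bl] by (auto simp: bB_def)
  show "bC U \<in> Fit (nsize U)" "eunit (D (nsize U) (bC U))"
    using blocks_schur[OF blocks_swap[OF bl]] by (auto simp: bC_def)
  show "D (msize U) (bB U) \<otimes> D (nsize U) (bC U) = d1 A U \<otimes> d2 A U"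
    using blocks_det[OF bl] by (simp add: bB_def bC_def d_block[OF e assms(2)])
  have mN: "msize U \<le> N" "nsize U \<le> N" using assms by auto
  have minus: "(x \<ominus>\<^bsub>MM\<^esub> y) i j = x i j \<ominus> y i j" if "y \<in> carrier MM" for x y i j
    using that by (simp add: M.minus_eq MM_simps(4) matring_minus a_minus_def)
  show "matB A U i j = bB U i j" if ij: "i < msize U" "j < msize U"
  proof -
    have 1: "mmul A (nsize U) (Xi12 U) (S22 A U) i l = (bq U \<otimes>\<^bsub>MM\<^esub> bs' U) i l" if "l < nsize U" for l
      using S_block[OF assms] ij that by (intro mmul_Cor_Fit[OF b(3) F(2) mN(2)]) (auto simp: bq_def)
    have "mmul A (nsize U) (mmul A (nsize U) (Xi12 U) (S22 A U)) (Xi21 U) i j = ((bq U \<otimes>\<^bsub>MM\<^esub> bs' U) \<otimes>\<^bsub>MM\<^esub> br U) i j"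
      using ij by (intro mmul_Cor_Cor[OF Cor_Fit[OF b(3) F(2)] b(4) mN(2)] 1) (auto simp: br_def)
    then show ?thesis
      using ij by (simp add: matB_def bB_def minus M.m_assoc) (simp add: bp_def)
  qed
  show "matC A U k l = bC U k l" if kl: "k < nsize U" "l < nsize U"
  proof -
    have 1: "mmul A (msize U) (Xi21 U) (S11 A U) k l' = (br U \<otimes>\<^bsub>MM\<^esub> bp' U) k l'" if "l' < msize U" for l'
      using S_block[OF assms] kl that by (intro mmul_Cor_Fit[OF b(4) F(1) mN(1)]) (auto simp: br_def)
    have "mmul A (msize U) (mmul A (msize U) (Xi21 U) (S11 A U)) (Xi12 U) k l = ((br U \<otimes>\<^bsub>MM\<^esub> bp' U) \<otimes>\<^bsub>MM\<^esub> bq U) k l"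
      using kl by (intro mmul_Cor_Cor[OF Cor_Fit[OF b(4) F(1)] b(3) mN(1)] 1) (auto simp: bq_def)
    then show ?thesis
      using kl by (simp add: matC_def bC_def minus M.m_assoc) (simp add: bs_def)
  qed
qed

lemma det_BC:
  assumes "gl_valid A G U" "N = msize U + nsize U"
  shows "mdet A (msize U) (matB A U) = D (msize U) (bB U)" "mdet A (nsize U) (matC A U) = D (nsize U) (bC U)"
    "Ber A U = D (nsize U) (bs' U) \<otimes> D (msize U) (bB U)"
proof -
  note b = BC_block[OF assms]
  have F: "bs' U \<in> Fit (nsize U)"
    using valid_blocks[OF assms] by (auto simp: blocks_def)
  show 1: "mdet A (msize U) (matB A U) = D (msize U) (bB U)"
    using Fit_entry[OF b(1)] b(3) by (intro mdet_cong) auto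
  show "mdet A (nsize U) (matC A U) = D (nsize U) (bC U)"
    using Fit_entry[OF b(2)] b(4) by (intro mdet_cong) auto
  have "mdet A (nsize U) (S22 A U) = D (nsize U) (bs' U)"
    using Fit_entry[OF F] S_block(2)[OF assms] by (intro mdet_cong) auto
  then show "Ber A U = D (nsize U) (bs' U) \<otimes> D (msize U) (bB U)"
    unfolding Ber_def 1 by simp
qed

text \<open>The sum over k < m + n, cut at m, gives the block formulas. In each block the two
  partial sums are products of padded blocks.\<close>

lemma product_blocks:
  assumes U: "gl_entries G U" and Y: "gl_entries G Y" and Z: "is_product A U Y Z" and N: "N = msize U + nsize U"
  shows "gl_entries G Z"
    and "bp Z = bp U \<otimes>\<^bsub>MM\<^esub> bp Y \<oplus>\<^bsub>MM\<^esub> bq U \<otimes>\<^bsub>MM\<^esub> br Y"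
    and "bq Z = bp U \<otimes>\<^bsub>MM\<^esub> bq Y \<oplus>\<^bsub>MM\<^esub> bq U \<otimes>\<^bsub>MM\<^esub> bs Y"
    and "br Z = br U \<otimes>\<^bsub>MM\<^esub> bp Y \<oplus>\<^bsub>MM\<^esub> bs U \<otimes>\<^bsub>MM\<^esub> br Y"
    and "bs Z = br U \<otimes>\<^bsub>MM\<^esub> bq Y \<oplus>\<^bsub>MM\<^esub> bs U \<otimes>\<^bsub>MM\<^esub> bs Y"
proof -
  let ?m = "msize U" and ?n = "nsize U"
  have s: "msize Y = ?m" "nsize Y = ?n" "msize Z = ?m" "nsize Z = ?n"
    using Z by (auto simp: is_product_def)
  have mN: "?m \<le> N" "?n \<le> N" using N by auto
  have eU: "entry U i j \<in> G ((i < ?m) \<noteq> (j < ?m))" if "i < N" "j < N" for i j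
    using U N that by (auto simp: gl_entries_def)
  have eY: "entry Y i j \<in> G ((i < ?m) \<noteq> (j < ?m))" if "i < N" "j < N" for i j
    using Y N s that by (auto simp: gl_entries_def)
  have eZ: "entry Z i j = mmul A N (entry U) (entry Y) i j" if "i < N" "j < N" for i j
    using Z N s that by (auto simp: is_product_def)
  show Zok: "gl_entries G Z"
    unfolding gl_entries_def s N[symmetric]
  proof (intro allI impI)
    fix i j assume ij: "i < N" "j < N"
    show "entry Z i j \<in> G ((i < ?m) \<noteq> (j < ?m))"
      unfolding eZ[OF ij] mmul_def
    proof (rule G_finsum)
      fix k assume k: "k \<in> {..<N}"
      show "entry U i k \<otimes> entry Y k j \<in> G ((i < ?m) \<noteq> (j < ?m))"
        by (rule G_mult'[OF eU[of i k] eY[of k j]]) (use ij k in auto)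
    qed
  qed
  note bU = block_closed[OF U N] and bY = block_closed[OF Y, unfolded s, OF N] and bZ = block_closed[OF Zok, unfolded s, OF N]
  have split: "entry Z i j = mmul A ?m (entry U) (entry Y) i j \<oplus> mmul A ?n (\<lambda>i l. entry U i (?m + l)) (\<lambda>l j. entry Y (?m + l) j) i j"
    if "i < N" "j < N" for i j
    unfolding eZ[OF that] mmul_def unfolding N using that G_carrier[OF eU] G_carrier[OF eY]
    by (intro finsum_lessThan_add m_closed) (simp_all add: N)
  show "bp Z = bp U \<otimes>\<^bsub>MM\<^esub> bp Y \<oplus>\<^bsub>MM\<^esub> bq U \<otimes>\<^bsub>MM\<^esub> br Y"
  proof (rule Fit_eqI[OF bZ(1) Fit_sum_Cor[OF Fit_mult[OF bU(1) bY(1)] bU(3) bY(4)]])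
    fix i j assume ij: "i < ?m" "j < ?m"
    have lt: "i < N" "j < N"
      using ij N by auto
    have be: "bp Z i j = entry Z (i) (j)"
      using ij s by (auto simp: bp_def block_entries)
    have "mmul A ?m (entry U) (entry Y) i j = (bp U \<otimes>\<^bsub>MM\<^esub> bp Y) i j"
      using ij s by (intro mmul_Fit_Fit[OF bU(1) bY(1) mN(1)]) (auto simp: bp_def block_entries)
    moreover have "mmul A ?n (\<lambda>i l. entry U i (?m + l)) (\<lambda>l j. entry Y (?m + l) j) i j = (bq U \<otimes>\<^bsub>MM\<^esub> br Y) i j"
      using ij s by (intro mmul_Cor_Cor[OF bU(3) bY(4) mN(2)]) (auto simp: bq_def br_def block_entries)
    ultimately show "bp Z i j = (bp U \<otimes>\<^bsub>MM\<^esub> bp Y \<oplus>\<^bsub>MM\<^esub> bq U \<otimes>\<^bsub>MM\<^esub> br Y) i j"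
      using split[OF lt] ij s by (simp add: MM_simps(4) be)
  qed
  have Cor_eqI: "x = y" if "x \<in> Cor True a b" "y \<in> Cor True a b" "\<And>i j. i < a \<Longrightarrow> j < b \<Longrightarrow> x i j = y i j" for x y a b
    using that Cor_zero[OF that(1)] Cor_zero[OF that(2)] by (intro ext) metis
  show "bq Z = bp U \<otimes>\<^bsub>MM\<^esub> bq Y \<oplus>\<^bsub>MM\<^esub> bq U \<otimes>\<^bsub>MM\<^esub> bs Y"
  proof (rule Cor_eqI[OF bZ(3) Cor_add[OF Fit_Cor[OF bU(1) bY(3)] Cor_Fit[OF bU(3) bY(2)]]])
    fix i j assume ij: "i < ?m" "j < ?n"
    have lt: "i < N" "?m + j < N"
      using ij N by auto
    have be: "bq Z i j = entry Z (i) (?m + j)"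
      using ij s by (auto simp: bq_def block_entries)
    have "mmul A ?m (entry U) (entry Y) i (?m + j) = mmul A ?m (entry U) (\<lambda>l j. entry Y l (?m + j)) i j"
      by (simp add: mmul_def)
    also have "\<dots> = (bp U \<otimes>\<^bsub>MM\<^esub> bq Y) i j"
      using ij s by (intro mmul_Fit_Cor[OF bU(1) bY(3) mN(1)]) (auto simp: bp_def bq_def block_entries)
    finally have 1: "mmul A ?m (entry U) (entry Y) i (?m + j) = (bp U \<otimes>\<^bsub>MM\<^esub> bq Y) i j" .
    have "mmul A ?n (\<lambda>i l. entry U i (?m + l)) (\<lambda>l j. entry Y (?m + l) j) i (?m + j) =
        mmul A ?n (\<lambda>i l. entry U i (?m + l)) (\<lambda>l j. entry Y (?m + l) (?m + j)) i j"
      by (simp add: mmul_def)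
    also have "\<dots> = (bq U \<otimes>\<^bsub>MM\<^esub> bs Y) i j"
      using ij s by (intro mmul_Cor_Fit[OF bU(3) bY(2) mN(2)]) (auto simp: bq_def bs_def block_entries)
    finally show "bq Z i j = (bp U \<otimes>\<^bsub>MM\<^esub> bq Y \<oplus>\<^bsub>MM\<^esub> bq U \<otimes>\<^bsub>MM\<^esub> bs Y) i j"
      using split[OF lt] 1 ij s by (simp add: MM_simps(4) be)
  qed
  show "br Z = br U \<otimes>\<^bsub>MM\<^esub> bp Y \<oplus>\<^bsub>MM\<^esub> bs U \<otimes>\<^bsub>MM\<^esub> br Y"
  proof (rule Cor_eqI[OF bZ(4) Cor_add[OF Cor_Fit[OF bU(4) bY(1)] Fit_Cor[OF bU(2) bY(4)]]])
    fix i j assume ij: "i < ?n" "j < ?m"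
    have lt: "?m + i < N" "j < N"
      using ij N by auto
    have be: "br Z i j = entry Z (?m + i) (j)"
      using ij s by (auto simp: br_def block_entries)
    have "mmul A ?m (entry U) (entry Y) (?m + i) j = mmul A ?m (\<lambda>i l. entry U (?m + i) l) (entry Y) i j"
      by (simp add: mmul_def)
    also have "\<dots> = (br U \<otimes>\<^bsub>MM\<^esub> bp Y) i j"
      using ij s by (intro mmul_Cor_Fit[OF bU(4) bY(1) mN(1)]) (auto simp: bp_def br_def block_entries)
    finally have 1: "mmul A ?m (entry U) (entry Y) (?m + i) j = (br U \<otimes>\<^bsub>MM\<^esub> bp Y) i j" .
    have "mmul A ?n (\<lambda>i l. entry U i (?m + l)) (\<lambda>l j. entry Y (?m + l) j) (?m + i) j =
        mmul A ?n (\<lambda>i l. entry U (?m + i) (?m + l)) (\<lambda>l j. entry Y (?m + l) j) i j"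
      by (simp add: mmul_def)
    also have "\<dots> = (bs U \<otimes>\<^bsub>MM\<^esub> br Y) i j"
      using ij s by (intro mmul_Fit_Cor[OF bU(2) bY(4) mN(2)]) (auto simp: br_def bs_def block_entries)
    finally show "br Z i j = (br U \<otimes>\<^bsub>MM\<^esub> bp Y \<oplus>\<^bsub>MM\<^esub> bs U \<otimes>\<^bsub>MM\<^esub> br Y) i j"
      using split[OF lt] 1 ij s by (simp add: MM_simps(4) be)
  qed
  show "bs Z = br U \<otimes>\<^bsub>MM\<^esub> bq Y \<oplus>\<^bsub>MM\<^esub> bs U \<otimes>\<^bsub>MM\<^esub> bs Y"
  proof (rule Fit_eqI[OF bZ(2)])
    have "br U \<otimes>\<^bsub>MM\<^esub> bq Y \<oplus>\<^bsub>MM\<^esub> bs U \<otimes>\<^bsub>MM\<^esub> bs Y = bs U \<otimes>\<^bsub>MM\<^esub> bs Y \<oplus>\<^bsub>MM\<^esub> br U \<otimes>\<^bsub>MM\<^esub> bq Y"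
      using bU bY by (intro M.a_comm M.m_closed) (auto simp: Fit_carrier Cor_carrier)
    then show "br U \<otimes>\<^bsub>MM\<^esub> bq Y \<oplus>\<^bsub>MM\<^esub> bs U \<otimes>\<^bsub>MM\<^esub> bs Y \<in> Fit ?n"
      using Fit_sum_Cor[OF Fit_mult[OF bU(2) bY(2)] bU(4) bY(3)] by simp
    fix i j assume ij: "i < ?n" "j < ?n"
    have lt: "?m + i < N" "?m + j < N"
      using ij N by auto
    have be: "bs Z i j = entry Z (?m + i) (?m + j)"
      using ij s by (auto simp: bs_def block_entries)
    have "mmul A ?m (entry U) (entry Y) (?m + i) (?m + j) = mmul A ?m (\<lambda>i l. entry U (?m + i) l) (\<lambda>l j. entry Y l (?m + j)) i j"
      by (simp add: mmul_def)
    also have "\<dots> = (br U \<otimes>\<^bsub>MM\<^esub> bq Y) i j"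
      using ij s by (intro mmul_Cor_Cor[OF bU(4) bY(3) mN(1)]) (auto simp: bq_def br_def block_entries)
    finally have 1: "mmul A ?m (entry U) (entry Y) (?m + i) (?m + j) = (br U \<otimes>\<^bsub>MM\<^esub> bq Y) i j" .
    have "mmul A ?n (\<lambda>i l. entry U i (?m + l)) (\<lambda>l j. entry Y (?m + l) j) (?m + i) (?m + j) =
        mmul A ?n (\<lambda>i l. entry U (?m + i) (?m + l)) (\<lambda>l j. entry Y (?m + l) (?m + j)) i j"
      by (simp add: mmul_def)
    also have "\<dots> = (bs U \<otimes>\<^bsub>MM\<^esub> bs Y) i j"
      using ij s by (intro mmul_Fit_Fit[OF bU(2) bY(2) mN(2)]) (auto simp: bs_def block_entries)
    finally show "bs Z i j = (br U \<otimes>\<^bsub>MM\<^esub> bq Y \<oplus>\<^bsub>MM\<^esub> bs U \<otimes>\<^bsub>MM\<^esub> bs Y) i j"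
      using split[OF lt] 1 ij s by (simp add: MM_simps(4) be)
  qed
qed

text \<open>The diagonal blocks of a product are p p2 + q r2 and s s2 + r q2, products of units
  perturbed by odd terms. Only afterwards can inverse determinants be chosen for \<open>Z\<close>,
  hence the extra premise of the last claim.\<close>

lemma product_valid:
  assumes U: "gl_valid A G U" and Y: "gl_valid A G Y" and Z: "is_product A U Y Z" and N: "N = msize U + nsize U"
  shows "gl_entries G Z" "eunit (d1 A Z)" "eunit (d2 A Z)"
    and "gl_valid A G Z \<Longrightarrow> Ber A Z = Ber A U \<otimes> Ber A Y"
proof -
  have e: "gl_entries G U" "gl_entries G Y" using U Y by (auto simp: gl_valid_def)
  have s: "msize Y = msize U" "nsize Y = nsize U" "msize Z = msize U" "nsize Z = nsize U"
    using Z by (auto simp: is_product_def)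
  note b = product_blocks[OF e Z N]
  note p = blocks_product[OF valid_blocks[OF U N] valid_blocks[OF Y, unfolded s, OF N]]
  show eZ: "gl_entries G Z" by (rule b)
  show "eunit (d1 A Z)" "eunit (d2 A Z)"
    using p(5,6) d_block[OF eZ, unfolded s, OF N] b by auto
  assume V: "gl_valid A G Z"
  have "bs' Z \<in> Fit (nsize U)" "bs' Z \<otimes>\<^bsub>MM\<^esub> bs Z = \<one>\<^bsub>MM\<^esub>"
    using valid_blocks[OF V, unfolded s, OF N] by (auto simp: blocks_def)
  from p(7)[OF this[unfolded b(5)]] show "Ber A Z = Ber A U \<otimes> Ber A Y"
    unfolding det_BC[OF U N] det_BC[OF Y, unfolded s, OF N] det_BC[OF V, unfolded s, OF N] bB_def b .
qed

text \<open>The inverse \<open>inv\<close> is taken in all of \<open>A\<close>, as in the formulas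
  for S_1(B) and S_2(C). It is even because inverses are unique.\<close>

lemma eunit_inv:
  assumes "eunit u"
  shows "inv u \<in> G False" "u \<otimes> inv u = \<one>" "inv u \<otimes> u = \<one>"
proof -
  obtain v where v: "u \<in> G False" "v \<in> G False" "u \<otimes> v = \<one>"
    using assms by (auto simp: eunit_def)
  then have "v \<otimes> u = \<one>" using even_commute by metis
  with v have "inv u = v" by (intro inv_char) auto
  with v \<open>v \<otimes> u = \<one>\<close> show "inv u \<in> G False" "u \<otimes> inv u = \<one>" "inv u \<otimes> u = \<one>" by auto
qed

section \<open>The inverse matrix and its Berezinian\<close>

definition bB' where "bB' U = padinv (msize U) (bB U) (inv (D (msize U) (bB U)))"
definition bC' where "bC' U = padinv (nsize U) (bC U) (inv (D (nsize U) (bC U)))"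

lemma BC_inverse:
  assumes "gl_valid A G U" "N = msize U + nsize U"
  shows "bB' U \<in> Fit (msize U)" "bB U \<otimes>\<^bsub>MM\<^esub> bB' U = \<one>\<^bsub>MM\<^esub>" "bB' U \<otimes>\<^bsub>MM\<^esub> bB U = \<one>\<^bsub>MM\<^esub>"
    "bC' U \<in> Fit (nsize U)" "bC U \<otimes>\<^bsub>MM\<^esub> bC' U = \<one>\<^bsub>MM\<^esub>" "bC' U \<otimes>\<^bsub>MM\<^esub> bC U = \<one>\<^bsub>MM\<^esub>"
    "i < msize U \<Longrightarrow> j < msize U \<Longrightarrow> S1B A U i j = bB' U i j"
    "k < nsize U \<Longrightarrow> l < nsize U \<Longrightarrow> S2C A U k l = bC' U k l"
proof -
  note b = BC_block[OF assms]
  have mN: "msize U \<le> N" "nsize U \<le> N" using assms(2) by simp_all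
  show "bB' U \<in> Fit (msize U)" "bB U \<otimes>\<^bsub>MM\<^esub> bB' U = \<one>\<^bsub>MM\<^esub>" "bB' U \<otimes>\<^bsub>MM\<^esub> bB U = \<one>\<^bsub>MM\<^esub>"
    unfolding bB'_def using padinv[OF b(1) eunit_inv(1,2)[OF b(5)] mN(1)] by auto
  show "bC' U \<in> Fit (nsize U)" "bC U \<otimes>\<^bsub>MM\<^esub> bC' U = \<one>\<^bsub>MM\<^esub>" "bC' U \<otimes>\<^bsub>MM\<^esub> bC U = \<one>\<^bsub>MM\<^esub>"
    unfolding bC'_def using padinv[OF b(2) eunit_inv(1,2)[OF b(6)] mN(2)] by auto
  show "i < msize U \<Longrightarrow> j < msize U \<Longrightarrow> S1B A U i j = bB' U i j"
    unfolding S1B_def bB'_def padinv_def det_BC[OF assms]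
    by simp (intro adj_inv_cong[symmetric], simp add: Fit_entry[OF b(1)], simp_all add: b(3))
  show "k < nsize U \<Longrightarrow> l < nsize U \<Longrightarrow> S2C A U k l = bC' U k l"
    unfolding S2C_def bC'_def padinv_def det_BC[OF assms]
    by simp (intro adj_inv_cong[symmetric], simp add: Fit_entry[OF b(2)], simp_all add: b(4))
qed

lemma antipode_blocks:
  assumes "gl_valid A G U" "N = msize U + nsize U"
  shows "bp (antipode_data A U) = bB' U" "bs (antipode_data A U) = bC' U"
    "bq (antipode_data A U) = \<ominus>\<^bsub>MM\<^esub> ((bp' U \<otimes>\<^bsub>MM\<^esub> bq U) \<otimes>\<^bsub>MM\<^esub> bC' U)"
    "br (antipode_data A U) = \<ominus>\<^bsub>MM\<^esub> ((bs' U \<otimes>\<^bsub>MM\<^esub> br U) \<otimes>\<^bsub>MM\<^esub> bB' U)"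
    "gl_entries G (antipode_data A U)"
proof -
  let ?m = "msize U" and ?n = "nsize U" and ?A = "antipode_data A U"
  have e: "gl_entries G U" using assms by (auto simp: gl_valid_def)
  note b = block_closed[OF e assms(2)] and i = BC_inverse[OF assms]
  have F: "bp' U \<in> Fit ?m" "bs' U \<in> Fit ?n"
    using valid_blocks[OF assms] by (auto simp: blocks_def)
  have mN: "?m \<le> N" "?n \<le> N" using assms(2) by simp_all
  have [simp]: "msize ?A = ?m" "nsize ?A = ?n" "entry ?A = antipode_matrix A U"
    by (simp_all add: antipode_data_def)
  show 1: "bp ?A = bB' U"
    using i(7) Fit_outside[OF i(1)]
    by (auto simp: bp_def fun_eq_iff block_entries antipode_matrix_def)
  show 2: "bs ?A = bC' U"
    using i(8) Fit_outside[OF i(4)]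
    by (auto simp: bs_def fun_eq_iff block_entries antipode_matrix_def)
  have q: "bp' U \<otimes>\<^bsub>MM\<^esub> bq U \<in> Cor True ?m ?n" and r: "bs' U \<otimes>\<^bsub>MM\<^esub> br U \<in> Cor True ?n ?m"
    using Fit_Cor[OF F(1) b(3)] Fit_Cor[OF F(2) b(4)] by auto
  note q' = Cor_Fit[OF q i(4)] and r' = Cor_Fit[OF r i(1)]
  show 3: "bq ?A = \<ominus>\<^bsub>MM\<^esub> ((bp' U \<otimes>\<^bsub>MM\<^esub> bq U) \<otimes>\<^bsub>MM\<^esub> bC' U)"
  proof (intro ext)
    fix i j
    show "bq ?A i j = (\<ominus>\<^bsub>MM\<^esub> ((bp' U \<otimes>\<^bsub>MM\<^esub> bq U) \<otimes>\<^bsub>MM\<^esub> bC' U)) i j"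
    proof (cases "i < ?m \<and> j < ?n")
      case True
      have 1: "mmul A ?m (S11 A U) (Xi12 U) i l = (bp' U \<otimes>\<^bsub>MM\<^esub> bq U) i l" if "l < ?n" for l
        using S_block[OF assms] True that by (intro mmul_Fit_Cor[OF F(1) b(3) mN(1)]) (auto simp: bq_def)
      have "mmul A ?n (mmul A ?m (S11 A U) (Xi12 U)) (S2C A U) i j = ((bp' U \<otimes>\<^bsub>MM\<^esub> bq U) \<otimes>\<^bsub>MM\<^esub> bC' U) i j"
        using True BC_inverse(8)[OF assms] by (intro mmul_Cor_Fit[OF q i(4) mN(2)] 1) auto
      then show ?thesis
        using True q' by (simp add: matring_minus Cor_carrier bq_def block_entries antipode_matrix_def)
    next
      case False
      then show ?thesis
        using q' by (auto simp: matring_minus Cor_carrier bq_def Cor_zero)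
    qed
  qed
  show 4: "br ?A = \<ominus>\<^bsub>MM\<^esub> ((bs' U \<otimes>\<^bsub>MM\<^esub> br U) \<otimes>\<^bsub>MM\<^esub> bB' U)"
  proof (intro ext)
    fix i j
    show "br ?A i j = (\<ominus>\<^bsub>MM\<^esub> ((bs' U \<otimes>\<^bsub>MM\<^esub> br U) \<otimes>\<^bsub>MM\<^esub> bB' U)) i j"
    proof (cases "i < ?n \<and> j < ?m")
      case True
      have 1: "mmul A ?n (S22 A U) (Xi21 U) i l = (bs' U \<otimes>\<^bsub>MM\<^esub> br U) i l" if "l < ?m" for l
        using S_block[OF assms] True that by (intro mmul_Fit_Cor[OF F(2) b(4) mN(2)]) (auto simp: br_def)
      have "mmul A ?m (mmul A ?n (S22 A U) (Xi21 U)) (S1B A U) i j = ((bs' U \<otimes>\<^bsub>MM\<^esub> br U) \<otimes>\<^bsub>MM\<^esub> bB' U) i j"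
        using True BC_inverse(7)[OF assms] by (intro mmul_Cor_Fit[OF r i(1) mN(1)] 1) auto
      then show ?thesis
        using True r' by (simp add: matring_minus Cor_carrier br_def block_entries antipode_matrix_def)
    next
      case False
      then show ?thesis
        using r' by (auto simp: matring_minus Cor_carrier br_def Cor_zero)
    qed
  qed
  show "gl_entries G ?A"
    unfolding gl_entries_def
  proof (intro allI impI)
    fix i j assume "i < msize ?A + nsize ?A" "j < msize ?A + nsize ?A"
    then show "entry ?A i j \<in> G ((i < msize ?A) \<noteq> (j < msize ?A))"
      using Fit_entry[OF i(1)] Fit_entry[OF i(4)] Cor_entry[OF Cor_minus[OF q']] Cor_entry[OF Cor_minus[OF r']]
      by (subst entry_block) (auto simp: 1 2 3 4)
  qed
qed

definition id_data :: "nat \<Rightarrow> nat \<Rightarrow> 'a gl_data" where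
  "id_data m n = \<lparr>msize = m, nsize = n, entry = (\<lambda>i j. if i = j then \<one> else \<zero>), dinv1 = \<one>, dinv2 = \<one>\<rparr>"

lemma id_data_simps [simp]: "msize (id_data m n) = m" "nsize (id_data m n) = n"
  "entry (id_data m n) = (\<lambda>i j. if i = j then \<one> else \<zero>)" "dinv1 (id_data m n) = \<one>" "dinv2 (id_data m n) = \<one>"
  by (simp_all add: id_data_def)

lemma id_blocks:
  assumes "N = m + n"
  shows "bp (id_data m n) = \<one>\<^bsub>MM\<^esub>" "bs (id_data m n) = \<one>\<^bsub>MM\<^esub>" "bq (id_data m n) = \<zero>\<^bsub>MM\<^esub>" "br (id_data m n) = \<zero>\<^bsub>MM\<^esub>"
proof -
  have mN: "m \<le> N" "n \<le> N" using assms by simp_all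
  show "bp (id_data m n) = \<one>\<^bsub>MM\<^esub>" "bs (id_data m n) = \<one>\<^bsub>MM\<^esub>" "bq (id_data m n) = \<zero>\<^bsub>MM\<^esub>" "br (id_data m n) = \<zero>\<^bsub>MM\<^esub>"
    using mN by (auto simp: bp_def bs_def bq_def br_def block_entries MM_simps(2,3) fun_eq_iff)
qed

lemma id_valid:
  assumes N: "N = m + n"
  shows "gl_valid A G (id_data m n)" "Ber A (id_data m n) = \<one>"
proof -
  have e: "gl_entries G (id_data m n)"
    by (auto simp: gl_entries_def)
  have mN: "m \<le> N" "n \<le> N" using N by simp_all
  show v: "gl_valid A G (id_data m n)"
    using e d_block[OF e, unfolded id_data_simps, OF N]
    by (simp add: gl_valid_def id_blocks[OF N] D_one[OF mN(1)] D_one[OF mN(2)])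
  have "blocks m n \<one>\<^bsub>MM\<^esub> (bp' (id_data m n)) \<zero>\<^bsub>MM\<^esub> \<zero>\<^bsub>MM\<^esub> \<one>\<^bsub>MM\<^esub> (bs' (id_data m n))"
    using valid_blocks[OF v] by (simp add: id_blocks[OF N] N[symmetric])
  then have s: "bs' (id_data m n) = \<one>\<^bsub>MM\<^esub>"
    by (auto simp: blocks_def Fit_carrier)
  have "Ber A (id_data m n) = D n \<one>\<^bsub>MM\<^esub> \<otimes> D m (bB (id_data m n))"
    using det_BC(3)[OF v] by (simp add: s N[symmetric])
  also have "bB (id_data m n) = \<one>\<^bsub>MM\<^esub>"
    by (simp add: bB_def id_blocks[OF N] s M.minus_eq)
  finally show "Ber A (id_data m n) = \<one>"
    by (simp add: D_one mN)
qed

text \<open>By padding, comparison with the identity matrix is an equation for each of the four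
  blocks, and these equations are the conclusions of \<open>blocks_inverse\<close>.\<close>

lemma antipode_product:
  assumes V: "gl_valid A G U" and N: "N = msize U + nsize U"
  shows "is_product A (antipode_data A U) U (id_data (msize U) (nsize U))"
    and "is_product A U (antipode_data A U) (id_data (msize U) (nsize U))"
proof -
  let ?A = "antipode_data A U" and ?I = "id_data (msize U) (nsize U)"
  have s [simp]: "msize ?A = msize U" "nsize ?A = nsize U"
    by (simp_all add: antipode_data_def)
  have e: "gl_entries G U" using V by (auto simp: gl_valid_def)
  note a = antipode_blocks[OF V N] and bl = valid_blocks[OF V N] and I = id_blocks[OF N]
  have NA: "N = msize ?A + nsize ?A" using N by simp
  note i = BC_inverse[OF V N]
  \<comment> \<open>\<open>ib\<close> contains the upper block rows of both products,
    \<open>ib'\<close> the lower ones, read off from the swapped block matrix.\<close>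
  note ib = blocks_inverse[OF bl i(1,4) i(2,3)[unfolded bB_def] i(5,6)[unfolded bC_def]]
  note ib' = blocks_inverse[OF blocks_swap[OF bl] i(4,1) i(5,6)[unfolded bC_def] i(2,3)[unfolded bB_def]]
  \<comment> \<open>The inverse determinants of \<open>P\<close> are placeholders copied from the
    identity; \<open>product_blocks\<close> looks at the entries only.\<close>
  define P where "P = ?I\<lparr>entry := mmul A N (entry ?A) (entry U)\<rparr>"
  have P: "is_product A ?A U P"
    by (simp add: is_product_def P_def N)
  note p = product_blocks[OF a(5) e P NA]
  have [simp]: "bp U \<in> carrier MM" "bq U \<in> carrier MM" "br U \<in> carrier MM" "bs U \<in> carrier MM"
    "bp' U \<in> carrier MM" "bs' U \<in> carrier MM" "bB' U \<in> carrier MM" "bC' U \<in> carrier MM"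
    using bl i by (auto simp: blocks_def Fit_carrier Cor_carrier)
  have "bp P = bp ?I" "bq P = bq ?I" "br P = br ?I" "bs P = bs ?I"
    unfolding p a I using ib ib' by (simp_all add: M.a_comm)
  from entries_eqI[OF this] show "is_product A ?A U ?I"
    by (simp add: is_product_def P_def N)
  define P2 where "P2 = ?I\<lparr>entry := mmul A N (entry U) (entry ?A)\<rparr>"
  have P2: "is_product A U ?A P2"
    by (simp add: is_product_def P2_def N)
  note p = product_blocks[OF e a(5) P2 N]
  have "bp P2 = bp ?I" "bq P2 = bq ?I" "br P2 = br ?I" "bs P2 = bs ?I"
    unfolding p a I using ib ib' by (simp_all add: M.a_comm)
  from entries_eqI[OF this] show "is_product A U ?A ?I"
    by (simp add: is_product_def P2_def N)
qed

text \<open>Ber is a unit because it multiplies with the Berezinian of the inverse matrix to that of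
  the identity. As S22 has determinant inverse to d2, the definition of Ber gives det B = Ber d2,
  and det B det C = d1 d2 then yields det C.\<close>

lemma antipode_valid:
  assumes V: "gl_valid A G U" and N: "N = msize U + nsize U"
  shows "gl_valid A G (antipode_data A U)" "Ber A (antipode_data A U) \<otimes> Ber A U = \<one>"
    "Ber A U \<otimes> Ber A (antipode_data A U) = \<one>" "Ber A U \<in> Units A"
    "mdet A (msize U) (matB A U) = Ber A U \<otimes> d2 A U" "mdet A (nsize U) (matC A U) = inv (Ber A U) \<otimes> d1 A U"
proof -
  let ?A = "antipode_data A U" and ?I = "id_data (msize U) (nsize U)"
  have s [simp]: "msize ?A = msize U" "nsize ?A = nsize U"
    by (simp_all add: antipode_data_def)
  have e: "gl_entries G U" using V by (auto simp: gl_valid_def)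
  have mN: "msize U \<le> N" "nsize U \<le> N" using N by simp_all
  note a = antipode_blocks[OF V N] and i = BC_inverse[OF V N] and b = BC_block[OF V N] and d = det_BC[OF V N]
  have "d1 A ?A = D (msize U) (bB' U)" "d2 A ?A = D (nsize U) (bC' U)"
    using d_block[OF a(5)] N a by simp_all
  moreover have "D (msize U) (bB' U) \<otimes> D (msize U) (bB U) = \<one>" "D (nsize U) (bC' U) \<otimes> D (nsize U) (bC U) = \<one>"
    using i b mN Fit_eunit(1) by blast+
  ultimately show v: "gl_valid A G ?A"
    using a(5) D_even[OF b(1)] D_even[OF b(2)] by (simp add: gl_valid_def) (simp add: antipode_data_def d)
  have NA: "N = msize ?A + nsize ?A" using N by simp
  have I: "gl_valid A G ?I" "Ber A ?I = \<one>" using id_valid[OF N] by auto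
  show 1: "Ber A ?A \<otimes> Ber A U = \<one>"
    using product_valid(4)[OF v V antipode_product(1)[OF V N] NA I(1)] I(2) by simp
  show 2: "Ber A U \<otimes> Ber A ?A = \<one>"
    using product_valid(4)[OF V v antipode_product(2)[OF V N] N I(1)] I(2) by simp
  have s': "bs' U \<in> Fit (nsize U)" "bs U \<in> Fit (nsize U)" "bs' U \<otimes>\<^bsub>MM\<^esub> bs U = \<one>\<^bsub>MM\<^esub>"
    using valid_blocks[OF V N] by (auto simp: blocks_def)
  have d12: "d1 A U \<in> G False" "d2 A U \<in> G False"
    using d_block[OF e N] D_even block_closed[OF e N] by auto
  note ev = D_even[OF s'(1)] D_even[OF b(1)] D_even[OF b(2)] d12
  have B: "Ber A U \<in> G False" using d ev by simp
  have "Ber A ?A \<in> G False"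
    using det_BC(3)[OF v NA] D_even[OF BC_block(1)[OF v NA]] valid_blocks[OF v NA] D_even
    by (auto simp: blocks_def)
  then show U: "Ber A U \<in> Units A"
    using 1 2 B by (auto simp: Units_def)
  have sd: "D (nsize U) (bs' U) \<otimes> d2 A U = \<one>"
    using Fit_eunit(1)[OF s'(1) mN(2) s'(2,3)] d_block[OF e N] by simp
  have "Ber A U \<otimes> d2 A U = D (msize U) (bB U) \<otimes> (D (nsize U) (bs' U) \<otimes> d2 A U)"
    unfolding d using ev E.m_ac by (simp add: m_assoc)
  then show "mdet A (msize U) (matB A U) = Ber A U \<otimes> d2 A U"
    using sd ev d by simp
  have "Ber A U \<otimes> D (nsize U) (bC U) = D (nsize U) (bs' U) \<otimes> (D (msize U) (bB U) \<otimes> D (nsize U) (bC U))"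
    unfolding d using ev by (simp add: m_assoc)
  also have "\<dots> = (D (nsize U) (bs' U) \<otimes> d2 A U) \<otimes> d1 A U"
    unfolding b(7) using ev even_commute[of "d1 A U" "d2 A U" False] by (simp add: m_assoc)
  finally have "Ber A U \<otimes> D (nsize U) (bC U) = d1 A U"
    using sd ev by simp
  then have "inv (Ber A U) \<otimes> d1 A U = inv (Ber A U) \<otimes> (Ber A U \<otimes> D (nsize U) (bC U))"
    by simp
  also have "\<dots> = D (nsize U) (bC U)"
    using U B ev by (simp flip: m_assoc)
  finally show "mdet A (nsize U) (matC A U) = inv (Ber A U) \<otimes> d1 A U"
    unfolding d by simp
qed

end

section \<open>Superalgebras and their quotients\<close>

text \<open>The predicate \<open>superalgebra\<close> merges a field, a ring and a module; the
  separate prefixes \<open>K\<close>, \<open>A\<close> and \<open>M\<close> keep their facts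
  apart.\<close>

locale salg =
  fixes K :: "('k, 'r) ring_scheme" and A :: "('k, 'a, 'z) superalg_scheme" (structure)
  assumes superalgebra: "superalgebra K A"
begin

sublocale K: field K
  using superalgebra by (simp add: superalgebra_def)

sublocale A: ring A
  using superalgebra by (simp add: superalgebra_def)

sublocale M: module K A
  using superalgebra by (simp add: superalgebra_def)

lemmas smult_mult_left = superalgebra.smult_mult_left[OF superalgebra]
lemmas smult_mult_right = superalgebra.smult_mult_right[OF superalgebra]
lemmas grade_submodule = superalgebra.grade_submodule[OF superalgebra]
lemmas grade_one [simp, intro] = superalgebra.grade_one[OF superalgebra]
lemmas grade_mult = superalgebra.grade_mult[OF superalgebra]

lemma grade_carrier: "x \<in> grade A p \<Longrightarrow> x \<in> carrier A"
  using M.submoduleE(1)[OF grade_submodule] by auto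

lemmas [simp] = grade_carrier[of _ False] grade_carrier[of _ True]

lemma grade_zero [simp, intro]: "\<zero> \<in> grade A p"
  using grade_submodule[of p] by (simp add: submodule_def subgroup_def)

lemma grade_add: "x \<in> grade A p \<Longrightarrow> y \<in> grade A p \<Longrightarrow> x \<oplus> y \<in> grade A p"
  using M.submoduleE(5)[OF grade_submodule] .

lemma grade_minus: "x \<in> grade A p \<Longrightarrow> \<ominus> x \<in> grade A p"
  using M.submoduleE(3)[OF grade_submodule] .

lemma grade_smult: "c \<in> carrier K \<Longrightarrow> x \<in> grade A p \<Longrightarrow> c \<odot> x \<in> grade A p"
  using M.submoduleE(4)[OF grade_submodule] .

lemma grade_disjoint: "x \<in> grade A p \<Longrightarrow> x \<in> grade A (\<not> p) \<Longrightarrow> x = \<zero>"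
  using superalgebra.grade_inter[OF superalgebra] by (cases p) auto

lemma grade_decomp:
  assumes "x \<in> carrier A"
  obtains a b where "a \<in> grade A p" "b \<in> grade A (\<not> p)" "x = a \<oplus> b"
proof -
  have "x \<in> grade A False <+>\<^bsub>A\<^esub> grade A True"
    using assms by (subst (asm) superalgebra.grade_sum[OF superalgebra])
  then obtain a b where ab: "a \<in> grade A False" "b \<in> grade A True" "x = a \<oplus> b"
    by (auto simp: set_add_def set_mult_def)
  show ?thesis
  proof (cases p)
    case True
    then show ?thesis
      using ab by (intro that[of b a]) (simp_all add: A.a_comm)
  next
    case False
    then show ?thesis
      using ab by (intro that[of a b]) simp_all
  qed
qed

text \<open>Two candidates for the component differ by an element that is both even and odd, hence
  by zero. So the description in \<open>hcomp\<close> is unique.\<close>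

lemma hcomp_eq:
  assumes "a \<in> grade A p" "b \<in> grade A (\<not> p)"
  shows "hcomp A p (a \<oplus> b) = a"
  unfolding hcomp_def
proof (rule the_equality)
  have c: "a \<in> carrier A" "b \<in> carrier A"
    using assms grade_carrier by auto
  have "a \<oplus> b \<ominus> a = b \<oplus> (a \<oplus> \<ominus> a)"
    using c by (simp add: A.minus_eq A.a_ac)
  then have "a \<oplus> b \<ominus> a = b"
    using c by (simp add: A.r_neg)
  then show "a \<in> grade A p \<and> a \<oplus> b \<ominus> a \<in> grade A (\<not> p)"
    using assms by simp
  fix y assume y: "y \<in> grade A p \<and> a \<oplus> b \<ominus> y \<in> grade A (\<not> p)"
  then have cy: "y \<in> carrier A" using grade_carrier by auto
  have "a \<ominus> y = (a \<oplus> b \<ominus> y) \<oplus> \<ominus> b"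
    using c cy by (simp add: A.minus_eq A.a_ac A.r_neg2 A.r_neg A.l_neg)
  moreover have "(a \<oplus> b \<ominus> y) \<oplus> \<ominus> b \<in> grade A (\<not> p)"
    using y assms by (intro grade_add grade_minus) auto
  moreover have "a \<ominus> y \<in> grade A p"
    unfolding A.minus_eq using y assms by (intro grade_add grade_minus) auto
  ultimately have "a \<ominus> y = \<zero>"
    using grade_disjoint by metis
  then show "y = a"
    using c cy by (simp add: A.r_right_minus_eq)
qed

lemma hcomp_grade: "x \<in> carrier A \<Longrightarrow> hcomp A p x \<in> grade A p"
  by (rule grade_decomp[of x p]) (auto simp: hcomp_eq)

lemma hcomp_closed [simp, intro]: "x \<in> carrier A \<Longrightarrow> hcomp A p x \<in> carrier A"
  using hcomp_grade grade_carrier by blast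

lemma hcomp_sum:
  assumes "x \<in> carrier A"
  shows "hcomp A False x \<oplus> hcomp A True x = x"
proof -
  obtain a b where ab: "a \<in> grade A False" "b \<in> grade A (\<not> False)" "x = a \<oplus> b"
    using grade_decomp[OF assms] .
  moreover have "hcomp A True x = b"
    using ab hcomp_eq[of b True a] A.a_comm[of a b] by simp
  ultimately show ?thesis
    using hcomp_eq[of a False b] by simp
qed

lemma hcomp_add:
  assumes "x \<in> carrier A" "y \<in> carrier A"
  shows "hcomp A p (x \<oplus> y) = hcomp A p x \<oplus> hcomp A p y"
proof -
  obtain a b where ab: "a \<in> grade A p" "b \<in> grade A (\<not> p)" "x = a \<oplus> b"
    using grade_decomp[OF assms(1)] .
  obtain a' b' where ab': "a' \<in> grade A p" "b' \<in> grade A (\<not> p)" "y = a' \<oplus> b'"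
    using grade_decomp[OF assms(2)] .
  have "x \<oplus> y = (a \<oplus> a') \<oplus> (b \<oplus> b')"
    using ab ab' grade_carrier by (simp add: A.a_ac)
  then show ?thesis
    using ab ab' by (simp add: hcomp_eq grade_add)
qed

lemma hcomp_smult:
  assumes "c \<in> carrier K" "x \<in> carrier A"
  shows "hcomp A p (c \<odot> x) = c \<odot> hcomp A p x"
proof -
  obtain a b where ab: "a \<in> grade A p" "b \<in> grade A (\<not> p)" "x = a \<oplus> b"
    using grade_decomp[OF assms(2)] .
  have "c \<odot> x = c \<odot> a \<oplus> c \<odot> b"
    using ab assms grade_carrier by (simp add: M.smult_r_distr)
  then show ?thesis
    using ab assms by (simp add: hcomp_eq grade_smult)
qed

lemma hcomp_same: "x \<in> grade A p \<Longrightarrow> hcomp A p x = x"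
  using hcomp_eq[of x p \<zero>] grade_carrier by simp

lemma hcomp_other: "x \<in> grade A q \<Longrightarrow> q \<noteq> p \<Longrightarrow> hcomp A p x = \<zero>"
  using hcomp_eq[of \<zero> p x] grade_carrier by (cases p; cases q) auto

text \<open>Scalars act through the ring: c x = (c 1) x.\<close>

lemma ideal_submodule:
  assumes "ideal I A"
  shows "submodule I K A"
proof -
  interpret ideal I A by fact
  show ?thesis
  proof (rule M.submoduleI)
    fix c x assume cx: "c \<in> carrier K" "x \<in> I"
    then have "c \<odot> x = (c \<odot> \<one>) \<otimes> x"
      using a_Hcarr by (simp add: smult_mult_left)
    then show "c \<odot> x \<in> I"
      using cx by (simp add: I_l_closed)
  qed (use a_subset in \<open>auto simp: additive_subgroup.a_inv_closed\<close>)
qed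

text \<open>Homogeneity of the ideal, the condition under which the images of the even and the odd
  part meet only in zero in the quotient.\<close>

definition graded_sub :: "'a set \<Rightarrow> bool" where
  "graded_sub I \<longleftrightarrow> (\<forall>x\<in>grade A False. \<forall>y\<in>grade A True. x \<oplus> y \<in> I \<longrightarrow> x \<in> I \<and> y \<in> I)"

text \<open>The elements of the ideal that split into an even and an odd element of the ideal form
  an ideal J again. It contains the homogeneous generators, so J is everything.\<close>

lemma genideal_graded:
  assumes H: "H \<subseteq> grade A False \<union> grade A True"
  shows "graded_sub (Idl H)"
proof -
  have HA: "H \<subseteq> carrier A"
    using H grade_carrier by auto
  interpret I: ideal "Idl H" A
    by (rule A.genideal_ideal[OF HA])
  define J where "J = {x \<oplus> y | x y. x \<in> Idl H \<and> y \<in> Idl H \<and> x \<in> grade A False \<and> y \<in> grade A True}"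
  have JI: "z \<in> J" if "z = x \<oplus> y" "x \<in> grade A False" "y \<in> grade A True" "x \<in> Idl H" "y \<in> Idl H" for x y z
    using that by (auto simp: J_def)
  have JE: thesis if "z \<in> J"
    "\<And>x y. z = x \<oplus> y \<Longrightarrow> x \<in> Idl H \<Longrightarrow> y \<in> Idl H \<Longrightarrow> x \<in> grade A False \<Longrightarrow> y \<in> grade A True \<Longrightarrow> thesis" for z thesis
    using that by (auto simp: J_def)
  have "ideal J A"
  proof (rule idealI)
    show "ring A" by (rule A.ring_axioms)
    show "subgroup J (add_monoid A)"
    proof (rule A.add.subgroupI)
      show "J \<subseteq> carrier A" by (auto elim!: JE)
      have "\<zero> \<in> J" by (rule JI[of _ \<zero> \<zero>]) auto
      then show "J \<noteq> {}" by blast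
    next
      fix a assume "a \<in> J"
      then obtain x y where xy: "a = x \<oplus> y" "x \<in> Idl H" "y \<in> Idl H" "x \<in> grade A False" "y \<in> grade A True"
        by (rule JE)
      then have "\<ominus> a = \<ominus> x \<oplus> \<ominus> y" by (simp add: A.minus_add)
      then show "\<ominus> a \<in> J"
        by (rule JI) (use xy grade_minus in auto)
    next
      fix a b assume "a \<in> J" "b \<in> J"
      then obtain x y x' y' where xy: "a = x \<oplus> y" "x \<in> Idl H" "y \<in> Idl H" "x \<in> grade A False" "y \<in> grade A True"
        "b = x' \<oplus> y'" "x' \<in> Idl H" "y' \<in> Idl H" "x' \<in> grade A False" "y' \<in> grade A True"
        by (metis JE)
      then have "a \<oplus> b = (x \<oplus> x') \<oplus> (y \<oplus> y')" by (simp add: A.a_ac)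
      then show "a \<oplus> b \<in> J"
        by (rule JI) (use xy grade_add in auto)
    qed
  next
    fix a b assume "a \<in> J" and b: "b \<in> carrier A"
    from this(1) obtain x y where xy: "a = x \<oplus> y" "x \<in> Idl H" "y \<in> Idl H" "x \<in> grade A False" "y \<in> grade A True"
      by (rule JE)
    obtain c d where cd: "c \<in> grade A False" "d \<in> grade A True" "b = c \<oplus> d"
      using grade_decomp[OF b, of False] by auto
    have "b \<otimes> a = (c \<otimes> x \<oplus> d \<otimes> y) \<oplus> (c \<otimes> y \<oplus> d \<otimes> x)"
      using xy cd by (simp add: A.l_distr A.r_distr A.a_ac)
    moreover have "c \<otimes> x \<oplus> d \<otimes> y \<in> grade A False" "c \<otimes> y \<oplus> d \<otimes> x \<in> grade A True"
      using xy cd grade_mult[of c False x False] grade_mult[of d True y True]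
        grade_mult[of c False y True] grade_mult[of d True x False] by (auto intro!: grade_add)
    moreover have "c \<otimes> x \<oplus> d \<otimes> y \<in> Idl H" "c \<otimes> y \<oplus> d \<otimes> x \<in> Idl H"
      using xy cd by (auto intro!: I.a_closed I.I_l_closed)
    ultimately show "b \<otimes> a \<in> J" by (rule JI)
    have "a \<otimes> b = (x \<otimes> c \<oplus> y \<otimes> d) \<oplus> (x \<otimes> d \<oplus> y \<otimes> c)"
      using xy cd by (simp add: A.l_distr A.r_distr A.a_ac)
    moreover have "x \<otimes> c \<oplus> y \<otimes> d \<in> grade A False" "x \<otimes> d \<oplus> y \<otimes> c \<in> grade A True"
      using xy cd grade_mult[of x False c False] grade_mult[of y True d True]
        grade_mult[of x False d True] grade_mult[of y True c False] by (auto intro!: grade_add)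
    moreover have "x \<otimes> c \<oplus> y \<otimes> d \<in> Idl H" "x \<otimes> d \<oplus> y \<otimes> c \<in> Idl H"
      using xy cd by (auto intro!: I.a_closed I.I_r_closed)
    ultimately show "a \<otimes> b \<in> J" by (rule JI)
  qed
  moreover have "H \<subseteq> J"
  proof
    fix h assume h: "h \<in> H"
    then have hI: "h \<in> Idl H" using A.genideal_self[OF HA] by auto
    have "h \<in> grade A False \<or> h \<in> grade A True" using h H by auto
    then show "h \<in> J"
      using h hI HA JI[of h h \<zero>] JI[of h \<zero> h] by auto
  qed
  ultimately have IJ: "Idl H \<subseteq> J"
    by (rule A.genideal_minimal)
  show ?thesis
    unfolding graded_sub_def
  proof (intro ballI impI)
    fix a b assume a: "a \<in> grade A False" and b: "b \<in> grade A True" and ab: "a \<oplus> b \<in> Idl H"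
    from subsetD[OF IJ ab]
    obtain x y where xy: "a \<oplus> b = x \<oplus> y" "x \<in> Idl H" "y \<in> Idl H" "x \<in> grade A False" "y \<in> grade A True"
      by (rule JE)
    have "a = x" using hcomp_eq[of a False b] hcomp_eq[of x False y] a b xy by simp
    moreover have "b = y"
      using hcomp_eq[of b True a] hcomp_eq[of y True x] a b xy A.a_comm[of a b] A.a_comm[of x y] by simp
    ultimately show "a \<in> Idl H \<and> b \<in> Idl H" using xy by simp
  qed
qed

end

lemma salgI: "superalgebra K A \<Longrightarrow> salg K A"
  by (simp add: salg_def)

text \<open>Nonassociative algebras, since \<open>free_pairs\<close> becomes associative only modulo \<open>bilinear_rel\<close>.\<close>

locale bilin_alg = module K A
  for K :: "('k, 'r) ring_scheme" and A :: "('k, 'a, 'z) superalg_scheme" (structure) +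
  assumes bmult_closed: "x \<in> carrier A \<Longrightarrow> y \<in> carrier A \<Longrightarrow> x \<otimes> y \<in> carrier A"
    and bone_closed: "\<one> \<in> carrier A"
    and bl_distr: "x \<in> carrier A \<Longrightarrow> y \<in> carrier A \<Longrightarrow> z \<in> carrier A \<Longrightarrow> (x \<oplus> y) \<otimes> z = x \<otimes> z \<oplus> y \<otimes> z"
    and br_distr: "x \<in> carrier A \<Longrightarrow> y \<in> carrier A \<Longrightarrow> z \<in> carrier A \<Longrightarrow> z \<otimes> (x \<oplus> y) = z \<otimes> x \<oplus> z \<otimes> y"
    and bsmult_left: "c \<in> carrier K \<Longrightarrow> x \<in> carrier A \<Longrightarrow> y \<in> carrier A \<Longrightarrow> (c \<odot> x) \<otimes> y = c \<odot> (x \<otimes> y)"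
    and bsmult_right: "c \<in> carrier K \<Longrightarrow> x \<in> carrier A \<Longrightarrow> y \<in> carrier A \<Longrightarrow> x \<otimes> (c \<odot> y) = c \<odot> (x \<otimes> y)"

lemma (in salg) bilin_alg: "bilin_alg K A"
  by unfold_locales (auto simp: smult_mult_left smult_mult_right A.l_distr A.r_distr)

text \<open>The additive part of a quotient comes before its multiplication: for the tensor product,
  calculations in the quotient module are what shows that the bilinear relations are stable under
  multiplication.\<close>

locale mod_quot = module K A for K :: "('k, 'r) ring_scheme" and A :: "('k, 'a, 'z) superalg_scheme" (structure) +
  fixes I :: "'a set"
  assumes I_submodule: "submodule I K A"
begin

abbreviation Q :: "('k, 'a set) superalg" where "Q \<equiv> super_quot A I"

abbreviation proj :: "'a \<Rightarrow> 'a set" where "proj x \<equiv> I +>\<^bsub>A\<^esub> x"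

sublocale S: abelian_subgroup I A
proof (rule abelian_subgroupI3)
  show "additive_subgroup I A"
    using I_submodule by (intro additive_subgroup.intro) (simp add: submodule_def)
  show "abelian_group A" by unfold_locales
qed

lemma I_carrier: "x \<in> I \<Longrightarrow> x \<in> carrier A"
  using S.a_subset by auto

lemma proj_eq_iff:
  assumes "x \<in> carrier A" "y \<in> carrier A"
  shows "proj x = proj y \<longleftrightarrow> x \<ominus> y \<in> I"
proof
  assume "proj x = proj y"
  then have "x \<in> proj y" using S.a_repr_independenceD assms by metis
  then obtain h where "h \<in> I" "x = h \<oplus> y" by (auto simp: a_r_coset_def r_coset_def)
  then show "x \<ominus> y \<in> I"
    using assms I_carrier by (simp add: a_minus_def M.a_assoc M.r_neg)
next
  assume "x \<ominus> y \<in> I"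
  moreover have "x = (x \<ominus> y) \<oplus> y"
    using assms by (simp add: a_minus_def M.a_assoc M.l_neg)
  ultimately have "x \<in> proj y" by (auto simp: a_r_coset_def r_coset_def)
  then show "proj x = proj y" using S.a_repr_independence' assms by metis
qed

lemma proj_memD:
  assumes "x \<in> carrier A" "y \<in> proj x"
  shows "y \<in> carrier A" "proj y = proj x"
proof -
  obtain h where "h \<in> I" "y = h \<oplus> x" using assms by (auto simp: a_r_coset_def r_coset_def)
  then show "y \<in> carrier A" using assms I_carrier by auto
  show "proj y = proj x" using S.a_repr_independence' assms by metis
qed

lemma proj_self: "x \<in> carrier A \<Longrightarrow> x \<in> proj x"
  using S.a_rcos_self .

lemma carrier_Q: "carrier Q = proj ` carrier A"
  by (auto simp: super_quot_def FactRing_def A_RCOSETS_def')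

lemma grade_Q: "grade Q p = proj ` grade A p"
  by (simp add: super_quot_def)

lemma zero_Q: "\<zero>\<^bsub>Q\<^esub> = proj \<zero>"
  by (simp add: super_quot_def FactRing_def M.a_coset_add_zero S.a_subset)

lemma one_Q: "\<one>\<^bsub>Q\<^esub> = proj \<one>"
  by (simp add: super_quot_def FactRing_def)

lemma add_Q: "x \<in> carrier A \<Longrightarrow> y \<in> carrier A \<Longrightarrow> proj x \<oplus>\<^bsub>Q\<^esub> proj y = proj (x \<oplus> y)"
  by (simp add: super_quot_def FactRing_def S.a_rcos_sum)

text \<open>In \<open>super_quot\<close> the scalar multiple is a union over all representatives;
  they all give the same coset because c (a - x) lies in the submodule.\<close>

lemma smult_Q:
  assumes "c \<in> carrier K" "x \<in> carrier A"
  shows "c \<odot>\<^bsub>Q\<^esub> proj x = proj (c \<odot> x)"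
proof -
  have *: "proj (c \<odot> a) = proj (c \<odot> x)" if a: "a \<in> proj x" for a
  proof -
    have ca: "a \<in> carrier A" and i: "a \<ominus> x \<in> I"
      using proj_memD[OF assms(2) a] proj_eq_iff assms by auto
    have "c \<odot> a \<ominus> c \<odot> x = c \<odot> (a \<ominus> x)"
      using ca assms by (simp add: a_minus_def smult_r_distr smult_r_minus)
    then show ?thesis
      using submodule.smult_closed[OF I_submodule assms(1) i] ca assms by (simp add: proj_eq_iff)
  qed
  have "c \<odot>\<^bsub>Q\<^esub> proj x = (\<Union>a\<in>proj x. proj (c \<odot> a))"
    by (simp add: super_quot_def)
  also have "\<dots> = (\<Union>a\<in>proj x. proj (c \<odot> x))"
    by (intro SUP_cong refl *)
  also have "\<dots> = proj (c \<odot> x)"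
    using proj_self[OF assms(2)] by blast
  finally show ?thesis .
qed

lemma quot_module: "module K Q"
proof (rule moduleI)
  show "cring K" by (rule R.cring_axioms)
  show "abelian_group Q"
  proof (rule abelian_groupI)
    fix x assume "x \<in> carrier Q"
    then obtain a where a: "a \<in> carrier A" "x = proj a" by (auto simp: carrier_Q)
    then show "\<exists>y\<in>carrier Q. y \<oplus>\<^bsub>Q\<^esub> x = \<zero>\<^bsub>Q\<^esub>"
      by (intro bexI[of _ "proj (\<ominus> a)"]) (auto simp: add_Q zero_Q carrier_Q M.l_neg)
  qed (auto simp: carrier_Q add_Q zero_Q M.a_ac)
qed (auto simp: carrier_Q add_Q smult_Q smult_l_distr smult_r_distr smult_assoc1)

lemma minus_Q: "x \<in> carrier A \<Longrightarrow> \<ominus>\<^bsub>Q\<^esub> proj x = proj (\<ominus> x)"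
proof -
  interpret Q: module K Q by (rule quot_module)
  assume "x \<in> carrier A"
  then show ?thesis
    by (intro Q.M.minus_equality) (auto simp: carrier_Q add_Q zero_Q M.l_neg)
qed

lemma proj_zero_iff: "x \<in> carrier A \<Longrightarrow> proj x = \<zero>\<^bsub>Q\<^esub> \<longleftrightarrow> x \<in> I"
  by (simp add: zero_Q proj_eq_iff a_minus_def M.minus_equality[of "\<zero>" "\<zero>"])

end

locale alg_quot = bilin_alg K A + mod_quot K A I
  for K :: "('k, 'r) ring_scheme" and A :: "('k, 'a, 'z) superalg_scheme" (structure) and I :: "'a set" +
  assumes I_left: "a \<in> carrier A \<Longrightarrow> x \<in> I \<Longrightarrow> a \<otimes> x \<in> I"
    and I_right: "a \<in> carrier A \<Longrightarrow> x \<in> I \<Longrightarrow> x \<otimes> a \<in> I"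
begin

text \<open>The product of cosets is a union over pairs of representatives. It is one coset since a
  b - x y = (a - x) b + x (b - y) lies in \<open>I\<close>; associativity does not enter, so that
  \<open>free_pairs\<close> is covered.\<close>

lemma mult_Q:
  assumes "x \<in> carrier A" "y \<in> carrier A"
  shows "proj x \<otimes>\<^bsub>Q\<^esub> proj y = proj (x \<otimes> y)"
proof -
  have *: "proj (a \<otimes> b) = proj (x \<otimes> y)" if ab: "a \<in> proj x" "b \<in> proj y" for a b
  proof -
    have c: "a \<in> carrier A" "b \<in> carrier A" and i: "a \<ominus> x \<in> I" "b \<ominus> y \<in> I"
      using proj_memD[OF assms(1) ab(1)] proj_memD[OF assms(2) ab(2)] proj_eq_iff assms by auto
    have "a \<otimes> b = ((a \<ominus> x) \<oplus> x) \<otimes> b" "x \<otimes> b = x \<otimes> ((b \<ominus> y) \<oplus> y)"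
      using c assms by (simp_all add: a_minus_def M.a_assoc M.l_neg)
    then have "a \<otimes> b = (a \<ominus> x) \<otimes> b \<oplus> (x \<otimes> (b \<ominus> y) \<oplus> x \<otimes> y)"
      using c assms by (simp add: bl_distr br_distr)
    then have "a \<otimes> b \<ominus> x \<otimes> y = (a \<ominus> x) \<otimes> b \<oplus> x \<otimes> (b \<ominus> y)"
      using c assms by (simp add: bmult_closed a_minus_def[of _ _ "x \<otimes> y"] M.a_assoc M.r_neg)
    moreover have "(a \<ominus> x) \<otimes> b \<oplus> x \<otimes> (b \<ominus> y) \<in> I"
      using I_left I_right i c assms by auto
    ultimately show ?thesis
      using c assms by (simp add: proj_eq_iff bmult_closed)
  qed
  have "proj x \<otimes>\<^bsub>Q\<^esub> proj y = (\<Union>a\<in>proj x. \<Union>b\<in>proj y. proj (a \<otimes> b))"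
    by (simp add: super_quot_def FactRing_def rcoset_mult_def)
  also have "\<dots> = (\<Union>a\<in>proj x. \<Union>b\<in>proj y. proj (x \<otimes> y))"
    by (intro SUP_cong refl *)
  also have "\<dots> = proj (x \<otimes> y)"
    using proj_self[OF assms(1)] proj_self[OF assms(2)] by blast
  finally show ?thesis .
qed

lemma quot_bilin: "bilin_alg K Q"
proof -
  interpret Q: module K Q by (rule quot_module)
  show ?thesis
    by unfold_locales (auto simp: carrier_Q add_Q smult_Q mult_Q one_Q bmult_closed bone_closed
      bl_distr br_distr bsmult_left bsmult_right)
qed

end

lemma (in salg) quot_superalgebra:
  assumes I: "ideal I A" and gr: "graded_sub I"
  shows "alg_quot K A I" "superalgebra K (super_quot A I)" "(\<lambda>x. I +>\<^bsub>A\<^esub> x) \<in> superalg_hom K A (super_quot A I)"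
proof -
  interpret I: ideal I A by (rule I)
  interpret B: bilin_alg K A by (rule bilin_alg)
  interpret alg_quot K A I
  proof (intro alg_quot.intro alg_quot_axioms.intro mod_quot.intro mod_quot_axioms.intro)
    show "bilin_alg K A" by (rule bilin_alg)
    show "module K A" by (rule M.module_axioms)
    show "submodule I K A" by (rule ideal_submodule[OF I])
    show "a \<otimes> x \<in> I" "x \<otimes> a \<in> I" if "a \<in> carrier A" "x \<in> I" for a x
      by (rule I.I_l_closed[OF that(2,1)], rule I.I_r_closed[OF that(2,1)])
  qed
  show "alg_quot K A I" by unfold_locales
  interpret Q: module K Q by (rule quot_module)
  interpret QB: bilin_alg K Q by (rule quot_bilin)
  have ring: "ring Q"
  proof (rule ringI)
    show "abelian_group Q" by unfold_locales
    show "Group.monoid Q"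
      by (rule monoidI) (auto simp: carrier_Q mult_Q one_Q A.m_assoc)
  qed (auto simp: QB.bl_distr QB.br_distr)
  show "superalgebra K Q"
  proof (intro superalgebra.intro superalgebra_axioms.intro)
    show "module K Q" by (rule quot_module)
    show "field K" by (rule K.field_axioms)
    show "ring Q" by (rule ring)
    show "submodule (grade Q p) K Q" for p
    proof (rule Q.submoduleI)
      show "\<zero>\<^bsub>Q\<^esub> \<in> grade Q p" by (auto simp: grade_Q zero_Q)
      show "grade Q p \<subseteq> carrier Q" using grade_carrier by (auto simp: grade_Q carrier_Q)
      fix a b assume "a \<in> grade Q p" "b \<in> grade Q p"
      then show "a \<oplus>\<^bsub>Q\<^esub> b \<in> grade Q p"
        using grade_carrier grade_add by (auto simp: grade_Q add_Q)
    next
      fix a assume "a \<in> grade Q p"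
      then show "\<ominus>\<^bsub>Q\<^esub> a \<in> grade Q p"
        using grade_carrier grade_minus by (auto simp: grade_Q minus_Q)
    next
      fix c a assume "c \<in> carrier K" "a \<in> grade Q p"
      then show "c \<odot>\<^bsub>Q\<^esub> a \<in> grade Q p"
        using grade_carrier grade_smult by (auto simp: grade_Q smult_Q)
    qed
    show "carrier Q = grade Q False <+>\<^bsub>Q\<^esub> grade Q True"
    proof (intro equalityI subsetI)
      fix x assume "x \<in> carrier Q"
      then obtain a where a: "a \<in> carrier A" "x = proj a" by (auto simp: carrier_Q)
      then have "x = proj (hcomp A False a) \<oplus>\<^bsub>Q\<^esub> proj (hcomp A True a)"
        by (simp add: add_Q hcomp_sum)
      then show "x \<in> grade Q False <+>\<^bsub>Q\<^esub> grade Q True"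
        using hcomp_grade[OF a(1), of False] hcomp_grade[OF a(1), of True]
        unfolding set_add_def set_mult_def grade_Q by auto
    next
      fix x assume "x \<in> grade Q False <+>\<^bsub>Q\<^esub> grade Q True"
      then obtain a b where "a \<in> grade A False" "b \<in> grade A True" "x = proj a \<oplus>\<^bsub>Q\<^esub> proj b"
        unfolding set_add_def set_mult_def grade_Q by auto
      then show "x \<in> carrier Q"
        by (simp add: add_Q carrier_Q)
    qed
    show "grade Q False \<inter> grade Q True = {\<zero>\<^bsub>Q\<^esub>}"
    proof (intro equalityI subsetI)
      fix z assume "z \<in> grade Q False \<inter> grade Q True"
      then obtain x y where xy: "z = proj x" "z = proj y" "x \<in> grade A False" "y \<in> grade A True"
        by (auto simp: grade_Q)
      \<comment> \<open>An even x and an odd y represent the same coset. Their difference lies in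
        the homogeneous ideal, so x itself does.\<close>
      then have "x \<oplus> \<ominus> y \<in> I" using proj_eq_iff[of x y] by (simp add: a_minus_def)
      then have "x \<in> I" using gr xy grade_minus[of y True] unfolding graded_sub_def by blast
      then show "z \<in> {\<zero>\<^bsub>Q\<^esub>}" using xy proj_zero_iff by simp
    qed (auto simp: grade_Q zero_Q)
    show "\<one>\<^bsub>Q\<^esub> \<in> grade Q False" by (auto simp: grade_Q one_Q)
    show "x \<otimes>\<^bsub>Q\<^esub> y \<in> grade Q (p \<noteq> q)" if "x \<in> grade Q p" "y \<in> grade Q q" for x y p q
      using that grade_mult grade_carrier by (auto simp: grade_Q mult_Q)
  qed (auto simp: QB.bsmult_left QB.bsmult_right)
  show "proj \<in> superalg_hom K A Q"
    by (auto simp: superalg_hom_def Ring.ring_hom_def even_linear_def carrier_Q mult_Q add_Q one_Q smult_Q grade_Q)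
qed

section \<open>Homomorphisms, generators and supercommutativity\<close>

lemma superalg_homD:
  assumes "h \<in> superalg_hom K A B"
  shows "x \<in> carrier A \<Longrightarrow> h x \<in> carrier B"
    and "x \<in> carrier A \<Longrightarrow> y \<in> carrier A \<Longrightarrow> h (x \<oplus>\<^bsub>A\<^esub> y) = h x \<oplus>\<^bsub>B\<^esub> h y"
    and "x \<in> carrier A \<Longrightarrow> y \<in> carrier A \<Longrightarrow> h (x \<otimes>\<^bsub>A\<^esub> y) = h x \<otimes>\<^bsub>B\<^esub> h y"
    and "h \<one>\<^bsub>A\<^esub> = \<one>\<^bsub>B\<^esub>"
    and "c \<in> carrier K \<Longrightarrow> x \<in> carrier A \<Longrightarrow> h (c \<odot>\<^bsub>A\<^esub> x) = c \<odot>\<^bsub>B\<^esub> h x"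
    and "x \<in> grade A p \<Longrightarrow> h x \<in> grade B p"
    and "h \<in> ring_hom A B"
  using assms by (auto simp: superalg_hom_def Ring.ring_hom_def even_linear_def)

lemma superalg_homI:
  assumes "\<And>x. x \<in> carrier A \<Longrightarrow> h x \<in> carrier B"
    and "\<And>x y. x \<in> carrier A \<Longrightarrow> y \<in> carrier A \<Longrightarrow> h (x \<oplus>\<^bsub>A\<^esub> y) = h x \<oplus>\<^bsub>B\<^esub> h y"
    and "\<And>x y. x \<in> carrier A \<Longrightarrow> y \<in> carrier A \<Longrightarrow> h (x \<otimes>\<^bsub>A\<^esub> y) = h x \<otimes>\<^bsub>B\<^esub> h y"
    and "h \<one>\<^bsub>A\<^esub> = \<one>\<^bsub>B\<^esub>"
    and "\<And>c x. c \<in> carrier K \<Longrightarrow> x \<in> carrier A \<Longrightarrow> h (c \<odot>\<^bsub>A\<^esub> x) = c \<odot>\<^bsub>B\<^esub> h x"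
    and "\<And>x p. x \<in> grade A p \<Longrightarrow> h x \<in> grade B p"
  shows "h \<in> superalg_hom K A B"
  using assms by (auto simp: superalg_hom_def Ring.ring_hom_def even_linear_def)

lemma superalg_hom_zero:
  assumes "salg K A" "salg K B" "h \<in> superalg_hom K A B"
  shows "h \<zero>\<^bsub>A\<^esub> = \<zero>\<^bsub>B\<^esub>"
proof -
  interpret A: salg K A by fact
  interpret B: salg K B by fact
  show ?thesis
    using superalg_homD(7)[OF assms(3)] A.A.ring_axioms B.A.ring_axioms by (rule ring_hom_zero)
qed

lemma superalg_hom_minus:
  assumes "salg K A" "salg K B" "h \<in> superalg_hom K A B" "x \<in> carrier A"
  shows "h (\<ominus>\<^bsub>A\<^esub> x) = \<ominus>\<^bsub>B\<^esub> h x"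
proof -
  interpret A: salg K A by fact
  interpret B: salg K B by fact
  interpret ring_hom_ring A B h
    using superalg_homD(7)[OF assms(3)] A.A.ring_axioms B.A.ring_axioms by (intro ring_hom_ringI2)
  show ?thesis using assms by simp
qed

lemma superalg_hom_compose:
  assumes "h \<in> superalg_hom K A B" "g \<in> superalg_hom K B C"
  shows "(\<lambda>x. g (h x)) \<in> superalg_hom K A C"
  by (rule superalg_homI) (simp_all add: superalg_homD[OF assms(1)] superalg_homD[OF assms(2)])

text \<open>Stated as an induction principle, in place of an explicitly built subalgebra. Closure is
  asked on \<open>U \<inter> carrier A\<close> only, as the operations are unspecified
  elsewhere.\<close>

definition generates :: "('k, 'r) ring_scheme \<Rightarrow> ('k, 'a, 'z) superalg_scheme \<Rightarrow> 'a set \<Rightarrow> bool" where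
  "generates K A \<Gamma> \<longleftrightarrow> \<Gamma> \<subseteq> carrier A \<and> (\<forall>U. \<Gamma> \<subseteq> U \<longrightarrow> \<one>\<^bsub>A\<^esub> \<in> U \<longrightarrow>
     (\<forall>x\<in>U \<inter> carrier A. \<forall>y\<in>U \<inter> carrier A. x \<oplus>\<^bsub>A\<^esub> y \<in> U \<and> x \<otimes>\<^bsub>A\<^esub> y \<in> U) \<longrightarrow>
     (\<forall>c\<in>carrier K. \<forall>x\<in>U \<inter> carrier A. c \<odot>\<^bsub>A\<^esub> x \<in> U) \<longrightarrow> carrier A \<subseteq> U)"

lemma generates_induct [consumes 2, case_names gen one add mult smult]:
  assumes "generates K A \<Gamma>" "x \<in> carrier A"
    and "\<And>x. x \<in> \<Gamma> \<Longrightarrow> P x" "P \<one>\<^bsub>A\<^esub>"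
    and "\<And>x y. x \<in> carrier A \<Longrightarrow> y \<in> carrier A \<Longrightarrow> P x \<Longrightarrow> P y \<Longrightarrow> P (x \<oplus>\<^bsub>A\<^esub> y)"
    and "\<And>x y. x \<in> carrier A \<Longrightarrow> y \<in> carrier A \<Longrightarrow> P x \<Longrightarrow> P y \<Longrightarrow> P (x \<otimes>\<^bsub>A\<^esub> y)"
    and "\<And>c x. c \<in> carrier K \<Longrightarrow> x \<in> carrier A \<Longrightarrow> P x \<Longrightarrow> P (c \<odot>\<^bsub>A\<^esub> x)"
  shows "P x"
proof -
  have "carrier A \<subseteq> {x. P x}"
    using assms(1)[unfolded generates_def, THEN conjunct2, rule_format, of "{x. P x}"] assms(3-7) by auto
  with assms(2) show ?thesis by auto
qed

lemma hom_eq_on_generators: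
  assumes "generates K A \<Gamma>" "h \<in> superalg_hom K A B" "g \<in> superalg_hom K A B"
    and "\<And>x. x \<in> \<Gamma> \<Longrightarrow> h x = g x" "x \<in> carrier A"
  shows "h x = g x"
  using assms(1,5)
proof (induction rule: generates_induct)
  case (gen x)
  then show ?case by (rule assms(4))
next
  case one
  then show ?case by (simp only: superalg_homD(4)[OF assms(2)] superalg_homD(4)[OF assms(3)])
next
  case (add x y)
  then show ?case by (simp only: superalg_homD(2)[OF assms(2)] superalg_homD(2)[OF assms(3)])
next
  case (mult x y)
  then show ?case by (simp only: superalg_homD(3)[OF assms(2)] superalg_homD(3)[OF assms(3)])
next
  case (smult c x)
  then show ?case by (simp only: superalg_homD(5)[OF assms(2)] superalg_homD(5)[OF assms(3)])
qed

text \<open>Vanishing squares of odd elements are part of the notion, as in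
  \<open>supercomm_ideal\<close>; in characteristic 2 the sign rule does not imply them.\<close>

definition supercommutative :: "('k, 'a, 'z) superalg_scheme \<Rightarrow> bool" where
  "supercommutative A \<longleftrightarrow>
    (\<forall>p q x y. x \<in> grade A p \<longrightarrow> y \<in> grade A q \<longrightarrow> x \<otimes>\<^bsub>A\<^esub> y = neg_if A (p \<and> q) (y \<otimes>\<^bsub>A\<^esub> x)) \<and>
    (\<forall>x. x \<in> grade A True \<longrightarrow> x \<otimes>\<^bsub>A\<^esub> x = \<zero>\<^bsub>A\<^esub>)"

lemma supercommutativeD:
  assumes "supercommutative A"
  shows "x \<in> grade A p \<Longrightarrow> y \<in> grade A q \<Longrightarrow> x \<otimes>\<^bsub>A\<^esub> y = neg_if A (p \<and> q) (y \<otimes>\<^bsub>A\<^esub> x)"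
    and "x \<in> grade A True \<Longrightarrow> x \<otimes>\<^bsub>A\<^esub> x = \<zero>\<^bsub>A\<^esub>"
  using assms unfolding supercommutative_def by blast+

lemma (in salg) super_ring:
  assumes "supercommutative A"
  shows "super_ring A (grade A)"
proof (intro super_ring.intro super_ring_axioms.intro A.ring_axioms)
  show "grade A p \<subseteq> carrier A" for p
    using grade_carrier by auto
  show "x \<otimes> y = neg_if A (p \<and> q) (y \<otimes> x)" if "x \<in> grade A p" "y \<in> grade A q" for x y p q
    by (rule supercommutativeD(1)[OF assms that])
  show "x \<otimes> x = \<zero>" if "x \<in> grade A True" for x
    by (rule supercommutativeD(2)[OF assms that])
  show "x \<otimes> y \<in> grade A (p \<noteq> q)" if "x \<in> grade A p" "y \<in> grade A q" for x y p q
    by (rule grade_mult[OF that])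
qed (simp_all add: grade_add grade_minus)

lemma (in ring) neg_if_closed: "x \<in> carrier R \<Longrightarrow> neg_if R c x \<in> carrier R"
  by (simp add: neg_if_def)

context salg
begin

lemma quot_supercommutative:
  assumes "supercommutative A" and I: "ideal I A" "graded_sub I"
  shows "supercommutative (super_quot A I)"
proof -
  interpret alg_quot K A I by (rule quot_superalgebra(1)[OF I])
  have "proj (neg_if A c x) = neg_if Q c (proj x)" if "x \<in> carrier A" for c x
    using that by (simp add: neg_if_def minus_Q)
  note neg = this
  show ?thesis
    unfolding supercommutative_def
  proof (intro conjI allI impI)
    fix p q x y assume "x \<in> grade Q p" "y \<in> grade Q q"
    then obtain a b where ab: "a \<in> grade A p" "b \<in> grade A q" "x = proj a" "y = proj b"
      by (auto simp: grade_Q)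
    then have "proj (a \<otimes> b) = neg_if Q (p \<and> q) (proj (b \<otimes> a))"
      using supercommutativeD(1)[OF assms(1) ab(1,2)] neg[of "b \<otimes> a" "p \<and> q"] grade_carrier by simp
    then show "x \<otimes>\<^bsub>Q\<^esub> y = neg_if Q (p \<and> q) (y \<otimes>\<^bsub>Q\<^esub> x)"
      using ab grade_carrier by (simp add: mult_Q)
  next
    fix x assume "x \<in> grade Q True"
    then obtain a where a: "a \<in> grade A True" "x = proj a"
      by (auto simp: grade_Q)
    then show "x \<otimes>\<^bsub>Q\<^esub> x = \<zero>\<^bsub>Q\<^esub>"
      using supercommutativeD(2)[OF assms(1) a(1)] by (simp add: mult_Q zero_Q)
  qed
qed

lemma quot_generates:
  assumes "generates K A \<Gamma>" and I: "ideal I A" "graded_sub I"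
  shows "generates K (super_quot A I) ((\<lambda>x. I +>\<^bsub>A\<^esub> x) ` \<Gamma>)"
proof -
  interpret alg_quot K A I by (rule quot_superalgebra(1)[OF I])
  have \<Gamma>: "\<Gamma> \<subseteq> carrier A"
    using assms(1) by (simp add: generates_def)
  show ?thesis
    unfolding generates_def
  proof (intro conjI allI impI)
    show "proj ` \<Gamma> \<subseteq> carrier Q"
      using \<Gamma> by (auto simp: carrier_Q)
    fix U assume U: "proj ` \<Gamma> \<subseteq> U" "\<one>\<^bsub>Q\<^esub> \<in> U"
      "\<forall>x\<in>U \<inter> carrier Q. \<forall>y\<in>U \<inter> carrier Q. x \<oplus>\<^bsub>Q\<^esub> y \<in> U \<and> x \<otimes>\<^bsub>Q\<^esub> y \<in> U"
      "\<forall>c\<in>carrier K. \<forall>x\<in>U \<inter> carrier Q. c \<odot>\<^bsub>Q\<^esub> x \<in> U"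
    have "proj x \<in> U" if "x \<in> carrier A" for x
      using assms(1) that
    proof (induction rule: generates_induct)
      case (add x y)
      then show ?case using U(3) by (auto simp: carrier_Q simp flip: add_Q)
    next
      case (mult x y)
      then show ?case using U(3) by (auto simp: carrier_Q simp flip: mult_Q)
    next
      case (smult c x)
      then show ?case using U(4) by (auto simp: carrier_Q simp flip: smult_Q)
    qed (use U(1,2) in \<open>auto simp: one_Q\<close>)
    then show "carrier Q \<subseteq> U" by (auto simp: carrier_Q)
  qed
qed

text \<open>The induced map evaluates \<open>h\<close> at a chosen representative. Representatives
  differ by elements of \<open>I\<close>, which \<open>h\<close> sends to zero.\<close>

lemma quot_lift:
  assumes B: "salg K B" and h: "h \<in> superalg_hom K A B" and I: "ideal I A" "graded_sub I"
    and zero: "\<And>x. x \<in> I \<Longrightarrow> h x = \<zero>\<^bsub>B\<^esub>"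
  obtains g where "g \<in> superalg_hom K (super_quot A I) B" "\<And>x. x \<in> carrier A \<Longrightarrow> g (I +>\<^bsub>A\<^esub> x) = h x"
proof -
  interpret alg_quot K A I by (rule quot_superalgebra(1)[OF I])
  interpret B: salg K B by (rule B)
  define g where "g Y = h (SOME x. x \<in> Y)" for Y
  have g: "g (proj x) = h x" if x: "x \<in> carrier A" for x
  proof -
    define y where "y = (SOME y. y \<in> proj x)"
    have "y \<in> proj x" unfolding y_def using proj_self[OF x] by (rule someI)
    then have y: "y \<in> carrier A" "y \<ominus> x \<in> I"
      using proj_memD[OF x] proj_eq_iff x by auto
    have "y = (y \<ominus> x) \<oplus> x"
      using x y(1) by (simp add: A.minus_eq A.a_assoc A.l_neg)
    then have "h y = h (y \<ominus> x) \<oplus>\<^bsub>B\<^esub> h x"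
      using superalg_homD(2)[OF h, of "y \<ominus> x" x] x y by simp
    then show ?thesis
      using zero[OF y(2)] superalg_homD(1)[OF h x] by (simp add: g_def y_def)
  qed
  have "g \<in> superalg_hom K Q B"
    by (rule superalg_homI)
      (auto simp: carrier_Q grade_Q add_Q mult_Q one_Q smult_Q g superalg_homD[OF h] grade_carrier)
  then show ?thesis using g that by blast
qed

lemma hom_kills_genideal:
  assumes B: "salg K B" and h: "h \<in> superalg_hom K A B" and H: "H \<subseteq> carrier A"
    and zero: "\<And>x. x \<in> H \<Longrightarrow> h x = \<zero>\<^bsub>B\<^esub>" and x: "x \<in> Idl H"
  shows "h x = \<zero>\<^bsub>B\<^esub>"
proof -
  interpret B: salg K B by (rule B)
  interpret ring_hom_ring A B h
    using superalg_homD(7)[OF h] A.ring_axioms B.A.ring_axioms by (intro ring_hom_ringI2)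
  have "H \<subseteq> a_kernel A B h"
    using H zero unfolding a_kernel_def' by blast
  from A.genideal_minimal[OF kernel_is_ideal this] x show ?thesis
    unfolding a_kernel_def' by blast
qed

end

section \<open>Free modules\<close>

text \<open>The linear extension of a map from a basis. The sum is the one in
  \<open>tens_lift\<close> after the choice of a representative, so that facts about
  \<open>lin_ext\<close> carry over.\<close>

definition lin_ext ::
  "('k, 'r) ring_scheme \<Rightarrow> ('k, 'm, 'z) module_scheme \<Rightarrow> ('s \<Rightarrow> 'm) \<Rightarrow> ('s \<Rightarrow> 'k) \<Rightarrow> 'm" where
  "lin_ext K M \<beta> f = (\<Oplus>\<^bsub>M\<^esub>s\<in>{s. f s \<noteq> \<zero>\<^bsub>K\<^esub>}. f s \<odot>\<^bsub>M\<^esub> \<beta> s)"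

definition spans :: "('k, 'r) ring_scheme \<Rightarrow> ('k, 'm, 'z) module_scheme \<Rightarrow> 'm set \<Rightarrow> bool" where
  "spans K M \<Gamma> \<longleftrightarrow> \<Gamma> \<subseteq> carrier M \<and> (\<forall>U. \<Gamma> \<subseteq> U \<longrightarrow> \<zero>\<^bsub>M\<^esub> \<in> U \<longrightarrow>
     (\<forall>x\<in>U \<inter> carrier M. \<forall>y\<in>U \<inter> carrier M. x \<oplus>\<^bsub>M\<^esub> y \<in> U) \<longrightarrow>
     (\<forall>c\<in>carrier K. \<forall>x\<in>U \<inter> carrier M. c \<odot>\<^bsub>M\<^esub> x \<in> U) \<longrightarrow> carrier M \<subseteq> U)"

lemma spans_induct [consumes 2, case_names gen zero add smult]:
  assumes "spans K M \<Gamma>" "x \<in> carrier M"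
    and "\<And>x. x \<in> \<Gamma> \<Longrightarrow> P x" "P \<zero>\<^bsub>M\<^esub>"
    and "\<And>x y. x \<in> carrier M \<Longrightarrow> y \<in> carrier M \<Longrightarrow> P x \<Longrightarrow> P y \<Longrightarrow> P (x \<oplus>\<^bsub>M\<^esub> y)"
    and "\<And>c x. c \<in> carrier K \<Longrightarrow> x \<in> carrier M \<Longrightarrow> P x \<Longrightarrow> P (c \<odot>\<^bsub>M\<^esub> x)"
  shows "P x"
proof -
  have "carrier M \<subseteq> {x. P x}"
    using assms(1)[unfolded spans_def, THEN conjunct2, rule_format, of "{x. P x}"] assms(3-6) by auto
  with assms(2) show ?thesis by auto
qed

lemma spans_carrier: "spans K M \<Gamma> \<Longrightarrow> x \<in> \<Gamma> \<Longrightarrow> x \<in> carrier M"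
  by (auto simp: spans_def)

text \<open>The common linear structure of \<open>free_superalg\<close>, with words as basis, and
  \<open>free_pairs\<close>, with pairs as basis.\<close>

locale free_mod = cring K for K :: "('k, 'r) ring_scheme" (structure) +
  fixes S :: "'s set" and F :: "('k, 's \<Rightarrow> 'k, 'z) module_scheme"
  assumes carrier_F: "carrier F = {f. (\<forall>s. f s \<in> carrier K) \<and> finite {s. f s \<noteq> \<zero>} \<and> (\<forall>s. f s \<noteq> \<zero> \<longrightarrow> s \<in> S)}"
    and zero_F: "\<zero>\<^bsub>F\<^esub> = (\<lambda>s. \<zero>)"
    and add_F: "f \<oplus>\<^bsub>F\<^esub> g = (\<lambda>s. f s \<oplus> g s)"
    and smult_F: "c \<odot>\<^bsub>F\<^esub> f = (\<lambda>s. c \<otimes> f s)"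
begin

definition gen :: "'s \<Rightarrow> 's \<Rightarrow> 'k" where
  "gen s = (\<lambda>t. if t = s then \<one> else \<zero>)"

lemma F_add_closed:
  assumes "f \<in> carrier F" "g \<in> carrier F"
  shows "f \<oplus>\<^bsub>F\<^esub> g \<in> carrier F"
proof -
  have "{s. f s \<oplus> g s \<noteq> \<zero>} \<subseteq> {s. f s \<noteq> \<zero>} \<union> {s. g s \<noteq> \<zero>}"
    by auto
  moreover have "finite ({s. f s \<noteq> \<zero>} \<union> {s. g s \<noteq> \<zero>})"
    using assms by (simp add: carrier_F)
  ultimately have "finite {s. f s \<oplus> g s \<noteq> \<zero>}"
    by (rule finite_subset)
  then show ?thesis
    using assms by (auto simp: carrier_F add_F) (metis l_zero zero_closed)
qed

lemma F_smult_closed: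
  assumes "c \<in> carrier K" "f \<in> carrier F"
  shows "c \<odot>\<^bsub>F\<^esub> f \<in> carrier F"
proof -
  have "{s. c \<otimes> f s \<noteq> \<zero>} \<subseteq> {s. f s \<noteq> \<zero>}"
    using assms by auto
  moreover have "finite {s. f s \<noteq> \<zero>}"
    using assms by (simp add: carrier_F)
  ultimately have "finite {s. c \<otimes> f s \<noteq> \<zero>}"
    by (rule finite_subset)
  then show ?thesis
    using assms unfolding carrier_F smult_F by (auto, metis r_null)
qed

lemma F_module: "module K F"
proof (rule moduleI)
  show "cring K" by unfold_locales
  show "abelian_group F"
  proof (rule abelian_groupI)
    fix f assume f: "f \<in> carrier F"
    have "(\<ominus> \<one>) \<odot>\<^bsub>F\<^esub> f \<oplus>\<^bsub>F\<^esub> f = \<zero>\<^bsub>F\<^esub>"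
      using f by (auto simp: carrier_F add_F smult_F zero_F l_minus l_neg)
    then show "\<exists>g\<in>carrier F. g \<oplus>\<^bsub>F\<^esub> f = \<zero>\<^bsub>F\<^esub>"
      using F_smult_closed[OF _ f, of "\<ominus> \<one>"] by auto
  next
    show "f \<oplus>\<^bsub>F\<^esub> g \<in> carrier F" if "f \<in> carrier F" "g \<in> carrier F" for f g
      using that by (rule F_add_closed)
  qed (auto simp: carrier_F add_F zero_F a_ac)
  show "c \<odot>\<^bsub>F\<^esub> f \<in> carrier F" if "c \<in> carrier K" "f \<in> carrier F" for c f
    using that by (rule F_smult_closed)
qed (auto simp: carrier_F add_F smult_F l_distr r_distr m_assoc)

sublocale F: module K F
  by (rule F_module)

lemma gen_closed [simp]: "s \<in> S \<Longrightarrow> gen s \<in> carrier F"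
  by (auto simp: carrier_F gen_def)

lemma F_finsum: "(\<And>i. i \<in> I \<Longrightarrow> f i \<in> carrier F) \<Longrightarrow> (\<Oplus>\<^bsub>F\<^esub>i\<in>I. f i) s = (\<Oplus>i\<in>I. f i s)"
proof (induction I rule: infinite_finite_induct)
  case (insert i I)
  then have "f j s \<in> carrier K" if "j \<in> insert i I" for j
    using insert.prems[OF that] by (auto simp: carrier_F)
  with insert show ?case
    by (simp add: F.finsum_insert Pi_def add_F)
qed (auto simp: zero_F F.finsum_infinite finsum_infinite)

text \<open>Induction on the support: setting one coefficient to zero removes one point from it and
  one basis vector from the sum.\<close>

lemma spans_gen: "spans K F (gen ` S)"
  unfolding spans_def
proof (intro conjI allI impI)
  show "gen ` S \<subseteq> carrier F" by auto
  fix U assume U: "gen ` S \<subseteq> U" "\<zero>\<^bsub>F\<^esub> \<in> U" "\<forall>x\<in>U \<inter> carrier F. \<forall>y\<in>U \<inter> carrier F. x \<oplus>\<^bsub>F\<^esub> y \<in> U"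
    "\<forall>c\<in>carrier K. \<forall>x\<in>U \<inter> carrier F. c \<odot>\<^bsub>F\<^esub> x \<in> U"
  have "f \<in> U" if "finite T" "f \<in> carrier F" "{s. f s \<noteq> \<zero>} = T" for f T
    using that
  proof (induction T arbitrary: f)
    case empty
    then have "f = \<zero>\<^bsub>F\<^esub>" by (auto simp: zero_F)
    with U show ?case by simp
  next
    case (insert t T)
    define g where "g = f(t := \<zero>)"
    have t: "t \<in> S" "f t \<in> carrier K" using insert.prems by (auto simp: carrier_F)
    have supp: "{s. g s \<noteq> \<zero>} = T" using insert by (auto simp: g_def)
    then have g: "g \<in> carrier F" using insert.prems insert.hyps by (auto simp: carrier_F g_def)
    have "f = f t \<odot>\<^bsub>F\<^esub> gen t \<oplus>\<^bsub>F\<^esub> g"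
      using insert.prems by (auto simp: g_def carrier_F smult_F add_F gen_def)
    moreover have "f t \<odot>\<^bsub>F\<^esub> gen t \<in> U"
      using U t by auto
    ultimately show ?case
      using insert.IH[OF g supp] g t U(3) F_smult_closed gen_closed by (metis IntI)
  qed
  then show "carrier F \<subseteq> U" by (auto simp: carrier_F)
qed

context
  fixes M :: "('k, 'm, 'y) module_scheme" and \<beta> :: "'s \<Rightarrow> 'm"
  assumes M: "module K M" and \<beta>: "\<And>s. s \<in> S \<Longrightarrow> \<beta> s \<in> carrier M"
begin

interpretation M: module K M by (rule M)

lemma lin_ext_superset:
  assumes "finite T" "T \<subseteq> S" "{s. f s \<noteq> \<zero>} \<subseteq> T" "\<And>s. f s \<in> carrier K"
  shows "lin_ext K M \<beta> f = (\<Oplus>\<^bsub>M\<^esub>s\<in>T. f s \<odot>\<^bsub>M\<^esub> \<beta> s)"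
  unfolding lin_ext_def using assms \<beta>
  by (intro M.finsum_mono_neutral[symmetric]) (auto simp: subset_iff)

lemma lin_ext_closed: "f \<in> carrier F \<Longrightarrow> lin_ext K M \<beta> f \<in> carrier M"
  unfolding lin_ext_def using \<beta> by (intro M.finsum_closed) (auto simp: carrier_F)

lemma lin_ext_gen: "s \<in> S \<Longrightarrow> lin_ext K M \<beta> (gen s) = \<beta> s"
  by (subst lin_ext_superset[of "{s}"]) (auto simp: gen_def \<beta>)

lemma lin_ext_zero: "lin_ext K M \<beta> \<zero>\<^bsub>F\<^esub> = \<zero>\<^bsub>M\<^esub>"
  by (simp add: lin_ext_def zero_F)

lemma lin_ext_add:
  assumes f: "f \<in> carrier F" and g: "g \<in> carrier F"
  shows "lin_ext K M \<beta> (f \<oplus>\<^bsub>F\<^esub> g) = lin_ext K M \<beta> f \<oplus>\<^bsub>M\<^esub> lin_ext K M \<beta> g"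
proof -
  let ?T = "{s. f s \<noteq> \<zero>} \<union> {s. g s \<noteq> \<zero>}"
  have T: "finite ?T" "?T \<subseteq> S" and c: "f s \<in> carrier K" "g s \<in> carrier K" for s
    using f g by (auto simp: carrier_F)
  have "lin_ext K M \<beta> (f \<oplus>\<^bsub>F\<^esub> g) = (\<Oplus>\<^bsub>M\<^esub>s\<in>?T. (f s \<oplus> g s) \<odot>\<^bsub>M\<^esub> \<beta> s)"
    unfolding add_F using T c by (intro lin_ext_superset) auto
  also have "\<dots> = (\<Oplus>\<^bsub>M\<^esub>s\<in>?T. f s \<odot>\<^bsub>M\<^esub> \<beta> s \<oplus>\<^bsub>M\<^esub> g s \<odot>\<^bsub>M\<^esub> \<beta> s)"
    using T c \<beta> by (intro M.finsum_cong') (auto simp: M.smult_l_distr subset_iff)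
  also have "\<dots> = (\<Oplus>\<^bsub>M\<^esub>s\<in>?T. f s \<odot>\<^bsub>M\<^esub> \<beta> s) \<oplus>\<^bsub>M\<^esub> (\<Oplus>\<^bsub>M\<^esub>s\<in>?T. g s \<odot>\<^bsub>M\<^esub> \<beta> s)"
    using T c \<beta> by (intro M.finsum_addf) (auto simp: subset_iff)
  also have "\<dots> = lin_ext K M \<beta> f \<oplus>\<^bsub>M\<^esub> lin_ext K M \<beta> g"
    using T c lin_ext_superset[of ?T f] lin_ext_superset[of ?T g] by simp
  finally show ?thesis .
qed

lemma lin_ext_smult:
  assumes c: "c \<in> carrier K" and f: "f \<in> carrier F"
  shows "lin_ext K M \<beta> (c \<odot>\<^bsub>F\<^esub> f) = c \<odot>\<^bsub>M\<^esub> lin_ext K M \<beta> f"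
proof -
  let ?T = "{s. f s \<noteq> \<zero>}"
  have T: "finite ?T" "?T \<subseteq> S" and k: "f s \<in> carrier K" for s
    using f by (auto simp: carrier_F)
  have "lin_ext K M \<beta> (c \<odot>\<^bsub>F\<^esub> f) = (\<Oplus>\<^bsub>M\<^esub>s\<in>?T. (c \<otimes> f s) \<odot>\<^bsub>M\<^esub> \<beta> s)"
    unfolding smult_F using T c k by (intro lin_ext_superset) auto
  also have "\<dots> = (\<Oplus>\<^bsub>M\<^esub>s\<in>?T. c \<odot>\<^bsub>M\<^esub> (f s \<odot>\<^bsub>M\<^esub> \<beta> s))"
    using T c k \<beta> by (intro M.finsum_cong') (auto simp: M.smult_assoc1 subset_iff)
  also have "\<dots> = c \<odot>\<^bsub>M\<^esub> lin_ext K M \<beta> f"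
    unfolding lin_ext_def using T c k \<beta> by (subst M.finsum_smult_ldistr) (auto simp: subset_iff)
  finally show ?thesis .
qed

end

end

section \<open>Bilinear algebras with a spanning set\<close>

context bilin_alg
begin

lemma bl_null: "x \<in> carrier A \<Longrightarrow> \<zero> \<otimes> x = \<zero>"
  using bsmult_left[of "\<zero>\<^bsub>K\<^esub>" \<zero> x] bmult_closed by simp

lemma br_null: "x \<in> carrier A \<Longrightarrow> x \<otimes> \<zero> = \<zero>"
  using bsmult_right[of "\<zero>\<^bsub>K\<^esub>" x \<zero>] bmult_closed by simp

text \<open>Both sides are linear in each argument, so the arguments are freed from the spanning set
  one at a time, from the last to the first.\<close>

lemma assoc_from_span:
  assumes sp: "spans K A \<Gamma>" and assoc: "\<And>a b c. a \<in> \<Gamma> \<Longrightarrow> b \<in> \<Gamma> \<Longrightarrow> c \<in> \<Gamma> \<Longrightarrow> (a \<otimes> b) \<otimes> c = a \<otimes> (b \<otimes> c)"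
    and "x \<in> carrier A" "y \<in> carrier A" "z \<in> carrier A"
  shows "(x \<otimes> y) \<otimes> z = x \<otimes> (y \<otimes> z)"
proof -
  note c = spans_carrier[OF sp]
  note dist = bmult_closed bl_distr br_distr bsmult_left bsmult_right bl_null br_null
  have 1: "(a \<otimes> b) \<otimes> z = a \<otimes> (b \<otimes> z)" if "a \<in> \<Gamma>" "b \<in> \<Gamma>" "z \<in> carrier A" for a b z
    using sp that(3) by (induction rule: spans_induct) (use that c assoc in \<open>auto simp: dist\<close>)
  have 2: "(a \<otimes> y) \<otimes> z = a \<otimes> (y \<otimes> z)" if "a \<in> \<Gamma>" "y \<in> carrier A" "z \<in> carrier A" for a y z
    using sp that(2) by (induction rule: spans_induct) (use that c 1 in \<open>auto simp: dist\<close>)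
  show ?thesis
    using sp assms(3) by (induction rule: spans_induct) (use assms(4,5) c 2 in \<open>auto simp: dist\<close>)
qed

lemma one_from_span:
  assumes sp: "spans K A \<Gamma>" and one: "\<And>a. a \<in> \<Gamma> \<Longrightarrow> \<one> \<otimes> a = a \<and> a \<otimes> \<one> = a" and "x \<in> carrier A"
  shows "\<one> \<otimes> x = x \<and> x \<otimes> \<one> = x"
  using sp assms(3) by (induction rule: spans_induct)
    (use one bone_closed in \<open>auto simp: bl_distr br_distr bsmult_left bsmult_right bl_null br_null\<close>)

lemma mult_hom_from_span:
  assumes sp: "spans K A \<Gamma>" and B: "bilin_alg K B"
    and h: "\<And>x. x \<in> carrier A \<Longrightarrow> h x \<in> carrier B"
      "\<And>x y. x \<in> carrier A \<Longrightarrow> y \<in> carrier A \<Longrightarrow> h (x \<oplus> y) = h x \<oplus>\<^bsub>B\<^esub> h y"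
      "\<And>c x. c \<in> carrier K \<Longrightarrow> x \<in> carrier A \<Longrightarrow> h (c \<odot> x) = c \<odot>\<^bsub>B\<^esub> h x"
    and mult: "\<And>a b. a \<in> \<Gamma> \<Longrightarrow> b \<in> \<Gamma> \<Longrightarrow> h (a \<otimes> b) = h a \<otimes>\<^bsub>B\<^esub> h b"
    and "x \<in> carrier A" "y \<in> carrier A"
  shows "h (x \<otimes> y) = h x \<otimes>\<^bsub>B\<^esub> h y"
proof -
  interpret B: bilin_alg K B by (rule B)
  note c = spans_carrier[OF sp]
  have zero: "h \<zero> = \<zero>\<^bsub>B\<^esub>"
    using h(3)[of "\<zero>\<^bsub>K\<^esub>" \<zero>] h(1)[of \<zero>] by simp
  note dist = bmult_closed bl_distr br_distr bsmult_left bsmult_right bl_null br_null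
    B.bmult_closed B.bl_distr B.br_distr B.bsmult_left B.bsmult_right B.bl_null B.br_null
  have 1: "h (a \<otimes> y) = h a \<otimes>\<^bsub>B\<^esub> h y" if "a \<in> \<Gamma>" "y \<in> carrier A" for a y
    using sp that(2) by (induction rule: spans_induct) (use that c mult in \<open>auto simp: dist h zero\<close>)
  show ?thesis
    using sp assms(7) by (induction rule: spans_induct) (use assms(8) c 1 in \<open>auto simp: dist h zero\<close>)
qed

end

section \<open>Free superalgebras\<close>

locale free_alg = field K for K :: "('k, 'r) ring_scheme" (structure) +
  fixes Gs :: "'g set" and \<pi> :: "'g \<Rightarrow> bool"
begin

abbreviation FA :: "('k, 'g list \<Rightarrow> 'k) superalg" where "FA \<equiv> free_superalg K Gs \<pi>"

abbreviation par :: "'g list \<Rightarrow> bool" where "par w \<equiv> odd (length (filter \<pi> w))"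

sublocale free_mod K "lists Gs" FA
  by unfold_locales (auto simp: free_superalg_def Let_def)

lemma FA_mult: "f \<otimes>\<^bsub>FA\<^esub> g = (\<lambda>w. \<Oplus>i\<in>{..length w}. f (take i w) \<otimes> g (drop i w))"
  by (simp add: free_superalg_def Let_def)

lemma FA_one: "\<one>\<^bsub>FA\<^esub> = gen []"
  by (auto simp: free_superalg_def Let_def gen_def)

lemma FA_grade: "grade FA p = {f \<in> carrier FA. \<forall>w. f w \<noteq> \<zero> \<longrightarrow> par w = p}"
  by (simp add: free_superalg_def Let_def)

lemma FA_value: "f \<in> carrier FA \<Longrightarrow> f w \<in> carrier K"
  by (simp add: carrier_F)

text \<open>Of all cuts of a word into two, only the one after \<open>length u\<close> letters can
  have u as its first part; a word other than \<open>u @ v\<close> has no matching cut.\<close>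

lemma FA_gen_mult: "gen u \<otimes>\<^bsub>FA\<^esub> gen v = gen (u @ v)"
proof
  fix w
  show "(gen u \<otimes>\<^bsub>FA\<^esub> gen v) w = gen (u @ v) w"
  proof (cases "w = u @ v")
    case True
    have "(\<Oplus>i\<in>{..length w}. gen u (take i w) \<otimes> gen v (drop i w)) = gen u (take (length u) w) \<otimes> gen v (drop (length u) w)"
    proof (rule finsum_single)
      fix i assume i: "i \<in> {..length w}" "i \<noteq> length u"
      then have "length (take i w) \<noteq> length u" by simp
      then have "take i w \<noteq> u" by metis
      then show "gen u (take i w) \<otimes> gen v (drop i w) = \<zero>" by (simp add: gen_def)
    qed (auto simp: gen_def True)
    then show ?thesis
      using True by (simp add: FA_mult gen_def)
  next
    case False
    then have "gen u (take i w) \<otimes> gen v (drop i w) = \<zero>" for i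
      using append_take_drop_id[of i w] by (auto simp: gen_def)
    then show ?thesis
      using False by (simp add: FA_mult gen_def)
  qed
qed

lemma FA_l_distr:
  assumes "f \<in> carrier FA" "g \<in> carrier FA" "h \<in> carrier FA"
  shows "(f \<oplus>\<^bsub>FA\<^esub> g) \<otimes>\<^bsub>FA\<^esub> h = f \<otimes>\<^bsub>FA\<^esub> h \<oplus>\<^bsub>FA\<^esub> g \<otimes>\<^bsub>FA\<^esub> h"
  using assms[THEN FA_value] by (simp add: FA_mult add_F l_distr finsum_addf Pi_def)

lemma FA_r_distr:
  assumes "f \<in> carrier FA" "g \<in> carrier FA" "h \<in> carrier FA"
  shows "h \<otimes>\<^bsub>FA\<^esub> (f \<oplus>\<^bsub>FA\<^esub> g) = h \<otimes>\<^bsub>FA\<^esub> f \<oplus>\<^bsub>FA\<^esub> h \<otimes>\<^bsub>FA\<^esub> g"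
  using assms[THEN FA_value] by (simp add: FA_mult add_F r_distr finsum_addf Pi_def)

lemma FA_smult_left:
  assumes "c \<in> carrier K" "f \<in> carrier FA" "g \<in> carrier FA"
  shows "(c \<odot>\<^bsub>FA\<^esub> f) \<otimes>\<^bsub>FA\<^esub> g = c \<odot>\<^bsub>FA\<^esub> (f \<otimes>\<^bsub>FA\<^esub> g)"
  using assms(1) assms(2,3)[THEN FA_value] by (simp add: FA_mult smult_F m_assoc finsum_rdistr Pi_def)

lemma FA_smult_right:
  assumes "c \<in> carrier K" "f \<in> carrier FA" "g \<in> carrier FA"
  shows "f \<otimes>\<^bsub>FA\<^esub> (c \<odot>\<^bsub>FA\<^esub> g) = c \<odot>\<^bsub>FA\<^esub> (f \<otimes>\<^bsub>FA\<^esub> g)"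
  using assms(1) assms(2,3)[THEN FA_value] by (simp add: FA_mult smult_F m_lcomm finsum_rdistr Pi_def)

text \<open>Finiteness of the support is not estimated: it is inherited from products of words,
  which are words, by linearity in each factor.\<close>

lemma FA_mult_closed:
  assumes "f \<in> carrier FA" "g \<in> carrier FA"
  shows "f \<otimes>\<^bsub>FA\<^esub> g \<in> carrier FA"
proof -
  have zero: "\<zero>\<^bsub>FA\<^esub> \<otimes>\<^bsub>FA\<^esub> h = \<zero>\<^bsub>FA\<^esub>" "h \<otimes>\<^bsub>FA\<^esub> \<zero>\<^bsub>FA\<^esub> = \<zero>\<^bsub>FA\<^esub>" if "h \<in> carrier FA" for h
    using FA_value[OF that] by (simp_all add: FA_mult zero_F)
  have 1: "gen u \<otimes>\<^bsub>FA\<^esub> g \<in> carrier FA" if "u \<in> lists Gs" "g \<in> carrier FA" for u g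
    using spans_gen that(2)
  proof (induction rule: spans_induct)
    case (gen x)
    then obtain v where v: "v \<in> lists Gs" "x = gen v" by auto
    have "u @ v \<in> lists Gs" using that(1) v(1) by simp
    then show ?case unfolding v(2) FA_gen_mult by (rule gen_closed)
  qed (use that(1) in \<open>simp_all add: zero FA_r_distr FA_smult_right\<close>)
  show ?thesis
    using spans_gen assms(1)
  proof (induction rule: spans_induct)
    case (gen x)
    then show ?case using 1 assms(2) by auto
  qed (use assms(2) in \<open>simp_all add: zero FA_l_distr FA_smult_left\<close>)
qed

lemma FA_bilin: "bilin_alg K FA"
proof (intro bilin_alg.intro bilin_alg_axioms.intro F_module)
  show "\<one>\<^bsub>FA\<^esub> \<in> carrier FA" by (simp add: FA_one)
qed (simp_all only: FA_mult_closed FA_l_distr FA_r_distr FA_smult_left FA_smult_right)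

lemma FA_ring: "ring FA"
proof (rule ringI)
  interpret B: bilin_alg K FA by (rule FA_bilin)
  show "abelian_group FA" by unfold_locales
  show "Group.monoid FA"
  proof (rule monoidI)
    fix x y z assume xyz: "x \<in> carrier FA" "y \<in> carrier FA" "z \<in> carrier FA"
    show "x \<otimes>\<^bsub>FA\<^esub> y \<otimes>\<^bsub>FA\<^esub> z = x \<otimes>\<^bsub>FA\<^esub> (y \<otimes>\<^bsub>FA\<^esub> z)"
      by (rule B.assoc_from_span[OF spans_gen _ xyz]) (auto simp: FA_gen_mult)
  next
    fix x assume x: "x \<in> carrier FA"
    have "\<one>\<^bsub>FA\<^esub> \<otimes>\<^bsub>FA\<^esub> x = x \<and> x \<otimes>\<^bsub>FA\<^esub> \<one>\<^bsub>FA\<^esub> = x"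
      by (rule B.one_from_span[OF spans_gen _ x]) (auto simp: FA_gen_mult FA_one)
    then show "\<one>\<^bsub>FA\<^esub> \<otimes>\<^bsub>FA\<^esub> x = x" "x \<otimes>\<^bsub>FA\<^esub> \<one>\<^bsub>FA\<^esub> = x" by auto
  qed (simp_all add: FA_mult_closed FA_one)
qed (simp_all only: FA_l_distr FA_r_distr)

lemma FA_grade_smult:
  assumes "c \<in> carrier K" "f \<in> grade FA p"
  shows "c \<odot>\<^bsub>FA\<^esub> f \<in> grade FA p"
proof -
  have "f w \<noteq> \<zero>" if "(c \<odot>\<^bsub>FA\<^esub> f) w \<noteq> \<zero>" for w
    using that assms(1) by (auto simp: smult_F)
  then show ?thesis
    using assms by (auto simp: FA_grade F_smult_closed)
qed

lemma FA_superalgebra: "superalgebra K FA"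
proof (intro superalgebra.intro superalgebra_axioms.intro F_module field_axioms FA_ring)
  show "submodule (grade FA p) K FA" for p
  proof (rule F.submoduleI)
    fix f assume f: "f \<in> grade FA p"
    have "\<ominus>\<^bsub>FA\<^esub> f = (\<ominus> \<one>) \<odot>\<^bsub>FA\<^esub> f"
      using f by (simp add: F.smult_l_minus FA_grade)
    moreover have "(\<ominus> \<one>) \<odot>\<^bsub>FA\<^esub> f \<in> grade FA p"
      using f by (simp add: FA_grade_smult)
    ultimately show "\<ominus>\<^bsub>FA\<^esub> f \<in> grade FA p" by simp
    fix g assume g: "g \<in> grade FA p"
    show "f \<oplus>\<^bsub>FA\<^esub> g \<in> grade FA p"
    proof -
      have "f w \<noteq> \<zero> \<or> g w \<noteq> \<zero>" if "(f \<oplus>\<^bsub>FA\<^esub> g) w \<noteq> \<zero>" for w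
        using that by (auto simp: add_F)
      then show ?thesis
        using f g by (auto simp: FA_grade F_add_closed)
    qed
  next
    fix c f assume "c \<in> carrier K" "f \<in> grade FA p"
    then show "c \<odot>\<^bsub>FA\<^esub> f \<in> grade FA p"
      by (rule FA_grade_smult)
  next
    show "grade FA p \<subseteq> carrier FA"
      by (auto simp: FA_grade)
    show "\<zero>\<^bsub>FA\<^esub> \<in> grade FA p"
      by (simp add: FA_grade) (simp add: zero_F)
  qed
  show "carrier FA = grade FA False <+>\<^bsub>FA\<^esub> grade FA True"
  proof (intro equalityI subsetI)
    fix f assume f: "f \<in> carrier FA"
    define h where "h p = (\<lambda>w. if par w = p then f w else \<zero>)" for p
    have "h p \<in> grade FA p" for p
    proof -
      have "{w. h p w \<noteq> \<zero>} \<subseteq> {w. f w \<noteq> \<zero>}" by (auto simp: h_def)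
      then have "finite {w. h p w \<noteq> \<zero>}"
        using f finite_subset by (auto simp: carrier_F)
      moreover have "\<forall>w. h p w \<noteq> \<zero> \<longrightarrow> w \<in> lists Gs \<and> par w = p" "\<forall>w. h p w \<in> carrier K"
        using f unfolding carrier_F h_def by auto
      ultimately show ?thesis
        unfolding FA_grade carrier_F by blast
    qed
    moreover have "f = h False \<oplus>\<^bsub>FA\<^esub> h True"
      using FA_value[OF f] by (auto simp: h_def add_F)
    ultimately show "f \<in> grade FA False <+>\<^bsub>FA\<^esub> grade FA True"
      unfolding set_add_def set_mult_def by auto
  next
    fix f assume "f \<in> grade FA False <+>\<^bsub>FA\<^esub> grade FA True"
    then obtain a b where "a \<in> grade FA False" "b \<in> grade FA True" "f = a \<oplus>\<^bsub>FA\<^esub> b"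
      unfolding set_add_def set_mult_def by auto
    then show "f \<in> carrier FA"
      by (simp add: FA_grade)
  qed
  show "grade FA False \<inter> grade FA True = {\<zero>\<^bsub>FA\<^esub>}"
    by (auto simp: FA_grade) (auto simp: zero_F)
  show "\<one>\<^bsub>FA\<^esub> \<in> grade FA False"
    by (auto simp: FA_grade FA_one) (auto simp: gen_def split: if_splits)
  show "f \<otimes>\<^bsub>FA\<^esub> g \<in> grade FA (p \<noteq> q)" if f: "f \<in> grade FA p" and g: "g \<in> grade FA q" for f g p q
  proof -
    have "par w = (p \<noteq> q)" if w: "(f \<otimes>\<^bsub>FA\<^esub> g) w \<noteq> \<zero>" for w
    proof -
      have "\<exists>i. f (take i w) \<otimes> g (drop i w) \<noteq> \<zero>"
        using w by (auto simp: FA_mult intro: add.finprod_one_eqI)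
      then obtain i where i: "f (take i w) \<otimes> g (drop i w) \<noteq> \<zero>" ..
      then have "f (take i w) \<noteq> \<zero>" "g (drop i w) \<noteq> \<zero>"
        using f g FA_value by (auto simp: FA_grade)
      then have "par (take i w) = p" "par (drop i w) = q"
        using f g by (auto simp: FA_grade)
      moreover have "length (filter \<pi> w) = length (filter \<pi> (take i w)) + length (filter \<pi> (drop i w))"
        by (metis append_take_drop_id filter_append length_append)
      ultimately show ?thesis by (cases p; cases q) simp_all
    qed
    then show ?thesis
      using f g unfolding FA_grade by (simp add: FA_mult_closed)
  qed
qed (simp_all only: FA_smult_left FA_smult_right)

lemma FA_gen_grade: "g \<in> Gs \<Longrightarrow> gen [g] \<in> grade FA (\<pi> g)"
  by (auto simp: FA_grade) (auto simp: gen_def split: if_splits)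

lemma FA_gradeD:
  assumes "f \<in> grade FA p"
  shows "f \<in> carrier FA" "f w \<noteq> \<zero> \<Longrightarrow> par w = p"
  using assms unfolding FA_grade by auto

lemma FA_salg: "salg K FA"
  by (rule salgI) (rule FA_superalgebra)

sublocale FA: salg K FA
  by (rule FA_salg)

lemma FA_generates: "generates K FA ((\<lambda>g. gen [g]) ` Gs)"
  unfolding generates_def
proof (intro conjI allI impI)
  show "(\<lambda>g. gen [g]) ` Gs \<subseteq> carrier FA" by auto
  fix U assume U: "(\<lambda>g. gen [g]) ` Gs \<subseteq> U" "\<one>\<^bsub>FA\<^esub> \<in> U"
    "\<forall>x\<in>U \<inter> carrier FA. \<forall>y\<in>U \<inter> carrier FA. x \<oplus>\<^bsub>FA\<^esub> y \<in> U \<and> x \<otimes>\<^bsub>FA\<^esub> y \<in> U"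
    "\<forall>c\<in>carrier K. \<forall>x\<in>U \<inter> carrier FA. c \<odot>\<^bsub>FA\<^esub> x \<in> U"
  have gen: "gen w \<in> U" if "w \<in> lists Gs" for w
    using that
  proof (induction w)
    case Nil
    then show ?case using U(2) by (simp add: FA_one)
  next
    case (Cons a w)
    then have "gen [a] \<in> U \<inter> carrier FA" "gen w \<in> U \<inter> carrier FA" using U(1) by auto
    then have "gen [a] \<otimes>\<^bsub>FA\<^esub> gen w \<in> U" using U(3) by blast
    then show ?case by (simp add: FA_gen_mult)
  qed
  have "f \<in> U" if "f \<in> carrier FA" for f
    using spans_gen that
  proof (induction rule: spans_induct)
    case zero
    \<comment> \<open>Zero is no case of \<open>generates\<close>; it is obtained as the multiple 0
      of one.\<close>
    have "\<zero> \<odot>\<^bsub>FA\<^esub> \<one>\<^bsub>FA\<^esub> \<in> U" using U(2,4) FA.A.one_closed by blast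
    then show ?case by simp
  next
    case (gen f)
    then show ?case using \<open>\<And>w. w \<in> lists Gs \<Longrightarrow> gen w \<in> U\<close> by auto
  next
    case (add x y)
    then show ?case using U(3) by blast
  next
    case (smult c x)
    then show ?case using U(4) by blast
  qed
  then show "carrier FA \<subseteq> U" by auto
qed

text \<open>A word goes to the product of the images of its letters. This is multiplicative under
  concatenation and has the parity of the word, and both properties extend linearly.\<close>

lemma FA_lift:
  assumes B: "salg K B" and b: "\<And>g. g \<in> Gs \<Longrightarrow> b g \<in> grade B (\<pi> g)"
  obtains h where "h \<in> superalg_hom K FA B" "\<And>g. g \<in> Gs \<Longrightarrow> h (gen [g]) = b g"
proof -
  interpret B: salg K B by (rule B)
  define \<beta> where "\<beta> w = foldr (\<lambda>g x. b g \<otimes>\<^bsub>B\<^esub> x) w \<one>\<^bsub>B\<^esub>" for w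
  have \<beta>_grade: "\<beta> w \<in> grade B (par w)" if "w \<in> lists Gs" for w
    using that
  proof (induction w)
    case (Cons a w)
    then show ?case
      using B.grade_mult[of "b a" "\<pi> a" "\<beta> w" "par w"] b[of a] by (cases "\<pi> a") (auto simp: \<beta>_def)
  qed (auto simp: \<beta>_def)
  have \<beta>: "\<beta> w \<in> carrier B" if "w \<in> lists Gs" for w
    using \<beta>_grade[OF that] B.grade_carrier by auto
  have b': "b g \<in> carrier B" if "g \<in> Gs" for g
    using b[OF that] B.grade_carrier by auto
  have \<beta>_append: "\<beta> (u @ v) = \<beta> u \<otimes>\<^bsub>B\<^esub> \<beta> v" if "u \<in> lists Gs" "v \<in> lists Gs" for u v
    using that
  proof (induction u)
    case (Cons a u)
    then have "\<beta> u \<in> carrier B" "\<beta> v \<in> carrier B" "b a \<in> carrier B" using \<beta> b' by auto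
    with Cons show ?case by (simp add: \<beta>_def B.A.m_assoc)
  qed (use \<beta> in \<open>simp add: \<beta>_def[of "[]"]\<close>)
  note ext = lin_ext_closed[OF B.M.module_axioms \<beta>] lin_ext_add[OF B.M.module_axioms \<beta>]
    lin_ext_smult[OF B.M.module_axioms \<beta>] lin_ext_gen[OF B.M.module_axioms \<beta>]
  have "lin_ext K B \<beta> \<in> superalg_hom K FA B"
  proof (rule superalg_homI)
    fix x y assume xy: "x \<in> carrier FA" "y \<in> carrier FA"
    show "lin_ext K B \<beta> (x \<otimes>\<^bsub>FA\<^esub> y) = lin_ext K B \<beta> x \<otimes>\<^bsub>B\<^esub> lin_ext K B \<beta> y"
    proof (rule bilin_alg.mult_hom_from_span[OF FA_bilin spans_gen B.bilin_alg _ _ _ _ xy])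
      show "lin_ext K B \<beta> (a \<otimes>\<^bsub>FA\<^esub> c) = lin_ext K B \<beta> a \<otimes>\<^bsub>B\<^esub> lin_ext K B \<beta> c"
        if ac: "a \<in> gen ` lists Gs" "c \<in> gen ` lists Gs" for a c
      proof -
        obtain u v where uv: "u \<in> lists Gs" "v \<in> lists Gs" "a = gen u" "c = gen v"
          using ac by auto
        have "u @ v \<in> lists Gs" using uv by simp
        then show ?thesis
          using uv(1,2) unfolding uv(3,4) FA_gen_mult by (simp only: ext(4) \<beta>_append)
      qed
    qed (simp_all add: ext)
  next
    show "lin_ext K B \<beta> \<one>\<^bsub>FA\<^esub> = \<one>\<^bsub>B\<^esub>"
      by (simp add: FA_one ext) (simp add: \<beta>_def)
  next
    fix f p assume f: "f \<in> grade FA p"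
    have "(\<Oplus>\<^bsub>B\<^esub>w\<in>W. f w \<odot>\<^bsub>B\<^esub> \<beta> w) \<in> grade B p" if "finite W" "W \<subseteq> {w. f w \<noteq> \<zero>}" for W
      using that
    proof (induction W)
      case (insert w W)
      have mem: "f v \<in> carrier K" "v \<in> lists Gs" "par v = p" if "f v \<noteq> \<zero>" for v
        using FA_gradeD[OF f] that by (auto simp: carrier_F)
      then have "f v \<odot>\<^bsub>B\<^esub> \<beta> v \<in> grade B p" if "v \<in> insert w W" for v
        using insert.prems that \<beta>_grade[of v] by (intro B.grade_smult) auto
      moreover from this have "f v \<odot>\<^bsub>B\<^esub> \<beta> v \<in> carrier B" if "v \<in> insert w W" for v
        using that B.grade_carrier by blast
      ultimately show ?case
        using insert by (subst B.A.finsum_insert) (auto intro: B.grade_add)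
    qed auto
    then show "lin_ext K B \<beta> f \<in> grade B p"
      using FA_gradeD(1)[OF f] unfolding lin_ext_def by (simp add: carrier_F)
  qed (simp_all add: ext)
  moreover have "lin_ext K B \<beta> (gen [g]) = b g" if "g \<in> Gs" for g
    using that b' by (simp add: ext) (simp add: \<beta>_def)
  ultimately show ?thesis using that by blast
qed

end

section \<open>Free commutative superalgebras\<close>

locale scsalg = salg +
  assumes supercommutative: "supercommutative A"
begin

sublocale SR: super_ring A "grade A"
  by (rule super_ring[OF supercommutative])

end

context salg
begin

lemma neg_if_grade: "x \<in> grade A p \<Longrightarrow> neg_if A c x \<in> grade A p"
  by (simp add: neg_if_def grade_minus)

definition supercomm_gens :: "'a set" where
  "supercomm_gens = {x \<otimes> y \<ominus> neg_if A (p \<and> q) (y \<otimes> x) | x y p q. x \<in> grade A p \<and> y \<in> grade A q} \<union>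
    {x \<otimes> x | x. x \<in> grade A True}"

lemma supercomm_gensE:
  assumes "z \<in> supercomm_gens"
  obtains x y p q where "x \<in> grade A p" "y \<in> grade A q" "z = x \<otimes> y \<ominus> neg_if A (p \<and> q) (y \<otimes> x)"
    | x where "x \<in> grade A True" "z = x \<otimes> x"
  using assms unfolding supercomm_gens_def by blast

lemma supercomm_gensI:
  "x \<in> grade A p \<Longrightarrow> y \<in> grade A q \<Longrightarrow> x \<otimes> y \<ominus> neg_if A (p \<and> q) (y \<otimes> x) \<in> supercomm_gens"
  "x \<in> grade A True \<Longrightarrow> x \<otimes> x \<in> supercomm_gens"
  unfolding supercomm_gens_def by blast+

lemma supercomm_ideal_eq: "supercomm_ideal A = Idl supercomm_gens"
  by (simp add: supercomm_ideal_def supercomm_gens_def)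

lemma supercomm_gens_homogeneous: "supercomm_gens \<subseteq> grade A False \<union> grade A True"
proof
  fix z assume "z \<in> supercomm_gens"
  then show "z \<in> grade A False \<union> grade A True"
  proof (cases rule: supercomm_gensE)
    case (1 x y p q)
    have yx: "y \<otimes> x \<in> grade A (p \<noteq> q)"
      using grade_mult[OF 1(2,1)] by (cases p; cases q) auto
    have "z \<in> grade A (p \<noteq> q)"
      unfolding 1(3) A.minus_eq by (rule grade_add[OF grade_mult[OF 1(1,2)] grade_minus[OF neg_if_grade[OF yx]]])
    then show ?thesis
      by (cases "p \<noteq> q") auto
  next
    case (2 x)
    then show ?thesis
      using grade_mult[OF 2(1) 2(1)] by simp
  qed
qed

lemma supercomm_gens_carrier: "supercomm_gens \<subseteq> carrier A"
  using supercomm_gens_homogeneous grade_carrier by blast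

lemma supercomm_ideal: "ideal (supercomm_ideal A) A" "graded_sub (supercomm_ideal A)"
  unfolding supercomm_ideal_eq
  by (rule A.genideal_ideal[OF supercomm_gens_carrier], rule genideal_graded[OF supercomm_gens_homogeneous])

lemma quot_supercomm: "supercommutative (super_quot A (supercomm_ideal A))"
proof -
  note I = supercomm_ideal
  interpret alg_quot K A "supercomm_ideal A" by (rule quot_superalgebra(1)[OF I])
  have self: "h \<in> supercomm_gens \<Longrightarrow> h \<in> supercomm_ideal A" for h
    unfolding supercomm_ideal_eq using A.genideal_self[OF supercomm_gens_carrier] by (rule subsetD)
  show ?thesis
    unfolding supercommutative_def
  proof (intro conjI allI impI)
    fix p q x y assume "x \<in> grade Q p" "y \<in> grade Q q"
    then obtain a b where ab: "a \<in> grade A p" "b \<in> grade A q" "x = proj a" "y = proj b"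
      by (auto simp: grade_Q)
    have c: "a \<in> carrier A" "b \<in> carrier A" using ab grade_carrier by auto
    have "proj (a \<otimes> b) = proj (neg_if A (p \<and> q) (b \<otimes> a))"
      using c self[OF supercomm_gensI(1)[OF ab(1,2)]] by (simp add: proj_eq_iff A.neg_if_closed)
    also have "\<dots> = neg_if Q (p \<and> q) (proj (b \<otimes> a))"
      using c by (simp add: neg_if_def minus_Q)
    finally show "x \<otimes>\<^bsub>Q\<^esub> y = neg_if Q (p \<and> q) (y \<otimes>\<^bsub>Q\<^esub> x)"
      using ab c by (simp add: mult_Q)
  next
    fix x assume "x \<in> grade Q True"
    then obtain a where a: "a \<in> grade A True" "x = proj a"
      by (auto simp: grade_Q)
    then show "x \<otimes>\<^bsub>Q\<^esub> x = \<zero>\<^bsub>Q\<^esub>"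
      using self[OF supercomm_gensI(2)[OF a(1)]] by (simp add: mult_Q proj_zero_iff)
  qed
qed

lemma hom_kills_supercomm_ideal:
  assumes B: "scsalg K B" and h: "h \<in> superalg_hom K A B" and x: "x \<in> supercomm_ideal A"
  shows "h x = \<zero>\<^bsub>B\<^esub>"
proof -
  interpret B: scsalg K B by (rule B)
  note sc = supercommutativeD[OF B.supercommutative]
  have salg: "salg K A" "salg K B" by unfold_locales
  show ?thesis
  proof (rule hom_kills_genideal[OF salg(2) h supercomm_gens_carrier _ x[unfolded supercomm_ideal_eq]])
    fix z assume "z \<in> supercomm_gens"
    then show "h z = \<zero>\<^bsub>B\<^esub>"
    proof (cases rule: supercomm_gensE)
      case (1 x y p q)
      then have c: "x \<in> carrier A" "y \<in> carrier A" using grade_carrier by auto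
      have "h (neg_if A (p \<and> q) (y \<otimes> x)) = neg_if B (p \<and> q) (h y \<otimes>\<^bsub>B\<^esub> h x)"
        using c by (simp add: neg_if_def superalg_hom_minus[OF salg h] superalg_homD(3)[OF h])
      also have "\<dots> = h x \<otimes>\<^bsub>B\<^esub> h y"
        using sc(1)[OF superalg_homD(6)[OF h 1(1)] superalg_homD(6)[OF h 1(2)]] by simp
      finally show ?thesis
        using c superalg_homD(1)[OF h] unfolding 1(3) A.minus_eq
        by (simp add: superalg_homD(2,3)[OF h] superalg_hom_minus[OF salg h] A.neg_if_closed B.A.r_neg)
    next
      case (2 x)
      then show ?thesis
        using sc(2)[OF superalg_homD(6)[OF h 2(1)]] superalg_homD(3)[OF h] by simp
    qed
  qed
qed

end

context free_alg
begin

abbreviation FC :: "('k, ('g list \<Rightarrow> 'k) set) superalg" where "FC \<equiv> free_comm_superalg K Gs \<pi>"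

lemma free_gen_eq: "free_gen K g = gen [g]"
  by (auto simp: free_gen_def gen_def)

lemma FC_scsalg: "scsalg K FC"
  unfolding free_comm_superalg_def
  using FA.quot_superalgebra(2)[OF FA.supercomm_ideal] FA.quot_supercomm
  by (intro scsalg.intro salgI scsalg_axioms.intro)

lemma FC_generates: "generates K FC (free_comm_gen K Gs \<pi> ` Gs)"
  using FA.quot_generates[OF FA_generates FA.supercomm_ideal]
  by (simp add: free_comm_superalg_def free_comm_gen_def image_image free_gen_eq)

lemma FC_gen_grade: "g \<in> Gs \<Longrightarrow> free_comm_gen K Gs \<pi> g \<in> grade FC (\<pi> g)"
  using FA_gen_grade by (simp add: free_comm_superalg_def free_comm_gen_def super_quot_def free_gen_eq)

text \<open>In a supercommutative target all supercommutators and all squares of odd elements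
  vanish, so the homomorphism from the free superalgebra factors through the quotient.\<close>

lemma FC_lift:
  assumes B: "scsalg K B" and b: "\<And>g. g \<in> Gs \<Longrightarrow> b g \<in> grade B (\<pi> g)"
  obtains h where "h \<in> superalg_hom K FC B" "\<And>g. g \<in> Gs \<Longrightarrow> h (free_comm_gen K Gs \<pi> g) = b g"
proof -
  interpret B: scsalg K B by (rule B)
  have sB: "salg K B" by unfold_locales
  obtain h where h: "h \<in> superalg_hom K FA B" "\<And>g. g \<in> Gs \<Longrightarrow> h (gen [g]) = b g"
    using FA_lift[OF sB b] by blast
  obtain k where k: "k \<in> superalg_hom K FC B"
    "\<And>x. x \<in> carrier FA \<Longrightarrow> k (supercomm_ideal FA +>\<^bsub>FA\<^esub> x) = h x"
    using FA.quot_lift[OF sB h(1) FA.supercomm_ideal FA.hom_kills_supercomm_ideal[OF B h(1)]]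
    unfolding free_comm_superalg_def by blast
  show ?thesis
  proof (rule that[OF k(1)])
    fix g assume g: "g \<in> Gs"
    then have "gen [g] \<in> carrier FA" by simp
    from k(2)[OF this] h(2)[OF g] show "k (free_comm_gen K Gs \<pi> g) = b g"
      by (simp add: free_comm_gen_def free_gen_eq)
  qed
qed

end

section \<open>Images of the formulas under homomorphisms\<close>

lemma map_data_simps [simp]: "msize (map_data h U) = msize U" "nsize (map_data h U) = nsize U"
  "entry (map_data h U) i j = h (entry U i j)" "dinv1 (map_data h U) = h (dinv1 U)" "dinv2 (map_data h U) = h (dinv2 U)"
  by (simp_all add: map_data_def)

lemma (in super_ring) mdet_even:
  assumes "\<And>i j. i < l \<Longrightarrow> j < l \<Longrightarrow> M i j \<in> G False"
  shows "mdet A l M \<in> G False"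
proof -
  interpret E: cring evens by (rule evens_cring)
  show ?thesis
    using E.mdet_closed[of l M] evens_mdet[of l M] assms by simp
qed

lemma adj_inv_hom:
  assumes "ring R" "ring S" "h \<in> ring_hom R S" "\<And>i j. i < l \<Longrightarrow> j < l \<Longrightarrow> M i j \<in> carrier R"
    "u \<in> carrier R" "i < l" "j < l"
  shows "h (adj_inv R l M u i j) = adj_inv S l (\<lambda>i j. h (M i j)) (h u) i j"
    and "adj_inv R l M u i j \<in> carrier R"
proof -
  interpret ring_hom_ring R S h
    using assms by (simp add: ring_hom_ringI2)
  have c: "suppress j i M i' j' \<in> carrier R" if "i' < l - 1" "j' < l - 1" for i' j'
    using that assms by (auto simp: suppress_def)
  have d: "mdet R (l - 1) (suppress j i M) \<in> carrier R"
    using c by (rule R.mdet_closed)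
  then show "adj_inv R l M u i j \<in> carrier R"
    using assms by (simp add: adj_inv_def neg_if_def)
  have "h (mdet R (l - 1) (suppress j i M)) = mdet S (l - 1) (\<lambda>i' j'. h (suppress j i M i' j'))"
    using c by (rule mdet_hom[OF assms(1-3)])
  also have "(\<lambda>i' j'. h (suppress j i M i' j')) = suppress j i (\<lambda>i j. h (M i j))"
    by (simp add: suppress_def)
  finally show "h (adj_inv R l M u i j) = adj_inv S l (\<lambda>i j. h (M i j)) (h u) i j"
    using assms(5) d by (simp add: adj_inv_def neg_if_def)
qed

text \<open>All formulas consist of ring operations. Entries are known to lie in the carrier only
  for indices in range, so each intermediate matrix is compared on its own range before the next
  product or determinant is formed.\<close>

lemma hom_formulas:
  assumes R: "ring R" and S: "ring S" and h: "h \<in> ring_hom R S"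
    and e: "\<And>i j. i < msize U + nsize U \<Longrightarrow> j < msize U + nsize U \<Longrightarrow> entry U i j \<in> carrier R"
    and t: "dinv1 U \<in> carrier R" "dinv2 U \<in> carrier R"
  shows "h (d1 R U) = d1 S (map_data h U)" "h (d2 R U) = d2 S (map_data h U)"
    and "h (Ber R U) = Ber S (map_data h U)"
proof -
  interpret ring_hom_ring R S h
    using assms by (simp add: ring_hom_ringI2)
  let ?m = "msize U" and ?n = "nsize U"
  have x: "i < ?m \<Longrightarrow> j < ?m \<Longrightarrow> X11 U i j \<in> carrier R" "i < ?n \<Longrightarrow> j < ?n \<Longrightarrow> X22 U i j \<in> carrier R"
    "i < ?m \<Longrightarrow> j < ?n \<Longrightarrow> Xi12 U i j \<in> carrier R" "i < ?n \<Longrightarrow> j < ?m \<Longrightarrow> Xi21 U i j \<in> carrier R" for i j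
    by (auto simp: X11_def X22_def Xi12_def Xi21_def intro!: e)
  have b: "X11 (map_data h U) = (\<lambda>i j. h (X11 U i j))" "X22 (map_data h U) = (\<lambda>i j. h (X22 U i j))"
    "Xi12 (map_data h U) = (\<lambda>i j. h (Xi12 U i j))" "Xi21 (map_data h U) = (\<lambda>i j. h (Xi21 U i j))"
    by (simp_all add: X11_def X22_def Xi12_def Xi21_def fun_eq_iff)
  show "h (d1 R U) = d1 S (map_data h U)" "h (d2 R U) = d2 S (map_data h U)"
    unfolding d1_def d2_def b map_data_simps using x by (auto intro: mdet_hom[OF R S h])
  note S22 = adj_inv_hom[OF R S h, of ?n "X22 U" "dinv2 U", OF x(2) t(2)]
  have S22': "h (S22 R U i j) = S22 S (map_data h U) i j" "S22 R U i j \<in> carrier R" if "i < ?n" "j < ?n" for i j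
    unfolding S22_def map_data_simps b using S22 that by auto
  have 1: "mmul R ?n (Xi12 U) (S22 R U) i j \<in> carrier R" if "i < ?m" "j < ?n" for i j
    using that x S22' by (intro R.mmul_closed) auto
  have 2: "h (mmul R ?n (Xi12 U) (S22 R U) i j) = mmul S ?n (Xi12 (map_data h U)) (S22 S (map_data h U)) i j"
    if "i < ?m" "j < ?n" for i j
  proof -
    have c: "S22 S (map_data h U) k j \<in> carrier S" if "k < ?n" for k
      using hom_closed[OF S22'(2)] S22'(1) that \<open>j < ?n\<close> by metis
    have "h (mmul R ?n (Xi12 U) (S22 R U) i j) = mmul S ?n (\<lambda>i j. h (Xi12 U i j)) (\<lambda>i j. h (S22 R U i j)) i j"
      using that x S22'(2) by (intro mmul_hom[OF R S h]) auto
    also have "\<dots> = mmul S ?n (\<lambda>i j. h (Xi12 U i j)) (S22 S (map_data h U)) i j"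
      by (rule S.mmul_cong) (simp_all add: S22'(1) c that x)
    finally show ?thesis
      unfolding b(3) .
  qed
  have 3: "mmul R ?n (mmul R ?n (Xi12 U) (S22 R U)) (Xi21 U) i j \<in> carrier R" if "i < ?m" "j < ?m" for i j
    by (rule R.mmul_closed) (use that x 1 in auto)
  have 4: "h (mmul R ?n (mmul R ?n (Xi12 U) (S22 R U)) (Xi21 U) i j) =
      mmul S ?n (mmul S ?n (Xi12 (map_data h U)) (S22 S (map_data h U))) (Xi21 (map_data h U)) i j"
    if "i < ?m" "j < ?m" for i j
  proof -
    have c: "mmul S ?n (Xi12 (map_data h U)) (S22 S (map_data h U)) i k \<in> carrier S" if "k < ?n" for k
      using hom_closed[OF 1] 2 that \<open>i < ?m\<close> by metis
    have "h (mmul R ?n (mmul R ?n (Xi12 U) (S22 R U)) (Xi21 U) i j) =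
        mmul S ?n (\<lambda>i j. h (mmul R ?n (Xi12 U) (S22 R U) i j)) (\<lambda>i j. h (Xi21 U i j)) i j"
      using that x 1 by (intro mmul_hom[OF R S h]) auto
    also have "\<dots> = mmul S ?n (mmul S ?n (Xi12 (map_data h U)) (S22 S (map_data h U))) (\<lambda>i j. h (Xi21 U i j)) i j"
      by (rule S.mmul_cong) (simp_all add: 2 c that x)
    finally show ?thesis
      unfolding b(4) .
  qed
  have 5: "matB R U i j \<in> carrier R \<and> h (matB R U i j) = matB S (map_data h U) i j" if "i < ?m" "j < ?m" for i j
    using that x(1)[OF that] 3[OF that] 4[OF that] by (simp add: matB_def a_minus_def) (simp add: b)
  have det: "mdet R l F \<in> carrier R \<and> h (mdet R l F) = mdet S l F'"
    if F: "\<And>i j. i < l \<Longrightarrow> j < l \<Longrightarrow> F i j \<in> carrier R \<and> h (F i j) = F' i j" for l F F'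
  proof -
    have c: "\<And>i j. i < l \<Longrightarrow> j < l \<Longrightarrow> F i j \<in> carrier R"
      using F by blast
    have "mdet S l (\<lambda>i j. h (F i j)) = mdet S l F'"
    proof (rule S.mdet_cong)
      show "h (F i j) \<in> carrier S" if "i < l" "j < l" for i j
        using hom_closed[OF c[OF that]] .
      show "h (F i j) = F' i j" if "i < l" "j < l" for i j
        using F[OF that] by blast
    qed
    then show ?thesis
      using mdet_hom[OF R S h c] R.mdet_closed[OF c] by simp
  qed
  have "mdet R ?m (matB R U) \<in> carrier R \<and> h (mdet R ?m (matB R U)) = mdet S ?m (matB S (map_data h U))"
    by (rule det) (rule 5)
  moreover have "mdet R ?n (S22 R U) \<in> carrier R \<and> h (mdet R ?n (S22 R U)) = mdet S ?n (S22 S (map_data h U))"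
    by (rule det) (use S22' in blast)
  ultimately show "h (Ber R U) = Ber S (map_data h U)"
    by (simp add: Ber_def)
qed

text \<open>The padded blocks ignore entries out of range, so they are equal as functions for both
  data, and the Berezinian is a formula in these blocks.\<close>

lemma (in super_ring) Ber_cong:
  assumes U: "gl_valid A G U" and V: "gl_valid A G V"
    and s: "msize V = msize U" "nsize V = nsize U" "dinv1 V = dinv1 U" "dinv2 V = dinv2 U"
    and e: "\<And>i j. i < msize U + nsize U \<Longrightarrow> j < msize U + nsize U \<Longrightarrow> entry V i j = entry U i j"
  shows "Ber A V = Ber A U"
proof -
  interpret super_mat A G "msize U + nsize U" by unfold_locales
  have "bp V = bp U" "bq V = bq U" "br V = br U" "bs V = bs U"
    using s e by (auto simp: bp_def bq_def br_def bs_def block_entries fun_eq_iff)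
  then show ?thesis
    using det_BC(3)[OF U refl] det_BC(3)[OF V] s by (simp add: bB_def bs'_def)
qed

lemma (in ring) d_cong:
  assumes s: "msize V = msize U" "nsize V = nsize U"
    and e: "\<And>i j. i < msize U + nsize U \<Longrightarrow> j < msize U + nsize U \<Longrightarrow> entry V i j = entry U i j"
    and c: "\<And>i j. i < msize U + nsize U \<Longrightarrow> j < msize U + nsize U \<Longrightarrow> entry U i j \<in> carrier R"
  shows "d1 R V = d1 R U" "d2 R V = d2 R U"
  unfolding d1_def d2_def s using e c
  by (auto intro!: mdet_cong simp: X11_def X22_def s)

section \<open>Universal properties of the coordinate superalgebras\<close>

definition gl_generators :: "'a gl_data \<Rightarrow> 'a set" where
  "gl_generators U = {entry U i j | i j. i < msize U + nsize U \<and> j < msize U + nsize U} \<union> {dinv1 U, dinv2 U}"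

text \<open>Agreement is demanded for indices in range only, so that \<open>V\<close> may differ
  elsewhere from \<open>map_data h U\<close>.\<close>

definition gl_agree :: "('a \<Rightarrow> 'b) \<Rightarrow> 'a gl_data \<Rightarrow> 'b gl_data \<Rightarrow> bool" where
  "gl_agree h U V \<longleftrightarrow> msize V = msize U \<and> nsize V = nsize U \<and> h (dinv1 U) = dinv1 V \<and> h (dinv2 U) = dinv2 V \<and>
     (\<forall>i<msize U + nsize U. \<forall>j<msize U + nsize U. h (entry U i j) = entry V i j)"

lemma gl_valid_hom:
  assumes A: "scsalg K A" and B: "scsalg K B" and h: "h \<in> superalg_hom K A B" and U: "gl_valid A (grade A) U"
  shows "gl_valid B (grade B) (map_data h U)" "h (d1 A U) = d1 B (map_data h U)" "h (d2 A U) = d2 B (map_data h U)"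
    "h (Ber A U) = Ber B (map_data h U)"
proof -
  interpret A: scsalg K A by (rule A)
  interpret B: scsalg K B by (rule B)
  have e: "entry U i j \<in> grade A ((i < msize U) \<noteq> (j < msize U))"
    if "i < msize U + nsize U" "j < msize U + nsize U" for i j
    using U that unfolding gl_valid_def gl_entries_def by blast
  have t: "dinv1 U \<in> grade A False" "dinv2 U \<in> grade A False"
    and inv: "d1 A U \<otimes>\<^bsub>A\<^esub> dinv1 U = \<one>\<^bsub>A\<^esub>" "d2 A U \<otimes>\<^bsub>A\<^esub> dinv2 U = \<one>\<^bsub>A\<^esub>"
    using U unfolding gl_valid_def by auto
  have e': "entry U i j \<in> carrier A" if "i < msize U + nsize U" "j < msize U + nsize U" for i j
    using e[OF that] A.grade_carrier by blast
  have t': "dinv1 U \<in> carrier A" "dinv2 U \<in> carrier A"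
    using t by simp_all
  note hf = hom_formulas[OF A.A.ring_axioms B.A.ring_axioms superalg_homD(7)[OF h] e' t']
  show "h (d1 A U) = d1 B (map_data h U)" "h (d2 A U) = d2 B (map_data h U)" "h (Ber A U) = Ber B (map_data h U)"
    using hf by auto
  have d: "d1 A U \<in> carrier A" "d2 A U \<in> carrier A"
    unfolding d1_def d2_def using e' by (auto intro!: A.A.mdet_closed simp: X11_def X22_def)
  have "gl_entries (grade B) (map_data h U)"
    unfolding gl_entries_def map_data_simps using e superalg_homD(6)[OF h] by blast
  moreover have "d1 B (map_data h U) \<otimes>\<^bsub>B\<^esub> h (dinv1 U) = \<one>\<^bsub>B\<^esub>" "d2 B (map_data h U) \<otimes>\<^bsub>B\<^esub> h (dinv2 U) = \<one>\<^bsub>B\<^esub>"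
    using superalg_homD(3)[OF h d(1) t'(1)] superalg_homD(3)[OF h d(2) t'(2)] hf inv superalg_homD(4)[OF h] by auto
  ultimately show "gl_valid B (grade B) (map_data h U)"
    using t superalg_homD(6)[OF h] by (simp add: gl_valid_def)
qed

lemma gl_agree_Ber:
  assumes A: "scsalg K A" and B: "scsalg K B" and h: "h \<in> superalg_hom K A B" and U: "gl_valid A (grade A) U"
    and V: "gl_valid B (grade B) V" and ag: "gl_agree h U V"
  shows "h (Ber A U) = Ber B V"
proof -
  interpret B: scsalg K B by (rule B)
  have "Ber B V = Ber B (map_data h U)"
    using ag by (intro B.SR.Ber_cong[OF gl_valid_hom(1)[OF A B h U] V]) (simp_all add: gl_agree_def)
  then show ?thesis
    using gl_valid_hom(4)[OF A B h U] by simp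
qed

lemma (in scsalg) quot_scsalg:
  assumes "ideal I A" "graded_sub I"
  shows "scsalg K (super_quot A I)"
  using quot_superalgebra(2)[OF assms] quot_supercommutative[OF supercommutative assms]
  by (intro scsalg.intro salgI scsalg_axioms.intro)

locale gl_algebra = field K for K :: "('k, 'r) ring_scheme" +
  fixes m n :: nat
begin

sublocale FG: free_alg K "gl_gens m n" "gl_parity m"
  by unfold_locales

abbreviation F where "F \<equiv> gl_free K m n"
abbreviation U where "U \<equiv> gl_free_data K m n"

lemma F_eq: "F = FG.FC"
  by (simp add: gl_free_def)

sublocale F: scsalg K F
  unfolding F_eq by (rule FG.FC_scsalg)

lemma U_simps [simp]: "msize U = m" "nsize U = n"
  "entry U i j = free_comm_gen K (gl_gens m n) (gl_parity m) (Entry i j)"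
  "dinv1 U = free_comm_gen K (gl_gens m n) (gl_parity m) DetInv1"
  "dinv2 U = free_comm_gen K (gl_gens m n) (gl_parity m) DetInv2"
  by (simp_all add: gl_free_data_def Let_def)

lemma U_entry_grade: "i < m + n \<Longrightarrow> j < m + n \<Longrightarrow> entry U i j \<in> grade F ((i < m) \<noteq> (j < m))"
  using FG.FC_gen_grade[of "Entry i j"] by (simp add: F_eq gl_gens_def)

lemma U_dinv_grade: "dinv1 U \<in> grade F False" "dinv2 U \<in> grade F False"
  using FG.FC_gen_grade[of "DetInv1"] FG.FC_gen_grade[of "DetInv2"] by (simp_all add: F_eq gl_gens_def)

lemma U_entry_closed: "i < m + n \<Longrightarrow> j < m + n \<Longrightarrow> entry U i j \<in> carrier F"
  using U_entry_grade F.grade_carrier by blast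

lemma U_dinv_closed: "dinv1 U \<in> carrier F" "dinv2 U \<in> carrier F"
  using U_dinv_grade F.grade_carrier by blast+

lemma U_d_grade: "d1 F U \<in> grade F False" "d2 F U \<in> grade F False"
proof -
  have "X11 U i j \<in> grade F False" if "i < m" "j < m" for i j
    using U_entry_grade[of i j] that by (simp add: X11_def)
  then show "d1 F U \<in> grade F False"
    unfolding d1_def by (intro F.SR.mdet_even) (simp only: U_simps)
  have "X22 U i j \<in> grade F False" if "i < n" "j < n" for i j
    using U_entry_grade[of "m + i" "m + j"] that by (simp add: X22_def)
  then show "d2 F U \<in> grade F False"
    unfolding d2_def by (intro F.SR.mdet_even) (simp only: U_simps)
qed

lemma F_generates: "generates K F (gl_generators U)"
proof -
  have "gl_generators U = free_comm_gen K (gl_gens m n) (gl_parity m) ` gl_gens m n"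
    by (auto simp: gl_generators_def gl_gens_def)
  then show ?thesis
    using FG.FC_generates by (simp only: F_eq)
qed

definition det_rels where
  "det_rels = {d1 F U \<otimes>\<^bsub>F\<^esub> dinv1 U \<ominus>\<^bsub>F\<^esub> \<one>\<^bsub>F\<^esub>, d2 F U \<otimes>\<^bsub>F\<^esub> dinv2 U \<ominus>\<^bsub>F\<^esub> \<one>\<^bsub>F\<^esub>}"

lemma gl_ideal_eq: "gl_ideal K m n = Idl\<^bsub>F\<^esub> det_rels"
  by (simp only: gl_ideal_def Let_def det_rels_def)

lemma det_rels_even: "det_rels \<subseteq> grade F False \<union> grade F True"
proof -
  have "d1 F U \<otimes>\<^bsub>F\<^esub> dinv1 U \<ominus>\<^bsub>F\<^esub> \<one>\<^bsub>F\<^esub> \<in> grade F False" "d2 F U \<otimes>\<^bsub>F\<^esub> dinv2 U \<ominus>\<^bsub>F\<^esub> \<one>\<^bsub>F\<^esub> \<in> grade F False"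
    unfolding a_minus_def
    using U_d_grade U_dinv_grade by (simp_all only: F.grade_add F.grade_minus F.SR.even_mult F.grade_one)
  then show ?thesis by (auto simp only: det_rels_def)
qed

lemma det_rels_closed: "det_rels \<subseteq> carrier F"
  using det_rels_even F.grade_carrier by blast

lemma gl_ideal: "ideal (gl_ideal K m n) F" "F.graded_sub (gl_ideal K m n)"
  unfolding gl_ideal_eq
  by (rule F.A.genideal_ideal[OF det_rels_closed], rule F.genideal_graded[OF det_rels_even])

sublocale Q: alg_quot K F "gl_ideal K m n"
  by (rule F.quot_superalgebra(1)[OF gl_ideal])

abbreviation GL where "GL \<equiv> kGL K m n"
abbreviation V where "V \<equiv> GL_data K m n"

lemma GL_scsalg: "scsalg K GL"
  unfolding kGL_def by (rule F.quot_scsalg[OF gl_ideal])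

sublocale GL: scsalg K GL
  by (rule GL_scsalg)

lemma V_eq: "V = map_data (\<lambda>x. gl_ideal K m n +>\<^bsub>F\<^esub> x) U"
  by (simp only: GL_data_def)

lemma V_size [simp]: "msize V = m" "nsize V = n"
  by (simp_all add: V_eq)

lemma GL_proj: "(\<lambda>x. gl_ideal K m n +>\<^bsub>F\<^esub> x) \<in> superalg_hom K F GL"
  unfolding kGL_def by (rule F.quot_superalgebra(3)[OF gl_ideal])

lemma GL_generates: "generates K GL (gl_generators V)"
proof -
  have "gl_generators V = (\<lambda>x. gl_ideal K m n +>\<^bsub>F\<^esub> x) ` gl_generators U"
    by (auto simp: gl_generators_def V_eq simp del: U_simps(3-5))
  then show ?thesis
    using F.quot_generates[OF F_generates gl_ideal] by (simp only: kGL_def)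
qed

lemma GL_valid: "gl_valid GL (grade GL) V"
proof -
  note h = superalg_homD[OF GL_proj]
  note hf = hom_formulas[OF F.A.ring_axioms GL.A.ring_axioms h(7), of U, unfolded U_simps(1,2), OF U_entry_closed U_dinv_closed, folded V_eq]
  have dc: "d1 F U \<in> carrier F" "d2 F U \<in> carrier F"
    using U_d_grade F.grade_carrier by blast+
  have rel: "gl_ideal K m n +>\<^bsub>F\<^esub> z = gl_ideal K m n +>\<^bsub>F\<^esub> \<one>\<^bsub>F\<^esub>" if "z \<ominus>\<^bsub>F\<^esub> \<one>\<^bsub>F\<^esub> \<in> det_rels" "z \<in> carrier F" for z
    using that F.A.genideal_self[OF det_rels_closed] by (subst Q.proj_eq_iff) (auto simp: gl_ideal_eq)
  have "d1 GL V \<otimes>\<^bsub>GL\<^esub> dinv1 V = gl_ideal K m n +>\<^bsub>F\<^esub> (d1 F U \<otimes>\<^bsub>F\<^esub> dinv1 U)"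
    using h(3)[OF dc(1) U_dinv_closed(1)] hf(1) by (simp add: V_eq)
  also have "\<dots> = \<one>\<^bsub>GL\<^esub>"
    using dc U_dinv_closed h(4) by (subst rel) (auto simp: det_rels_def)
  finally have 1: "d1 GL V \<otimes>\<^bsub>GL\<^esub> dinv1 V = \<one>\<^bsub>GL\<^esub>" .
  have "d2 GL V \<otimes>\<^bsub>GL\<^esub> dinv2 V = gl_ideal K m n +>\<^bsub>F\<^esub> (d2 F U \<otimes>\<^bsub>F\<^esub> dinv2 U)"
    using h(3)[OF dc(2) U_dinv_closed(2)] hf(2) by (simp add: V_eq)
  also have "\<dots> = \<one>\<^bsub>GL\<^esub>"
    using dc U_dinv_closed h(4) by (subst rel) (auto simp: det_rels_def)
  finally have 2: "d2 GL V \<otimes>\<^bsub>GL\<^esub> dinv2 V = \<one>\<^bsub>GL\<^esub>" .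
  have "gl_entries (grade GL) V"
    unfolding gl_entries_def V_size using h(6) U_entry_grade by (simp add: V_eq del: U_simps(3-5))
  with 1 2 show ?thesis
    using h(6)[OF U_dinv_grade(1)] h(6)[OF U_dinv_grade(2)]
    unfolding gl_valid_def by (simp add: V_eq del: U_simps(3-5))
qed

text \<open>The universal property of k[GL(m|n)]. The entries and inverse determinants of
  \<open>E\<close> have the right parities to define a map on the free commutative superalgebra, and
  validity of \<open>E\<close> says that the two determinant relations go to zero.\<close>

lemma GL_lift:
  assumes B: "scsalg K B" and E: "gl_valid B (grade B) E" "msize E = m" "nsize E = n"
  obtains h where "h \<in> superalg_hom K GL B" "gl_agree h V E"
proof -
  interpret B: scsalg K B by (rule B)
  define b where "b g = (case g of Entry i j \<Rightarrow> entry E i j | DetInv1 \<Rightarrow> dinv1 E | DetInv2 \<Rightarrow> dinv2 E)" for g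
  have Ee: "entry E i j \<in> grade B ((i < m) \<noteq> (j < m))" if "i < m + n" "j < m + n" for i j
    using E that unfolding gl_valid_def gl_entries_def by blast
  have bg: "b g \<in> grade B (gl_parity m g)" if "g \<in> gl_gens m n" for g
    using that E(1) Ee by (auto simp: gl_gens_def b_def gl_valid_def)
  obtain h where h: "h \<in> superalg_hom K F B"
    "\<And>g. g \<in> gl_gens m n \<Longrightarrow> h (free_comm_gen K (gl_gens m n) (gl_parity m) g) = b g"
    using FG.FC_lift[OF B bg] unfolding F_eq by blast
  have he: "h (entry U i j) = entry E i j" if "i < m + n" "j < m + n" for i j
    using h(2)[of "Entry i j"] that by (simp add: gl_gens_def b_def)
  have ht: "h (dinv1 U) = dinv1 E" "h (dinv2 U) = dinv2 E"
    using h(2)[of DetInv1] h(2)[of DetInv2] by (simp_all add: gl_gens_def b_def)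
  have sB: "salg K B" "salg K F" by unfold_locales
  note hf = hom_formulas[OF F.A.ring_axioms B.A.ring_axioms superalg_homD(7)[OF h(1)], of U, unfolded U_simps(1,2), OF U_entry_closed U_dinv_closed]
  have hd: "h (d1 F U) = d1 B E" "h (d2 F U) = d2 B E"
  proof -
    have "entry E i j \<in> carrier B" if "i < m + n" "j < m + n" for i j
      using Ee[OF that] B.grade_carrier by blast
    then have "d1 B (map_data h U) = d1 B E" "d2 B (map_data h U) = d2 B E"
      using he E(2,3) by (intro B.A.d_cong; simp del: U_simps(3-5))+
    with hf show "h (d1 F U) = d1 B E" "h (d2 F U) = d2 B E" by auto
  qed
  have dc: "d1 F U \<in> carrier F" "d2 F U \<in> carrier F"
    using U_d_grade F.grade_carrier by blast+
  have "h z = \<zero>\<^bsub>B\<^esub>" if "z \<in> det_rels" for z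
  proof -
    have inv: "d1 B E \<otimes>\<^bsub>B\<^esub> dinv1 E = \<one>\<^bsub>B\<^esub>" "d2 B E \<otimes>\<^bsub>B\<^esub> dinv2 E = \<one>\<^bsub>B\<^esub>"
      using E by (simp_all add: gl_valid_def)
    have "h (d \<otimes>\<^bsub>F\<^esub> t \<ominus>\<^bsub>F\<^esub> \<one>\<^bsub>F\<^esub>) = h d \<otimes>\<^bsub>B\<^esub> h t \<ominus>\<^bsub>B\<^esub> \<one>\<^bsub>B\<^esub>" if "d \<in> carrier F" "t \<in> carrier F" for d t
      using that by (simp add: a_minus_def superalg_homD(2-4)[OF h(1)] superalg_hom_minus[OF sB(2,1) h(1)])
    then show ?thesis
      using that dc U_dinv_closed unfolding det_rels_def
      by (auto simp: hd ht inv B.A.r_neg a_minus_def simp del: U_simps(3-5))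
  qed
  then have "h z = \<zero>\<^bsub>B\<^esub>" if "z \<in> gl_ideal K m n" for z
    using F.hom_kills_genideal[OF sB(1) h(1) det_rels_closed] that unfolding gl_ideal_eq by blast
  then obtain k where k: "k \<in> superalg_hom K GL B" "\<And>x. x \<in> carrier F \<Longrightarrow> k (gl_ideal K m n +>\<^bsub>F\<^esub> x) = h x"
    using F.quot_lift[OF sB(1) h(1) gl_ideal] unfolding kGL_def by blast
  have "gl_agree k V E"
    unfolding gl_agree_def V_size using E k(2) U_entry_closed U_dinv_closed he ht
    by (simp add: V_eq del: U_simps(3-5))
  with k(1) that show ?thesis by blast
qed

abbreviation SL where "SL \<equiv> kSL K m n"
abbreviation W where "W \<equiv> SL_data K m n"

definition ber_rel where "ber_rel = Ber GL V \<ominus>\<^bsub>GL\<^esub> \<one>\<^bsub>GL\<^esub>"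

text \<open>Needed to know that Ber - 1 is even and hence generates a homogeneous ideal, so that
  k[SL(m|n)] is graded.\<close>

lemma V_Ber_grade: "Ber GL V \<in> grade GL False"
proof -
  interpret SM: super_mat GL "grade GL" "m + n" by unfold_locales
  note b = SM.BC_block[OF GL_valid] and bl = SM.valid_blocks[OF GL_valid]
  show ?thesis
    using SM.det_BC(3)[OF GL_valid] SM.D_even[OF b(1)] bl SM.D_even[of "SM.bs' V" n]
    by (auto simp: SM.blocks_def)
qed

lemma ber_rel_grade: "{ber_rel} \<subseteq> grade GL False \<union> grade GL True"
  unfolding ber_rel_def a_minus_def using V_Ber_grade
  by (auto intro!: GL.grade_add GL.grade_minus)

lemma ber_rel_closed: "{ber_rel} \<subseteq> carrier GL"
  using ber_rel_grade GL.grade_carrier by blast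

lemma sl_ideal_eq: "sl_ideal K m n = Idl\<^bsub>GL\<^esub> {ber_rel}"
  by (simp only: sl_ideal_def ber_rel_def)

lemma sl_ideal: "ideal (sl_ideal K m n) GL" "GL.graded_sub (sl_ideal K m n)"
  unfolding sl_ideal_eq
  by (rule GL.A.genideal_ideal[OF ber_rel_closed], rule GL.genideal_graded[OF ber_rel_grade])

sublocale SQ: alg_quot K GL "sl_ideal K m n"
  by (rule GL.quot_superalgebra(1)[OF sl_ideal])

lemma SL_scsalg: "scsalg K SL"
  unfolding kSL_def by (rule GL.quot_scsalg[OF sl_ideal])

sublocale SL: scsalg K SL
  by (rule SL_scsalg)

lemma W_eq: "W = map_data (\<lambda>x. sl_ideal K m n +>\<^bsub>GL\<^esub> x) V"
  by (simp only: SL_data_def)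

lemma W_size [simp]: "msize W = m" "nsize W = n"
  by (simp_all add: W_eq)

lemma SL_proj: "(\<lambda>x. sl_ideal K m n +>\<^bsub>GL\<^esub> x) \<in> superalg_hom K GL SL"
  unfolding kSL_def by (rule GL.quot_superalgebra(3)[OF sl_ideal])

lemma SL_generates: "generates K SL (gl_generators W)"
proof -
  have "gl_generators W = (\<lambda>x. sl_ideal K m n +>\<^bsub>GL\<^esub> x) ` gl_generators V"
    by (auto simp: gl_generators_def W_eq)
  then show ?thesis
    using GL.quot_generates[OF GL_generates sl_ideal] by (simp only: kSL_def)
qed

lemma SL_valid: "gl_valid SL (grade SL) W" "Ber SL W = \<one>\<^bsub>SL\<^esub>"
proof -
  note v = gl_valid_hom[OF GL_scsalg SL_scsalg SL_proj GL_valid, folded W_eq]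
  show "gl_valid SL (grade SL) W" by (rule v)
  have c: "Ber GL V \<in> carrier GL" using V_Ber_grade by simp
  have "ber_rel \<in> sl_ideal K m n"
    unfolding sl_ideal_eq using GL.A.genideal_self[OF ber_rel_closed] by blast
  then have "sl_ideal K m n +>\<^bsub>GL\<^esub> Ber GL V = sl_ideal K m n +>\<^bsub>GL\<^esub> \<one>\<^bsub>GL\<^esub>"
    unfolding ber_rel_def by (rule SQ.proj_eq_iff[OF c GL.A.one_closed, THEN iffD2])
  then show "Ber SL W = \<one>\<^bsub>SL\<^esub>"
    using v(4) superalg_homD(4)[OF SL_proj] by simp
qed

text \<open>The homomorphism from k[GL(m|n)] takes Ber of the generic matrix to Ber of
  \<open>E\<close>, which is 1; so it kills the generator of the ideal.\<close>

lemma SL_lift: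
  assumes B: "scsalg K B" and E: "gl_valid B (grade B) E" "msize E = m" "nsize E = n" and Ber: "Ber B E = \<one>\<^bsub>B\<^esub>"
  obtains h where "h \<in> superalg_hom K SL B" "gl_agree h W E"
proof -
  interpret B: scsalg K B by (rule B)
  have sB: "salg K B" "salg K GL" by unfold_locales
  obtain h where h: "h \<in> superalg_hom K GL B" "gl_agree h V E"
    using GL_lift[OF B E] .
  have c: "Ber GL V \<in> carrier GL" using V_Ber_grade by simp
  have "h (Ber GL V) = \<one>\<^bsub>B\<^esub>"
    using gl_agree_Ber[OF GL_scsalg B h(1) GL_valid E(1) h(2)] Ber by simp
  then have "h ber_rel = \<zero>\<^bsub>B\<^esub>"
    using c by (simp add: ber_rel_def a_minus_def superalg_homD(2,4)[OF h(1)] superalg_hom_minus[OF sB(2,1) h(1)] B.A.r_neg)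
  then have "h z = \<zero>\<^bsub>B\<^esub>" if "z \<in> sl_ideal K m n" for z
    using GL.hom_kills_genideal[OF sB(1) h(1) ber_rel_closed] that unfolding sl_ideal_eq by blast
  then obtain k where k: "k \<in> superalg_hom K SL B" "\<And>x. x \<in> carrier GL \<Longrightarrow> k (sl_ideal K m n +>\<^bsub>GL\<^esub> x) = h x"
    using GL.quot_lift[OF sB(1) h(1) sl_ideal] unfolding kSL_def by blast
  have "gl_generators V \<subseteq> carrier GL"
    using GL_generates by (simp add: generates_def)
  then have "entry V i j \<in> carrier GL" "dinv1 V \<in> carrier GL" "dinv2 V \<in> carrier GL" if "i < m + n" "j < m + n" for i j
    using that by (auto simp: gl_generators_def)
  moreover from \<open>gl_generators V \<subseteq> carrier GL\<close> have "dinv1 V \<in> carrier GL" "dinv2 V \<in> carrier GL"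
    by (auto simp: gl_generators_def)
  ultimately have "gl_agree k W E"
    using h(2) k(2) by (simp add: gl_agree_def W_eq)
  with k(1) that show ?thesis by blast
qed

end

section \<open>Tensor products\<close>

context free_mod
begin

lemma lin_ext_compose:
  assumes M: "module K M" and L: "module K L" and \<beta>: "\<And>s. s \<in> S \<Longrightarrow> \<beta> s \<in> carrier M"
    and h: "\<And>x. x \<in> carrier M \<Longrightarrow> h x \<in> carrier L"
      "\<And>x y. x \<in> carrier M \<Longrightarrow> y \<in> carrier M \<Longrightarrow> h (x \<oplus>\<^bsub>M\<^esub> y) = h x \<oplus>\<^bsub>L\<^esub> h y"
      "\<And>c x. c \<in> carrier K \<Longrightarrow> x \<in> carrier M \<Longrightarrow> h (c \<odot>\<^bsub>M\<^esub> x) = c \<odot>\<^bsub>L\<^esub> h x"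
    and f: "f \<in> carrier F"
  shows "h (lin_ext K M \<beta> f) = lin_ext K L (\<lambda>s. h (\<beta> s)) f"
proof -
  interpret M: module K M by (rule M)
  interpret L: module K L by (rule L)
  have h\<beta>: "\<And>s. s \<in> S \<Longrightarrow> h (\<beta> s) \<in> carrier L"
    using \<beta> h(1) by blast
  have h0: "h \<zero>\<^bsub>M\<^esub> = \<zero>\<^bsub>L\<^esub>"
  proof -
    have "h \<zero>\<^bsub>M\<^esub> = h (\<zero> \<odot>\<^bsub>M\<^esub> \<zero>\<^bsub>M\<^esub>)" by simp
    also have "\<dots> = \<zero> \<odot>\<^bsub>L\<^esub> h \<zero>\<^bsub>M\<^esub>" by (rule h(3)) auto
    also have "\<dots> = \<zero>\<^bsub>L\<^esub>" by (rule L.smult_l_null[OF h(1)]) auto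
    finally show ?thesis .
  qed
  note eM = lin_ext_closed[OF M \<beta>] lin_ext_gen[OF M \<beta>] lin_ext_zero[OF M \<beta>] lin_ext_add[OF M \<beta>] lin_ext_smult[OF M \<beta>]
  note eL = lin_ext_closed[OF L h\<beta>] lin_ext_gen[OF L h\<beta>] lin_ext_zero[OF L h\<beta>] lin_ext_add[OF L h\<beta>] lin_ext_smult[OF L h\<beta>]
  show ?thesis
    using spans_gen f
  proof (induction rule: spans_induct)
    case (gen x)
    then obtain s where "s \<in> S" "x = gen s" by auto
    then show ?case by (simp only: eM(2) eL(2))
  next
    case zero
    then show ?case by (simp add: lin_ext_def zero_F h0)
  next
    case (add x y)
    then show ?case by (simp only: eM eL h)
  next
    case (smult c x)
    then show ?case by (simp only: eM eL h)
  qed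
qed

lemma linear_kernel_submodule:
  assumes M: "module K M" and \<beta>: "\<And>s. s \<in> S \<Longrightarrow> \<beta> s \<in> carrier M"
  shows "submodule {f \<in> carrier F. lin_ext K M \<beta> f = \<zero>\<^bsub>M\<^esub>} K F"
proof -
  interpret M: module K M by (rule M)
  note e = lin_ext_closed[OF M \<beta>] lin_ext_gen[OF M \<beta>] lin_ext_zero[OF M \<beta>] lin_ext_add[OF M \<beta>] lin_ext_smult[OF M \<beta>]
  show ?thesis
  proof (rule F.submoduleI)
    fix f assume f: "f \<in> {f \<in> carrier F. lin_ext K M \<beta> f = \<zero>\<^bsub>M\<^esub>}"
    have "\<ominus>\<^bsub>F\<^esub> f = (\<ominus> \<one>) \<odot>\<^bsub>F\<^esub> f"
      using f by (simp add: F.smult_l_minus)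
    then show "\<ominus>\<^bsub>F\<^esub> f \<in> {f \<in> carrier F. lin_ext K M \<beta> f = \<zero>\<^bsub>M\<^esub>}"
      using f by (simp add: e)
  qed (auto simp: e)
qed

end

locale tens_alg = A: salg K A + B: salg K B
  for K :: "('k, 'r) ring_scheme" and A :: "('k, 'a, 'y) superalg_scheme" and B :: "('k, 'b, 'z) superalg_scheme"
begin

abbreviation FP :: "('k, 'a \<times> 'b \<Rightarrow> 'k) superalg" where "FP \<equiv> free_pairs K A B"

sublocale FM: free_mod K "carrier A \<times> carrier B" FP
  by unfold_locales (auto simp: free_pairs_def Let_def)

abbreviation rel where "rel \<equiv> bilinear_rel K A B"

abbreviation T where "T \<equiv> tensor K A B"

lemma pair_gen_eq: "pair_gen K a b = FM.gen (a, b)"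
  by (auto simp: pair_gen_def FM.gen_def)

definition relators where
  "relators = {pair_gen K (a \<oplus>\<^bsub>A\<^esub> a') b \<ominus>\<^bsub>FP\<^esub> (pair_gen K a b \<oplus>\<^bsub>FP\<^esub> pair_gen K a' b) | a a' b.
                a \<in> carrier A \<and> a' \<in> carrier A \<and> b \<in> carrier B} \<union>
             {pair_gen K a (b \<oplus>\<^bsub>B\<^esub> b') \<ominus>\<^bsub>FP\<^esub> (pair_gen K a b \<oplus>\<^bsub>FP\<^esub> pair_gen K a b') | a b b'.
                a \<in> carrier A \<and> b \<in> carrier B \<and> b' \<in> carrier B} \<union>
             {pair_gen K (c \<odot>\<^bsub>A\<^esub> a) b \<ominus>\<^bsub>FP\<^esub> c \<odot>\<^bsub>FP\<^esub> pair_gen K a b | c a b.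
                c \<in> carrier K \<and> a \<in> carrier A \<and> b \<in> carrier B} \<union>
             {pair_gen K a (c \<odot>\<^bsub>B\<^esub> b) \<ominus>\<^bsub>FP\<^esub> c \<odot>\<^bsub>FP\<^esub> pair_gen K a b | c a b.
                c \<in> carrier K \<and> a \<in> carrier A \<and> b \<in> carrier B}"

lemma rel_eq: "rel = \<Inter>{N. submodule N K FP \<and> relators \<subseteq> N}"
  by (simp only: bilinear_rel_def Let_def relators_def)

lemma relators_rel: "relators \<subseteq> rel"
  unfolding rel_eq by blast

lemma rel_minimal: "submodule N K FP \<Longrightarrow> relators \<subseteq> N \<Longrightarrow> rel \<subseteq> N"
  unfolding rel_eq by blast

lemma relators_cases:
  assumes "z \<in> relators"
  obtains a a' b where "a \<in> carrier A" "a' \<in> carrier A" "b \<in> carrier B"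
      "z = FM.gen (a \<oplus>\<^bsub>A\<^esub> a', b) \<ominus>\<^bsub>FP\<^esub> (FM.gen (a, b) \<oplus>\<^bsub>FP\<^esub> FM.gen (a', b))"
    | a b b' where "a \<in> carrier A" "b \<in> carrier B" "b' \<in> carrier B"
      "z = FM.gen (a, b \<oplus>\<^bsub>B\<^esub> b') \<ominus>\<^bsub>FP\<^esub> (FM.gen (a, b) \<oplus>\<^bsub>FP\<^esub> FM.gen (a, b'))"
    | c a b where "c \<in> carrier K" "a \<in> carrier A" "b \<in> carrier B"
      "z = FM.gen (c \<odot>\<^bsub>A\<^esub> a, b) \<ominus>\<^bsub>FP\<^esub> c \<odot>\<^bsub>FP\<^esub> FM.gen (a, b)"
    | c a b where "c \<in> carrier K" "a \<in> carrier A" "b \<in> carrier B"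
      "z = FM.gen (a, c \<odot>\<^bsub>B\<^esub> b) \<ominus>\<^bsub>FP\<^esub> c \<odot>\<^bsub>FP\<^esub> FM.gen (a, b)"
  using assms unfolding relators_def pair_gen_eq
proof (elim UnE CollectE exE conjE)
qed (rule that(1) that(2) that(3) that(4); assumption)+

lemma relators_closed: "relators \<subseteq> carrier FP"
proof
  fix z assume "z \<in> relators"
  then show "z \<in> carrier FP"
    by (cases rule: relators_cases) auto
qed

lemma rel_submodule: "submodule rel K FP"
proof -
  have full: "submodule (carrier FP) K FP"
    by (rule FM.F.submoduleI) auto
  note E = FM.F.submoduleE
  have mem: "x \<in> rel \<longleftrightarrow> (\<forall>N. submodule N K FP \<and> relators \<subseteq> N \<longrightarrow> x \<in> N)" for x
    unfolding rel_eq by blast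
  show ?thesis
  proof (rule FM.F.submoduleI)
    show "rel \<subseteq> carrier FP"
      by (rule rel_minimal[OF full relators_closed])
    show "\<zero>\<^bsub>FP\<^esub> \<in> rel"
      unfolding mem by (auto simp: submodule_def subgroup_def)
    fix a assume a: "a \<in> rel"
    show "\<ominus>\<^bsub>FP\<^esub> a \<in> rel"
      unfolding mem using a E(3) by (auto simp: mem)
    show "a \<oplus>\<^bsub>FP\<^esub> b \<in> rel" if "b \<in> rel" for b
      unfolding mem using a that E(5) by (auto simp: mem)
    show "c \<odot>\<^bsub>FP\<^esub> a \<in> rel" if "c \<in> carrier K" for c
      unfolding mem using a that E(4) by (auto simp: mem)
  qed
qed

sublocale MQ: mod_quot K FP rel
  by (intro mod_quot.intro mod_quot_axioms.intro FM.F_module rel_submodule)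

lemma T_eq: "T = super_quot FP rel"
  by (simp only: tensor_def)

lemma T_module: "module K T"
  unfolding T_eq by (rule MQ.quot_module)

sublocale TM: module K T
  by (rule T_module)

lemma tens_eq: "tens K A B a b = rel +>\<^bsub>FP\<^esub> FM.gen (a, b)"
  by (simp only: tens_def pair_gen_eq)

abbreviation tn :: "'a \<Rightarrow> 'b \<Rightarrow> ('a \<times> 'b \<Rightarrow> 'k) set" where "tn \<equiv> tens K A B"

lemma tn_closed [simp]: "a \<in> carrier A \<Longrightarrow> b \<in> carrier B \<Longrightarrow> tn a b \<in> carrier T"
  unfolding T_eq tens_eq MQ.carrier_Q by (rule imageI) simp

definition bilin :: "('k, 'm, 'w) module_scheme \<Rightarrow> ('a \<Rightarrow> 'b \<Rightarrow> 'm) \<Rightarrow> bool" where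
  "bilin M \<beta> \<longleftrightarrow> (\<forall>a\<in>carrier A. \<forall>b\<in>carrier B. \<beta> a b \<in> carrier M) \<and>
     (\<forall>a\<in>carrier A. \<forall>a'\<in>carrier A. \<forall>b\<in>carrier B. \<beta> (a \<oplus>\<^bsub>A\<^esub> a') b = \<beta> a b \<oplus>\<^bsub>M\<^esub> \<beta> a' b) \<and>
     (\<forall>a\<in>carrier A. \<forall>b\<in>carrier B. \<forall>b'\<in>carrier B. \<beta> a (b \<oplus>\<^bsub>B\<^esub> b') = \<beta> a b \<oplus>\<^bsub>M\<^esub> \<beta> a b') \<and>
     (\<forall>c\<in>carrier K. \<forall>a\<in>carrier A. \<forall>b\<in>carrier B. \<beta> (c \<odot>\<^bsub>A\<^esub> a) b = c \<odot>\<^bsub>M\<^esub> \<beta> a b) \<and>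
     (\<forall>c\<in>carrier K. \<forall>a\<in>carrier A. \<forall>b\<in>carrier B. \<beta> a (c \<odot>\<^bsub>B\<^esub> b) = c \<odot>\<^bsub>M\<^esub> \<beta> a b)"

lemma bilinD:
  assumes "bilin M \<beta>"
  shows "a \<in> carrier A \<Longrightarrow> b \<in> carrier B \<Longrightarrow> \<beta> a b \<in> carrier M"
    and "a \<in> carrier A \<Longrightarrow> a' \<in> carrier A \<Longrightarrow> b \<in> carrier B \<Longrightarrow> \<beta> (a \<oplus>\<^bsub>A\<^esub> a') b = \<beta> a b \<oplus>\<^bsub>M\<^esub> \<beta> a' b"
    and "a \<in> carrier A \<Longrightarrow> b \<in> carrier B \<Longrightarrow> b' \<in> carrier B \<Longrightarrow> \<beta> a (b \<oplus>\<^bsub>B\<^esub> b') = \<beta> a b \<oplus>\<^bsub>M\<^esub> \<beta> a b'"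
    and "c \<in> carrier K \<Longrightarrow> a \<in> carrier A \<Longrightarrow> b \<in> carrier B \<Longrightarrow> \<beta> (c \<odot>\<^bsub>A\<^esub> a) b = c \<odot>\<^bsub>M\<^esub> \<beta> a b"
    and "c \<in> carrier K \<Longrightarrow> a \<in> carrier A \<Longrightarrow> b \<in> carrier B \<Longrightarrow> \<beta> a (c \<odot>\<^bsub>B\<^esub> b) = c \<odot>\<^bsub>M\<^esub> \<beta> a b"
  using assms unfolding bilin_def by blast+

lemma bilin_closed: "bilin M \<beta> \<Longrightarrow> \<forall>a\<in>carrier A. \<forall>b\<in>carrier B. \<beta> a b \<in> carrier M"
  by (simp add: bilin_def)

lemma bilinI:
  assumes "\<And>a b. a \<in> carrier A \<Longrightarrow> b \<in> carrier B \<Longrightarrow> \<beta> a b \<in> carrier M"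
    and "\<And>a a' b. a \<in> carrier A \<Longrightarrow> a' \<in> carrier A \<Longrightarrow> b \<in> carrier B \<Longrightarrow> \<beta> (a \<oplus>\<^bsub>A\<^esub> a') b = \<beta> a b \<oplus>\<^bsub>M\<^esub> \<beta> a' b"
    and "\<And>a b b'. a \<in> carrier A \<Longrightarrow> b \<in> carrier B \<Longrightarrow> b' \<in> carrier B \<Longrightarrow> \<beta> a (b \<oplus>\<^bsub>B\<^esub> b') = \<beta> a b \<oplus>\<^bsub>M\<^esub> \<beta> a b'"
    and "\<And>c a b. c \<in> carrier K \<Longrightarrow> a \<in> carrier A \<Longrightarrow> b \<in> carrier B \<Longrightarrow> \<beta> (c \<odot>\<^bsub>A\<^esub> a) b = c \<odot>\<^bsub>M\<^esub> \<beta> a b"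
    and "\<And>c a b. c \<in> carrier K \<Longrightarrow> a \<in> carrier A \<Longrightarrow> b \<in> carrier B \<Longrightarrow> \<beta> a (c \<odot>\<^bsub>B\<^esub> b) = c \<odot>\<^bsub>M\<^esub> \<beta> a b"
  shows "bilin M \<beta>"
  unfolding bilin_def by (intro conjI ballI; rule assms; assumption)

abbreviation lin :: "('k, 'm, 'w) module_scheme \<Rightarrow> ('a \<Rightarrow> 'b \<Rightarrow> 'm) \<Rightarrow> ('a \<times> 'b \<Rightarrow> 'k) \<Rightarrow> 'm" where
  "lin M \<beta> \<equiv> lin_ext K M (\<lambda>s. \<beta> (fst s) (snd s))"

lemma lin_facts:
  assumes M: "module K M" and \<beta>: "\<forall>a\<in>carrier A. \<forall>b\<in>carrier B. \<beta> a b \<in> carrier M"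
  shows "f \<in> carrier FP \<Longrightarrow> lin M \<beta> f \<in> carrier M"
    and "f \<in> carrier FP \<Longrightarrow> g \<in> carrier FP \<Longrightarrow> lin M \<beta> (f \<oplus>\<^bsub>FP\<^esub> g) = lin M \<beta> f \<oplus>\<^bsub>M\<^esub> lin M \<beta> g"
    and "c \<in> carrier K \<Longrightarrow> f \<in> carrier FP \<Longrightarrow> lin M \<beta> (c \<odot>\<^bsub>FP\<^esub> f) = c \<odot>\<^bsub>M\<^esub> lin M \<beta> f"
    and "a \<in> carrier A \<Longrightarrow> b \<in> carrier B \<Longrightarrow> lin M \<beta> (FM.gen (a, b)) = \<beta> a b"
    and "f \<in> carrier FP \<Longrightarrow> g \<in> carrier FP \<Longrightarrow> lin M \<beta> (f \<ominus>\<^bsub>FP\<^esub> g) = lin M \<beta> f \<ominus>\<^bsub>M\<^esub> lin M \<beta> g"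
proof -
  interpret M: module K M by (rule M)
  have \<beta>': "\<beta> (fst s) (snd s) \<in> carrier M" if "s \<in> carrier A \<times> carrier B" for s
    using \<beta> that by auto
  show "f \<in> carrier FP \<Longrightarrow> lin M \<beta> f \<in> carrier M"
    by (rule FM.lin_ext_closed[OF M \<beta>'])
  show "f \<in> carrier FP \<Longrightarrow> g \<in> carrier FP \<Longrightarrow> lin M \<beta> (f \<oplus>\<^bsub>FP\<^esub> g) = lin M \<beta> f \<oplus>\<^bsub>M\<^esub> lin M \<beta> g"
    by (rule FM.lin_ext_add[OF M \<beta>'])
  show "c \<in> carrier K \<Longrightarrow> f \<in> carrier FP \<Longrightarrow> lin M \<beta> (c \<odot>\<^bsub>FP\<^esub> f) = c \<odot>\<^bsub>M\<^esub> lin M \<beta> f"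
    by (rule FM.lin_ext_smult[OF M \<beta>'])
  show "a \<in> carrier A \<Longrightarrow> b \<in> carrier B \<Longrightarrow> lin M \<beta> (FM.gen (a, b)) = \<beta> a b"
    by (subst FM.lin_ext_gen[OF M \<beta>']) simp_all
  assume f: "f \<in> carrier FP" and g: "g \<in> carrier FP"
  have "\<ominus>\<^bsub>FP\<^esub> g = (\<ominus>\<^bsub>K\<^esub> \<one>\<^bsub>K\<^esub>) \<odot>\<^bsub>FP\<^esub> g"
    using g by (simp add: FM.F.smult_l_minus)
  then have "lin M \<beta> (\<ominus>\<^bsub>FP\<^esub> g) = lin M \<beta> ((\<ominus>\<^bsub>K\<^esub> \<one>\<^bsub>K\<^esub>) \<odot>\<^bsub>FP\<^esub> g)"
    by simp
  also have "\<dots> = (\<ominus>\<^bsub>K\<^esub> \<one>\<^bsub>K\<^esub>) \<odot>\<^bsub>M\<^esub> lin M \<beta> g"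
    by (rule FM.lin_ext_smult[OF M \<beta>']) (simp_all add: g)
  also have "\<dots> = \<ominus>\<^bsub>M\<^esub> lin M \<beta> g"
  proof -
    have "lin M \<beta> g \<in> carrier M"
      by (rule FM.lin_ext_closed[OF M \<beta>']) (simp_all add: g)
    then show ?thesis by (simp add: M.smult_l_minus)
  qed
  finally have neg: "lin M \<beta> (\<ominus>\<^bsub>FP\<^esub> g) = \<ominus>\<^bsub>M\<^esub> lin M \<beta> g" .
  have "lin M \<beta> (f \<oplus>\<^bsub>FP\<^esub> \<ominus>\<^bsub>FP\<^esub> g) = lin M \<beta> f \<oplus>\<^bsub>M\<^esub> lin M \<beta> (\<ominus>\<^bsub>FP\<^esub> g)"
    by (rule FM.lin_ext_add[OF M \<beta>']) (simp_all add: f g)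
  then show "lin M \<beta> (f \<ominus>\<^bsub>FP\<^esub> g) = lin M \<beta> f \<ominus>\<^bsub>M\<^esub> lin M \<beta> g"
    unfolding neg by (simp add: a_minus_def)
qed

text \<open>For bilinear \<beta> the kernel of the linear extension is a submodule that contains the
  relators, hence one of the submodules whose intersection is \<open>rel\<close>.\<close>

lemma lin_kills_rel:
  assumes M: "module K M" and \<beta>: "bilin M \<beta>" and f: "f \<in> rel"
  shows "lin M \<beta> f = \<zero>\<^bsub>M\<^esub>"
proof -
  interpret M: module K M by (rule M)
  note b = bilinD[OF \<beta>]
  note l = lin_facts[OF M bilin_closed[OF \<beta>]]
  have sub: "submodule {f \<in> carrier FP. lin M \<beta> f = \<zero>\<^bsub>M\<^esub>} K FP"
    using b(1) by (intro FM.linear_kernel_submodule[OF M]) auto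
  have eq: "x \<ominus>\<^bsub>M\<^esub> x = \<zero>\<^bsub>M\<^esub>" if "x \<in> carrier M" for x
    using that by (simp add: a_minus_def M.M.r_neg)
  have "relators \<subseteq> {f \<in> carrier FP. lin M \<beta> f = \<zero>\<^bsub>M\<^esub>}"
  proof
    fix z assume z: "z \<in> relators"
    then have "z \<in> carrier FP" using relators_closed by blast
    moreover have "lin M \<beta> z = \<zero>\<^bsub>M\<^esub>"
      using z
    proof (cases rule: relators_cases)
      case (1 a a' b)
      then show ?thesis by (simp add: l b eq)
    next
      case (2 a b b')
      then show ?thesis by (simp add: l b eq)
    next
      case (3 c a b)
      then show ?thesis by (simp add: l b eq)
    next
      case (4 c a b)
      then show ?thesis by (simp add: l b eq)
    qed
    ultimately show "z \<in> {f \<in> carrier FP. lin M \<beta> f = \<zero>\<^bsub>M\<^esub>}" by simp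
  qed
  from rel_minimal[OF sub this] f show ?thesis by blast
qed

lemma tn_bilin: "bilin T tn"
proof (rule bilinI)
  have eq: "rel +>\<^bsub>FP\<^esub> x = rel +>\<^bsub>FP\<^esub> y" if "x \<ominus>\<^bsub>FP\<^esub> y \<in> relators" "x \<in> carrier FP" "y \<in> carrier FP" for x y
    using that relators_rel by (subst MQ.proj_eq_iff) auto
  fix a a' b b' c
  show "tn a b \<in> carrier T" if "a \<in> carrier A" "b \<in> carrier B"
    using that by (rule tn_closed)
  show "tn (a \<oplus>\<^bsub>A\<^esub> a') b = tn a b \<oplus>\<^bsub>T\<^esub> tn a' b" if "a \<in> carrier A" "a' \<in> carrier A" "b \<in> carrier B"
    unfolding tens_eq T_eq using that
    by (subst MQ.add_Q, simp, simp, intro eq) (auto simp: relators_def pair_gen_eq)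
  show "tn a (b \<oplus>\<^bsub>B\<^esub> b') = tn a b \<oplus>\<^bsub>T\<^esub> tn a b'" if "a \<in> carrier A" "b \<in> carrier B" "b' \<in> carrier B"
    unfolding tens_eq T_eq using that
    by (subst MQ.add_Q, simp, simp, intro eq) (auto simp: relators_def pair_gen_eq)
  show "tn (c \<odot>\<^bsub>A\<^esub> a) b = c \<odot>\<^bsub>T\<^esub> tn a b" if "c \<in> carrier K" "a \<in> carrier A" "b \<in> carrier B"
    unfolding tens_eq T_eq using that
    by (subst MQ.smult_Q, simp, simp, intro eq) (auto simp: relators_def pair_gen_eq)
  show "tn a (c \<odot>\<^bsub>B\<^esub> b) = c \<odot>\<^bsub>T\<^esub> tn a b" if "c \<in> carrier K" "a \<in> carrier A" "b \<in> carrier B"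
    unfolding tens_eq T_eq using that
    by (subst MQ.smult_Q, simp, simp, intro eq) (auto simp: relators_def pair_gen_eq)
qed

lemmas tn_rules = bilinD(2-5)[OF tn_bilin]

lemma tn_zero: "a \<in> carrier A \<Longrightarrow> tn a \<zero>\<^bsub>B\<^esub> = \<zero>\<^bsub>T\<^esub>" "b \<in> carrier B \<Longrightarrow> tn \<zero>\<^bsub>A\<^esub> b = \<zero>\<^bsub>T\<^esub>"
  using tn_rules(4)[of "\<zero>\<^bsub>K\<^esub>" a "\<zero>\<^bsub>B\<^esub>"] tn_rules(3)[of "\<zero>\<^bsub>K\<^esub>" "\<zero>\<^bsub>A\<^esub>" b] by simp_all

lemma proj_lin:
  assumes "f \<in> carrier FP"
  shows "rel +>\<^bsub>FP\<^esub> f = lin T tn f"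
proof -
  note l = lin_facts[OF T_module bilin_closed[OF tn_bilin]]
  show ?thesis
    using FM.spans_gen assms
  proof (induction rule: spans_induct)
    case (gen x)
    then obtain a b where ab: "a \<in> carrier A" "b \<in> carrier B" "x = FM.gen (a, b)" by auto
    then show ?case unfolding ab(3) l(4)[OF ab(1,2)] by (simp only: tens_eq)
  next
    case zero
    have "lin T tn (\<zero>\<^bsub>K\<^esub> \<odot>\<^bsub>FP\<^esub> \<zero>\<^bsub>FP\<^esub>) = \<zero>\<^bsub>T\<^esub>"
      using l(1)[of "\<zero>\<^bsub>FP\<^esub>"] by (subst l(3)) auto
    then show ?case using MQ.zero_Q by (simp add: T_eq)
  next
    case (add x y)
    then show ?case using MQ.add_Q[OF add(1,2), folded T_eq] by (simp add: l(2))
  next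
    case (smult c x)
    then show ?case using MQ.smult_Q[OF smult(1,2), folded T_eq] by (simp add: l(3))
  qed
qed

lemma T_spans: "spans K T {tn a b | a b. a \<in> carrier A \<and> b \<in> carrier B}"
  unfolding spans_def
proof (intro conjI allI impI)
  show "{tn a b | a b. a \<in> carrier A \<and> b \<in> carrier B} \<subseteq> carrier T"
    by auto
  fix U assume U: "{tn a b | a b. a \<in> carrier A \<and> b \<in> carrier B} \<subseteq> U" "\<zero>\<^bsub>T\<^esub> \<in> U"
    "\<forall>x\<in>U \<inter> carrier T. \<forall>y\<in>U \<inter> carrier T. x \<oplus>\<^bsub>T\<^esub> y \<in> U"
    "\<forall>c\<in>carrier K. \<forall>x\<in>U \<inter> carrier T. c \<odot>\<^bsub>T\<^esub> x \<in> U"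
  have cl: "rel +>\<^bsub>FP\<^esub> x \<in> carrier T" if "x \<in> carrier FP" for x
    using that by (simp add: T_eq MQ.carrier_Q)
  have "rel +>\<^bsub>FP\<^esub> f \<in> U" if "f \<in> carrier FP" for f
    using FM.spans_gen that
  proof (induction rule: spans_induct)
    case (gen x)
    then show ?case using U(1) by (auto simp: tens_eq)
  next
    case zero
    then show ?case using U(2) MQ.zero_Q by (simp add: T_eq)
  next
    case (add x y)
    then have "(rel +>\<^bsub>FP\<^esub> x) \<oplus>\<^bsub>T\<^esub> (rel +>\<^bsub>FP\<^esub> y) \<in> U"
      using U(3) cl[OF add(1)] cl[OF add(2)] by blast
    then show ?case using MQ.add_Q[OF add(1,2)] by (simp add: T_eq)
  next
    case (smult c x)
    then have "c \<odot>\<^bsub>T\<^esub> (rel +>\<^bsub>FP\<^esub> x) \<in> U"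
      using U(4) cl[OF smult(2)] by blast
    then show ?case using MQ.smult_Q[OF smult(1,2)] by (simp add: T_eq)
  qed
  then show "carrier T \<subseteq> U"
    unfolding T_eq MQ.carrier_Q by blast
qed

lemma spans_subset:
  assumes "spans K M \<Gamma>" "\<Delta> \<subseteq> carrier M" "\<And>U x. \<lbrakk>\<Delta> \<subseteq> U; \<zero>\<^bsub>M\<^esub> \<in> U; \<forall>x\<in>U \<inter> carrier M. \<forall>y\<in>U \<inter> carrier M. x \<oplus>\<^bsub>M\<^esub> y \<in> U;
    \<forall>c\<in>carrier K. \<forall>x\<in>U \<inter> carrier M. c \<odot>\<^bsub>M\<^esub> x \<in> U; x \<in> \<Gamma>\<rbrakk> \<Longrightarrow> x \<in> U"
  shows "spans K M \<Delta>"
  unfolding spans_def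
proof (intro conjI allI impI)
  show "\<Delta> \<subseteq> carrier M" by (rule assms(2))
  fix U assume U: "\<Delta> \<subseteq> U" "\<zero>\<^bsub>M\<^esub> \<in> U" "\<forall>x\<in>U \<inter> carrier M. \<forall>y\<in>U \<inter> carrier M. x \<oplus>\<^bsub>M\<^esub> y \<in> U"
    "\<forall>c\<in>carrier K. \<forall>x\<in>U \<inter> carrier M. c \<odot>\<^bsub>M\<^esub> x \<in> U"
  then have "\<Gamma> \<subseteq> U" using assms(3)[OF U] by blast
  then show "carrier M \<subseteq> U"
    using assms(1) U(2-4) unfolding spans_def by blast
qed

text \<open>Tensors of homogeneous elements, for which the product of the tensor product is a single
  tensor up to sign. They still span, and so suffice for associativity and for multiplicativity of
  maps.\<close>

definition hgens where
  "hgens = {tn a b | a b p q. a \<in> grade A p \<and> b \<in> grade B q}"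

lemma hgens_spans: "spans K T hgens"
proof (rule spans_subset[OF T_spans])
  show "hgens \<subseteq> carrier T"
    using A.grade_carrier B.grade_carrier by (auto simp: hgens_def)
  fix U x assume U: "hgens \<subseteq> U" "\<forall>x\<in>U \<inter> carrier T. \<forall>y\<in>U \<inter> carrier T. x \<oplus>\<^bsub>T\<^esub> y \<in> U"
    and "x \<in> {tn a b | a b. a \<in> carrier A \<and> b \<in> carrier B}"
  then obtain a b where ab: "a \<in> carrier A" "b \<in> carrier B" "x = tn a b" by auto
  have "tn (hcomp A p a) (hcomp B q b) \<in> hgens" for p q
    unfolding hgens_def using A.hcomp_grade[OF ab(1)] B.hcomp_grade[OF ab(2)] by blast
  then have "tn (hcomp A p a) (hcomp B q b) \<in> U \<inter> carrier T" for p q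
    using U(1) ab by auto
  moreover have "x = (tn (hcomp A False a) (hcomp B False b) \<oplus>\<^bsub>T\<^esub> tn (hcomp A False a) (hcomp B True b)) \<oplus>\<^bsub>T\<^esub>
      (tn (hcomp A True a) (hcomp B False b) \<oplus>\<^bsub>T\<^esub> tn (hcomp A True a) (hcomp B True b))"
  proof -
    have "x = tn (hcomp A False a \<oplus>\<^bsub>A\<^esub> hcomp A True a) b"
      using ab A.hcomp_sum by simp
    also have "\<dots> = tn (hcomp A False a) b \<oplus>\<^bsub>T\<^esub> tn (hcomp A True a) b"
      using ab by (simp add: tn_rules)
    finally have "x = tn (hcomp A False a) b \<oplus>\<^bsub>T\<^esub> tn (hcomp A True a) b" .
    moreover have "tn (hcomp A p a) b = tn (hcomp A p a) (hcomp B False b) \<oplus>\<^bsub>T\<^esub> tn (hcomp A p a) (hcomp B True b)" for p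
      using ab B.hcomp_sum[OF ab(2)] tn_rules(2)[of "hcomp A p a" "hcomp B False b" "hcomp B True b"] by simp
    ultimately show ?thesis by simp
  qed
  ultimately show "x \<in> U"
    using U(2) by (simp add: Int_iff)
qed

end

section \<open>Multiplication on the tensor product\<close>

lemma (in abelian_monoid) finsum_bool:
  "(\<And>p. h p \<in> carrier G) \<Longrightarrow> (\<Oplus>p\<in>(UNIV :: bool set). h p) = h False \<oplus> h True"
  by (simp add: UNIV_bool)

lemma (in bilin_alg) bl_minus:
  assumes "x \<in> carrier A" "y \<in> carrier A"
  shows "(\<ominus> x) \<otimes> y = \<ominus> (x \<otimes> y)" "x \<otimes> (\<ominus> y) = \<ominus> (x \<otimes> y)"
proof -
  have m: "\<ominus> z = (\<ominus>\<^bsub>K\<^esub> \<one>\<^bsub>K\<^esub>) \<odot> z" if "z \<in> carrier A" for z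
    using that by (simp add: smult_l_minus)
  show "(\<ominus> x) \<otimes> y = \<ominus> (x \<otimes> y)" "x \<otimes> (\<ominus> y) = \<ominus> (x \<otimes> y)"
    using assms m[OF assms(1)] m[OF assms(2)] m[OF bmult_closed[OF assms]]
    by (simp_all add: bsmult_left bsmult_right)
qed

lemma (in free_mod) F_minus: "f \<in> carrier F \<Longrightarrow> (\<ominus>\<^bsub>F\<^esub> f) s = \<ominus> f s"
proof -
  assume f: "f \<in> carrier F"
  then have "\<ominus>\<^bsub>F\<^esub> f = (\<ominus> \<one>) \<odot>\<^bsub>F\<^esub> f"
    by (simp add: F.smult_l_minus)
  then show ?thesis
    using f by (simp add: smult_F carrier_F l_minus)
qed

lemma (in free_mod) lin_ext_cong:
  assumes "module K M" "f \<in> carrier F" "\<And>s. s \<in> S \<Longrightarrow> \<beta> s = \<beta>' s" "\<And>s. s \<in> S \<Longrightarrow> \<beta>' s \<in> carrier M"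
  shows "lin_ext K M \<beta> f = lin_ext K M \<beta>' f"
proof -
  interpret M: module K M by fact
  show ?thesis
    unfolding lin_ext_def using assms by (intro M.finsum_cong') (auto simp: carrier_F)
qed

context tens_alg
begin

definition hp :: "'a \<times> 'b \<Rightarrow> 'a \<times> 'b \<Rightarrow> bool \<Rightarrow> bool \<Rightarrow> 'a \<times> 'b" where
  "hp s t p q = (fst s \<otimes>\<^bsub>A\<^esub> hcomp A q (fst t), hcomp B p (snd s) \<otimes>\<^bsub>B\<^esub> snd t)"

text \<open>The product of two basis pairs in \<open>free_pairs\<close>. The four terms belong to
  the parities p of the component of the second entry of s and q of that of the first entry of t;
  the sign is negative when both are odd.\<close>

definition pmul :: "'a \<times> 'b \<Rightarrow> 'a \<times> 'b \<Rightarrow> 'a \<times> 'b \<Rightarrow> 'k" where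
  "pmul s t = (FM.gen (hp s t False False) \<oplus>\<^bsub>FP\<^esub> FM.gen (hp s t False True)) \<oplus>\<^bsub>FP\<^esub>
     (FM.gen (hp s t True False) \<oplus>\<^bsub>FP\<^esub> \<ominus>\<^bsub>FP\<^esub> FM.gen (hp s t True True))"

abbreviation SS where "SS \<equiv> carrier A \<times> carrier B"

lemma hp_closed [simp]: "s \<in> SS \<Longrightarrow> t \<in> SS \<Longrightarrow> hp s t p q \<in> SS"
  by (auto simp: hp_def)

lemma pmul_closed: "s \<in> SS \<Longrightarrow> t \<in> SS \<Longrightarrow> pmul s t \<in> carrier FP"
  unfolding pmul_def by simp

text \<open>Multiplication by the basis pair s from the left, as a linear map of the right
  factor.\<close>

definition rmul where "rmul s g = lin_ext K FP (pmul s) g"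

lemma rmul:
  assumes "s \<in> SS"
  shows "g \<in> carrier FP \<Longrightarrow> rmul s g \<in> carrier FP"
    and "f \<in> carrier FP \<Longrightarrow> g \<in> carrier FP \<Longrightarrow> rmul s (f \<oplus>\<^bsub>FP\<^esub> g) = rmul s f \<oplus>\<^bsub>FP\<^esub> rmul s g"
    and "c \<in> carrier K \<Longrightarrow> g \<in> carrier FP \<Longrightarrow> rmul s (c \<odot>\<^bsub>FP\<^esub> g) = c \<odot>\<^bsub>FP\<^esub> rmul s g"
    and "t \<in> SS \<Longrightarrow> rmul s (FM.gen t) = pmul s t"
proof -
  have p: "pmul s t \<in> carrier FP" if "t \<in> SS" for t
    using pmul_closed[OF assms that] .
  show "g \<in> carrier FP \<Longrightarrow> rmul s g \<in> carrier FP"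
    unfolding rmul_def by (rule FM.lin_ext_closed[OF FM.F_module p])
  show "f \<in> carrier FP \<Longrightarrow> g \<in> carrier FP \<Longrightarrow> rmul s (f \<oplus>\<^bsub>FP\<^esub> g) = rmul s f \<oplus>\<^bsub>FP\<^esub> rmul s g"
    unfolding rmul_def by (rule FM.lin_ext_add[OF FM.F_module p])
  show "c \<in> carrier K \<Longrightarrow> g \<in> carrier FP \<Longrightarrow> rmul s (c \<odot>\<^bsub>FP\<^esub> g) = c \<odot>\<^bsub>FP\<^esub> rmul s g"
    unfolding rmul_def by (rule FM.lin_ext_smult[OF FM.F_module p])
  show "t \<in> SS \<Longrightarrow> rmul s (FM.gen t) = pmul s t"
    unfolding rmul_def by (rule FM.lin_ext_gen[OF FM.F_module p])
qed

lemma FP_value: "f \<in> carrier FP \<Longrightarrow> f s \<in> carrier K"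
  by (cases s) (simp add: FM.carrier_F)

lemma pmul_value:
  assumes "s \<in> SS" "t \<in> SS"
  shows "pmul s t z = (\<Oplus>\<^bsub>K\<^esub>p\<in>UNIV. \<Oplus>\<^bsub>K\<^esub>q\<in>UNIV.
    if z = hp s t p q then neg_if K (p \<and> q) \<one>\<^bsub>K\<^esub> else \<zero>\<^bsub>K\<^esub>)"
proof -
  define h where "h p q = (if z = hp s t p q then neg_if K (p \<and> q) \<one>\<^bsub>K\<^esub> else \<zero>\<^bsub>K\<^esub>)" for p q
  have c: "h p q \<in> carrier K" for p q
    by (simp add: h_def neg_if_def)
  have "(\<Oplus>\<^bsub>K\<^esub>p\<in>UNIV. \<Oplus>\<^bsub>K\<^esub>q\<in>UNIV. h p q) = (\<Oplus>\<^bsub>K\<^esub>p\<in>UNIV. h p False \<oplus>\<^bsub>K\<^esub> h p True)"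
    using A.K.finsum_bool[OF c] by simp
  also have "\<dots> = (h False False \<oplus>\<^bsub>K\<^esub> h False True) \<oplus>\<^bsub>K\<^esub> (h True False \<oplus>\<^bsub>K\<^esub> h True True)"
    by (rule A.K.finsum_bool) (simp add: c)
  also have "\<dots> = pmul s t z"
  proof -
    have g: "FM.gen (hp s t p q) \<in> carrier FP" for p q
      by (rule FM.gen_closed[OF hp_closed[OF assms]])
    show ?thesis
      unfolding pmul_def FM.add_F FM.F_minus[OF g] by (simp add: FM.gen_def h_def neg_if_def)
  qed
  finally show ?thesis
    by (simp add: h_def)
qed

text \<open>Regroups the fourfold sum of the definition into two nested linear extensions. In this
  form bilinearity is that of \<open>lin_ext\<close>, whereas the sums over supports depend on the
  arguments in their index sets.\<close>

lemma FP_mult: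
  assumes f: "f \<in> carrier FP" and g: "g \<in> carrier FP"
  shows "f \<otimes>\<^bsub>FP\<^esub> g = lin_ext K FP (\<lambda>s. rmul s g) f"
proof
  fix z
  have S: "finite {s. f s \<noteq> \<zero>\<^bsub>K\<^esub>}" "finite {t. g t \<noteq> \<zero>\<^bsub>K\<^esub>}" "{s. f s \<noteq> \<zero>\<^bsub>K\<^esub>} \<subseteq> SS" "{t. g t \<noteq> \<zero>\<^bsub>K\<^esub>} \<subseteq> SS"
    using f g by (auto simp: FM.carrier_F)
  have v: "f s \<in> carrier K" "g s \<in> carrier K" for s
    using FP_value[OF f] FP_value[OF g] by auto
  have 1: "rmul s g z = (\<Oplus>\<^bsub>K\<^esub>t\<in>{t. g t \<noteq> \<zero>\<^bsub>K\<^esub>}. g t \<otimes>\<^bsub>K\<^esub> pmul s t z)" if "s \<in> SS" for s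
    unfolding rmul_def lin_ext_def using S that pmul_closed v
    by (subst FM.F_finsum) (auto simp: subset_iff FM.smult_F intro!: FM.F_smult_closed[unfolded FM.smult_F])
  have "lin_ext K FP (\<lambda>s. rmul s g) f z = (\<Oplus>\<^bsub>K\<^esub>s\<in>{s. f s \<noteq> \<zero>\<^bsub>K\<^esub>}. f s \<otimes>\<^bsub>K\<^esub> rmul s g z)"
    unfolding lin_ext_def using S rmul(1) v g
    by (subst FM.F_finsum) (auto simp: subset_iff FM.smult_F intro!: FM.F_smult_closed[unfolded FM.smult_F])
  also have "\<dots> = (\<Oplus>\<^bsub>K\<^esub>s\<in>{s. f s \<noteq> \<zero>\<^bsub>K\<^esub>}. \<Oplus>\<^bsub>K\<^esub>t\<in>{t. g t \<noteq> \<zero>\<^bsub>K\<^esub>}. \<Oplus>\<^bsub>K\<^esub>p\<in>UNIV. \<Oplus>\<^bsub>K\<^esub>q\<in>UNIV.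
             if z = hp s t p q then neg_if K (p \<and> q) (f s \<otimes>\<^bsub>K\<^esub> g t) else \<zero>\<^bsub>K\<^esub>)"
  proof (rule A.K.finsum_cong')
    fix s assume s: "s \<in> {s. f s \<noteq> \<zero>\<^bsub>K\<^esub>}"
    then have sS: "s \<in> SS" using S by auto
    have p: "pmul s t z \<in> carrier K" if "t \<in> {t. g t \<noteq> \<zero>\<^bsub>K\<^esub>}" for t
      using FP_value[OF pmul_closed[OF sS]] S that by blast
    have "f s \<otimes>\<^bsub>K\<^esub> rmul s g z = (\<Oplus>\<^bsub>K\<^esub>t\<in>{t. g t \<noteq> \<zero>\<^bsub>K\<^esub>}. f s \<otimes>\<^bsub>K\<^esub> (g t \<otimes>\<^bsub>K\<^esub> pmul s t z))"
      unfolding 1[OF sS] using S v p by (intro A.K.finsum_rdistr) auto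
    also have "\<dots> = (\<Oplus>\<^bsub>K\<^esub>t\<in>{t. g t \<noteq> \<zero>\<^bsub>K\<^esub>}. \<Oplus>\<^bsub>K\<^esub>p\<in>UNIV. \<Oplus>\<^bsub>K\<^esub>q\<in>UNIV.
             if z = hp s t p q then neg_if K (p \<and> q) (f s \<otimes>\<^bsub>K\<^esub> g t) else \<zero>\<^bsub>K\<^esub>)"
    proof (rule A.K.finsum_cong')
      fix t assume t: "t \<in> {t. g t \<noteq> \<zero>\<^bsub>K\<^esub>}"
      then have tS: "t \<in> SS" using S by auto
      have c: "(if z = hp s t p q then neg_if K (p \<and> q) \<one>\<^bsub>K\<^esub> else \<zero>\<^bsub>K\<^esub>) \<in> carrier K" for p q
        by (simp add: neg_if_def)
      have "f s \<otimes>\<^bsub>K\<^esub> (g t \<otimes>\<^bsub>K\<^esub> pmul s t z) = (f s \<otimes>\<^bsub>K\<^esub> g t) \<otimes>\<^bsub>K\<^esub> pmul s t z"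
        using v p[OF t] by (simp add: A.K.m_assoc)
      also have "\<dots> = (\<Oplus>\<^bsub>K\<^esub>p\<in>UNIV. (f s \<otimes>\<^bsub>K\<^esub> g t) \<otimes>\<^bsub>K\<^esub>
          (\<Oplus>\<^bsub>K\<^esub>q\<in>UNIV. if z = hp s t p q then neg_if K (p \<and> q) \<one>\<^bsub>K\<^esub> else \<zero>\<^bsub>K\<^esub>))"
        unfolding pmul_value[OF sS tS] using v c by (intro A.K.finsum_rdistr) auto
      also have "\<dots> = (\<Oplus>\<^bsub>K\<^esub>p\<in>UNIV. \<Oplus>\<^bsub>K\<^esub>q\<in>UNIV. (f s \<otimes>\<^bsub>K\<^esub> g t) \<otimes>\<^bsub>K\<^esub>
          (if z = hp s t p q then neg_if K (p \<and> q) \<one>\<^bsub>K\<^esub> else \<zero>\<^bsub>K\<^esub>))"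
        using v c by (intro A.K.finsum_cong' A.K.finsum_rdistr) auto
      also have "\<dots> = (\<Oplus>\<^bsub>K\<^esub>p\<in>UNIV. \<Oplus>\<^bsub>K\<^esub>q\<in>UNIV. if z = hp s t p q then neg_if K (p \<and> q) (f s \<otimes>\<^bsub>K\<^esub> g t) else \<zero>\<^bsub>K\<^esub>)"
      proof -
        have "(f s \<otimes>\<^bsub>K\<^esub> g t) \<otimes>\<^bsub>K\<^esub> (if z = hp s t p q then neg_if K (p \<and> q) \<one>\<^bsub>K\<^esub> else \<zero>\<^bsub>K\<^esub>) =
          (if z = hp s t p q then neg_if K (p \<and> q) (f s \<otimes>\<^bsub>K\<^esub> g t) else \<zero>\<^bsub>K\<^esub>)" for p q
          using v by (simp add: neg_if_def A.K.r_minus)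
        then show ?thesis by simp
      qed
      finally show "f s \<otimes>\<^bsub>K\<^esub> (g t \<otimes>\<^bsub>K\<^esub> pmul s t z) = (\<Oplus>\<^bsub>K\<^esub>p\<in>UNIV. \<Oplus>\<^bsub>K\<^esub>q\<in>UNIV.
             if z = hp s t p q then neg_if K (p \<and> q) (f s \<otimes>\<^bsub>K\<^esub> g t) else \<zero>\<^bsub>K\<^esub>)" .
    qed (use v in \<open>auto simp: neg_if_def intro!: A.K.finsum_closed\<close>)
    finally show "f s \<otimes>\<^bsub>K\<^esub> rmul s g z = (\<Oplus>\<^bsub>K\<^esub>t\<in>{t. g t \<noteq> \<zero>\<^bsub>K\<^esub>}. \<Oplus>\<^bsub>K\<^esub>p\<in>UNIV. \<Oplus>\<^bsub>K\<^esub>q\<in>UNIV.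
             if z = hp s t p q then neg_if K (p \<and> q) (f s \<otimes>\<^bsub>K\<^esub> g t) else \<zero>\<^bsub>K\<^esub>)" .
  qed (use v in \<open>auto simp: neg_if_def intro!: A.K.finsum_closed\<close>)
  finally show "(f \<otimes>\<^bsub>FP\<^esub> g) z = lin_ext K FP (\<lambda>s. rmul s g) f z"
    by (simp add: free_pairs_def Let_def hp_def)
qed

lemma FP_one: "\<one>\<^bsub>FP\<^esub> = FM.gen (\<one>\<^bsub>A\<^esub>, \<one>\<^bsub>B\<^esub>)"
  by (auto simp: free_pairs_def Let_def FM.gen_def)

lemma FP_gen_mult: "s \<in> SS \<Longrightarrow> g \<in> carrier FP \<Longrightarrow> FM.gen s \<otimes>\<^bsub>FP\<^esub> g = rmul s g"
  by (subst FP_mult, simp, simp, rule FM.lin_ext_gen[OF FM.F_module rmul(1)])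

lemma FP_bilin: "bilin_alg K FP"
proof -
  have closed: "f \<otimes>\<^bsub>FP\<^esub> g \<in> carrier FP" if "f \<in> carrier FP" "g \<in> carrier FP" for f g
    unfolding FP_mult[OF that] by (rule FM.lin_ext_closed[OF FM.F_module rmul(1)[OF _ that(2)] that(1)])
  have ladd: "(f \<oplus>\<^bsub>FP\<^esub> f') \<otimes>\<^bsub>FP\<^esub> g = f \<otimes>\<^bsub>FP\<^esub> g \<oplus>\<^bsub>FP\<^esub> f' \<otimes>\<^bsub>FP\<^esub> g"
    if "f \<in> carrier FP" "f' \<in> carrier FP" "g \<in> carrier FP" for f f' g
    using that FM.lin_ext_add[OF FM.F_module rmul(1)[OF _ that(3)], of "\<lambda>s. s" f f']
    by (simp add: FP_mult)
  have lsmult: "(c \<odot>\<^bsub>FP\<^esub> f) \<otimes>\<^bsub>FP\<^esub> g = c \<odot>\<^bsub>FP\<^esub> (f \<otimes>\<^bsub>FP\<^esub> g)"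
    if "c \<in> carrier K" "f \<in> carrier FP" "g \<in> carrier FP" for c f g
    using that FM.lin_ext_smult[OF FM.F_module rmul(1)[OF _ that(3)], of "\<lambda>s. s" c f]
    by (simp add: FP_mult)
  have lzero: "\<zero>\<^bsub>FP\<^esub> \<otimes>\<^bsub>FP\<^esub> g = \<zero>\<^bsub>FP\<^esub>" if "g \<in> carrier FP" for g
    using lsmult[of "\<zero>\<^bsub>K\<^esub>" "\<zero>\<^bsub>FP\<^esub>" g] closed that by simp
  have radd: "h \<otimes>\<^bsub>FP\<^esub> (f \<oplus>\<^bsub>FP\<^esub> g) = h \<otimes>\<^bsub>FP\<^esub> f \<oplus>\<^bsub>FP\<^esub> h \<otimes>\<^bsub>FP\<^esub> g"
    if "f \<in> carrier FP" "g \<in> carrier FP" "h \<in> carrier FP" for f g h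
    using FM.spans_gen that(3)
  proof (induction rule: spans_induct)
    case (gen x)
    then obtain s where "s \<in> SS" "x = FM.gen s" by auto
    then show ?case using that by (simp add: FP_gen_mult rmul)
  next
    case (add x y)
    then show ?case using that closed by (simp add: ladd FM.F.M.a_ac)
  next
    case (smult c x)
    then show ?case using that closed by (simp add: lsmult FM.F.smult_r_distr)
  qed (use that in \<open>simp add: lzero\<close>)
  have rsmult: "h \<otimes>\<^bsub>FP\<^esub> (c \<odot>\<^bsub>FP\<^esub> f) = c \<odot>\<^bsub>FP\<^esub> (h \<otimes>\<^bsub>FP\<^esub> f)"
    if "c \<in> carrier K" "f \<in> carrier FP" "h \<in> carrier FP" for c f h
    using FM.spans_gen that(3)
  proof (induction rule: spans_induct)
    case (gen x)
    then obtain s where "s \<in> SS" "x = FM.gen s" by auto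
    then show ?case using that by (simp add: FP_gen_mult rmul)
  next
    case (add x y)
    then show ?case using that closed by (simp add: ladd FM.F.smult_r_distr)
  next
    case (smult d x)
    have "d \<odot>\<^bsub>FP\<^esub> (c \<odot>\<^bsub>FP\<^esub> (x \<otimes>\<^bsub>FP\<^esub> f)) = c \<odot>\<^bsub>FP\<^esub> (d \<odot>\<^bsub>FP\<^esub> (x \<otimes>\<^bsub>FP\<^esub> f))"
      using smult(1,2) that closed by (simp add: A.K.m_comm flip: FM.F.smult_assoc1)
    then show ?case using smult that closed by (simp add: lsmult)
  qed (use that in \<open>simp add: lzero\<close>)
  show ?thesis
    by (intro bilin_alg.intro bilin_alg_axioms.intro FM.F_module)
      (simp_all add: FP_one closed ladd radd lsmult rsmult)
qed

sublocale FB: bilin_alg K FP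
  by (rule FP_bilin)

text \<open>The class of \<open>pmul\<close> modulo the relations. Unlike \<open>pmul\<close> it is
  bilinear in (a, b) and in (c, d), since tensors are.\<close>

definition tmul where
  "tmul a b c d = (tn (a \<otimes>\<^bsub>A\<^esub> hcomp A False c) (hcomp B False b \<otimes>\<^bsub>B\<^esub> d) \<oplus>\<^bsub>T\<^esub> tn (a \<otimes>\<^bsub>A\<^esub> hcomp A True c) (hcomp B False b \<otimes>\<^bsub>B\<^esub> d)) \<oplus>\<^bsub>T\<^esub>
    (tn (a \<otimes>\<^bsub>A\<^esub> hcomp A False c) (hcomp B True b \<otimes>\<^bsub>B\<^esub> d) \<oplus>\<^bsub>T\<^esub> \<ominus>\<^bsub>T\<^esub> tn (a \<otimes>\<^bsub>A\<^esub> hcomp A True c) (hcomp B True b \<otimes>\<^bsub>B\<^esub> d))"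

lemma proj_pmul:
  assumes "a \<in> carrier A" "b \<in> carrier B" "c \<in> carrier A" "d \<in> carrier B"
  shows "rel +>\<^bsub>FP\<^esub> pmul (a, b) (c, d) = tmul a b c d"
  using assms unfolding pmul_def tmul_def hp_def fst_conv snd_conv tens_eq T_eq
  by (simp add: MQ.add_Q MQ.minus_Q)

lemma tmul_bilin1:
  assumes "c \<in> carrier A" "d \<in> carrier B"
  shows "bilin T (\<lambda>a b. tmul a b c d)"
  unfolding tmul_def using assms
  by (intro bilinI) (simp_all add: tn_rules A.A.l_distr B.A.l_distr A.smult_mult_left B.smult_mult_left
    B.hcomp_add B.hcomp_smult TM.M.minus_add TM.M.a_ac TM.smult_r_distr TM.smult_r_minus)

lemma tmul_bilin2:
  assumes "a \<in> carrier A" "b \<in> carrier B"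
  shows "bilin T (\<lambda>c d. tmul a b c d)"
  unfolding tmul_def using assms
  by (intro bilinI) (simp_all add: tn_rules A.A.r_distr B.A.r_distr A.smult_mult_right B.smult_mult_right
    A.hcomp_add A.hcomp_smult TM.M.minus_add TM.M.a_ac TM.smult_r_distr TM.smult_r_minus)

lemma proj_T_linear:
  "x \<in> carrier FP \<Longrightarrow> rel +>\<^bsub>FP\<^esub> x \<in> carrier T"
  "x \<in> carrier FP \<Longrightarrow> y \<in> carrier FP \<Longrightarrow> rel +>\<^bsub>FP\<^esub> (x \<oplus>\<^bsub>FP\<^esub> y) = (rel +>\<^bsub>FP\<^esub> x) \<oplus>\<^bsub>T\<^esub> (rel +>\<^bsub>FP\<^esub> y)"
  "c \<in> carrier K \<Longrightarrow> x \<in> carrier FP \<Longrightarrow> rel +>\<^bsub>FP\<^esub> (c \<odot>\<^bsub>FP\<^esub> x) = c \<odot>\<^bsub>T\<^esub> (rel +>\<^bsub>FP\<^esub> x)"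
  by (simp_all add: T_eq MQ.carrier_Q MQ.add_Q MQ.smult_Q)

lemma proj_mult_gen_right:
  assumes f: "f \<in> carrier FP" and t: "c \<in> carrier A" "d \<in> carrier B"
  shows "rel +>\<^bsub>FP\<^esub> (f \<otimes>\<^bsub>FP\<^esub> FM.gen (c, d)) = lin T (\<lambda>a b. tmul a b c d) f"
proof -
  have tS: "(c, d) \<in> SS" using t by simp
  have cl: "rmul s (FM.gen (c, d)) \<in> carrier FP" if "s \<in> SS" for s
    using rmul(1)[OF that] tS by simp
  have "rel +>\<^bsub>FP\<^esub> (f \<otimes>\<^bsub>FP\<^esub> FM.gen (c, d)) = rel +>\<^bsub>FP\<^esub> lin_ext K FP (\<lambda>s. rmul s (FM.gen (c, d))) f"
    using f tS by (simp add: FP_mult)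
  also have "\<dots> = lin_ext K T (\<lambda>s. rel +>\<^bsub>FP\<^esub> rmul s (FM.gen (c, d))) f"
    by (rule FM.lin_ext_compose[OF FM.F_module T_module cl _ _ _ f]) (simp_all add: proj_T_linear)
  also have "\<dots> = lin T (\<lambda>a b. tmul a b c d) f"
  proof (rule FM.lin_ext_cong[OF T_module f])
    fix s assume s: "s \<in> SS"
    show "rel +>\<^bsub>FP\<^esub> rmul s (FM.gen (c, d)) = tmul (fst s) (snd s) c d"
      using s t proj_pmul[of "fst s" "snd s" c d] by (auto simp: rmul(4)[OF s])
    show "tmul (fst s) (snd s) c d \<in> carrier T"
      using s bilinD(1)[OF tmul_bilin1[OF t]] by auto
  qed
  finally show ?thesis .
qed

lemma proj_mult_gen_left:
  assumes f: "f \<in> carrier FP" and t: "a \<in> carrier A" "b \<in> carrier B"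
  shows "rel +>\<^bsub>FP\<^esub> (FM.gen (a, b) \<otimes>\<^bsub>FP\<^esub> f) = lin T (\<lambda>c d. tmul a b c d) f"
proof -
  have tS: "(a, b) \<in> SS" using t by simp
  have cl: "pmul (a, b) s \<in> carrier FP" if "s \<in> SS" for s
    using pmul_closed[OF tS that] .
  have "rel +>\<^bsub>FP\<^esub> (FM.gen (a, b) \<otimes>\<^bsub>FP\<^esub> f) = rel +>\<^bsub>FP\<^esub> lin_ext K FP (pmul (a, b)) f"
    using FP_gen_mult[OF tS f] by (simp add: rmul_def)
  also have "\<dots> = lin_ext K T (\<lambda>s. rel +>\<^bsub>FP\<^esub> pmul (a, b) s) f"
    by (rule FM.lin_ext_compose[OF FM.F_module T_module cl _ _ _ f]) (simp_all add: proj_T_linear)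
  also have "\<dots> = lin T (\<lambda>c d. tmul a b c d) f"
  proof (rule FM.lin_ext_cong[OF T_module f])
    fix s assume s: "s \<in> SS"
    show "rel +>\<^bsub>FP\<^esub> pmul (a, b) s = tmul a b (fst s) (snd s)"
      using s t proj_pmul[of a b "fst s" "snd s"] by auto
    show "tmul a b (fst s) (snd s) \<in> carrier T"
      using s bilinD(1)[OF tmul_bilin2[OF t]] by auto
  qed
  finally show ?thesis .
qed

lemma rel_iff: "f \<in> carrier FP \<Longrightarrow> f \<in> rel \<longleftrightarrow> rel +>\<^bsub>FP\<^esub> f = \<zero>\<^bsub>T\<^esub>"
  using MQ.proj_zero_iff by (simp add: T_eq)

lemma rel_carrier: "f \<in> rel \<Longrightarrow> f \<in> carrier FP"
  using MQ.I_carrier .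

text \<open>Multiplying by a basis pair and projecting to the tensor product is the linear extension
  of the bilinear map \<open>tmul\<close>, so it kills \<open>rel\<close>. General factors follow by
  linearity.\<close>

lemma rel_ideal:
  assumes f: "f \<in> rel" and g: "g \<in> carrier FP"
  shows "f \<otimes>\<^bsub>FP\<^esub> g \<in> rel" "g \<otimes>\<^bsub>FP\<^esub> f \<in> rel"
proof -
  note fc = rel_carrier[OF f]
  note E = FM.F.submoduleE[OF rel_submodule]
  have zero: "\<zero>\<^bsub>FP\<^esub> \<in> rel"
    using rel_submodule by (simp add: submodule_def subgroup_def)
  show "f \<otimes>\<^bsub>FP\<^esub> g \<in> rel"
    using FM.spans_gen g
  proof (induction rule: spans_induct)
    case (gen x)
    then obtain c d where cd: "c \<in> carrier A" "d \<in> carrier B" "x = FM.gen (c, d)" by auto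
    have "f \<otimes>\<^bsub>FP\<^esub> x \<in> carrier FP"
      using fc cd by (simp add: FB.bmult_closed)
    then show ?case
      using proj_mult_gen_right[OF fc cd(1,2)] lin_kills_rel[OF T_module tmul_bilin1[OF cd(1,2)] f]
      by (simp add: rel_iff cd(3))
  qed (use fc zero E(4,5) in \<open>simp_all add: FB.br_null FB.br_distr FB.bsmult_right\<close>)
  show "g \<otimes>\<^bsub>FP\<^esub> f \<in> rel"
    using FM.spans_gen g
  proof (induction rule: spans_induct)
    case (gen x)
    then obtain c d where cd: "c \<in> carrier A" "d \<in> carrier B" "x = FM.gen (c, d)" by auto
    have "x \<otimes>\<^bsub>FP\<^esub> f \<in> carrier FP"
      using fc cd by (simp add: FB.bmult_closed)
    then show ?case
      using proj_mult_gen_left[OF fc cd(1,2)] lin_kills_rel[OF T_module tmul_bilin2[OF cd(1,2)] f]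
      by (simp add: rel_iff cd(3))
  qed (use fc zero E(4,5) in \<open>simp_all add: FB.bl_null FB.bl_distr FB.bsmult_left\<close>)
qed

sublocale AQ: alg_quot K FP rel
  by (intro alg_quot.intro FP_bilin MQ.mod_quot_axioms alg_quot_axioms.intro rel_ideal)

lemma T_bilin: "bilin_alg K T"
  unfolding T_eq by (rule AQ.quot_bilin)

sublocale TB: bilin_alg K T
  by (rule T_bilin)

lemma T_one: "\<one>\<^bsub>T\<^esub> = tn \<one>\<^bsub>A\<^esub> \<one>\<^bsub>B\<^esub>"
  by (simp add: T_eq MQ.one_Q FP_one tens_eq)

lemma tn_mult:
  assumes "a \<in> carrier A" "b \<in> carrier B" "c \<in> carrier A" "d \<in> carrier B"
  shows "tn a b \<otimes>\<^bsub>T\<^esub> tn c d = tmul a b c d"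
proof -
  have "tn a b \<otimes>\<^bsub>T\<^esub> tn c d = rel +>\<^bsub>FP\<^esub> (FM.gen (a, b) \<otimes>\<^bsub>FP\<^esub> FM.gen (c, d))"
    using assms by (simp add: tens_eq T_eq AQ.mult_Q)
  also have "\<dots> = rel +>\<^bsub>FP\<^esub> pmul (a, b) (c, d)"
    using assms by (simp add: FP_gen_mult rmul)
  finally show ?thesis
    using proj_pmul[OF assms] by simp
qed

text \<open>For homogeneous b and c three of the four terms of \<open>tmul\<close> have a zero
  component and vanish. The sign depends on these two parities alone, as b passes c.\<close>

lemma tn_mult_homogeneous:
  assumes "a \<in> carrier A" "b \<in> grade B p" "c \<in> grade A q" "d \<in> carrier B"
  shows "tn a b \<otimes>\<^bsub>T\<^esub> tn c d = neg_if T (p \<and> q) (tn (a \<otimes>\<^bsub>A\<^esub> c) (b \<otimes>\<^bsub>B\<^esub> d))"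
proof -
  have bc: "b \<in> carrier B" "c \<in> carrier A"
    using assms A.grade_carrier B.grade_carrier by auto
  have b: "hcomp B p' b = (if p' = p then b else \<zero>\<^bsub>B\<^esub>)" for p'
    using B.hcomp_same[OF assms(2)] B.hcomp_other[OF assms(2)] by auto
  have c: "hcomp A q' c = (if q' = q then c else \<zero>\<^bsub>A\<^esub>)" for q'
    using A.hcomp_same[OF assms(3)] A.hcomp_other[OF assms(3)] by auto
  have m0: "\<ominus>\<^bsub>T\<^esub> \<zero>\<^bsub>T\<^esub> = \<zero>\<^bsub>T\<^esub>"
    by (rule TM.M.minus_equality) auto
  show ?thesis
    unfolding tn_mult[OF assms(1) bc assms(4)] tmul_def b c neg_if_def
    using assms(1,4) bc by (cases p; cases q) (simp_all add: tn_zero m0)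
qed

end

section \<open>The tensor product as a superalgebra\<close>

context tens_alg
begin

lemma T_minus_zero: "\<ominus>\<^bsub>T\<^esub> \<zero>\<^bsub>T\<^esub> = \<zero>\<^bsub>T\<^esub>"
  by (rule TM.M.minus_equality) auto

lemma neg_if_T:
  assumes "x \<in> carrier T"
  shows "neg_if T c x \<in> carrier T" "neg_if T c (neg_if T d x) = neg_if T (c \<noteq> d) x"
    and "y \<in> carrier T \<Longrightarrow> neg_if T c x \<otimes>\<^bsub>T\<^esub> y = neg_if T c (x \<otimes>\<^bsub>T\<^esub> y)"
    and "y \<in> carrier T \<Longrightarrow> y \<otimes>\<^bsub>T\<^esub> neg_if T c x = neg_if T c (y \<otimes>\<^bsub>T\<^esub> x)"
  using assms by (auto simp: neg_if_def TB.bl_minus)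

lemma tn_minus:
  assumes "a \<in> carrier A" "b \<in> carrier B"
  shows "tn (neg_if A c a) b = neg_if T c (tn a b)" "tn a (neg_if B c b) = neg_if T c (tn a b)"
proof -
  have "\<ominus>\<^bsub>A\<^esub> a = (\<ominus>\<^bsub>K\<^esub> \<one>\<^bsub>K\<^esub>) \<odot>\<^bsub>A\<^esub> a" "\<ominus>\<^bsub>B\<^esub> b = (\<ominus>\<^bsub>K\<^esub> \<one>\<^bsub>K\<^esub>) \<odot>\<^bsub>B\<^esub> b"
    "\<ominus>\<^bsub>T\<^esub> tn a b = (\<ominus>\<^bsub>K\<^esub> \<one>\<^bsub>K\<^esub>) \<odot>\<^bsub>T\<^esub> tn a b"
    using assms by (simp_all add: A.M.smult_l_minus B.M.smult_l_minus TM.smult_l_minus)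
  then show "tn (neg_if A c a) b = neg_if T c (tn a b)" "tn a (neg_if B c b) = neg_if T c (tn a b)"
    using assms by (simp_all add: neg_if_def tn_rules)
qed

lemma hgensE:
  assumes "x \<in> hgens"
  obtains a b p q where "a \<in> grade A p" "b \<in> grade B q" "x = tn a b"
  using assms unfolding hgens_def by blast

text \<open>On homogeneous tensors associativity is the equality of sign exponents pb pc + (pb + pd)
  pe = pd pe + pb (pc + pe) modulo 2, besides associativity in each factor.\<close>

lemma T_ring: "ring T"
proof (rule ringI)
  show "abelian_group T" by unfold_locales
  show "Group.monoid T"
  proof (rule monoidI)
    fix x y z assume xyz: "x \<in> carrier T" "y \<in> carrier T" "z \<in> carrier T"
    show "x \<otimes>\<^bsub>T\<^esub> y \<otimes>\<^bsub>T\<^esub> z = x \<otimes>\<^bsub>T\<^esub> (y \<otimes>\<^bsub>T\<^esub> z)"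
    proof (rule TB.assoc_from_span[OF hgens_spans _ xyz])
      fix x y z assume "x \<in> hgens" "y \<in> hgens" "z \<in> hgens"
      then obtain a b pa pb c d pc pd e f pe pf where
        h: "a \<in> grade A pa" "b \<in> grade B pb" "c \<in> grade A pc" "d \<in> grade B pd" "e \<in> grade A pe" "f \<in> grade B pf"
        and xyz: "x = tn a b" "y = tn c d" "z = tn e f"
        by (metis hgensE)
      have cl: "a \<in> carrier A" "b \<in> carrier B" "c \<in> carrier A" "d \<in> carrier B" "e \<in> carrier A" "f \<in> carrier B"
        using h A.grade_carrier B.grade_carrier by auto
      have bd: "b \<otimes>\<^bsub>B\<^esub> d \<in> grade B (pb \<noteq> pd)" and ce: "c \<otimes>\<^bsub>A\<^esub> e \<in> grade A (pc \<noteq> pe)"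
        using h A.grade_mult B.grade_mult by auto
      have "x \<otimes>\<^bsub>T\<^esub> y \<otimes>\<^bsub>T\<^esub> z = neg_if T (pb \<and> pc) (neg_if T ((pb \<noteq> pd) \<and> pe) (tn (a \<otimes>\<^bsub>A\<^esub> c \<otimes>\<^bsub>A\<^esub> e) (b \<otimes>\<^bsub>B\<^esub> d \<otimes>\<^bsub>B\<^esub> f)))"
        unfolding xyz tn_mult_homogeneous[OF cl(1) h(2,3) cl(4)] using cl
        by (simp only: neg_if_T(3) tn_closed A.A.m_closed B.A.m_closed tn_mult_homogeneous[OF _ bd h(5) cl(6)])
      moreover have "x \<otimes>\<^bsub>T\<^esub> (y \<otimes>\<^bsub>T\<^esub> z) = neg_if T (pd \<and> pe) (neg_if T (pb \<and> (pc \<noteq> pe)) (tn (a \<otimes>\<^bsub>A\<^esub> (c \<otimes>\<^bsub>A\<^esub> e)) (b \<otimes>\<^bsub>B\<^esub> (d \<otimes>\<^bsub>B\<^esub> f))))"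
        unfolding xyz tn_mult_homogeneous[OF cl(3) h(4,5) cl(6)] using cl
        by (simp only: neg_if_T(4) tn_closed A.A.m_closed B.A.m_closed tn_mult_homogeneous[OF cl(1) h(2) ce])
      moreover have "((pb \<and> pc) \<noteq> ((pb \<noteq> pd) \<and> pe)) = ((pd \<and> pe) \<noteq> (pb \<and> (pc \<noteq> pe)))"
        by auto
      ultimately show "x \<otimes>\<^bsub>T\<^esub> y \<otimes>\<^bsub>T\<^esub> z = x \<otimes>\<^bsub>T\<^esub> (y \<otimes>\<^bsub>T\<^esub> z)"
        using cl by (simp only: neg_if_T(2) tn_closed A.A.m_closed B.A.m_closed A.A.m_assoc B.A.m_assoc)
    qed
  next
    fix x assume x: "x \<in> carrier T"
    have "\<one>\<^bsub>T\<^esub> \<otimes>\<^bsub>T\<^esub> x = x \<and> x \<otimes>\<^bsub>T\<^esub> \<one>\<^bsub>T\<^esub> = x"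
    proof (rule TB.one_from_span[OF hgens_spans _ x])
      fix y assume "y \<in> hgens"
      then obtain a b p q where h: "a \<in> grade A p" "b \<in> grade B q" "y = tn a b" by (rule hgensE)
      then have cl: "a \<in> carrier A" "b \<in> carrier B"
        using A.grade_carrier B.grade_carrier by auto
      have "\<one>\<^bsub>T\<^esub> \<otimes>\<^bsub>T\<^esub> y = y"
        unfolding T_one h(3) tn_mult_homogeneous[OF A.A.one_closed B.grade_one h(1) cl(2)]
        using cl by (simp add: neg_if_def)
      moreover have "y \<otimes>\<^bsub>T\<^esub> \<one>\<^bsub>T\<^esub> = y"
        unfolding T_one h(3) tn_mult_homogeneous[OF cl(1) h(2) A.grade_one B.A.one_closed]
        using cl by (simp add: neg_if_def)
      ultimately show "\<one>\<^bsub>T\<^esub> \<otimes>\<^bsub>T\<^esub> y = y \<and> y \<otimes>\<^bsub>T\<^esub> \<one>\<^bsub>T\<^esub> = y" ..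
    qed
    then show "\<one>\<^bsub>T\<^esub> \<otimes>\<^bsub>T\<^esub> x = x" "x \<otimes>\<^bsub>T\<^esub> \<one>\<^bsub>T\<^esub> = x" by auto
  qed (simp_all only: TB.bmult_closed TB.bone_closed)
qed (simp_all only: TB.bl_distr TB.br_distr)

definition homs :: "bool \<Rightarrow> ('a \<times> 'b) set" where
  "homs r = {s. \<exists>p q. fst s \<in> grade A p \<and> snd s \<in> grade B q \<and> r = (p \<noteq> q)}"

lemma FP_grade: "grade FP r = {f \<in> carrier FP. \<forall>s. f s \<noteq> \<zero>\<^bsub>K\<^esub> \<longrightarrow> s \<in> homs r}"
  by (simp add: free_pairs_def Let_def homs_def)

lemma FP_grade_submodule: "submodule (grade FP r) K FP"
proof -
  have sm: "c \<odot>\<^bsub>FP\<^esub> f \<in> grade FP r" if "c \<in> carrier K" "f \<in> grade FP r" for c f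
  proof -
    have "f s \<noteq> \<zero>\<^bsub>K\<^esub>" if "(c \<odot>\<^bsub>FP\<^esub> f) s \<noteq> \<zero>\<^bsub>K\<^esub>" for s
      using that \<open>c \<in> carrier K\<close> by (auto simp: FM.smult_F)
    then show ?thesis
      using that by (auto simp: FP_grade)
  qed
  show ?thesis
  proof (rule FM.F.submoduleI)
    show "grade FP r \<subseteq> carrier FP" by (auto simp: FP_grade)
    show "\<zero>\<^bsub>FP\<^esub> \<in> grade FP r" by (simp add: FP_grade) (simp add: FM.zero_F)
    fix f assume f: "f \<in> grade FP r"
    have "\<ominus>\<^bsub>FP\<^esub> f = (\<ominus>\<^bsub>K\<^esub> \<one>\<^bsub>K\<^esub>) \<odot>\<^bsub>FP\<^esub> f"
      using f by (simp add: FM.F.smult_l_minus FP_grade)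
    then show "\<ominus>\<^bsub>FP\<^esub> f \<in> grade FP r"
      using sm[of "\<ominus>\<^bsub>K\<^esub> \<one>\<^bsub>K\<^esub>" f] f by simp
    fix g assume g: "g \<in> grade FP r"
    have "f s \<noteq> \<zero>\<^bsub>K\<^esub> \<or> g s \<noteq> \<zero>\<^bsub>K\<^esub>" if "(f \<oplus>\<^bsub>FP\<^esub> g) s \<noteq> \<zero>\<^bsub>K\<^esub>" for s
      using that by (auto simp: FM.add_F)
    moreover have "f \<oplus>\<^bsub>FP\<^esub> g \<in> carrier FP"
      using f g by (simp add: FP_grade)
    ultimately show "f \<oplus>\<^bsub>FP\<^esub> g \<in> grade FP r"
      using f g unfolding FP_grade mem_Collect_eq by meson
  qed (rule sm)
qed

lemma T_grade: "grade T r = (\<lambda>f. rel +>\<^bsub>FP\<^esub> f) ` grade FP r"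
  by (simp add: T_eq MQ.grade_Q)

lemma FP_grade_carrier: "f \<in> grade FP r \<Longrightarrow> f \<in> carrier FP"
  by (simp add: FP_grade)

lemma T_grade_submodule: "submodule (grade T r) K T"
proof -
  note E = FM.F.submoduleE[OF FP_grade_submodule]
  have zero: "\<zero>\<^bsub>FP\<^esub> \<in> grade FP r"
    using FP_grade_submodule by (simp add: submodule_def subgroup_def)
  show ?thesis
  proof (rule TM.submoduleI)
    show "grade T r \<subseteq> carrier T"
      using FP_grade_carrier proj_T_linear(1) by (auto simp: T_grade)
    show "\<zero>\<^bsub>T\<^esub> \<in> grade T r"
    proof -
      have "\<zero>\<^bsub>T\<^esub> = rel +>\<^bsub>FP\<^esub> \<zero>\<^bsub>FP\<^esub>"
        using MQ.zero_Q by (simp add: T_eq)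
      then show ?thesis using zero unfolding T_grade by blast
    qed
    fix x assume "x \<in> grade T r"
    then obtain f where f: "f \<in> grade FP r" "x = rel +>\<^bsub>FP\<^esub> f" by (auto simp: T_grade)
    have "\<ominus>\<^bsub>T\<^esub> x = rel +>\<^bsub>FP\<^esub> (\<ominus>\<^bsub>FP\<^esub> f)"
      using MQ.minus_Q[OF FP_grade_carrier[OF f(1)]] by (simp add: f(2) T_eq)
    then show "\<ominus>\<^bsub>T\<^esub> x \<in> grade T r"
      using E(3)[OF f(1)] unfolding T_grade by blast
    fix y assume "y \<in> grade T r"
    then obtain g where g: "g \<in> grade FP r" "y = rel +>\<^bsub>FP\<^esub> g" by (auto simp: T_grade)
    have "x \<oplus>\<^bsub>T\<^esub> y = rel +>\<^bsub>FP\<^esub> (f \<oplus>\<^bsub>FP\<^esub> g)"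
      using proj_T_linear(2)[OF FP_grade_carrier[OF f(1)] FP_grade_carrier[OF g(1)]] by (simp add: f(2) g(2))
    then show "x \<oplus>\<^bsub>T\<^esub> y \<in> grade T r"
      using E(5)[OF f(1) g(1)] unfolding T_grade by blast
  next
    fix c x assume c: "c \<in> carrier K" and "x \<in> grade T r"
    then obtain f where f: "f \<in> grade FP r" "x = rel +>\<^bsub>FP\<^esub> f" by (auto simp: T_grade)
    have "c \<odot>\<^bsub>T\<^esub> x = rel +>\<^bsub>FP\<^esub> (c \<odot>\<^bsub>FP\<^esub> f)"
      using proj_T_linear(3)[OF c FP_grade_carrier[OF f(1)]] by (simp add: f(2))
    then show "c \<odot>\<^bsub>T\<^esub> x \<in> grade T r"
      using E(4)[OF c f(1)] unfolding T_grade by blast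
  qed
qed

lemma tn_grade:
  assumes "a \<in> grade A p" "b \<in> grade B q"
  shows "tn a b \<in> grade T (p \<noteq> q)"
proof -
  have "FM.gen (a, b) \<in> carrier FP"
    using assms A.grade_carrier B.grade_carrier by auto
  moreover have "(a, b) \<in> homs (p \<noteq> q)"
    unfolding homs_def using assms by auto
  ultimately have "FM.gen (a, b) \<in> grade FP (p \<noteq> q)"
    unfolding FP_grade by (auto simp: FM.gen_def)
  then show ?thesis
    unfolding tens_eq T_grade by blast
qed

text \<open>A representative in \<open>grade FP r\<close> is supported on pairs of homogeneous
  elements of total parity r, so the class is a combination of their tensors. The induction follows
  the partial sums and keeps them in \<open>grade T r\<close>.\<close>

lemma grade_T_induct [consumes 1, case_names gen zero add smult]:
  assumes x: "x \<in> grade T r"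
    and gen: "\<And>a b p q. a \<in> grade A p \<Longrightarrow> b \<in> grade B q \<Longrightarrow> r = (p \<noteq> q) \<Longrightarrow> P (tn a b)"
    and zero: "P \<zero>\<^bsub>T\<^esub>"
    and add: "\<And>x y. x \<in> grade T r \<Longrightarrow> y \<in> grade T r \<Longrightarrow> P x \<Longrightarrow> P y \<Longrightarrow> P (x \<oplus>\<^bsub>T\<^esub> y)"
    and smult: "\<And>c x. c \<in> carrier K \<Longrightarrow> x \<in> grade T r \<Longrightarrow> P x \<Longrightarrow> P (c \<odot>\<^bsub>T\<^esub> x)"
  shows "P x"
proof -
  obtain f where f: "f \<in> grade FP r" "x = rel +>\<^bsub>FP\<^esub> f" using x by (auto simp: T_grade)
  note E = TM.submoduleE[OF T_grade_submodule]
  have fc: "f \<in> carrier FP" using f FP_grade_carrier by blast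
  have zg: "\<zero>\<^bsub>T\<^esub> \<in> grade T r"
    using T_grade_submodule by (simp add: submodule_def subgroup_def)
  have "P (\<Oplus>\<^bsub>T\<^esub>s\<in>W. f s \<odot>\<^bsub>T\<^esub> tn (fst s) (snd s)) \<and> (\<Oplus>\<^bsub>T\<^esub>s\<in>W. f s \<odot>\<^bsub>T\<^esub> tn (fst s) (snd s)) \<in> grade T r"
    if "finite W" "W \<subseteq> {s. f s \<noteq> \<zero>\<^bsub>K\<^esub>}" for W
    using that
  proof (induction W)
    case empty
    then show ?case using zero zg by simp
  next
    case (insert w W)
    have h: "P (f s \<odot>\<^bsub>T\<^esub> tn (fst s) (snd s)) \<and> f s \<odot>\<^bsub>T\<^esub> tn (fst s) (snd s) \<in> grade T r" if "s \<in> insert w W" for s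
    proof -
      have "f s \<noteq> \<zero>\<^bsub>K\<^esub>" using that insert.prems by auto
      then have "s \<in> homs r" using f(1) unfolding FP_grade by blast
      then obtain p q where pq: "fst s \<in> grade A p" "snd s \<in> grade B q" "r = (p \<noteq> q)"
        unfolding homs_def by blast
      then show ?thesis
        using gen[OF pq] tn_grade[OF pq(1,2)] smult[OF FP_value[OF fc]] E(4)[OF FP_value[OF fc]] by simp
    qed
    moreover have "f s \<odot>\<^bsub>T\<^esub> tn (fst s) (snd s) \<in> carrier T" if "s \<in> insert w W" for s
      using h[OF that] E(1) by blast
    moreover from this have "(\<Oplus>\<^bsub>T\<^esub>s\<in>insert w W. f s \<odot>\<^bsub>T\<^esub> tn (fst s) (snd s)) =
        f w \<odot>\<^bsub>T\<^esub> tn (fst w) (snd w) \<oplus>\<^bsub>T\<^esub> (\<Oplus>\<^bsub>T\<^esub>s\<in>W. f s \<odot>\<^bsub>T\<^esub> tn (fst s) (snd s))"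
      using insert.hyps by (intro TM.M.finsum_insert) auto
    ultimately show ?case
      using insert add E(5) by simp
  qed
  moreover have "finite {s. f s \<noteq> \<zero>\<^bsub>K\<^esub>}" using fc by (simp add: FM.carrier_F)
  ultimately have "P (lin T tn f)"
    unfolding lin_ext_def by blast
  then show ?thesis
    using proj_lin[OF fc] f(2) by simp
qed

text \<open>The projection to parity r: from a and b only the products of components with total
  parity r are kept. It is bilinear, so it can tell even and odd classes apart independently of
  representatives.\<close>

definition comp_map where
  "comp_map r a b = tn (hcomp A False a) (hcomp B r b) \<oplus>\<^bsub>T\<^esub> tn (hcomp A True a) (hcomp B (\<not> r) b)"

lemma comp_map_bilin: "bilin T (comp_map r)"
  unfolding comp_map_def
  by (intro bilinI) (simp_all add: tn_rules A.hcomp_add B.hcomp_add A.hcomp_smult B.hcomp_smult TM.M.a_ac TM.smult_r_distr)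

lemma comp_map_homs:
  assumes "s \<in> homs r"
  shows "comp_map r' (fst s) (snd s) = (if r' = r then tn (fst s) (snd s) else \<zero>\<^bsub>T\<^esub>)"
proof -
  obtain p q where pq: "fst s \<in> grade A p" "snd s \<in> grade B q" "r = (p \<noteq> q)"
    using assms unfolding homs_def by blast
  have cl: "fst s \<in> carrier A" "snd s \<in> carrier B"
    using pq A.grade_carrier B.grade_carrier by auto
  have a: "hcomp A p' (fst s) = (if p' = p then fst s else \<zero>\<^bsub>A\<^esub>)" for p'
    using A.hcomp_same[OF pq(1)] A.hcomp_other[OF pq(1)] by auto
  have b: "hcomp B q' (snd s) = (if q' = q then snd s else \<zero>\<^bsub>B\<^esub>)" for q'
    using B.hcomp_same[OF pq(2)] B.hcomp_other[OF pq(2)] by auto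
  show ?thesis
    unfolding comp_map_def a b pq(3) using cl by (cases p; cases q; cases r') (simp_all add: tn_zero)
qed

lemma comp_map_grade:
  assumes "f \<in> grade FP r"
  shows "lin T (comp_map r') f = (if r' = r then rel +>\<^bsub>FP\<^esub> f else \<zero>\<^bsub>T\<^esub>)"
proof -
  have fc: "f \<in> carrier FP" using assms FP_grade_carrier by blast
  have h: "s \<in> homs r \<and> s \<in> SS" if "f s \<noteq> \<zero>\<^bsub>K\<^esub>" for s
  proof -
    have "s \<in> homs r" using assms that unfolding FP_grade by blast
    moreover have "s \<in> SS" using fc that unfolding FM.carrier_F by blast
    ultimately show ?thesis ..
  qed
  have tc: "tn (fst s) (snd s) \<in> carrier T" if "s \<in> SS" for s
    using that by auto
  show ?thesis
  proof (cases "r' = r")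
    case True
    have "lin T (comp_map r') f = lin T tn f"
      unfolding lin_ext_def using h tc FP_value[OF fc] True
    proof (intro TM.M.finsum_cong' refl funcsetI TM.smult_closed)
      fix s assume "s \<in> {s. f s \<noteq> \<zero>\<^bsub>K\<^esub>}"
      then have s: "s \<in> homs r" "s \<in> SS" using h by auto
      show "tn (fst s) (snd s) \<in> carrier T" by (rule tc[OF s(2)])
      show "f s \<odot>\<^bsub>T\<^esub> comp_map r' (fst s) (snd s) = f s \<odot>\<^bsub>T\<^esub> tn (fst s) (snd s)"
        by (simp only: comp_map_homs[OF s(1)] True simp_thms if_True)
    qed (rule FP_value[OF fc])
    then show ?thesis using proj_lin[OF fc] True by simp
  next
    case False
    have "lin T (comp_map r') f = (\<Oplus>\<^bsub>T\<^esub>s\<in>{s. f s \<noteq> \<zero>\<^bsub>K\<^esub>}. \<zero>\<^bsub>T\<^esub>)"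
      unfolding lin_ext_def using h FP_value[OF fc] False
    proof (intro TM.M.finsum_cong' refl funcsetI TM.M.zero_closed)
      fix s assume "s \<in> {s. f s \<noteq> \<zero>\<^bsub>K\<^esub>}"
      then have s: "s \<in> homs r" using h by auto
      show "f s \<odot>\<^bsub>T\<^esub> comp_map r' (fst s) (snd s) = \<zero>\<^bsub>T\<^esub>"
        by (simp only: comp_map_homs[OF s] False if_False TM.smult_r_null[OF FP_value[OF fc]])
    qed
    then show ?thesis using False by simp
  qed
qed

lemma T_superalgebra: "superalgebra K T"
proof (intro superalgebra.intro superalgebra_axioms.intro T_module A.K.field_axioms T_ring T_grade_submodule)
  note E = TM.submoduleE[OF T_grade_submodule]
  have zg: "\<zero>\<^bsub>T\<^esub> \<in> grade T r" for r
    using T_grade_submodule[of r] by (simp add: submodule_def subgroup_def)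
  have gc: "x \<in> carrier T" if "x \<in> grade T r" for x r
    using that E(1) by blast
  show "carrier T = grade T False <+>\<^bsub>T\<^esub> grade T True"
  proof (intro equalityI subsetI)
    fix x assume "x \<in> carrier T"
    with hgens_spans have "\<exists>u\<in>grade T False. \<exists>v\<in>grade T True. x = u \<oplus>\<^bsub>T\<^esub> v"
    proof (induction rule: spans_induct)
      case (gen x)
      then obtain a b p q where h: "a \<in> grade A p" "b \<in> grade B q" "x = tn a b" by (rule hgensE)
      then have x: "x \<in> grade T (p \<noteq> q)" using tn_grade by simp
      show ?case
      proof (cases "p \<noteq> q")
        case True
        then have "(p \<noteq> q) = True" by blast
        then have "x \<in> grade T True" using x by metis
        then show ?thesis using zg[of False] gc[of x True] by (metis TM.M.l_zero)
      next
        case False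
        then have "(p \<noteq> q) = False" by blast
        then have "x \<in> grade T False" using x by metis
        then show ?thesis using zg[of True] gc[of x False] by (metis TM.M.r_zero)
      qed
    next
      case zero
      then show ?case using zg TM.M.l_zero TM.M.zero_closed by metis
    next
      case (add x y)
      then obtain u v u' v' where uv: "u \<in> grade T False" "v \<in> grade T True" "x = u \<oplus>\<^bsub>T\<^esub> v"
        "u' \<in> grade T False" "v' \<in> grade T True" "y = u' \<oplus>\<^bsub>T\<^esub> v'" by blast
      have "x \<oplus>\<^bsub>T\<^esub> y = (u \<oplus>\<^bsub>T\<^esub> u') \<oplus>\<^bsub>T\<^esub> (v \<oplus>\<^bsub>T\<^esub> v')"
        unfolding uv using gc[OF uv(1)] gc[OF uv(2)] gc[OF uv(4)] gc[OF uv(5)] by (simp add: TM.M.a_ac)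
      then show ?case using E(5)[OF uv(1,4)] E(5)[OF uv(2,5)] by blast
    next
      case (smult c x)
      then obtain u v where uv: "u \<in> grade T False" "v \<in> grade T True" "x = u \<oplus>\<^bsub>T\<^esub> v" by blast
      have "c \<odot>\<^bsub>T\<^esub> x = c \<odot>\<^bsub>T\<^esub> u \<oplus>\<^bsub>T\<^esub> c \<odot>\<^bsub>T\<^esub> v"
        unfolding uv using smult(1) gc[OF uv(1)] gc[OF uv(2)] by (simp add: TM.smult_r_distr)
      then show ?case using E(4)[OF smult(1) uv(1)] E(4)[OF smult(1) uv(2)] by blast
    qed
    then show "x \<in> grade T False <+>\<^bsub>T\<^esub> grade T True"
      unfolding set_add_def set_mult_def by auto
  next
    fix x assume "x \<in> grade T False <+>\<^bsub>T\<^esub> grade T True"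
    then obtain u v where "u \<in> grade T False" "v \<in> grade T True" "x = u \<oplus>\<^bsub>T\<^esub> v"
      unfolding set_add_def set_mult_def by auto
    then show "x \<in> carrier T" using gc by blast
  qed
  show "grade T False \<inter> grade T True = {\<zero>\<^bsub>T\<^esub>}"
  proof (intro equalityI subsetI)
    fix x assume x: "x \<in> grade T False \<inter> grade T True"
    then obtain f where f: "f \<in> grade FP False" "x = rel +>\<^bsub>FP\<^esub> f" by (auto simp: T_grade)
    obtain g where g: "g \<in> grade FP True" "x = rel +>\<^bsub>FP\<^esub> g" using x by (auto simp: T_grade)
    have c: "f \<in> carrier FP" "g \<in> carrier FP" using f g FP_grade_carrier by blast+
    have "f \<ominus>\<^bsub>FP\<^esub> g \<in> rel"
      using MQ.proj_eq_iff[OF c] f g by simp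
    \<comment> \<open>The class x has an even representative f and an odd one g. The even projection
      maps f to x and g to zero, but it agrees on both; so x = 0.\<close>
    then have "lin T (comp_map False) (f \<ominus>\<^bsub>FP\<^esub> g) = \<zero>\<^bsub>T\<^esub>"
      by (rule lin_kills_rel[OF T_module comp_map_bilin])
    then have "lin T (comp_map False) f \<ominus>\<^bsub>T\<^esub> lin T (comp_map False) g = \<zero>\<^bsub>T\<^esub>"
      using lin_facts(5)[OF T_module bilin_closed[OF comp_map_bilin] c] by simp
    then have z: "x \<ominus>\<^bsub>T\<^esub> \<zero>\<^bsub>T\<^esub> = \<zero>\<^bsub>T\<^esub>"
      using comp_map_grade[OF f(1), of False] comp_map_grade[OF g(1), of False] f(2) by simp
    have "x \<in> carrier T" using x gc by blast
    then show "x \<in> {\<zero>\<^bsub>T\<^esub>}"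
      using z by (simp add: a_minus_def T_minus_zero)
  qed (use zg in auto)
  show "\<one>\<^bsub>T\<^esub> \<in> grade T False"
    using tn_grade[OF A.grade_one B.grade_one] by (simp add: T_one)
  show "x \<otimes>\<^bsub>T\<^esub> y \<in> grade T (p \<noteq> q)" if x: "x \<in> grade T p" and y: "y \<in> grade T q" for x y p q
    using x
  proof (induction rule: grade_T_induct)
    case (gen a b pa pb)
    have cl: "a \<in> carrier A" "b \<in> carrier B"
      using gen A.grade_carrier B.grade_carrier by auto
    show ?case
      using y
    proof (induction rule: grade_T_induct)
      case (gen c d pc pd)
      have d: "d \<in> carrier B" using gen B.grade_carrier by blast
      have "tn (a \<otimes>\<^bsub>A\<^esub> c) (b \<otimes>\<^bsub>B\<^esub> d) \<in> grade T ((pa \<noteq> pc) \<noteq> (pb \<noteq> pd))"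
        using \<open>a \<in> grade A pa\<close> \<open>b \<in> grade B pb\<close> gen by (intro tn_grade A.grade_mult B.grade_mult)
      moreover have pq: "((pa \<noteq> pc) \<noteq> (pb \<noteq> pd)) = (p \<noteq> q)"
        using gen(3) \<open>p = (pa \<noteq> pb)\<close> by auto
      ultimately have "tn (a \<otimes>\<^bsub>A\<^esub> c) (b \<otimes>\<^bsub>B\<^esub> d) \<in> grade T (p \<noteq> q)" unfolding pq by simp
      then show ?case
        unfolding tn_mult_homogeneous[OF cl(1) \<open>b \<in> grade B pb\<close> gen(1) d] neg_if_def using E(3) by auto
    next
      case zero
      then show ?case using cl zg by (simp add: TB.br_null)
    next
      case (add x y)
      then show ?case using cl gc E(5) by (simp add: TB.br_distr)
    next
      case (smult c x)
      then show ?case using cl gc E(4) by (simp add: TB.bsmult_right)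
    qed
  next
    case zero
    then show ?case using y gc zg by (simp add: TB.bl_null)
  next
    case (add x y')
    then show ?case using y gc E(5) by (simp add: TB.bl_distr)
  next
    case (smult c x)
    then show ?case using y gc E(4) by (simp add: TB.bsmult_left)
  qed
qed (simp_all only: TB.bsmult_left TB.bsmult_right)

lemma T_salg: "salg K T"
  by (rule salgI) (rule T_superalgebra)

sublocale TA: salg K T
  by (rule T_salg)

end

section \<open>Supercommutativity and universal property of the tensor product\<close>

context tens_alg
begin

lemma neg_if_T_linear:
  assumes "x \<in> carrier T"
  shows "y \<in> carrier T \<Longrightarrow> neg_if T c (x \<oplus>\<^bsub>T\<^esub> y) = neg_if T c x \<oplus>\<^bsub>T\<^esub> neg_if T c y"
    and "k \<in> carrier K \<Longrightarrow> neg_if T c (k \<odot>\<^bsub>T\<^esub> x) = k \<odot>\<^bsub>T\<^esub> neg_if T c x"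
  using assms by (simp_all add: neg_if_def TM.M.minus_add TM.smult_r_minus)

lemma T_grade_carrier: "x \<in> grade T r \<Longrightarrow> x \<in> carrier T"
  by (rule TA.grade_carrier)

text \<open>On homogeneous tensors the claim is pb pc + pa pc + pb pd = (pa + pb) (pc + pd) + pd pa
  modulo 2: exchanging a with c and b with d, plus the signs of the two products.\<close>

lemma T_commute:
  assumes A: "supercommutative A" and B: "supercommutative B"
    and x: "x \<in> grade T p" and y: "y \<in> grade T q"
  shows "x \<otimes>\<^bsub>T\<^esub> y = neg_if T (p \<and> q) (y \<otimes>\<^bsub>T\<^esub> x)"
  using x
proof (induction rule: grade_T_induct)
  case (gen a b pa pb)
  note ab = gen
  have clab: "a \<in> carrier A" "b \<in> carrier B"
    using ab A.grade_carrier B.grade_carrier by auto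
  show ?case
    using y
  proof (induction rule: grade_T_induct)
    case (gen c d pc pd)
    have cl: "a \<in> carrier A" "b \<in> carrier B" "c \<in> carrier A" "d \<in> carrier B"
      using ab gen A.grade_carrier B.grade_carrier by auto
    have ac: "a \<otimes>\<^bsub>A\<^esub> c = neg_if A (pa \<and> pc) (c \<otimes>\<^bsub>A\<^esub> a)"
      by (rule supercommutativeD(1)[OF A ab(1) gen(1)])
    have bd: "b \<otimes>\<^bsub>B\<^esub> d = neg_if B (pb \<and> pd) (d \<otimes>\<^bsub>B\<^esub> b)"
      by (rule supercommutativeD(1)[OF B ab(2) gen(2)])
    have c2: "c \<otimes>\<^bsub>A\<^esub> a \<in> carrier A" "d \<otimes>\<^bsub>B\<^esub> b \<in> carrier B" "tn (c \<otimes>\<^bsub>A\<^esub> a) (d \<otimes>\<^bsub>B\<^esub> b) \<in> carrier T"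
      "neg_if B (pb \<and> pd) (d \<otimes>\<^bsub>B\<^esub> b) \<in> carrier B"
      using cl by (simp_all add: neg_if_def)
    have "tn a b \<otimes>\<^bsub>T\<^esub> tn c d = neg_if T (pb \<and> pc) (neg_if T (pa \<and> pc) (neg_if T (pb \<and> pd) (tn (c \<otimes>\<^bsub>A\<^esub> a) (d \<otimes>\<^bsub>B\<^esub> b))))"
      unfolding tn_mult_homogeneous[OF cl(1) ab(2) gen(1) cl(4)] ac bd
      by (simp only: tn_minus(1)[OF c2(1,4)] tn_minus(2)[OF c2(1,2)])
    also have "\<dots> = neg_if T (p \<and> q) (neg_if T (pd \<and> pa) (tn (c \<otimes>\<^bsub>A\<^esub> a) (d \<otimes>\<^bsub>B\<^esub> b)))"
      unfolding neg_if_T(2)[OF c2(3)] neg_if_T(2)[OF neg_if_T(1)[OF c2(3)]] ab(3) gen(3)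
      by (rule arg_cong[where f = "\<lambda>c. neg_if T c _"]) blast
    also have "\<dots> = neg_if T (p \<and> q) (tn c d \<otimes>\<^bsub>T\<^esub> tn a b)"
      unfolding tn_mult_homogeneous[OF cl(3) gen(2) ab(1) cl(2)] ..
    finally show ?case .
  next
    case zero
    then show ?case using clab by (simp add: TB.br_null TB.bl_null neg_if_def T_minus_zero)
  next
    case (add x y)
    then show ?case using clab T_grade_carrier by (simp add: TB.br_distr TB.bl_distr neg_if_T_linear)
  next
    case (smult c x)
    then show ?case using clab T_grade_carrier by (simp add: TB.bsmult_left TB.bsmult_right neg_if_T_linear)
  qed
next
  case zero
  then show ?case using y T_grade_carrier by (simp add: TB.br_null TB.bl_null neg_if_def T_minus_zero)
next
  case (add x y')
  then show ?case using y T_grade_carrier by (simp add: TB.br_distr TB.bl_distr neg_if_T_linear)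
next
  case (smult c x)
  then show ?case using y T_grade_carrier by (simp add: TB.bsmult_left TB.bsmult_right neg_if_T_linear)
qed

text \<open>In characteristic 2 the sign rule does not give this. An odd homogeneous tensor has one
  odd factor, whose square is zero; for a sum the cross terms cancel by the sign rule.\<close>

lemma T_square:
  assumes A: "supercommutative A" and B: "supercommutative B" and x: "x \<in> grade T True"
  shows "x \<otimes>\<^bsub>T\<^esub> x = \<zero>\<^bsub>T\<^esub>"
  using x
proof (induction rule: grade_T_induct)
  case (gen a b p q)
  have cl: "a \<in> carrier A" "b \<in> carrier B"
    using gen A.grade_carrier B.grade_carrier by auto
  have "tn (a \<otimes>\<^bsub>A\<^esub> a) (b \<otimes>\<^bsub>B\<^esub> b) = \<zero>\<^bsub>T\<^esub>"
  proof (cases p)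
    case True
    then have "a \<otimes>\<^bsub>A\<^esub> a = \<zero>\<^bsub>A\<^esub>" using gen(1) supercommutativeD(2)[OF A] by simp
    then show ?thesis using cl tn_zero by simp
  next
    case False
    then have "b \<otimes>\<^bsub>B\<^esub> b = \<zero>\<^bsub>B\<^esub>" using gen(2,3) supercommutativeD(2)[OF B] by simp
    then show ?thesis using cl tn_zero by simp
  qed
  then show ?case
    unfolding tn_mult_homogeneous[OF cl(1) gen(2,1) cl(2)] by (simp add: neg_if_def T_minus_zero)
next
  case zero
  show ?case by (simp add: TB.br_null)
next
  case (add x y)
  have c: "x \<in> carrier T" "y \<in> carrier T" using add T_grade_carrier by auto
  have "(x \<oplus>\<^bsub>T\<^esub> y) \<otimes>\<^bsub>T\<^esub> (x \<oplus>\<^bsub>T\<^esub> y) = x \<otimes>\<^bsub>T\<^esub> y \<oplus>\<^bsub>T\<^esub> y \<otimes>\<^bsub>T\<^esub> x"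
    using c add(3,4) by (simp add: TB.br_distr TB.bl_distr TB.bmult_closed TM.M.a_ac)
  also have "\<dots> = \<zero>\<^bsub>T\<^esub>"
    using T_commute[OF A B add(1,2)] c by (simp add: neg_if_def TM.M.l_neg TB.bmult_closed)
  finally show ?case .
next
  case (smult c x)
  then show ?case using T_grade_carrier by (simp add: TB.bsmult_left TB.bsmult_right TB.bmult_closed)
qed

lemma T_scsalg:
  assumes "supercommutative A" "supercommutative B"
  shows "scsalg K T"
proof (intro scsalg.intro scsalg_axioms.intro T_salg)
  show "supercommutative T"
    unfolding supercommutative_def using T_commute[OF assms] T_square[OF assms] by blast
qed

lemma T_proj: "Y \<in> carrier T \<Longrightarrow> \<exists>f\<in>carrier FP. Y = rel +>\<^bsub>FP\<^esub> f"
  unfolding T_eq MQ.carrier_Q by blast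

text \<open>The representative chosen inside \<open>tens_lift\<close> differs from f by an element
  of \<open>rel\<close>, and the linear extension of a bilinear map kills it.\<close>

lemma tens_lift_proj:
  assumes M: "module K M" and \<beta>: "bilin M \<beta>" and f: "f \<in> carrier FP"
  shows "tens_lift M K \<beta> (rel +>\<^bsub>FP\<^esub> f) = lin M \<beta> f"
proof -
  interpret M: module K M by (rule M)
  note l = lin_facts[OF M bilin_closed[OF \<beta>]]
  define g where "g = (SOME g. g \<in> rel +>\<^bsub>FP\<^esub> f)"
  have "g \<in> rel +>\<^bsub>FP\<^esub> f" unfolding g_def using MQ.proj_self[OF f] by (rule someI[of "\<lambda>g. g \<in> rel +>\<^bsub>FP\<^esub> f"])
  then have g: "g \<in> carrier FP" "g \<ominus>\<^bsub>FP\<^esub> f \<in> rel"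
    using MQ.proj_memD[OF f] MQ.proj_eq_iff f by auto
  have d: "g \<ominus>\<^bsub>FP\<^esub> f \<in> carrier FP"
    using g(1) f by (simp add: a_minus_def FM.F_add_closed)
  have "g = (g \<ominus>\<^bsub>FP\<^esub> f) \<oplus>\<^bsub>FP\<^esub> f"
    using g(1) f by (simp add: a_minus_def FM.F.a_assoc FM.F.l_neg)
  then have "lin M \<beta> g = lin M \<beta> (g \<ominus>\<^bsub>FP\<^esub> f) \<oplus>\<^bsub>M\<^esub> lin M \<beta> f"
    using l(2)[OF d f] by simp
  then have "lin M \<beta> g = lin M \<beta> f"
    using lin_kills_rel[OF M \<beta> g(2)] l(1)[OF f] by simp
  then show ?thesis
    by (simp add: tens_lift_def g_def Let_def lin_ext_def)
qed

lemma tens_lift_facts: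
  assumes M: "module K M" and \<beta>: "bilin M \<beta>"
  shows "Y \<in> carrier T \<Longrightarrow> tens_lift M K \<beta> Y \<in> carrier M"
    and "Y \<in> carrier T \<Longrightarrow> Z \<in> carrier T \<Longrightarrow>
      tens_lift M K \<beta> (Y \<oplus>\<^bsub>T\<^esub> Z) = tens_lift M K \<beta> Y \<oplus>\<^bsub>M\<^esub> tens_lift M K \<beta> Z"
    and "c \<in> carrier K \<Longrightarrow> Y \<in> carrier T \<Longrightarrow> tens_lift M K \<beta> (c \<odot>\<^bsub>T\<^esub> Y) = c \<odot>\<^bsub>M\<^esub> tens_lift M K \<beta> Y"
    and "a \<in> carrier A \<Longrightarrow> b \<in> carrier B \<Longrightarrow> tens_lift M K \<beta> (tn a b) = \<beta> a b"
    and "tens_lift M K \<beta> \<zero>\<^bsub>T\<^esub> = \<zero>\<^bsub>M\<^esub>"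
proof -
  interpret M: module K M by (rule M)
  note l = lin_facts[OF M bilin_closed[OF \<beta>]]
  note p = tens_lift_proj[OF M \<beta>]
  show c: "tens_lift M K \<beta> Y \<in> carrier M" if "Y \<in> carrier T" for Y
    using T_proj[OF that] l(1) p by auto
  show "tens_lift M K \<beta> (Y \<oplus>\<^bsub>T\<^esub> Z) = tens_lift M K \<beta> Y \<oplus>\<^bsub>M\<^esub> tens_lift M K \<beta> Z"
    if YZ: "Y \<in> carrier T" "Z \<in> carrier T" for Y Z
  proof -
    obtain f g where f: "f \<in> carrier FP" "Y = rel +>\<^bsub>FP\<^esub> f" and g: "g \<in> carrier FP" "Z = rel +>\<^bsub>FP\<^esub> g"
      using T_proj[OF YZ(1)] T_proj[OF YZ(2)] by blast
    show ?thesis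
      unfolding f(2) g(2) proj_T_linear(2)[OF f(1) g(1), symmetric]
      by (simp only: p f(1) g(1) l(2) FM.F_add_closed)
  qed
  show s: "tens_lift M K \<beta> (c \<odot>\<^bsub>T\<^esub> Y) = c \<odot>\<^bsub>M\<^esub> tens_lift M K \<beta> Y"
    if c: "c \<in> carrier K" and Y: "Y \<in> carrier T" for c Y
  proof -
    obtain f where f: "f \<in> carrier FP" "Y = rel +>\<^bsub>FP\<^esub> f"
      using T_proj[OF Y] by blast
    show ?thesis
      unfolding f(2) proj_T_linear(3)[OF c f(1), symmetric]
      by (simp only: p f(1) c l(3) FM.F_smult_closed)
  qed
  show "tens_lift M K \<beta> (tn a b) = \<beta> a b" if "a \<in> carrier A" "b \<in> carrier B" for a b
    unfolding tens_eq using that by (simp add: p l(4))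
  show "tens_lift M K \<beta> \<zero>\<^bsub>T\<^esub> = \<zero>\<^bsub>M\<^esub>"
    using s[of "\<zero>\<^bsub>K\<^esub>" "\<zero>\<^bsub>T\<^esub>"] c[of "\<zero>\<^bsub>T\<^esub>"] by simp
qed

lemma bilin_cong:
  assumes "bilin M \<beta>" "\<And>a b. a \<in> carrier A \<Longrightarrow> b \<in> carrier B \<Longrightarrow> \<beta>' a b = \<beta> a b"
  shows "bilin M \<beta>'"
  using bilinD[OF assms(1)] by (intro bilinI) (simp_all add: assms(2))

lemma linear_eq_tens_lift:
  assumes M: "module K M" and \<beta>: "bilin M \<beta>"
    and h: "\<And>x y. x \<in> carrier T \<Longrightarrow> y \<in> carrier T \<Longrightarrow> h (x \<oplus>\<^bsub>T\<^esub> y) = h x \<oplus>\<^bsub>M\<^esub> h y"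
      "\<And>c x. c \<in> carrier K \<Longrightarrow> x \<in> carrier T \<Longrightarrow> h (c \<odot>\<^bsub>T\<^esub> x) = c \<odot>\<^bsub>M\<^esub> h x"
      "h \<zero>\<^bsub>T\<^esub> = \<zero>\<^bsub>M\<^esub>"
    and v: "\<And>a b. a \<in> carrier A \<Longrightarrow> b \<in> carrier B \<Longrightarrow> h (tn a b) = \<beta> a b"
    and x: "x \<in> carrier T"
  shows "tens_lift M K \<beta> x = h x"
  using T_spans x
proof (induction rule: spans_induct)
  case (gen x)
  then show ?case using v by (auto simp: tens_lift_facts(4)[OF M \<beta>])
next
  case zero
  show ?case by (simp only: h(3) tens_lift_facts(5)[OF M \<beta>])
next
  case (add x y)
  then show ?case by (simp only: h(1) tens_lift_facts(2)[OF M \<beta>])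
next
  case (smult c x)
  then show ?case by (simp only: h(2) tens_lift_facts(3)[OF M \<beta>])
qed

text \<open>Lets the bilinear maps in the Hopf algebra axioms be replaced by products of two
  homomorphisms, the form that \<open>T_lift\<close> handles.\<close>

lemma tens_lift_cong:
  assumes M: "module K M" and \<beta>: "bilin M \<beta>" and x: "x \<in> carrier T"
    and e: "\<And>a b. a \<in> carrier A \<Longrightarrow> b \<in> carrier B \<Longrightarrow> \<beta>' a b = \<beta> a b"
  shows "tens_lift M K \<beta>' x = tens_lift M K \<beta> x"
proof (rule linear_eq_tens_lift[OF M bilin_cong[OF \<beta> e] _ _ _ _ x])
  show "tens_lift M K \<beta> (tn a b) = \<beta>' a b" if "a \<in> carrier A" "b \<in> carrier B" for a b
    using that by (simp add: e tens_lift_facts(4)[OF M \<beta>])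
qed (simp_all add: tens_lift_facts[OF M \<beta>])

text \<open>The sign from moving \<psi> b past \<phi> c in the supercommutative target is the sign
  in the product of tensors. So the product of two homomorphisms is again one, the main tool for the
  axioms.\<close>

lemma T_lift:
  assumes C: "scsalg K C" and \<phi>: "\<phi> \<in> superalg_hom K A C" and \<psi>: "\<psi> \<in> superalg_hom K B C"
  shows "bilin C (\<lambda>a b. \<phi> a \<otimes>\<^bsub>C\<^esub> \<psi> b)"
    and "tens_lift C K (\<lambda>a b. \<phi> a \<otimes>\<^bsub>C\<^esub> \<psi> b) \<in> superalg_hom K T C"
proof -
  interpret C: scsalg K C by (rule C)
  interpret CB: bilin_alg K C by (rule C.bilin_alg)
  note ph = superalg_homD[OF \<phi>]
  note ps = superalg_homD[OF \<psi>]
  show b: "bilin C (\<lambda>a b. \<phi> a \<otimes>\<^bsub>C\<^esub> \<psi> b)"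
    by (rule bilinI) (simp_all add: ph(1,2,5) ps(1,2,5) CB.bl_distr CB.br_distr CB.bsmult_left CB.bsmult_right)
  let ?h = "tens_lift C K (\<lambda>a b. \<phi> a \<otimes>\<^bsub>C\<^esub> \<psi> b)"
  note t = tens_lift_facts[OF C.M.module_axioms b]
  have neg: "?h (neg_if T c x) = neg_if C c (?h x)" if "x \<in> carrier T" for c x
  proof -
    have "\<ominus>\<^bsub>T\<^esub> x = (\<ominus>\<^bsub>K\<^esub> \<one>\<^bsub>K\<^esub>) \<odot>\<^bsub>T\<^esub> x" using that by (simp add: TM.smult_l_minus)
    then have "?h (\<ominus>\<^bsub>T\<^esub> x) = \<ominus>\<^bsub>C\<^esub> ?h x"
      using that t(1)[OF that] by (simp add: t(3) C.M.smult_l_minus)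
    then show ?thesis by (simp add: neg_if_def)
  qed
  show "?h \<in> superalg_hom K T C"
  proof (rule superalg_homI)
    fix x y assume xy: "x \<in> carrier T" "y \<in> carrier T"
    show "?h (x \<otimes>\<^bsub>T\<^esub> y) = ?h x \<otimes>\<^bsub>C\<^esub> ?h y"
    proof (rule TB.mult_hom_from_span[OF hgens_spans CB.bilin_alg_axioms t(1) t(2) t(3) _ xy])
      fix x y assume "x \<in> hgens" "y \<in> hgens"
      then obtain a b p q c d r s where
        h: "a \<in> grade A p" "b \<in> grade B q" "x = tn a b" "c \<in> grade A r" "d \<in> grade B s" "y = tn c d"
        by (metis hgensE)
      have cl: "a \<in> carrier A" "b \<in> carrier B" "c \<in> carrier A" "d \<in> carrier B"
        using h A.grade_carrier B.grade_carrier by auto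
      have cC: "\<phi> a \<in> carrier C" "\<psi> b \<in> carrier C" "\<phi> c \<in> carrier C" "\<psi> d \<in> carrier C"
        using cl ph(1) ps(1) by auto
      have com: "\<psi> b \<otimes>\<^bsub>C\<^esub> \<phi> c = neg_if C (q \<and> r) (\<phi> c \<otimes>\<^bsub>C\<^esub> \<psi> b)"
        by (rule supercommutativeD(1)[OF C.supercommutative ps(6)[OF h(2)] ph(6)[OF h(4)]])
      have "?h (x \<otimes>\<^bsub>T\<^esub> y) = neg_if C (q \<and> r) ((\<phi> a \<otimes>\<^bsub>C\<^esub> \<phi> c) \<otimes>\<^bsub>C\<^esub> (\<psi> b \<otimes>\<^bsub>C\<^esub> \<psi> d))"
        unfolding h(3,6) tn_mult_homogeneous[OF cl(1) h(2,4) cl(4)] using cl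
        by (simp add: neg t(4) ph(3) ps(3))
      also have "\<dots> = \<phi> a \<otimes>\<^bsub>C\<^esub> (neg_if C (q \<and> r) (\<phi> c \<otimes>\<^bsub>C\<^esub> \<psi> b)) \<otimes>\<^bsub>C\<^esub> \<psi> d"
        using cC by (simp add: neg_if_def C.A.m_assoc C.A.l_minus C.A.r_minus)
      also have "\<dots> = ?h x \<otimes>\<^bsub>C\<^esub> ?h y"
        unfolding com[symmetric] h(3,6) using cC cl by (simp add: t(4) C.A.m_assoc)
      finally show "?h (x \<otimes>\<^bsub>T\<^esub> y) = ?h x \<otimes>\<^bsub>C\<^esub> ?h y" .
    qed
  next
    show "?h \<one>\<^bsub>T\<^esub> = \<one>\<^bsub>C\<^esub>"
      by (simp add: T_one t(4) ph(4) ps(4))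
  next
    fix x p assume "x \<in> grade T p"
    then show "?h x \<in> grade C p"
    proof (induction rule: grade_T_induct)
      case (gen a b r s)
      then have "a \<in> carrier A" "b \<in> carrier B" using A.grade_carrier B.grade_carrier by auto
      moreover have "\<phi> a \<otimes>\<^bsub>C\<^esub> \<psi> b \<in> grade C (r \<noteq> s)"
        by (rule C.grade_mult[OF ph(6)[OF gen(1)] ps(6)[OF gen(2)]])
      ultimately show ?case unfolding gen(3) by (simp only: t(4))
    next
      case zero
      show ?case by (simp only: t(5) C.grade_zero)
    next
      case (add x y)
      then show ?case by (simp only: t(2) T_grade_carrier C.grade_add)
    next
      case (smult c x)
      then show ?case by (simp only: t(3) T_grade_carrier C.grade_smult)
    qed
  qed (simp_all only: t)
qed

text \<open>One of the two elements that pass each other is 1, which is even, so no sign arises. The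
  product rule asks the other one to be homogeneous, hence the splitting into components.\<close>

lemma T_inclusions:
  shows "(\<lambda>a. tn a \<one>\<^bsub>B\<^esub>) \<in> superalg_hom K A T" "tn \<one>\<^bsub>A\<^esub> \<in> superalg_hom K B T"
    and "a \<in> carrier A \<Longrightarrow> b \<in> carrier B \<Longrightarrow> tn a \<one>\<^bsub>B\<^esub> \<otimes>\<^bsub>T\<^esub> tn \<one>\<^bsub>A\<^esub> b = tn a b"
proof -
  show "(\<lambda>a. tn a \<one>\<^bsub>B\<^esub>) \<in> superalg_hom K A T"
  proof (rule superalg_homI)
    fix a c assume ac: "a \<in> carrier A" "c \<in> carrier A"
    have h: "tn a \<one>\<^bsub>B\<^esub> \<otimes>\<^bsub>T\<^esub> tn c' \<one>\<^bsub>B\<^esub> = tn (a \<otimes>\<^bsub>A\<^esub> c') \<one>\<^bsub>B\<^esub>" if "c' \<in> grade A q" for c' q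
      using tn_mult_homogeneous[OF ac(1) B.grade_one that B.A.one_closed] by (simp add: neg_if_def)
    have cc: "hcomp A p c \<in> carrier A" for p using A.hcomp_grade[OF ac(2)] A.grade_carrier by blast
    have "c = hcomp A False c \<oplus>\<^bsub>A\<^esub> hcomp A True c" using A.hcomp_sum[OF ac(2)] by simp
    then have "tn a \<one>\<^bsub>B\<^esub> \<otimes>\<^bsub>T\<^esub> tn c \<one>\<^bsub>B\<^esub> = tn a \<one>\<^bsub>B\<^esub> \<otimes>\<^bsub>T\<^esub> (tn (hcomp A False c) \<one>\<^bsub>B\<^esub> \<oplus>\<^bsub>T\<^esub> tn (hcomp A True c) \<one>\<^bsub>B\<^esub>)"
      using tn_rules(1)[OF cc cc B.A.one_closed] by metis
    also have "\<dots> = tn (a \<otimes>\<^bsub>A\<^esub> hcomp A False c) \<one>\<^bsub>B\<^esub> \<oplus>\<^bsub>T\<^esub> tn (a \<otimes>\<^bsub>A\<^esub> hcomp A True c) \<one>\<^bsub>B\<^esub>"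
      using ac cc by (simp add: TB.br_distr h[OF A.hcomp_grade[OF ac(2)]])
    also have "\<dots> = tn (a \<otimes>\<^bsub>A\<^esub> (hcomp A False c \<oplus>\<^bsub>A\<^esub> hcomp A True c)) \<one>\<^bsub>B\<^esub>"
      using ac cc by (simp add: tn_rules(1) A.A.r_distr)
    finally show "tn (a \<otimes>\<^bsub>A\<^esub> c) \<one>\<^bsub>B\<^esub> = tn a \<one>\<^bsub>B\<^esub> \<otimes>\<^bsub>T\<^esub> tn c \<one>\<^bsub>B\<^esub>"
      using A.hcomp_sum[OF ac(2)] by simp
  next
    fix a p assume "a \<in> grade A p"
    then show "tn a \<one>\<^bsub>B\<^esub> \<in> grade T p" using tn_grade[OF _ B.grade_one] by simp
  qed (simp_all add: tn_rules T_one)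
  show "tn \<one>\<^bsub>A\<^esub> \<in> superalg_hom K B T"
  proof (rule superalg_homI)
    fix b d assume bd: "b \<in> carrier B" "d \<in> carrier B"
    have h: "tn \<one>\<^bsub>A\<^esub> b' \<otimes>\<^bsub>T\<^esub> tn \<one>\<^bsub>A\<^esub> d = tn \<one>\<^bsub>A\<^esub> (b' \<otimes>\<^bsub>B\<^esub> d)" if "b' \<in> grade B q" for b' q
      using tn_mult_homogeneous[OF A.A.one_closed that A.grade_one bd(2)] by (simp add: neg_if_def)
    have cc: "hcomp B p b \<in> carrier B" for p using B.hcomp_grade[OF bd(1)] B.grade_carrier by blast
    have "b = hcomp B False b \<oplus>\<^bsub>B\<^esub> hcomp B True b" using B.hcomp_sum[OF bd(1)] by simp
    then have "tn \<one>\<^bsub>A\<^esub> b \<otimes>\<^bsub>T\<^esub> tn \<one>\<^bsub>A\<^esub> d = (tn \<one>\<^bsub>A\<^esub> (hcomp B False b) \<oplus>\<^bsub>T\<^esub> tn \<one>\<^bsub>A\<^esub> (hcomp B True b)) \<otimes>\<^bsub>T\<^esub> tn \<one>\<^bsub>A\<^esub> d"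
      using tn_rules(2)[OF A.A.one_closed cc cc] by metis
    also have "\<dots> = tn \<one>\<^bsub>A\<^esub> (hcomp B False b \<otimes>\<^bsub>B\<^esub> d) \<oplus>\<^bsub>T\<^esub> tn \<one>\<^bsub>A\<^esub> (hcomp B True b \<otimes>\<^bsub>B\<^esub> d)"
      using bd cc by (simp add: TB.bl_distr h[OF B.hcomp_grade[OF bd(1)]])
    also have "\<dots> = tn \<one>\<^bsub>A\<^esub> ((hcomp B False b \<oplus>\<^bsub>B\<^esub> hcomp B True b) \<otimes>\<^bsub>B\<^esub> d)"
      using bd cc by (simp add: tn_rules(2) B.A.l_distr)
    finally show "tn \<one>\<^bsub>A\<^esub> (b \<otimes>\<^bsub>B\<^esub> d) = tn \<one>\<^bsub>A\<^esub> b \<otimes>\<^bsub>T\<^esub> tn \<one>\<^bsub>A\<^esub> d"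
      using B.hcomp_sum[OF bd(1)] by simp
  next
    fix b p assume "b \<in> grade B p"
    then show "tn \<one>\<^bsub>A\<^esub> b \<in> grade T p" using tn_grade[OF A.grade_one] by fastforce
  qed (simp_all add: tn_rules T_one)
  show "tn a \<one>\<^bsub>B\<^esub> \<otimes>\<^bsub>T\<^esub> tn \<one>\<^bsub>A\<^esub> b = tn a b" if "a \<in> carrier A" "b \<in> carrier B"
    using tn_mult_homogeneous[OF that(1) B.grade_one A.grade_one that(2)] that by (simp add: neg_if_def)
qed

end

section \<open>The Hopf structure determined by a generic matrix\<close>

context ring
begin

lemma mmul_assoc:
  assumes "\<And>k. k < l \<Longrightarrow> M i k \<in> carrier R" "\<And>k r. k < l \<Longrightarrow> r < l \<Longrightarrow> N k r \<in> carrier R"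
    "\<And>r. r < l \<Longrightarrow> P r j \<in> carrier R"
  shows "mmul R l (mmul R l M N) P i j = mmul R l M (mmul R l N P) i j"
proof -
  have "mmul R l (mmul R l M N) P i j = (\<Oplus>r\<in>{..<l}. \<Oplus>k\<in>{..<l}. M i k \<otimes> N k r \<otimes> P r j)"
    unfolding mmul_def using assms by (intro finsum_cong') (auto simp: finsum_ldistr)
  also have "\<dots> = (\<Oplus>k\<in>{..<l}. \<Oplus>r\<in>{..<l}. M i k \<otimes> N k r \<otimes> P r j)"
    using assms by (intro finsum_swap) auto
  also have "\<dots> = mmul R l M (mmul R l N P) i j"
  proof -
    have "(\<Oplus>r\<in>{..<l}. M i k \<otimes> N k r \<otimes> P r j) = M i k \<otimes> (\<Oplus>r\<in>{..<l}. N k r \<otimes> P r j)" if "k < l" for k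
    proof -
      have "(\<Oplus>r\<in>{..<l}. M i k \<otimes> N k r \<otimes> P r j) = (\<Oplus>r\<in>{..<l}. M i k \<otimes> (N k r \<otimes> P r j))"
        using assms that by (intro finsum_cong') (auto simp: m_assoc)
      then show ?thesis
        using assms that by (simp add: finsum_rdistr Pi_def)
    qed
    then show ?thesis
      unfolding mmul_def using assms by (intro finsum_cong') auto
  qed
  finally show ?thesis .
qed

lemma mmul_one:
  assumes "i < l" "j < l" "M i j \<in> carrier R"
  shows "(\<And>k. k < l \<Longrightarrow> M k j \<in> carrier R) \<Longrightarrow> mmul R l (\<lambda>i j. if i = j then \<one> else \<zero>) M i j = M i j"
    and "(\<And>k. k < l \<Longrightarrow> M i k \<in> carrier R) \<Longrightarrow> mmul R l M (\<lambda>i j. if i = j then \<one> else \<zero>) i j = M i j"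
  unfolding mmul_def using assms
  by (subst finsum_single[of _ i], auto) (subst finsum_single[of _ j], auto)

end

lemma base_superalg_simps [simp]:
  "carrier (base_superalg K) = carrier K" "x \<otimes>\<^bsub>base_superalg K\<^esub> y = x \<otimes>\<^bsub>K\<^esub> y" "\<one>\<^bsub>base_superalg K\<^esub> = \<one>\<^bsub>K\<^esub>"
  "\<zero>\<^bsub>base_superalg K\<^esub> = \<zero>\<^bsub>K\<^esub>" "x \<oplus>\<^bsub>base_superalg K\<^esub> y = x \<oplus>\<^bsub>K\<^esub> y" "x \<odot>\<^bsub>base_superalg K\<^esub> y = x \<otimes>\<^bsub>K\<^esub> y"
  "grade (base_superalg K) p = (if p then {\<zero>\<^bsub>K\<^esub>} else carrier K)"
  by (simp_all add: base_superalg_def)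

lemma base_superalg_inv: "inv\<^bsub>base_superalg K\<^esub> x = inv\<^bsub>K\<^esub> x"
  by (simp add: m_inv_def)

text \<open>The field sits in even degree with odd part zero, so the sign rule is ordinary
  commutativity.\<close>

lemma base_scsalg:
  assumes "field K"
  shows "scsalg K (base_superalg K)"
proof -
  interpret field K by (rule assms)
  let ?B = "base_superalg K"
  have ag: "abelian_group ?B"
  proof (rule abelian_groupI)
    fix x assume "x \<in> carrier ?B"
    then show "\<exists>y\<in>carrier ?B. y \<oplus>\<^bsub>?B\<^esub> x = \<zero>\<^bsub>?B\<^esub>"
      by (intro bexI[of _ "\<ominus>\<^bsub>K\<^esub> x"]) (simp_all add: l_neg)
  qed (simp_all add: a_ac)
  have r: "ring ?B"
    by (rule ringI[OF ag monoidI]) (simp_all add: m_assoc l_distr r_distr)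
  have m: "module K ?B"
    by (rule moduleI[OF cring_axioms ag]) (simp_all add: l_distr r_distr m_assoc)
  interpret M: module K ?B by (rule m)
  have minus: "\<ominus>\<^bsub>?B\<^esub> x = \<ominus>\<^bsub>K\<^esub> x" if "x \<in> carrier K" for x
    using that by (intro M.minus_equality) (simp_all add: l_neg)
  have "superalgebra K ?B"
  proof (intro superalgebra.intro superalgebra_axioms.intro m field_axioms r)
    show "submodule (grade ?B p) K ?B" for p
      by (rule M.submoduleI) (auto simp: minus split: if_splits)
    show "carrier ?B = grade ?B False <+>\<^bsub>?B\<^esub> grade ?B True"
      by (auto simp: set_add_def set_mult_def)
    show "grade ?B False \<inter> grade ?B True = {\<zero>\<^bsub>?B\<^esub>}"
      by auto
  qed (auto simp: m_assoc m_lcomm split: if_splits)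
  then show ?thesis
    by (intro scsalg.intro salgI scsalg_axioms.intro)
      (auto simp: supercommutative_def neg_if_def minus m_comm split: if_splits)
qed

lemma (in scsalg) gl_valid_closed:
  assumes "gl_valid A (grade A) U"
  shows "i < msize U + nsize U \<Longrightarrow> j < msize U + nsize U \<Longrightarrow> entry U i j \<in> carrier A"
    and "dinv1 U \<in> grade A False" "dinv2 U \<in> grade A False" "d1 A U \<in> grade A False" "d2 A U \<in> grade A False"
    and "d1 A U \<otimes> dinv1 U = \<one>" "d2 A U \<otimes> dinv2 U = \<one>"
proof -
  have e: "entry U i j \<in> grade A ((i < msize U) \<noteq> (j < msize U))"
    if "i < msize U + nsize U" "j < msize U + nsize U" for i j
    using assms that unfolding gl_valid_def gl_entries_def by blast
  then show "i < msize U + nsize U \<Longrightarrow> j < msize U + nsize U \<Longrightarrow> entry U i j \<in> carrier A"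
    using grade_carrier by blast
  show "d1 A U \<in> grade A False" "d2 A U \<in> grade A False"
  proof -
    have "X11 U i j \<in> grade A False" if "i < msize U" "j < msize U" for i j
      using e[of i j] that by (simp add: X11_def)
    then show "d1 A U \<in> grade A False" unfolding d1_def by (rule SR.mdet_even)
    have "X22 U i j \<in> grade A False" if "i < nsize U" "j < nsize U" for i j
      using e[of "msize U + i" "msize U + j"] that by (simp add: X22_def)
    then show "d2 A U \<in> grade A False" unfolding d2_def by (rule SR.mdet_even)
  qed
qed (use assms in \<open>auto simp: gl_valid_def\<close>)

text \<open>A homomorphism takes inverses to inverses, and inverses are unique. This yields the
  values of comultiplication and counit on the inverse determinants.\<close>

lemma gl_hom_dinv:
  assumes A: "scsalg K A" and B: "scsalg K B" and h: "h \<in> superalg_hom K A B" and U: "gl_valid A (grade A) U"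
  shows "h (dinv1 U) = inv\<^bsub>B\<^esub> (h (d1 A U))" "h (dinv2 U) = inv\<^bsub>B\<^esub> (h (d2 A U))"
proof -
  interpret A: scsalg K A by (rule A)
  interpret B: scsalg K B by (rule B)
  note c = A.gl_valid_closed[OF U]
  have *: "h t = inv\<^bsub>B\<^esub> (h d)" if d: "d \<in> grade A False" "t \<in> grade A False" "d \<otimes>\<^bsub>A\<^esub> t = \<one>\<^bsub>A\<^esub>" for d t
  proof -
    have hd: "h d \<in> grade B False" "h t \<in> grade B False"
      using superalg_homD(6)[OF h] d by auto
    have "h d \<otimes>\<^bsub>B\<^esub> h t = \<one>\<^bsub>B\<^esub>"
      using superalg_homD(3)[OF h, of d t] superalg_homD(4)[OF h] d by simp
    moreover from this have "h t \<otimes>\<^bsub>B\<^esub> h d = \<one>\<^bsub>B\<^esub>"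
      using B.SR.even_commute[OF hd] by simp
    ultimately show ?thesis
      using B.A.inv_char[of "h d" "h t"] hd by simp
  qed
  show "h (dinv1 U) = inv\<^bsub>B\<^esub> (h (d1 A U))" "h (dinv2 U) = inv\<^bsub>B\<^esub> (h (d2 A U))"
    using * c by auto
qed

text \<open>The inverse determinants are generators as well, but their images are the inverses of
  determinants of images of entries, so agreement on entries is enough.\<close>

lemma gl_hom_eq:
  assumes A: "scsalg K A" and B: "scsalg K B" and U: "gl_valid A (grade A) U"
    and gen: "generates K A (gl_generators U)"
    and h: "h \<in> superalg_hom K A B" and g: "g \<in> superalg_hom K A B"
    and e: "\<And>i j. i < msize U + nsize U \<Longrightarrow> j < msize U + nsize U \<Longrightarrow> h (entry U i j) = g (entry U i j)"
    and x: "x \<in> carrier A"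
  shows "h x = g x"
proof -
  interpret A: scsalg K A by (rule A)
  interpret B: scsalg K B by (rule B)
  have d: "d1 B (map_data h U) = d1 B (map_data g U)" "d2 B (map_data h U) = d2 B (map_data g U)"
    using e B.gl_valid_closed(1)[OF gl_valid_hom(1)[OF A B g U]] by (auto intro!: B.A.d_cong simp: map_data_def)
  have "h (dinv1 U) = g (dinv1 U)" "h (dinv2 U) = g (dinv2 U)"
    unfolding gl_hom_dinv[OF A B h U] gl_hom_dinv[OF A B g U]
      gl_valid_hom(2,3)[OF A B h U] gl_valid_hom(2,3)[OF A B g U] d by simp_all
  then have "h y = g y" if "y \<in> gl_generators U" for y
    using that e by (auto simp: gl_generators_def)
  then show ?thesis
    by (rule hom_eq_on_generators[OF gen h g _ x])
qed

lemma superalg_hom_mmul: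
  assumes A: "salg K A" and B: "salg K B" and h: "h \<in> superalg_hom K A B"
    and "\<And>k. k < l \<Longrightarrow> M i k \<in> carrier A" "\<And>k. k < l \<Longrightarrow> N k j \<in> carrier A"
  shows "h (mmul A l M N i j) = mmul B l (\<lambda>i j. h (M i j)) (\<lambda>i j. h (N i j)) i j"
proof -
  interpret A: salg K A by (rule A)
  interpret B: salg K B by (rule B)
  show ?thesis
    using assms(4,5) by (intro mmul_hom[OF A.A.ring_axioms B.A.ring_axioms superalg_homD(7)[OF h]])
qed

text \<open>Common ground for k[GL(m|n)] and k[SL(m|n)]. The comultiplication of the generic matrix
  X is written as the product of the matrices X \<otimes> 1 and 1 \<otimes> X over the tensor
  square, so that facts about products of points apply; the usual sum of tensors is recovered in
  \<open>matrix_coalgebra\<close>.\<close>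

locale gl_hopf = scsalg K A
  for K :: "('k, 'r) ring_scheme" and A :: "('k, 'a, 'z) superalg_scheme" (structure) +
  fixes U :: "'a gl_data" and \<Delta> :: "'a \<Rightarrow> ('a \<times> 'a \<Rightarrow> 'k) set" and \<epsilon> :: "'a \<Rightarrow> 'k" and S :: "'a \<Rightarrow> 'a"
  assumes valid: "gl_valid A (grade A) U"
    and generated: "generates K A (gl_generators U)"
    and \<Delta>: "\<Delta> \<in> superalg_hom K A (tensor K A A)"
    and \<Delta>_entry: "\<lbrakk>i < msize U + nsize U; j < msize U + nsize U\<rbrakk> \<Longrightarrow> \<Delta> (entry U i j) =
      mmul (tensor K A A) (msize U + nsize U) (\<lambda>i j. tens K A A (entry U i j) \<one>) (\<lambda>i j. tens K A A \<one> (entry U i j)) i j"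
    and \<epsilon>: "\<epsilon> \<in> superalg_hom K A (base_superalg K)"
    and \<epsilon>_entry: "\<lbrakk>i < msize U + nsize U; j < msize U + nsize U\<rbrakk> \<Longrightarrow> \<epsilon> (entry U i j) = (if i = j then \<one>\<^bsub>K\<^esub> else \<zero>\<^bsub>K\<^esub>)"
    and S: "S \<in> superalg_hom K A A"
    and S_entry: "\<lbrakk>i < msize U + nsize U; j < msize U + nsize U\<rbrakk> \<Longrightarrow> S (entry U i j) = antipode_matrix A U i j"
begin

abbreviation N where "N \<equiv> msize U + nsize U"

abbreviation T2 where "T2 \<equiv> tensor K A A"

abbreviation T3 where "T3 \<equiv> tensor K A T2"

abbreviation T4 where "T4 \<equiv> tensor K T2 A"

sublocale TT: tens_alg K A A
  by unfold_locales

sublocale S3: tens_alg K A T2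
  by unfold_locales

sublocale S4: tens_alg K T2 A
  by unfold_locales

lemma tensor_scsalg: "scsalg K A" "scsalg K T2" "scsalg K T3" "scsalg K T4"
proof -
  show "scsalg K A" by unfold_locales
  show T2: "scsalg K T2"
    by (rule TT.T_scsalg[OF supercommutative supercommutative])
  show "scsalg K T3" "scsalg K T4"
    by (rule S3.T_scsalg S4.T_scsalg supercommutative scsalg.supercommutative[OF T2])+
qed

lemma entry_closed: "i < N \<Longrightarrow> j < N \<Longrightarrow> entry U i j \<in> carrier A"
  by (rule gl_valid_closed(1)[OF valid])

text \<open>The convolution of two homomorphisms is a homomorphism because the target is
  supercommutative. On the generic matrix it is the product of the two image matrices, which turns
  the axioms into matrix identities.\<close>

lemma convolution:
  assumes C: "scsalg K C" and \<phi>: "\<phi> \<in> superalg_hom K A C" and \<psi>: "\<psi> \<in> superalg_hom K A C"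
  shows "(\<lambda>x. tens_lift C K (\<lambda>a b. \<phi> a \<otimes>\<^bsub>C\<^esub> \<psi> b) (\<Delta> x)) \<in> superalg_hom K A C"
    and "i < N \<Longrightarrow> j < N \<Longrightarrow> tens_lift C K (\<lambda>a b. \<phi> a \<otimes>\<^bsub>C\<^esub> \<psi> b) (\<Delta> (entry U i j)) =
      mmul C N (\<lambda>i j. \<phi> (entry U i j)) (\<lambda>i j. \<psi> (entry U i j)) i j"
proof -
  interpret C: scsalg K C by (rule C)
  let ?h = "tens_lift C K (\<lambda>a b. \<phi> a \<otimes>\<^bsub>C\<^esub> \<psi> b)"
  note l = TT.T_lift[OF C \<phi> \<psi>]
  note t = TT.tens_lift_facts(4)[OF C.M.module_axioms l(1)]
  show "(\<lambda>x. ?h (\<Delta> x)) \<in> superalg_hom K A C"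
    by (rule superalg_hom_compose[OF \<Delta> l(2)])
  assume ij: "i < N" "j < N"
  have "?h (\<Delta> (entry U i j)) = mmul C N (\<lambda>i j. ?h (tens K A A (entry U i j) \<one>)) (\<lambda>i j. ?h (tens K A A \<one> (entry U i j))) i j"
    unfolding \<Delta>_entry[OF ij]
    by (rule superalg_hom_mmul[OF TT.T_salg C.salg_axioms l(2)]) (simp_all add: ij entry_closed)
  also have "\<dots> = mmul C N (\<lambda>i j. \<phi> (entry U i j)) (\<lambda>i j. \<psi> (entry U i j)) i j"
    by (rule C.A.mmul_cong)
      (simp_all add: t ij entry_closed superalg_homD(1,4)[OF \<phi>] superalg_homD(1,4)[OF \<psi>])
  finally show "?h (\<Delta> (entry U i j)) = mmul C N (\<lambda>i j. \<phi> (entry U i j)) (\<lambda>i j. \<psi> (entry U i j)) i j" .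
qed

lemma \<Delta>_closed: "x \<in> carrier A \<Longrightarrow> \<Delta> x \<in> carrier T2"
  by (rule superalg_homD(1)[OF \<Delta>])

text \<open>Both sides are homomorphisms into \<open>T3\<close>. With j1, j2, j3 the three
  inclusions of \<open>A\<close> into \<open>T3\<close>, both send the generic matrix to the product
  of its three images.\<close>

lemma coassociative:
  assumes x: "x \<in> carrier A"
  shows "tens_lift T3 K (\<lambda>t c. tens_lift T3 K (\<lambda>a b. tens K A T2 a (tens K A A b c)) t)
          (tens_lift T4 K (\<lambda>a b. tens K T2 A (\<Delta> a) b) (\<Delta> x))
        = tens_lift T3 K (\<lambda>a b. tens K A T2 a (\<Delta> b)) (\<Delta> x)"
proof -
  define i2 where "i2 = tens K A T2 \<one>"
  define j1 where "j1 = (\<lambda>a. tens K A T2 a \<one>\<^bsub>T2\<^esub>)"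
  define j2 where "j2 = (\<lambda>b. i2 (tens K A A b \<one>))"
  define j3 where "j3 = (\<lambda>c. i2 (tens K A A \<one> c))"
  \<comment> \<open>\<kappa>1 is the comultiplication followed by the inclusion of the first factor
    of \<open>T4\<close>, \<kappa>2 the inclusion of the second. Their convolution applies the
    comultiplication to the first tensor factor after comultiplying.\<close>
  define \<kappa>1 where "\<kappa>1 = (\<lambda>a. tens K T2 A (\<Delta> a) \<one>)"
  define \<kappa>2 where "\<kappa>2 = tens K T2 A \<one>\<^bsub>T2\<^esub>"
  have i2: "i2 \<in> superalg_hom K T2 T3" unfolding i2_def by (rule S3.T_inclusions(2))
  have j1: "j1 \<in> superalg_hom K A T3" unfolding j1_def by (rule S3.T_inclusions(1))
  have j2: "j2 \<in> superalg_hom K A T3" unfolding j2_def by (rule superalg_hom_compose[OF TT.T_inclusions(1) i2])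
  have j3: "j3 \<in> superalg_hom K A T3" unfolding j3_def by (rule superalg_hom_compose[OF TT.T_inclusions(2) i2])
  have \<kappa>1: "\<kappa>1 \<in> superalg_hom K A T4" unfolding \<kappa>1_def by (rule superalg_hom_compose[OF \<Delta> S4.T_inclusions(1)])
  have \<kappa>2: "\<kappa>2 \<in> superalg_hom K A T4" unfolding \<kappa>2_def by (rule S4.T_inclusions(2))
  have i2\<Delta>: "(\<lambda>b. i2 (\<Delta> b)) \<in> superalg_hom K A T3" by (rule superalg_hom_compose[OF \<Delta> i2])
  let ?L = "tens_lift T3 K (\<lambda>a b. j1 a \<otimes>\<^bsub>T3\<^esub> j2 b)"
  note L = TT.T_lift[OF tensor_scsalg(3) j1 j2]
  \<comment> \<open>The change of brackets from \<open>T4\<close> to \<open>T3\<close>, written as a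
    product of homomorphisms: a \<otimes> (b \<otimes> c) is the product of j1 a, j2 b and j3
    c.\<close>
  let ?H = "tens_lift T3 K (\<lambda>t c. ?L t \<otimes>\<^bsub>T3\<^esub> j3 c)"
  note H = S4.T_lift[OF tensor_scsalg(3) L(2) j3]
  note Hv = S4.tens_lift_facts(4)[OF S3.T_module H(1)]
  have inner: "tens_lift T3 K (\<lambda>a b. tens K A T2 a (tens K A A b c)) t = ?L t \<otimes>\<^bsub>T3\<^esub> j3 c"
    if t: "t \<in> carrier T2" and c: "c \<in> carrier A" for t c
  proof (rule TT.linear_eq_tens_lift[OF S3.T_module _ _ _ _ _ t])
    have Lc: "?L y \<in> carrier T3" if "y \<in> carrier T2" for y
      using that by (rule superalg_homD(1)[OF L(2)])
    have jc: "j3 c \<in> carrier T3" by (rule superalg_homD(1)[OF j3 c])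
    show "TT.bilin T3 (\<lambda>a b. tens K A T2 a (tens K A A b c))"
      using c by (intro TT.bilinI) (simp_all add: S3.tn_rules TT.tn_rules)
    show "?L (y \<oplus>\<^bsub>T2\<^esub> z) \<otimes>\<^bsub>T3\<^esub> j3 c = ?L y \<otimes>\<^bsub>T3\<^esub> j3 c \<oplus>\<^bsub>T3\<^esub> ?L z \<otimes>\<^bsub>T3\<^esub> j3 c"
      if "y \<in> carrier T2" "z \<in> carrier T2" for y z
      unfolding superalg_homD(2)[OF L(2) that] by (rule S3.TA.A.l_distr[OF Lc[OF that(1)] Lc[OF that(2)] jc])
    show "?L (k \<odot>\<^bsub>T2\<^esub> y) \<otimes>\<^bsub>T3\<^esub> j3 c = k \<odot>\<^bsub>T3\<^esub> (?L y \<otimes>\<^bsub>T3\<^esub> j3 c)"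
      if "k \<in> carrier K" "y \<in> carrier T2" for k y
      unfolding superalg_homD(5)[OF L(2) that] by (rule S3.TA.smult_mult_left[OF that(1) Lc[OF that(2)] jc])
    show "?L \<zero>\<^bsub>T2\<^esub> \<otimes>\<^bsub>T3\<^esub> j3 c = \<zero>\<^bsub>T3\<^esub>"
      using jc by (simp add: superalg_hom_zero[OF TT.T_salg S3.T_salg L(2)])
    fix a b assume ab: "a \<in> carrier A" "b \<in> carrier A"
    have "?L (tens K A A a b) \<otimes>\<^bsub>T3\<^esub> j3 c = j1 a \<otimes>\<^bsub>T3\<^esub> (j2 b \<otimes>\<^bsub>T3\<^esub> j3 c)"
      unfolding TT.tens_lift_facts(4)[OF S3.T_module L(1) ab]
      using ab c by (intro S3.TA.A.m_assoc superalg_homD(1)[OF j1] superalg_homD(1)[OF j2] superalg_homD(1)[OF j3])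
    also have "j2 b \<otimes>\<^bsub>T3\<^esub> j3 c = i2 (tens K A A b c)"
      unfolding j2_def j3_def using ab c
      by (subst superalg_homD(3)[OF i2, symmetric]) (simp_all add: TT.T_inclusions(3))
    also have "j1 a \<otimes>\<^bsub>T3\<^esub> i2 (tens K A A b c) = tens K A T2 a (tens K A A b c)"
      unfolding j1_def i2_def using ab c by (simp add: S3.T_inclusions(3))
    finally show "?L (tens K A A a b) \<otimes>\<^bsub>T3\<^esub> j3 c = tens K A T2 a (tens K A A b c)" .
  qed
  let ?P = "\<lambda>x. tens_lift T4 K (\<lambda>a b. \<kappa>1 a \<otimes>\<^bsub>T4\<^esub> \<kappa>2 b) (\<Delta> x)"
  note P = convolution[OF tensor_scsalg(4) \<kappa>1 \<kappa>2]
  have "tens_lift T4 K (\<lambda>a b. tens K T2 A (\<Delta> a) b) (\<Delta> x) = ?P x"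
    by (rule TT.tens_lift_cong[OF S4.T_module TT.T_lift(1)[OF tensor_scsalg(4) \<kappa>1 \<kappa>2] \<Delta>_closed[OF x]])
      (simp add: \<kappa>1_def \<kappa>2_def S4.T_inclusions(3) \<Delta>_closed)
  moreover have "tens_lift T3 K (\<lambda>t c. tens_lift T3 K (\<lambda>a b. tens K A T2 a (tens K A A b c)) t) (?P x) = ?H (?P x)"
    by (rule S4.tens_lift_cong[OF S3.T_module H(1) superalg_homD(1)[OF P(1) x] inner])
  moreover have "tens_lift T3 K (\<lambda>a b. tens K A T2 a (\<Delta> b)) (\<Delta> x) = tens_lift T3 K (\<lambda>a b. j1 a \<otimes>\<^bsub>T3\<^esub> i2 (\<Delta> b)) (\<Delta> x)"
    by (rule TT.tens_lift_cong[OF S3.T_module TT.T_lift(1)[OF tensor_scsalg(3) j1 i2\<Delta>] \<Delta>_closed[OF x]])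
      (simp add: j1_def i2_def S3.T_inclusions(3) \<Delta>_closed)
  moreover have "?H (?P x) = tens_lift T3 K (\<lambda>a b. j1 a \<otimes>\<^bsub>T3\<^esub> i2 (\<Delta> b)) (\<Delta> x)"
  proof (rule gl_hom_eq[OF tensor_scsalg(1,3) valid generated superalg_hom_compose[OF P(1) H(2)]
        convolution(1)[OF tensor_scsalg(3) j1 i2\<Delta>] _ x])
    fix i j assume ij: "i < N" "j < N"
    have c: "\<kappa>1 (entry U r s) \<in> carrier T4" "\<kappa>2 (entry U r s) \<in> carrier T4" "j1 (entry U r s) \<in> carrier T3"
      "j2 (entry U r s) \<in> carrier T3" "j3 (entry U r s) \<in> carrier T3"
      if "r < N" "s < N" for r s
      using entry_closed[OF that] superalg_homD(1)[OF \<kappa>1] superalg_homD(1)[OF \<kappa>2] superalg_homD(1)[OF j1]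
        superalg_homD(1)[OF j2] superalg_homD(1)[OF j3] by auto
    have "?H (?P (entry U i j)) = ?H (mmul T4 N (\<lambda>i j. \<kappa>1 (entry U i j)) (\<lambda>i j. \<kappa>2 (entry U i j)) i j)"
      unfolding P(2)[OF ij] ..
    also have "\<dots> = mmul T3 N (\<lambda>i j. ?H (\<kappa>1 (entry U i j))) (\<lambda>i j. ?H (\<kappa>2 (entry U i j))) i j"
      by (rule superalg_hom_mmul[OF S4.T_salg S3.T_salg H(2)]) (simp_all add: ij c)
    also have "\<dots> = mmul T3 N (mmul T3 N (\<lambda>i j. j1 (entry U i j)) (\<lambda>i j. j2 (entry U i j))) (\<lambda>i j. j3 (entry U i j)) i j"
    proof (rule S3.TA.A.mmul_cong)
      fix k assume k: "k < N"
      have "?H (\<kappa>1 (entry U i k)) = ?L (\<Delta> (entry U i k))"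
        unfolding \<kappa>1_def using ij k entry_closed superalg_homD(4)[OF j3] superalg_homD(1)[OF L(2)]
        by (subst Hv) (simp_all add: \<Delta>_closed)
      then show "?H (\<kappa>1 (entry U i k)) = mmul T3 N (\<lambda>i j. j1 (entry U i j)) (\<lambda>i j. j2 (entry U i j)) i k"
        using convolution(2)[OF tensor_scsalg(3) j1 j2 ij(1) k] by simp
      show "?H (\<kappa>2 (entry U k j)) = j3 (entry U k j)"
        unfolding \<kappa>2_def using ij k entry_closed superalg_homD(4)[OF L(2)] c(5)[OF k ij(2)]
        by (subst Hv) simp_all
      show "mmul T3 N (\<lambda>i j. j1 (entry U i j)) (\<lambda>i j. j2 (entry U i j)) i k \<in> carrier T3"
        by (rule S3.TA.A.mmul_closed) (simp_all add: c ij k)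
    qed (simp add: c ij)
    also have "\<dots> = mmul T3 N (\<lambda>i j. j1 (entry U i j)) (mmul T3 N (\<lambda>i j. j2 (entry U i j)) (\<lambda>i j. j3 (entry U i j))) i j"
      by (rule S3.TA.A.mmul_assoc) (simp_all add: c ij)
    also have "\<dots> = mmul T3 N (\<lambda>i j. j1 (entry U i j)) (\<lambda>i j. i2 (\<Delta> (entry U i j))) i j"
    proof (rule S3.TA.A.mmul_cong)
      fix k assume k: "k < N"
      show "mmul T3 N (\<lambda>i j. j2 (entry U i j)) (\<lambda>i j. j3 (entry U i j)) k j = i2 (\<Delta> (entry U k j))"
        unfolding \<Delta>_entry[OF k ij(2)] j2_def j3_def
        by (rule superalg_hom_mmul[OF TT.T_salg S3.T_salg i2, symmetric]) (simp_all add: ij k entry_closed)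
      show "i2 (\<Delta> (entry U k j)) \<in> carrier T3"
        using k ij by (intro superalg_homD(1)[OF i2\<Delta>] entry_closed)
    qed (simp_all add: c ij)
    also have "\<dots> = tens_lift T3 K (\<lambda>a b. j1 a \<otimes>\<^bsub>T3\<^esub> i2 (\<Delta> b)) (\<Delta> (entry U i j))"
      using convolution(2)[OF tensor_scsalg(3) j1 i2\<Delta> ij] by simp
    finally show "?H (?P (entry U i j)) = tens_lift T3 K (\<lambda>a b. j1 a \<otimes>\<^bsub>T3\<^esub> i2 (\<Delta> b)) (\<Delta> (entry U i j))" .
  qed
  ultimately show ?thesis by simp
qed

text \<open>Unit after counit, the neutral element of convolution. It replaces scalar multiples by
  ring products, so that the counit axioms become convolutions with the identity map.\<close>

definition \<eta> where "\<eta> a = \<epsilon> a \<odot> \<one>"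

lemma \<epsilon>_closed: "a \<in> carrier A \<Longrightarrow> \<epsilon> a \<in> carrier K"
  using superalg_homD(1)[OF \<epsilon>] by simp

lemma \<eta>: "\<eta> \<in> superalg_hom K A A"
proof (rule superalg_homI)
  show "\<eta> x \<in> grade A p" if "x \<in> grade A p" for x p
    using superalg_homD(6)[OF \<epsilon> that] by (cases p) (auto simp: \<eta>_def grade_smult)
  show "\<eta> (x \<otimes> y) = \<eta> x \<otimes> \<eta> y" if "x \<in> carrier A" "y \<in> carrier A" for x y
    using that superalg_homD(3)[OF \<epsilon>, of x y]
    by (simp add: \<eta>_def \<epsilon>_closed smult_mult_left smult_mult_right M.smult_assoc1[symmetric] K.m_comm)
qed (use superalg_homD(2,4,5)[OF \<epsilon>] in \<open>simp_all add: \<eta>_def \<epsilon>_closed M.smult_l_distr M.smult_assoc1\<close>)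

lemma \<eta>_mult: "a \<in> carrier A \<Longrightarrow> b \<in> carrier A \<Longrightarrow> \<epsilon> a \<odot> b = \<eta> a \<otimes> b"
  "a \<in> carrier A \<Longrightarrow> b \<in> carrier A \<Longrightarrow> \<epsilon> b \<odot> a = a \<otimes> \<eta> b"
  by (simp_all add: \<eta>_def \<epsilon>_closed smult_mult_left smult_mult_right)

lemma \<eta>_entry: "i < N \<Longrightarrow> j < N \<Longrightarrow> \<eta> (entry U i j) = (if i = j then \<one> else \<zero>)"
  by (simp add: \<eta>_def \<epsilon>_entry)

lemma id_hom: "(\<lambda>x. x) \<in> superalg_hom K A A"
  by (rule superalg_homI) simp_all

lemma counit:
  assumes x: "x \<in> carrier A"
  shows "tens_lift A K (\<lambda>a b. \<epsilon> a \<odot> b) (\<Delta> x) = x" "tens_lift A K (\<lambda>a b. \<epsilon> b \<odot> a) (\<Delta> x) = x"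
proof -
  note sc = tensor_scsalg(1)
  have "tens_lift A K (\<lambda>a b. \<epsilon> a \<odot> b) (\<Delta> x) = tens_lift A K (\<lambda>a b. \<eta> a \<otimes> b) (\<Delta> x)"
    by (rule TT.tens_lift_cong[OF M.module_axioms TT.T_lift(1)[OF sc \<eta> id_hom] \<Delta>_closed[OF x] \<eta>_mult(1)])
  also have "\<dots> = x"
  proof (rule gl_hom_eq[OF sc sc valid generated convolution(1)[OF sc \<eta> id_hom] id_hom _ x])
    fix i j assume ij: "i < N" "j < N"
    have "tens_lift A K (\<lambda>a b. \<eta> a \<otimes> b) (\<Delta> (entry U i j)) = mmul A N (\<lambda>i j. if i = j then \<one> else \<zero>) (entry U) i j"
      unfolding convolution(2)[OF sc \<eta> id_hom ij]
      by (rule A.mmul_cong) (simp_all add: \<eta>_entry ij entry_closed)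
    also have "\<dots> = entry U i j"
      using ij by (intro A.mmul_one) (simp_all add: entry_closed)
    finally show "tens_lift A K (\<lambda>a b. \<eta> a \<otimes> b) (\<Delta> (entry U i j)) = entry U i j" .
  qed
  finally show "tens_lift A K (\<lambda>a b. \<epsilon> a \<odot> b) (\<Delta> x) = x" .
  have "tens_lift A K (\<lambda>a b. \<epsilon> b \<odot> a) (\<Delta> x) = tens_lift A K (\<lambda>a b. a \<otimes> \<eta> b) (\<Delta> x)"
    by (rule TT.tens_lift_cong[OF M.module_axioms TT.T_lift(1)[OF sc id_hom \<eta>] \<Delta>_closed[OF x] \<eta>_mult(2)])
  also have "\<dots> = x"
  proof (rule gl_hom_eq[OF sc sc valid generated convolution(1)[OF sc id_hom \<eta>] id_hom _ x])
    fix i j assume ij: "i < N" "j < N"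
    have "tens_lift A K (\<lambda>a b. a \<otimes> \<eta> b) (\<Delta> (entry U i j)) = mmul A N (entry U) (\<lambda>i j. if i = j then \<one> else \<zero>) i j"
      unfolding convolution(2)[OF sc id_hom \<eta> ij]
      by (rule A.mmul_cong) (simp_all add: \<eta>_entry ij entry_closed)
    also have "\<dots> = entry U i j"
      using ij by (intro A.mmul_one) (simp_all add: entry_closed)
    finally show "tens_lift A K (\<lambda>a b. a \<otimes> \<eta> b) (\<Delta> (entry U i j)) = entry U i j" .
  qed
  finally show "tens_lift A K (\<lambda>a b. \<epsilon> b \<odot> a) (\<Delta> x) = x" .
qed

lemma antipode_entries:
  assumes "i < N" "j < N"
  shows "mmul A N (antipode_matrix A U) (entry U) i j = (if i = j then \<one> else \<zero>)"
    "mmul A N (entry U) (antipode_matrix A U) i j = (if i = j then \<one> else \<zero>)"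
proof -
  interpret SM: super_mat A "grade A" N by unfold_locales
  have "msize (antipode_data A U) = msize U" "nsize (antipode_data A U) = nsize U"
    "entry (antipode_data A U) = antipode_matrix A U"
    by (simp_all add: antipode_data_def)
  then show "mmul A N (antipode_matrix A U) (entry U) i j = (if i = j then \<one> else \<zero>)"
    "mmul A N (entry U) (antipode_matrix A U) i j = (if i = j then \<one> else \<zero>)"
    using SM.antipode_product[OF valid refl] assms by (simp_all add: is_product_def)
qed

lemma antipode: "antipode K A \<Delta> \<epsilon> S"
  unfolding antipode_def
proof (intro conjI ballI)
  show "S \<in> even_linear K A A" using S by (simp add: superalg_hom_def)
  fix x assume x: "x \<in> carrier A"
  note sc = tensor_scsalg(1)
  have Sc: "antipode_matrix A U i j \<in> carrier A" if "i < N" "j < N" for i j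
    using superalg_homD(1)[OF S entry_closed[OF that]] S_entry[OF that] by simp
  have "tens_lift A K (\<lambda>a b. S a \<otimes> b) (\<Delta> x) = \<eta> x"
  proof (rule gl_hom_eq[OF sc sc valid generated convolution(1)[OF sc S id_hom] \<eta> _ x])
    fix i j assume ij: "i < N" "j < N"
    have "tens_lift A K (\<lambda>a b. S a \<otimes> b) (\<Delta> (entry U i j)) = mmul A N (antipode_matrix A U) (entry U) i j"
      unfolding convolution(2)[OF sc S id_hom ij]
      by (rule A.mmul_cong) (simp_all add: S_entry Sc ij entry_closed)
    then show "tens_lift A K (\<lambda>a b. S a \<otimes> b) (\<Delta> (entry U i j)) = \<eta> (entry U i j)"
      using antipode_entries(1)[OF ij] \<eta>_entry[OF ij] by simp
  qed
  then show "tens_lift A K (\<lambda>a b. S a \<otimes> b) (\<Delta> x) = \<epsilon> x \<odot> \<one>" by (simp add: \<eta>_def)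
  have "tens_lift A K (\<lambda>a b. a \<otimes> S b) (\<Delta> x) = \<eta> x"
  proof (rule gl_hom_eq[OF sc sc valid generated convolution(1)[OF sc id_hom S] \<eta> _ x])
    fix i j assume ij: "i < N" "j < N"
    have "tens_lift A K (\<lambda>a b. a \<otimes> S b) (\<Delta> (entry U i j)) = mmul A N (entry U) (antipode_matrix A U) i j"
      unfolding convolution(2)[OF sc id_hom S ij]
      by (rule A.mmul_cong) (simp_all add: S_entry Sc ij entry_closed)
    then show "tens_lift A K (\<lambda>a b. a \<otimes> S b) (\<Delta> (entry U i j)) = \<eta> (entry U i j)"
      using antipode_entries(2)[OF ij] \<eta>_entry[OF ij] by simp
  qed
  then show "tens_lift A K (\<lambda>a b. a \<otimes> S b) (\<Delta> x) = \<epsilon> x \<odot> \<one>" by (simp add: \<eta>_def)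
qed

lemma matrix_coalgebra: "matrix_coalgebra K A U \<Delta> \<epsilon>"
proof -
  have "\<Delta> (entry U i j) = (\<Oplus>\<^bsub>T2\<^esub>k\<in>{..<N}. tens K A A (entry U i k) (entry U k j))" if "i < N" "j < N" for i j
    unfolding \<Delta>_entry[OF that] mmul_def using that
    by (intro TT.TM.M.finsum_cong') (auto simp: TT.T_inclusions(3) entry_closed)
  then show ?thesis
    unfolding matrix_coalgebra_def Let_def
    using \<epsilon>_entry gl_hom_dinv[OF tensor_scsalg(1,2) \<Delta> valid]
      gl_hom_dinv[OF tensor_scsalg(1) base_scsalg[OF K.field_axioms] \<epsilon> valid]
    by (simp add: base_superalg_inv)
qed

lemma hopf: "hopf_superalgebra K A \<Delta> \<epsilon> S"
  unfolding hopf_superalgebra_def superbialgebra_def Let_def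
  using superalgebra \<Delta> \<epsilon> coassociative counit antipode by blast

end

section \<open>Existence of comultiplication, counit and antipode\<close>

lemma (in super_mat) product_data_exists:
  assumes U: "gl_valid A G U" and Y: "gl_valid A G Y" and s: "msize Y = msize U" "nsize Y = nsize U"
    and N: "N = msize U + nsize U"
  obtains Z where "gl_valid A G Z" "is_product A U Y Z" "Ber A Z = Ber A U \<otimes> Ber A Y"
proof -
  \<comment> \<open>The inverse determinants are left open as t and u. Since d1 and d2 depend on the
    entries only, they are evaluated with 1 in both places, shown to be units, and their inverses
    are then filled in.\<close>
  define Z where "Z t u = \<lparr>msize = msize U, nsize = nsize U,
    entry = mmul A (msize U + nsize U) (entry U) (entry Y), dinv1 = t, dinv2 = u\<rparr>" for t u
  have d: "d1 A (Z t u) = d1 A (Z \<one> \<one>)" "d2 A (Z t u) = d2 A (Z \<one> \<one>)" for t u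
    by (simp_all add: d1_def d2_def X11_def[abs_def] X22_def[abs_def] Z_def)
  have P: "is_product A U Y (Z t u)" for t u
    using s by (simp add: is_product_def Z_def)
  note pv = product_valid[OF U Y P N]
  let ?t = "inv d1 A (Z \<one> \<one>)" and ?u = "inv d2 A (Z \<one> \<one>)"
  have "dinv1 (Z ?t ?u) = ?t" "dinv2 (Z ?t ?u) = ?u"
    by (simp_all only: Z_def gl_data.simps)
  then have v: "gl_valid A G (Z ?t ?u)"
    unfolding gl_valid_def d[of ?t ?u]
    using pv(1)[of ?t ?u] eunit_inv[OF pv(2)[of \<one> \<one>]] eunit_inv[OF pv(3)[of \<one> \<one>]] by simp
  show ?thesis
    by (rule that[OF v P pv(4)[OF v]])
qed

text \<open>The generic matrix has two images in the tensor square, under the two inclusions, and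
  their product is again a point. Multiplicativity of the Berezinian keeps the condition Ber = 1, as
  required for k[SL(m|n)].\<close>

lemma (in scsalg) comultiplication_data:
  assumes U: "gl_valid A (grade A) U"
  obtains Z where "gl_valid (tensor K A A) (grade (tensor K A A)) Z" "msize Z = msize U" "nsize Z = nsize U"
    and "\<And>i j. i < msize U + nsize U \<Longrightarrow> j < msize U + nsize U \<Longrightarrow> entry Z i j =
      mmul (tensor K A A) (msize U + nsize U) (\<lambda>i j. tens K A A (entry U i j) \<one>) (\<lambda>i j. tens K A A \<one> (entry U i j)) i j"
    and "Ber A U = \<one> \<Longrightarrow> Ber (tensor K A A) Z = \<one>\<^bsub>tensor K A A\<^esub>"
proof -
  interpret T: tens_alg K A A by unfold_locales
  have sc: "scsalg K A" by unfold_locales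
  have T2: "scsalg K (tensor K A A)" by (rule T.T_scsalg[OF supercommutative supercommutative])
  interpret R: scsalg K "tensor K A A" by (rule T2)
  interpret SM: super_mat "tensor K A A" "grade (tensor K A A)" "msize U + nsize U" by unfold_locales
  let ?V = "map_data (\<lambda>a. tens K A A a \<one>) U" and ?W = "map_data (tens K A A \<one>) U"
  note v = gl_valid_hom[OF sc T2 T.T_inclusions(1) U]
  note w = gl_valid_hom[OF sc T2 T.T_inclusions(2) U]
  obtain Z where Z: "gl_valid (tensor K A A) (grade (tensor K A A)) Z" "is_product (tensor K A A) ?V ?W Z"
    "Ber (tensor K A A) Z = Ber (tensor K A A) ?V \<otimes>\<^bsub>tensor K A A\<^esub> Ber (tensor K A A) ?W"
    using SM.product_data_exists[OF v(1) w(1)] by (auto simp: map_data_simps)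
  have "Ber (tensor K A A) Z = \<one>\<^bsub>tensor K A A\<^esub>" if "Ber A U = \<one>"
    unfolding Z(3) v(4)[symmetric] w(4)[symmetric] that by (simp add: T.T_inclusions(3) T.T_one)
  with Z(1,2) show ?thesis
    by (intro that[of Z]) (simp_all add: is_product_def map_data_def)
qed

text \<open>The last claim holds because the Berezinians of a matrix and of its inverse multiply to
  1; it lets the antipode descend to k[SL(m|n)].\<close>

lemma (in scsalg) antipode_data_facts:
  assumes U: "gl_valid A (grade A) U"
  shows "gl_valid A (grade A) (antipode_data A U)"
    "dinv1 (antipode_data A U) = Ber A U \<otimes> d2 A U" "dinv2 (antipode_data A U) = inv (Ber A U) \<otimes> d1 A U"
    "msize (antipode_data A U) = msize U" "nsize (antipode_data A U) = nsize U"
    "entry (antipode_data A U) = antipode_matrix A U"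
    and "Ber A U = \<one> \<Longrightarrow> Ber A (antipode_data A U) = \<one>"
proof -
  interpret SM: super_mat A "grade A" "msize U + nsize U" by unfold_locales
  note a = SM.antipode_valid[OF U refl]
  show s: "msize (antipode_data A U) = msize U" "nsize (antipode_data A U) = nsize U"
    and "entry (antipode_data A U) = antipode_matrix A U"
    by (simp_all add: antipode_data_def)
  show "gl_valid A (grade A) (antipode_data A U)" by (rule a(1))
  show "dinv1 (antipode_data A U) = Ber A U \<otimes> d2 A U" "dinv2 (antipode_data A U) = inv (Ber A U) \<otimes> d1 A U"
    using a(5,6) by (simp_all add: antipode_data_def)
  have "Ber A (antipode_data A U) \<in> carrier A"
    using SM.antipode_valid(4)[OF a(1)] s A.Units_closed by simp
  then show "Ber A (antipode_data A U) = \<one>" if "Ber A U = \<one>"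
    using a(2) that by simp
qed

lemma counit_data:
  assumes "field K"
  obtains Z where "gl_valid (base_superalg K) (grade (base_superalg K)) Z" "msize Z = m" "nsize Z = n"
    "entry Z = (\<lambda>i j. if i = j then \<one>\<^bsub>K\<^esub> else \<zero>\<^bsub>K\<^esub>)" "Ber (base_superalg K) Z = \<one>\<^bsub>base_superalg K\<^esub>"
proof -
  interpret scsalg K "base_superalg K" by (rule base_scsalg[OF assms])
  interpret SM: super_mat "base_superalg K" "grade (base_superalg K)" "m + n" by unfold_locales
  show ?thesis
    by (rule that[OF SM.id_valid(1)[OF refl] _ _ _ SM.id_valid(2)[OF refl]]) (simp_all add: SM.id_data_def cong: if_cong)
qed

lemma (in gl_algebra) GL_hopf:
  "\<exists>\<Delta> \<epsilon> S. gl_hopf K GL V \<Delta> \<epsilon> S \<and> gl_agree S V (antipode_data GL V)"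
proof -
  have sc: "scsalg K GL" by (rule GL_scsalg)
  have T2: "scsalg K (tensor K GL GL)"
  proof -
    interpret T: tens_alg K GL GL by unfold_locales
    show ?thesis by (rule T.T_scsalg[OF GL.supercommutative GL.supercommutative])
  qed
  note ad = GL.antipode_data_facts[OF GL_valid]
  obtain Z where Z: "gl_valid (tensor K GL GL) (grade (tensor K GL GL)) Z" "msize Z = m" "nsize Z = n"
    "\<And>i j. i < m + n \<Longrightarrow> j < m + n \<Longrightarrow> entry Z i j =
      mmul (tensor K GL GL) (m + n) (\<lambda>i j. tens K GL GL (entry V i j) \<one>\<^bsub>GL\<^esub>) (\<lambda>i j. tens K GL GL \<one>\<^bsub>GL\<^esub> (entry V i j)) i j"
    by (rule GL.comultiplication_data[OF GL_valid]) (simp only: V_size)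
  obtain \<Delta> where \<Delta>: "\<Delta> \<in> superalg_hom K GL (tensor K GL GL)" "gl_agree \<Delta> V Z"
    using GL_lift[OF T2 Z(1-3)] .
  obtain E where E: "gl_valid (base_superalg K) (grade (base_superalg K)) E" "msize E = m" "nsize E = n"
    "entry E = (\<lambda>i j. if i = j then \<one>\<^bsub>K\<^esub> else \<zero>\<^bsub>K\<^esub>)"
    using counit_data[OF field_axioms] .
  obtain \<epsilon> where \<epsilon>: "\<epsilon> \<in> superalg_hom K GL (base_superalg K)" "gl_agree \<epsilon> V E"
    using GL_lift[OF base_scsalg[OF field_axioms] E(1-3)] .
  obtain S where S: "S \<in> superalg_hom K GL GL" "gl_agree S V (antipode_data GL V)"
    using GL_lift[OF sc ad(1) ad(4)[unfolded V_size] ad(5)[unfolded V_size]] .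
  have "gl_hopf K GL V \<Delta> \<epsilon> S"
    using \<Delta> \<epsilon> S GL_valid GL_generates Z(4) E(4) ad(6)
    by (intro gl_hopf.intro sc gl_hopf_axioms.intro) (simp_all add: gl_agree_def)
  with S(2) show ?thesis by blast
qed

text \<open>Comultiplication, counit and antipode are built on k[SL(m|n)] directly from its own
  universal property: the product, the identity and the inverse matrix all have Berezinian 1. No
  Hopf ideal has to be discussed.\<close>

lemma (in gl_algebra) SL_hopf:
  "\<exists>\<Delta> \<epsilon> S. gl_hopf K SL W \<Delta> \<epsilon> S \<and> gl_agree S W (antipode_data SL W)"
proof -
  have sc: "scsalg K SL" by (rule SL_scsalg)
  have T2: "scsalg K (tensor K SL SL)"
  proof -
    interpret T: tens_alg K SL SL by unfold_locales
    show ?thesis by (rule T.T_scsalg[OF SL.supercommutative SL.supercommutative])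
  qed
  note ad = SL.antipode_data_facts[OF SL_valid(1)]
  obtain Z where Z: "gl_valid (tensor K SL SL) (grade (tensor K SL SL)) Z" "msize Z = m" "nsize Z = n"
    "\<And>i j. i < m + n \<Longrightarrow> j < m + n \<Longrightarrow> entry Z i j =
      mmul (tensor K SL SL) (m + n) (\<lambda>i j. tens K SL SL (entry W i j) \<one>\<^bsub>SL\<^esub>) (\<lambda>i j. tens K SL SL \<one>\<^bsub>SL\<^esub> (entry W i j)) i j"
    "Ber (tensor K SL SL) Z = \<one>\<^bsub>tensor K SL SL\<^esub>"
    by (rule SL.comultiplication_data[OF SL_valid(1)]) (simp only: W_size SL_valid(2))
  obtain \<Delta> where \<Delta>: "\<Delta> \<in> superalg_hom K SL (tensor K SL SL)" "gl_agree \<Delta> W Z"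
    using SL_lift[OF T2 Z(1-3,5)] .
  obtain E where E: "gl_valid (base_superalg K) (grade (base_superalg K)) E" "msize E = m" "nsize E = n"
    "entry E = (\<lambda>i j. if i = j then \<one>\<^bsub>K\<^esub> else \<zero>\<^bsub>K\<^esub>)" "Ber (base_superalg K) E = \<one>\<^bsub>base_superalg K\<^esub>"
    using counit_data[OF field_axioms] .
  obtain \<epsilon> where \<epsilon>: "\<epsilon> \<in> superalg_hom K SL (base_superalg K)" "gl_agree \<epsilon> W E"
    using SL_lift[OF base_scsalg[OF field_axioms] E(1-3,5)] .
  obtain S where S: "S \<in> superalg_hom K SL SL" "gl_agree S W (antipode_data SL W)"
    using SL_lift[OF sc ad(1) ad(4)[unfolded W_size] ad(5)[unfolded W_size] ad(7)[OF SL_valid(2)]] .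
  have "gl_hopf K SL W \<Delta> \<epsilon> S"
    using \<Delta> \<epsilon> S SL_valid(1) SL_generates Z(4) E(4) ad(6)
    by (intro gl_hopf.intro sc gl_hopf_axioms.intro) (simp_all add: gl_agree_def)
  with S(2) show ?thesis by blast
qed

text \<open>As \<open>S\<close> is a homomorphism with the given values on the entries, its values
  on the inverses of d1 and d2 are det B and det C. In k[GL(m|n)] these are d2 times Ber and d1
  times the inverse of Ber; the formulas without Ber appear in k[SL(m|n)].\<close>

theorem proposition3p7:
  fixes K :: "('k, 'r) ring_scheme" and m n :: nat
  assumes "algebraically_closed K"
  shows
    "(\<exists>\<Delta> \<epsilon> S.
        matrix_coalgebra K (kGL K m n) (GL_data K m n) \<Delta> \<epsilon> \<and>
        hopf_superalgebra K (kGL K m n) \<Delta> \<epsilon> S \<and>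
        S \<in> superalg_hom K (kGL K m n) (kGL K m n) \<and>
        (\<forall>i<m + n. \<forall>j<m + n. S (entry (GL_data K m n) i j)
           = antipode_matrix (kGL K m n) (GL_data K m n) i j) \<and>
        S (dinv1 (GL_data K m n)) =
          Ber (kGL K m n) (GL_data K m n) \<otimes>\<^bsub>kGL K m n\<^esub> d2 (kGL K m n) (GL_data K m n) \<and>
        S (dinv2 (GL_data K m n)) =
          inv\<^bsub>kGL K m n\<^esub> (Ber (kGL K m n) (GL_data K m n))
            \<otimes>\<^bsub>kGL K m n\<^esub> d1 (kGL K m n) (GL_data K m n)) \<and>
     (\<exists>\<Delta> \<epsilon> S.
        matrix_coalgebra K (kSL K m n) (SL_data K m n) \<Delta> \<epsilon> \<and>
        hopf_superalgebra K (kSL K m n) \<Delta> \<epsilon> S \<and>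
        S \<in> superalg_hom K (kSL K m n) (kSL K m n) \<and>
        (\<forall>i<m + n. \<forall>j<m + n. S (entry (SL_data K m n) i j)
           = antipode_matrix (kSL K m n) (SL_data K m n) i j) \<and>
        S (dinv1 (SL_data K m n)) = d2 (kSL K m n) (SL_data K m n) \<and>
        S (dinv2 (SL_data K m n)) = d1 (kSL K m n) (SL_data K m n))"
proof -
  interpret algebraically_closed K by (rule assms)
  interpret gl_algebra K m n by (intro gl_algebra.intro field_axioms)
  note adV = GL.antipode_data_facts[OF GL_valid]
  note adW = SL.antipode_data_facts[OF SL_valid(1)]
  obtain \<Delta> \<epsilon> S where H: "gl_hopf K GL V \<Delta> \<epsilon> S" and S: "gl_agree S V (antipode_data GL V)"
    using GL_hopf by blast
  obtain \<Delta>' \<epsilon>' S' where H': "gl_hopf K SL W \<Delta>' \<epsilon>' S'" and S': "gl_agree S' W (antipode_data SL W)"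
    using SL_hopf by blast
  interpret Q: gl_hopf K GL V \<Delta> \<epsilon> S by (rule H)
  interpret Q': gl_hopf K SL W \<Delta>' \<epsilon>' S' by (rule H')
  have "d1 SL W \<in> carrier SL" "d2 SL W \<in> carrier SL"
    using SL.gl_valid_closed(4,5)[OF SL_valid(1)] by simp_all
  \<comment> \<open>With Ber = 1 the factors Ber and its inverse drop out of the general
    formulas.\<close>
  then have "S' (dinv1 W) = d2 SL W" "S' (dinv2 W) = d1 SL W"
    using S' adW(2,3) by (simp_all add: gl_agree_def SL_valid(2))
  moreover have "S (dinv1 V) = Ber GL V \<otimes>\<^bsub>GL\<^esub> d2 GL V" "S (dinv2 V) = inv\<^bsub>GL\<^esub> (Ber GL V) \<otimes>\<^bsub>GL\<^esub> d1 GL V"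
    using S adV(2,3) by (simp_all add: gl_agree_def)
  moreover have "\<forall>i<m + n. \<forall>j<m + n. S (entry V i j) = antipode_matrix GL V i j"
    "\<forall>i<m + n. \<forall>j<m + n. S' (entry W i j) = antipode_matrix SL W i j"
    using Q.S_entry Q'.S_entry by simp_all
  ultimately show ?thesis
    using Q.matrix_coalgebra Q.hopf Q.S Q'.matrix_coalgebra Q'.hopf Q'.S by blast
qed

end
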